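(* Let $m$ be a positive integer and $\varphi\in F^2$. Then $S_\varphi$ is bounded on $F^{2,m}$ if and only if $$S_\varphi=C_iGM_uG^{-1}C_{-i}$$ for some multiplier $u$ on $W^{2,m}(\gamma)$. In this case, $$\varphi(z)=\left(\frac{2}{\pi}\right)^{n/2}\int_{\mathbb{R}^n}u(2x)\,e^{-2\left(x-\frac i2z\right)\cdot\left(x-\frac i2z\right)}dx,\qquad z\in\mathbb{C}^n.$$
   Context: Let $d\lambda(z)=\pi^{-n}e^{-|z|^2}dv(z)$ on $\mathbb{C}^n$. The Fock space $F^2$ is the space of entire functions $f$ on $\mathbb{C}^n$ with $\|f\|_{F^2}=(\int_{\mathbb{C}^n}|f|^2d\lambda)^{1/2}<\infty$; the Fock-Sobolev space $F^{2,m}$ is the space of entire functions $f$ with $\|f\|_{F^{2,m}}=\sum_{|\alpha|\le m}\|\partial^\alpha f\|_{F^2}<\infty$. For $\varphi\in F^2$, $S_\varphi$ is the integral operator $S_\varphi f(z)=\int_{\mathbb{C}^n}f(w)e^{z\cdot\overline w}\varphi(z-\overline w)\,d\lambda(w)$, $f\in F^{2,m}$, where $z\cdot\overline w=\sum_jz_j\overline w_j$. $C_i,C_{-i}$ are the composition operators $C_if(z)=f(iz)$, $C_{-i}f(z)=f(-iz)$. For $a,b\in\mathbb{C}^n$, $a\cdot b=\sum_ja_jb_j$. Let $d\gamma(x)=(2\pi)^{-n/2}e^{-|x|^2/2}dx$ on $\mathbb{R}^n$. The Gauss-Sobolev space $W^{2,m}(\gamma)$ is the completion of $C_0^\infty(\mathbb{R}^n)$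 with respect to $\|f\|_{W^{2,m}(\gamma)}=\sum_{0\le|\alpha|\le m}\left[\int_{\mathbb{R}^n}|\partial^\alpha f|^2d\gamma\right]^{1/2}$. A function $u\in L^1_{loc}(\mathbb{R}^n)$ is a multiplier on $W^{2,m}(\gamma)$ if the multiplication operator $M_u$ is bounded on $W^{2,m}(\gamma)$. $G$ is the Gauss-Bargmann transform, the isometry from $W^{2,m}(\gamma)$ onto $F^{2,m}$ given by $Gf(z)=\int_{\mathbb{R}^n}f(x)e^{x\cdot z-z^2/2}d\gamma(x)$ with $z^2=z_1^2+\dots+z_n^2$. *)

theory Defs
  imports "HOL-Analysis.Analysis"
begin

subsection \<open>Multi-indices and iterated partial derivatives\<close>

definition multi_indices :: "nat \<Rightarrow> ('n::finite \<Rightarrow> nat) set" where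
  "multi_indices m = {\<alpha>. (\<Sum>j\<in>UNIV. \<alpha> j) \<le> m}"

lemma finite_multi_indices: "finite (multi_indices m :: ('n::finite \<Rightarrow> nat) set)"
proof (rule finite_subset)
  show "multi_indices m \<subseteq> (PiE UNIV (\<lambda>_. {..m}) :: ('n \<Rightarrow> nat) set)"
  proof
    fix \<alpha> :: "'n \<Rightarrow> nat"
    assume "\<alpha> \<in> multi_indices m"
    then have "(\<Sum>j\<in>UNIV. \<alpha> j) \<le> m"
      by (simp add: multi_indices_def)
    moreover have "\<alpha> i \<le> (\<Sum>j\<in>UNIV. \<alpha> j)" for i
      by (rule member_le_sum) auto
    ultimately show "\<alpha> \<in> PiE UNIV (\<lambda>_. {..m})"
      by (auto intro: order_trans)
  qed
  show "finite (PiE UNIV (\<lambda>_. {..m}) :: ('n \<Rightarrow> nat) set)"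
    by (intro finite_PiE) auto
qed

text \<open>The derivative with multi-index \<open>\<alpha>\<close>, where \<open>D j\<close> is the partial derivative in direction \<open>j\<close>.
  The directions are processed in some fixed order; on smooth and on entire functions, the only ones
  to which this is applied below, the partial derivatives commute and the order is irrelevant.\<close>

definition multi_deriv :: "('n::finite \<Rightarrow> 'f \<Rightarrow> 'f) \<Rightarrow> ('n \<Rightarrow> nat) \<Rightarrow> 'f \<Rightarrow> 'f" where
  "multi_deriv D \<alpha> = foldr (\<lambda>j. D j ^^ \<alpha> j) (SOME js. distinct js \<and> set js = UNIV)"

definition cpartial :: "'n::finite \<Rightarrow> (complex^'n \<Rightarrow> complex) \<Rightarrow> complex^'n \<Rightarrow> complex" where
  "cpartial j f z = deriv (\<lambda>t. f (z + axis j t)) 0"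

definition rpartial :: "'n::finite \<Rightarrow> (real^'n \<Rightarrow> complex) \<Rightarrow> real^'n \<Rightarrow> complex" where
  "rpartial j f x = vector_derivative (\<lambda>t. f (x + axis j t)) (at 0)"

subsection \<open>Bilinear products\<close>

text \<open>\<open>a \<cdot> b = \<Sum>\<^sub>j a\<^sub>j b\<^sub>j\<close>, without conjugation.\<close>

definition cdot :: "complex^'n::finite \<Rightarrow> complex^'n \<Rightarrow> complex" where
  "cdot a b = (\<Sum>j\<in>UNIV. a $ j * b $ j)"

definition vcnj :: "complex^'n::finite \<Rightarrow> complex^'n" where
  "vcnj w = (\<chi> j. cnj (w $ j))"

definition cvec :: "real^'n::finite \<Rightarrow> complex^'n" where
  "cvec x = (\<chi> j. complex_of_real (x $ j))"

subsection \<open>Boundedness\<close>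

definition bounded_op :: "'f set \<Rightarrow> ('f \<Rightarrow> real) \<Rightarrow> ('f \<Rightarrow> 'f) \<Rightarrow> bool" where
  "bounded_op X N T \<longleftrightarrow> (\<exists>C. \<forall>f\<in>X. T f \<in> X \<and> N (T f) \<le> C * N f)"

subsection \<open>Fock and Fock-Sobolev spaces\<close>

definition fock_measure :: "(complex^'n::finite) measure" where
  "fock_measure = density lborel (\<lambda>z. ennreal (exp (- (norm z)\<^sup>2) / pi ^ CARD('n)))"

text \<open>Holomorphic on the whole space: complex-differentiable at every point.\<close>

definition entire :: "(complex^'n::finite \<Rightarrow> complex) \<Rightarrow> bool" where
  "entire f \<longleftrightarrow> (\<forall>z. \<exists>D. (f has_derivative D) (at z) \<and> (\<forall>c v. D (c *s v) = c * D v))"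

definition fock_space :: "(complex^'n::finite \<Rightarrow> complex) set" where
  "fock_space = {f. entire f \<and> integrable fock_measure (\<lambda>z. (norm (f z))\<^sup>2)}"

definition fock_norm :: "(complex^'n::finite \<Rightarrow> complex) \<Rightarrow> real" where
  "fock_norm f = sqrt (LINT z|fock_measure. (norm (f z))\<^sup>2)"

definition fock_sobolev :: "nat \<Rightarrow> (complex^'n::finite \<Rightarrow> complex) set" where
  "fock_sobolev m = {f. entire f \<and>
     (\<forall>\<alpha>\<in>multi_indices m. integrable fock_measure (\<lambda>z. (norm (multi_deriv cpartial \<alpha> f z))\<^sup>2))}"

definition fock_sobolev_norm :: "nat \<Rightarrow> (complex^'n::finite \<Rightarrow> complex) \<Rightarrow> real" where
  "fock_sobolev_norm m f = (\<Sum>\<alpha>\<in>multi_indices m. fock_norm (multi_deriv cpartial \<alpha> f))"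

subsection \<open>The integral operator\<close>

definition S_integrand ::
  "(complex^'n::finite \<Rightarrow> complex) \<Rightarrow> (complex^'n \<Rightarrow> complex) \<Rightarrow> complex^'n \<Rightarrow> complex^'n \<Rightarrow> complex" where
  "S_integrand \<phi> f z w = f w * exp (cdot z (vcnj w)) * \<phi> (z - vcnj w)"

definition S_op ::
  "(complex^'n::finite \<Rightarrow> complex) \<Rightarrow> (complex^'n \<Rightarrow> complex) \<Rightarrow> complex^'n \<Rightarrow> complex" where
  "S_op \<phi> f z = (LINT w|fock_measure. S_integrand \<phi> f z w)"

text \<open>For \<open>\<phi>\<close> and \<open>f\<close> in the Fock space the defining integral need not converge, and the Bochner
  integral of a non-integrable function is 0 by convention. Boundedness of the operator therefore
  includes that the integral exists for every \<open>f\<close> in the space and every point.\<close>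

definition S_bounded :: "nat \<Rightarrow> (complex^'n::finite \<Rightarrow> complex) \<Rightarrow> bool" where
  "S_bounded m \<phi> \<longleftrightarrow>
     (\<forall>f\<in>fock_sobolev m. \<forall>z. integrable fock_measure (S_integrand \<phi> f z)) \<and>
     bounded_op (fock_sobolev m) (fock_sobolev_norm m) (S_op \<phi>)"

definition comp_op :: "complex \<Rightarrow> (complex^'n::finite \<Rightarrow> complex) \<Rightarrow> complex^'n \<Rightarrow> complex" where
  "comp_op c f z = f (c *s z)"

subsection \<open>Gauss-Sobolev spaces\<close>

definition gauss_measure :: "(real^'n::finite) measure" where
  "gauss_measure = density lborel
     (\<lambda>x. ennreal (exp (- (norm x)\<^sup>2 / 2) / (2 * pi) powr (real CARD('n) / 2)))"

definition gauss_L2 :: "(real^'n::finite \<Rightarrow> complex) set" where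
  "gauss_L2 = {f. f \<in> borel_measurable borel \<and> integrable gauss_measure (\<lambda>x. (norm (f x))\<^sup>2)}"

definition gauss_L2_norm :: "(real^'n::finite \<Rightarrow> complex) \<Rightarrow> real" where
  "gauss_L2_norm f = sqrt (LINT x|gauss_measure. (norm (f x))\<^sup>2)"

text \<open>Smooth functions with compact support: all iterated partial derivatives (along arbitrary finite
  sequences of directions) exist and are continuous.\<close>

definition test_functions :: "(real^'n::finite \<Rightarrow> complex) set" where
  "test_functions = {f. compact (closure {x. f x \<noteq> 0}) \<and>
     (\<forall>js. continuous_on UNIV (foldr rpartial js f) \<and>
       (\<forall>j x. (\<lambda>t. foldr rpartial js f (x + axis j t)) differentiable (at 0)))}"

definition test_norm :: "nat \<Rightarrow> (real^'n::finite \<Rightarrow> complex) \<Rightarrow> real" where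
  "test_norm m f = (\<Sum>\<alpha>\<in>multi_indices m. gauss_L2_norm (multi_deriv rpartial \<alpha> f))"

text \<open>The completion of \<open>test_functions\<close> under \<open>test_norm m\<close> is realised inside \<open>L\<^sup>2(\<gamma>)\<close>: an element is
  represented by the \<open>L\<^sup>2(\<gamma>)\<close> limit of a \<open>test_norm m\<close>-Cauchy sequence of test functions, and its norm
  is the limit of the norms. This limit does not depend on the sequence because differentiation is
  closable on \<open>L\<^sup>2(\<gamma>)\<close>. Elements are (Borel) functions rather than classes modulo null sets, so
  \<open>gauss_sobolev m\<close> contains all representatives of each class.\<close>

definition gauss_sobolev_approx ::
  "nat \<Rightarrow> (nat \<Rightarrow> real^'n::finite \<Rightarrow> complex) \<Rightarrow> (real^'n \<Rightarrow> complex) \<Rightarrow> bool" where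
  "gauss_sobolev_approx m F f \<longleftrightarrow>
     (\<forall>k. F k \<in> test_functions) \<and>
     (\<forall>e>0. \<exists>N. \<forall>k\<ge>N. \<forall>l\<ge>N. test_norm m (\<lambda>x. F k x - F l x) < e) \<and>
     f \<in> gauss_L2 \<and>
     (\<lambda>k. gauss_L2_norm (\<lambda>x. F k x - f x)) \<longlonglongrightarrow> 0"

definition gauss_sobolev :: "nat \<Rightarrow> (real^'n::finite \<Rightarrow> complex) set" where
  "gauss_sobolev m = {f. \<exists>F. gauss_sobolev_approx m F f}"

definition gauss_sobolev_norm :: "nat \<Rightarrow> (real^'n::finite \<Rightarrow> complex) \<Rightarrow> real" where
  "gauss_sobolev_norm m f =
     (THE l. \<forall>F. gauss_sobolev_approx m F f \<longrightarrow> (\<lambda>k. test_norm m (F k)) \<longlonglongrightarrow> l)"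

definition locally_integrable :: "(real^'n::finite \<Rightarrow> complex) \<Rightarrow> bool" where
  "locally_integrable u \<longleftrightarrow> (\<forall>K. compact K \<longrightarrow> set_integrable lborel K u)"

definition mult_op :: "(real^'n::finite \<Rightarrow> complex) \<Rightarrow> (real^'n \<Rightarrow> complex) \<Rightarrow> real^'n \<Rightarrow> complex" where
  "mult_op u f x = u x * f x"

definition multiplier :: "nat \<Rightarrow> (real^'n::finite \<Rightarrow> complex) \<Rightarrow> bool" where
  "multiplier m u \<longleftrightarrow> locally_integrable u \<and>
     bounded_op (gauss_sobolev m) (gauss_sobolev_norm m) (mult_op u)"

subsection \<open>The Gauss-Bargmann transform\<close>

definition gauss_bargmann :: "(real^'n::finite \<Rightarrow> complex) \<Rightarrow> complex^'n \<Rightarrow> complex" where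
  "gauss_bargmann f z = (LINT x|gauss_measure. f x * exp (cdot (cvec x) z - cdot z z / 2))"

text \<open>The inverse of the transform from \<open>gauss_sobolev m\<close> onto \<open>fock_sobolev m\<close>; its values are
  determined up to null sets.\<close>

definition gauss_bargmann_inv :: "nat \<Rightarrow> (complex^'n::finite \<Rightarrow> complex) \<Rightarrow> real^'n \<Rightarrow> complex" where
  "gauss_bargmann_inv m = inv_into (gauss_sobolev m) gauss_bargmann"

text \<open>Equality of the integral operator with the composite
  \<open>C\<^sub>\<i> G M\<^sub>u G\<inverse> C\<^sub>-\<^sub>\<i>\<close> as operators on \<open>fock_sobolev m\<close>.\<close>

definition S_represented_by ::
  "nat \<Rightarrow> (complex^'n::finite \<Rightarrow> complex) \<Rightarrow> (real^'n \<Rightarrow> complex) \<Rightarrow> bool" where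
  "S_represented_by m \<phi> u \<longleftrightarrow>
     (\<forall>f\<in>fock_sobolev m. S_op \<phi> f =
        (comp_op \<i> \<circ> gauss_bargmann \<circ> mult_op u \<circ> gauss_bargmann_inv m \<circ> comp_op (- \<i>)) f)"

end

theory Submission
  imports Defs "HOL-Probability.Characteristic_Functions" "HOL-Complex_Analysis.Cauchy_Integral_Formula" "HOL-Real_Asymp.Real_Asymp"
begin

text \<open>
  Throughout, \<open>G\<close> is the Gauss-Bargmann transform and \<open>C\<^sub>\<i>\<close>, \<open>C\<^sub>-\<^sub>\<i>\<close> are the compositions with the
  multiplications by \<open>\<i>\<close> and \<open>-\<i>\<close>.

  The integral operator becomes a multiplication on the other side of \<open>G\<close>. If \<open>\<phi> = C\<^sub>\<i> G u\<close> and
  \<open>f = C\<^sub>\<i> G g\<close>, then for fixed \<open>z\<close> the integral \<open>S\<^sub>\<phi> f z\<close> is an inner product in the Fock space between \<open>G g\<close>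
  and the transform of an explicit function built from \<open>u\<close> and an exponential. Since \<open>G\<close> preserves inner
  products, \<open>S\<^sub>\<phi> f z = G (u g) (\<i> z)\<close>, provided \<open>u\<close> times the exponential \<open>exp (\<i> x \<cdot> z)\<close> is square
  integrable; this is \<open>S_op_transform\<close>. For real \<open>z\<close> the exponential has modulus one and the proviso is
  void.

  Let \<open>S\<^sub>\<phi>\<close> be bounded and put \<open>u = G\<inverse> C\<^sub>-\<^sub>\<i> \<phi>\<close>. At real points the identity holds, and the values of a
  transform on \<open>\<i> \<real>\<^sup>n\<close> are a Fourier transform, so they determine the function
  (\<open>gauss_bargmann_unique\<close>). Hence \<open>u g\<close> is the preimage of \<open>C\<^sub>-\<^sub>\<i> S\<^sub>\<phi> C\<^sub>\<i> G g\<close>, and the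
  boundedness of \<open>S\<^sub>\<phi>\<close> carries over to the multiplication by \<open>u\<close> (\<open>bounded_imp_multiplier\<close>).

  Conversely, let the representation hold with a multiplier \<open>u\<close>. Applied to the constant function 1 it
  gives \<open>\<phi> = C\<^sub>\<i> G u\<close> (\<open>represented_symbol\<close>). Iterating the multiplication on the function 1 shows that
  \<open>u\<close> is essentially bounded (\<open>multiplier_essentially_bounded\<close>), so the defining integral of \<open>S\<^sub>\<phi>\<close> converges
  at every complex point, and boundedness is read off from the representation
  (\<open>multiplier_imp_bounded\<close>). The formula for \<open>\<phi>\<close> is the definition of \<open>G u\<close> at \<open>\<i> z\<close> after the
  substitution of \<open>2 x\<close> for \<open>x\<close> (\<open>symbol_integral_formula\<close>).

  The bulk of the work is that \<open>G\<close> is an isometry between the Sobolev spaces and onto. On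
  \<open>L\<^sup>2\<close>, the isometry comes from a Gaussian computation for continuous functions of compact support,
  regularised in the imaginary direction so that Fubini's theorem applies
  (\<open>bargmann_regularized\<close>, \<open>gauss_bargmann_isometry\<close>). Real derivatives are turned into complex ones,
  because the Gaussian density times the kernel depends on \<open>x - z\<close> only (\<open>cpartial_gauss_bargmann\<close>); with
  the continuity of point evaluations on the Fock space this extends to the completion
  (\<open>gauss_bargmann_sobolev_isometry\<close>). Surjectivity rests on an explicit inversion integral, which
  converges for dilations \<open>F (r z)\<close> with \<open>r < 1\<close> (\<open>dilation_preimage\<close>); these are dense in the
  Fock-Sobolev space (\<open>gauss_bargmann_surjective\<close>).
\<close>

section \<open>Square integrable functions\<close>

definition L2 :: "'a measure \<Rightarrow> ('a \<Rightarrow> complex) set" where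
  "L2 M = {f. f \<in> borel_measurable M \<and> integrable M (\<lambda>x. (norm (f x))\<^sup>2)}"

definition L2_norm :: "'a measure \<Rightarrow> ('a \<Rightarrow> complex) \<Rightarrow> real" where
  "L2_norm M f = sqrt (LINT x|M. (norm (f x))\<^sup>2)"

lemma L2_norm_nonneg [simp]: "0 \<le> L2_norm M f"
  by (simp add: L2_norm_def)

lemma L2_norm_square: "(L2_norm M f)\<^sup>2 = (LINT x|M. (norm (f x))\<^sup>2)"
  by (simp add: L2_norm_def)

lemma L2_measurable [measurable_dest]: "f \<in> L2 M \<Longrightarrow> f \<in> borel_measurable M"
  by (simp add: L2_def)

lemma L2_integrable: "f \<in> L2 M \<Longrightarrow> integrable M (\<lambda>x. (norm (f x))\<^sup>2)"
  by (simp add: L2_def)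

lemma L2_bound:
  assumes "integrable M w" "f \<in> borel_measurable M" "AE x in M. (norm (f x))\<^sup>2 \<le> w x"
  shows "f \<in> L2 M"
proof -
  have "integrable M (\<lambda>x. (norm (f x))\<^sup>2)"
  proof (rule Bochner_Integration.integrable_bound[OF assms(1)])
    show "AE x in M. norm ((norm (f x))\<^sup>2) \<le> norm (w x)"
      using assms(3) by eventually_elim simp
  qed (use assms(2) in simp)
  then show ?thesis using assms(2) by (simp add: L2_def)
qed

lemma L2_mult_bounded:
  assumes "f \<in> L2 M" "h \<in> borel_measurable M" "\<And>x. norm (h x) \<le> B"
  shows "(\<lambda>x. h x * f x) \<in> L2 M"
proof (rule L2_bound)
  show "integrable M (\<lambda>x. B\<^sup>2 * (norm (f x))\<^sup>2)"
    using assms(1) by (simp add: L2_def)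
  show "(\<lambda>x. h x * f x) \<in> borel_measurable M"
    using assms by (intro borel_measurable_times) (auto simp: L2_def)
  show "AE x in M. (norm (h x * f x))\<^sup>2 \<le> B\<^sup>2 * (norm (f x))\<^sup>2"
    using assms(3) by (intro AE_I2) (auto simp: norm_mult power_mult_distrib intro!: mult_right_mono power_mono)
qed

lemma L2_cmult: "f \<in> L2 M \<Longrightarrow> (\<lambda>x. c * f x) \<in> L2 M"
  by (rule L2_mult_bounded[where B="norm c"]) auto

lemma L2_norm_cmult: "L2_norm M (\<lambda>x. c * f x) = norm c * L2_norm M f"
  by (simp add: L2_norm_def norm_mult power_mult_distrib real_sqrt_mult)

lemma L2_cnj: "f \<in> L2 M \<Longrightarrow> (\<lambda>x. cnj (f x)) \<in> L2 M"
  unfolding L2_def using measurable_compose[of f M borel cnj borel] borel_measurable_continuous_onI[of cnj]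
  by (simp add: continuous_on_cnj)

lemma norm_add_square_le: "(norm (a + b :: complex))\<^sup>2 \<le> 2 * (norm a)\<^sup>2 + 2 * (norm b)\<^sup>2"
proof -
  have "(norm (a + b))\<^sup>2 \<le> (norm a + norm b)\<^sup>2"
    by (intro power_mono norm_triangle_ineq) auto
  also have "\<dots> \<le> 2 * (norm a)\<^sup>2 + 2 * (norm b)\<^sup>2"
    using sum_squares_bound[of "norm a" "norm b"] by (simp add: power2_sum)
  finally show ?thesis .
qed

lemma L2_add: "f \<in> L2 M \<Longrightarrow> g \<in> L2 M \<Longrightarrow> (\<lambda>x. f x + g x) \<in> L2 M"
  by (rule L2_bound[where w="\<lambda>x. 2 * (norm (f x))\<^sup>2 + 2 * (norm (g x))\<^sup>2"])
     (auto simp: L2_def norm_add_square_le)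

lemma L2_diff: "f \<in> L2 M \<Longrightarrow> g \<in> L2 M \<Longrightarrow> (\<lambda>x. f x - g x) \<in> L2 M"
  using L2_add[of f M "\<lambda>x. (-1) * g x"] L2_cmult[of g M "-1"] by simp

lemma L2_norm_diff_commute: "L2_norm M (\<lambda>x. f x - g x) = L2_norm M (\<lambda>x. g x - f x)"
  by (simp add: L2_norm_def norm_minus_commute)

lemma L2_zero: "(\<lambda>x. 0) \<in> L2 M"
  by (simp add: L2_def)

lemma L2_AE_eq:
  assumes "f \<in> L2 M" "g \<in> borel_measurable M" "AE x in M. f x = g x"
  shows "g \<in> L2 M"
  by (rule L2_bound[OF L2_integrable[OF assms(1)] assms(2)]) (use assms(3) in auto)

lemma L2_norm_cong_AE:
  assumes "f \<in> borel_measurable M" "g \<in> borel_measurable M" "AE x in M. f x = g x"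
  shows "L2_norm M f = L2_norm M g"
  unfolding L2_norm_def using assms by (intro arg_cong[where f=sqrt] integral_cong_AE) auto

lemma L2_mult_integrable_norm:
  assumes "f \<in> L2 M" "g \<in> L2 M"
  shows "integrable M (\<lambda>x. norm (f x) * norm (g x))"
proof (rule Bochner_Integration.integrable_bound[where f="\<lambda>x. (norm (f x))\<^sup>2 + (norm (g x))\<^sup>2"])
  show "AE x in M. norm (norm (f x) * norm (g x)) \<le> norm ((norm (f x))\<^sup>2 + (norm (g x))\<^sup>2)"
  proof (intro AE_I2)
    fix x
    have "2 * (norm (f x) * norm (g x)) \<le> (norm (f x))\<^sup>2 + (norm (g x))\<^sup>2"
      using sum_squares_bound[of "norm (f x)" "norm (g x)"] by (simp add: mult.assoc)
    moreover have "0 \<le> norm (f x) * norm (g x)" by simp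
    ultimately have "norm (f x) * norm (g x) \<le> (norm (f x))\<^sup>2 + (norm (g x))\<^sup>2" by linarith
    then show "norm (norm (f x) * norm (g x)) \<le> norm ((norm (f x))\<^sup>2 + (norm (g x))\<^sup>2)"
      by (simp add: abs_mult)
  qed
qed (use assms in \<open>auto simp: L2_def\<close>)

lemma L2_mult_integrable:
  assumes "f \<in> L2 M" "g \<in> L2 M"
  shows "integrable M (\<lambda>x. f x * g x)"
  using L2_mult_integrable_norm[OF assms] assms
  by (elim Bochner_Integration.integrable_bound) (auto simp: L2_def norm_mult)

lemma L2_Cauchy_Schwarz_norm:
  assumes "f \<in> L2 M" "g \<in> L2 M"
  shows "(LINT x|M. norm (f x) * norm (g x)) \<le> L2_norm M f * L2_norm M g"
proof -
  have key: "(LINT x|M. norm (f x) * norm (g x)) \<le> (L2_norm M f + e) * (L2_norm M g + e)" if "e > 0" for e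
  proof -
    define p where "p = L2_norm M f + e"
    define q where "q = L2_norm M g + e"
    have pq: "p > 0" "q > 0" using that by (auto simp: p_def q_def add_nonneg_pos)
    have pt: "norm (f x) * norm (g x) \<le> (q / p) / 2 * (norm (f x))\<^sup>2 + (p / q) / 2 * (norm (g x))\<^sup>2" for x
    proof -
      have "0 \<le> (q * norm (f x) - p * norm (g x))\<^sup>2" by simp
      then have "2 * p * q * (norm (f x) * norm (g x)) \<le> q\<^sup>2 * (norm (f x))\<^sup>2 + p\<^sup>2 * (norm (g x))\<^sup>2"
        by (simp add: power2_diff power_mult_distrib algebra_simps)
      then show ?thesis using pq by (simp add: field_simps power2_eq_square)
    qed
    have "(LINT x|M. norm (f x) * norm (g x)) \<le> (LINT x|M. (q / p) / 2 * (norm (f x))\<^sup>2 + (p / q) / 2 * (norm (g x))\<^sup>2)"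
      using assms pt by (intro integral_mono L2_mult_integrable_norm) (auto simp: L2_def)
    also have "\<dots> = (q / p) / 2 * (L2_norm M f)\<^sup>2 + (p / q) / 2 * (L2_norm M g)\<^sup>2"
      using assms by (simp add: L2_norm_square L2_def)
    also have "\<dots> \<le> (q / p) / 2 * p\<^sup>2 + (p / q) / 2 * q\<^sup>2"
      using pq that by (intro add_mono mult_left_mono power_mono) (auto simp: p_def q_def)
    also have "\<dots> = p * q" using pq by (simp add: field_simps power2_eq_square)
    finally show ?thesis by (simp add: p_def q_def)
  qed
  have "((\<lambda>e. (L2_norm M f + e) * (L2_norm M g + e)) \<longlongrightarrow> (L2_norm M f + 0) * (L2_norm M g + 0)) (at_right 0)"
    by (intro tendsto_intros)
  moreover have "eventually (\<lambda>e. (LINT x|M. norm (f x) * norm (g x)) \<le> (L2_norm M f + e) * (L2_norm M g + e)) (at_right 0)"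
    using key by (auto intro: eventually_at_rightI[of 0 1])
  ultimately show ?thesis
    using tendsto_lowerbound[of _ _ "at_right (0::real)"] by force
qed

lemma L2_Cauchy_Schwarz:
  assumes "f \<in> L2 M" "g \<in> L2 M"
  shows "norm (LINT x|M. f x * g x) \<le> L2_norm M f * L2_norm M g"
proof -
  have "norm (LINT x|M. f x * g x) \<le> (LINT x|M. norm (f x * g x))"
    by (rule integral_norm_bound)
  also have "\<dots> = (LINT x|M. norm (f x) * norm (g x))" by (simp add: norm_mult)
  finally show ?thesis using L2_Cauchy_Schwarz_norm[OF assms] by linarith
qed

lemma L2_norm_triangle:
  assumes "f \<in> L2 M" "g \<in> L2 M"
  shows "L2_norm M (\<lambda>x. f x + g x) \<le> L2_norm M f + L2_norm M g"
proof (rule power2_le_imp_le)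
  have pt: "(norm (f x + g x))\<^sup>2 \<le> (norm (f x))\<^sup>2 + (norm (g x))\<^sup>2 + 2 * (norm (f x) * norm (g x))" for x
  proof -
    have "(norm (f x + g x))\<^sup>2 \<le> (norm (f x) + norm (g x))\<^sup>2"
      by (intro power_mono norm_triangle_ineq) auto
    then show ?thesis by (simp add: power2_sum mult.assoc)
  qed
  have "(L2_norm M (\<lambda>x. f x + g x))\<^sup>2 = (LINT x|M. (norm (f x + g x))\<^sup>2)"
    by (rule L2_norm_square)
  also have "\<dots> \<le> (LINT x|M. (norm (f x))\<^sup>2 + (norm (g x))\<^sup>2 + 2 * (norm (f x) * norm (g x)))"
    using pt L2_add[OF assms] assms L2_mult_integrable_norm[OF assms] by (intro integral_mono) (auto simp: L2_def)
  also have "\<dots> = (L2_norm M f)\<^sup>2 + (L2_norm M g)\<^sup>2 + 2 * (LINT x|M. norm (f x) * norm (g x))"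
    using assms L2_mult_integrable_norm[OF assms] by (simp add: L2_norm_square L2_def)
  also have "\<dots> \<le> (L2_norm M f + L2_norm M g)\<^sup>2"
    using L2_Cauchy_Schwarz_norm[OF assms] by (simp add: power2_sum mult.assoc)
  finally show "(L2_norm M (\<lambda>x. f x + g x))\<^sup>2 \<le> (L2_norm M f + L2_norm M g)\<^sup>2" .
qed simp

lemma L2_norm_triangle_diff:
  assumes "f \<in> L2 M" "g \<in> L2 M" "h \<in> L2 M"
  shows "L2_norm M (\<lambda>x. f x - h x) \<le> L2_norm M (\<lambda>x. f x - g x) + L2_norm M (\<lambda>x. g x - h x)"
  using L2_norm_triangle[OF L2_diff[OF assms(1,2)] L2_diff[OF assms(2,3)]] by simp

lemma L2_norm_diff_ineq:
  assumes "f \<in> L2 M" "g \<in> L2 M"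
  shows "\<bar>L2_norm M f - L2_norm M g\<bar> \<le> L2_norm M (\<lambda>x. f x - g x)"
  using L2_norm_triangle_diff[OF assms L2_zero] L2_norm_triangle_diff[OF assms(2,1) L2_zero]
    L2_norm_diff_commute[of M f g] by simp

lemma L2_norm_tendsto:
  assumes "\<And>k. F k \<in> L2 M" "f \<in> L2 M" "(\<lambda>k. L2_norm M (\<lambda>x. F k x - f x)) \<longlonglongrightarrow> 0"
  shows "(\<lambda>k. L2_norm M (F k)) \<longlonglongrightarrow> L2_norm M f"
proof -
  have "(\<lambda>k. L2_norm M (F k) - L2_norm M f) \<longlonglongrightarrow> 0"
    by (rule tendsto_rabs_zero_cancel, rule tendsto_sandwich[OF _ _ tendsto_const assms(3)])
       (use L2_norm_diff_ineq[OF assms(1,2)] in auto)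
  then show ?thesis by (simp add: LIM_zero_iff)
qed

text \<open>Fatou's lemma, applied to \<open>F k - F (r l)\<close> as \<open>l\<close> grows, bounds the distance from \<open>F k\<close> to the
  pointwise limit by the Cauchy modulus. The limit function is prescribed in advance: below it is often
  the transform of a known function, and the conclusion is that this particular function is the limit.\<close>

lemma L2_Cauchy_AE_limit:
  assumes F: "\<And>k. F k \<in> L2 M" and f: "f \<in> borel_measurable M"
    and cauchy: "\<And>e. e > 0 \<Longrightarrow> \<exists>N. \<forall>k\<ge>N. \<forall>l\<ge>N. L2_norm M (\<lambda>x. F k x - F l x) < e"
    and r: "strict_mono r" and lim: "AE x in M. (\<lambda>k. F (r k) x) \<longlonglongrightarrow> f x"
  shows "f \<in> L2 M" "(\<lambda>k. L2_norm M (\<lambda>x. F k x - f x)) \<longlonglongrightarrow> 0"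
proof -
  have [measurable]: "F k \<in> borel_measurable M" "f \<in> borel_measurable M" for k
    using F f by (auto simp: L2_def)
  have bound: "(\<lambda>x. F k x - f x) \<in> L2 M \<and> L2_norm M (\<lambda>x. F k x - f x) \<le> e"
    if N: "\<And>k l. k \<ge> N \<Longrightarrow> l \<ge> N \<Longrightarrow> L2_norm M (\<lambda>x. F k x - F l x) < e" and "k \<ge> N" "e > 0" for N k e
  proof -
    have "(\<integral>\<^sup>+x. ennreal ((norm (F k x - f x))\<^sup>2) \<partial>M) = (\<integral>\<^sup>+x. liminf (\<lambda>l. ennreal ((norm (F k x - F (r l) x))\<^sup>2)) \<partial>M)"
    proof (rule nn_integral_cong_AE, use lim in eventually_elim)
      fix x assume "(\<lambda>k. F (r k) x) \<longlonglongrightarrow> f x"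
      then have "(\<lambda>l. ennreal ((norm (F k x - F (r l) x))\<^sup>2)) \<longlonglongrightarrow> ennreal ((norm (F k x - f x))\<^sup>2)"
        by (intro tendsto_intros)
      then show "ennreal ((norm (F k x - f x))\<^sup>2) = liminf (\<lambda>l. ennreal ((norm (F k x - F (r l) x))\<^sup>2))"
        using lim_imp_Liminf[OF sequentially_bot, symmetric] by blast
    qed
    also have "\<dots> \<le> liminf (\<lambda>l. \<integral>\<^sup>+x. ennreal ((norm (F k x - F (r l) x))\<^sup>2) \<partial>M)"
      by (rule nn_integral_liminf) measurable
    also have "\<dots> \<le> ennreal (e\<^sup>2)"
    proof (rule Liminf_le)
      show "\<forall>\<^sub>F l in sequentially. (\<integral>\<^sup>+x. ennreal ((norm (F k x - F (r l) x))\<^sup>2) \<partial>M) \<le> ennreal (e\<^sup>2)"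
        unfolding eventually_sequentially
      proof (intro exI allI impI)
        fix l assume "l \<ge> N"
        then have "r l \<ge> N" using strict_mono_imp_increasing[OF r, of l] by linarith
        then have "(L2_norm M (\<lambda>x. F k x - F (r l) x))\<^sup>2 \<le> e\<^sup>2"
          using N[OF \<open>k \<ge> N\<close>, of "r l"] by (intro power_mono) auto
        then show "(\<integral>\<^sup>+x. ennreal ((norm (F k x - F (r l) x))\<^sup>2) \<partial>M) \<le> ennreal (e\<^sup>2)"
          using L2_integrable[OF L2_diff[OF F F]] by (subst nn_integral_eq_integral) (auto simp: L2_norm_square)
      qed
    qed simp
    finally have le: "(\<integral>\<^sup>+x. ennreal ((norm (F k x - f x))\<^sup>2) \<partial>M) \<le> ennreal (e\<^sup>2)" .
    then have int: "integrable M (\<lambda>x. (norm (F k x - f x))\<^sup>2)"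
      by (intro integrableI_bounded) (auto simp: top_unique less_top elim: le_less_trans)
    then have "(L2_norm M (\<lambda>x. F k x - f x))\<^sup>2 \<le> e\<^sup>2"
      using le by (subst (asm) nn_integral_eq_integral) (auto simp: L2_norm_square)
    then have "L2_norm M (\<lambda>x. F k x - f x) \<le> e"
      using \<open>e > 0\<close> by (meson less_imp_le power2_le_imp_le)
    with int show ?thesis by (simp add: L2_def)
  qed
  obtain N where N: "\<forall>k\<ge>N. \<forall>l\<ge>N. L2_norm M (\<lambda>x. F k x - F l x) < 1" using cauchy[of 1] by auto
  then have "(\<lambda>x. F N x - f x) \<in> L2 M" using bound[of N 1 N] by auto
  from L2_diff[OF F[of N] this] show "f \<in> L2 M" by simp
  show "(\<lambda>k. L2_norm M (\<lambda>x. F k x - f x)) \<longlonglongrightarrow> 0"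
  proof (rule LIMSEQ_I)
    fix e :: real assume "e > 0"
    then obtain N where N: "\<forall>k\<ge>N. \<forall>l\<ge>N. L2_norm M (\<lambda>x. F k x - F l x) < e / 2" using cauchy[of "e / 2"] by auto
    have "norm (L2_norm M (\<lambda>x. F k x - f x) - 0) < e" if "k \<ge> N" for k
      using bound[of N "e/2" k] N that \<open>e > 0\<close> by auto
    then show "\<exists>N. \<forall>k\<ge>N. norm (L2_norm M (\<lambda>x. F k x - f x) - 0) < e" by blast
  qed
qed

lemma (in finite_measure) integrable_L2:
  assumes "f \<in> L2 M"
  shows "integrable M f"
proof -
  have "(\<lambda>x. 1) \<in> L2 M" by (simp add: L2_def)
  from L2_mult_integrable[OF assms this] show ?thesis by simp
qed

text \<open>The classical argument of Riesz and Fischer: a subsequence with summable distances converges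
  almost everywhere. Finiteness of the measure gives the summability in \<open>L\<^sup>1\<close> by the Cauchy-Schwarz
  inequality.\<close>

lemma (in finite_measure) L2_complete:
  assumes F: "\<And>k. F k \<in> L2 M"
    and cauchy: "\<And>e. e > 0 \<Longrightarrow> \<exists>N. \<forall>k\<ge>N. \<forall>l\<ge>N. L2_norm M (\<lambda>x. F k x - F l x) < e"
  shows "\<exists>f\<in>L2 M. (\<lambda>k. L2_norm M (\<lambda>x. F k x - f x)) \<longlonglongrightarrow> 0"
proof -
  have [measurable]: "F k \<in> borel_measurable M" for k
    using F by (auto simp: L2_def)
  have "\<exists>r::nat\<Rightarrow>nat. strict_mono r \<and> (\<forall>k. \<forall>l\<ge>r k. L2_norm M (\<lambda>x. F (r k) x - F l x) < (1/2)^k)"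
  proof -
    have "\<exists>r::nat\<Rightarrow>nat. \<forall>k. (\<forall>l\<ge>r k. L2_norm M (\<lambda>x. F (r k) x - F l x) < (1/2)^k) \<and> r k < r (Suc k)"
    proof (rule dependent_nat_choice)
      show "\<exists>x. \<forall>l\<ge>x. L2_norm M (\<lambda>y. F x y - F l y) < (1/2)^0" using cauchy[of 1] by auto
      fix x n
      obtain N where "\<forall>k\<ge>N. \<forall>l\<ge>N. L2_norm M (\<lambda>x. F k x - F l x) < (1/2)^Suc n"
        using cauchy[of "(1/2)^Suc n"] by auto
      then show "\<exists>y. (\<forall>l\<ge>y. L2_norm M (\<lambda>x. F y x - F l x) < (1/2)^Suc n) \<and> x < y"
        by (intro exI[of _ "max N (Suc x)"]) auto
    qed
    then show ?thesis by (auto simp: strict_mono_Suc_iff)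
  qed
  then obtain r where r: "strict_mono r"
    and d: "\<And>k l. l \<ge> r k \<Longrightarrow> L2_norm M (\<lambda>x. F (r k) x - F l x) < (1/2)^k" by blast
  define D where "D k x = F (r (Suc k)) x - F (r k) x" for k x
  have DL2: "D k \<in> L2 M" for k unfolding D_def by (intro L2_diff F)
  have Dn: "L2_norm M (D k) < (1/2)^k" for k
    unfolding D_def L2_norm_diff_commute[of M "F (r (Suc k))"] by (intro d) (meson r strict_monoD lessI less_imp_le)
  have one: "(\<lambda>x. 1) \<in> L2 M" by (simp add: L2_def)
  have [measurable]: "D k \<in> borel_measurable M" for k using DL2 by (auto simp: L2_def)
  have "(\<integral>\<^sup>+x. (\<Sum>k. ennreal (norm (D k x))) \<partial>M) = (\<Sum>k. \<integral>\<^sup>+x. ennreal (norm (D k x)) \<partial>M)"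
    by (rule nn_integral_suminf) measurable
  also have "\<dots> \<le> (\<Sum>k. ennreal (L2_norm M (\<lambda>x. 1) * (1/2)^k))"
  proof (rule suminf_le)
    fix k
    have "(LINT x|M. norm (D k x)) \<le> L2_norm M (D k) * L2_norm M (\<lambda>x. 1)"
      using L2_Cauchy_Schwarz_norm[OF DL2 one, of k] by simp
    also have "\<dots> \<le> L2_norm M (\<lambda>x. 1) * (1/2)^k"
      using Dn[of k] by (simp add: mult.commute mult_left_mono)
    finally show "(\<integral>\<^sup>+x. ennreal (norm (D k x)) \<partial>M) \<le> ennreal (L2_norm M (\<lambda>x. 1) * (1/2)^k)"
      using integrable_L2[OF DL2] by (subst nn_integral_eq_integral) (auto intro: ennreal_leI)
  qed auto
  also have "\<dots> < \<infinity>"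
  proof -
    have "summable (\<lambda>k. L2_norm M (\<lambda>x. 1) * (1/2)^k)" by (intro summable_mult summable_geometric) auto
    then show ?thesis by (subst suminf_ennreal2) auto
  qed
  finally have "(\<integral>\<^sup>+x. (\<Sum>k. ennreal (norm (D k x))) \<partial>M) \<noteq> \<infinity>" by simp
  then have "AE x in M. (\<Sum>k. ennreal (norm (D k x))) \<noteq> \<infinity>"
    by (intro nn_integral_noteq_infinite) auto
  then have conv: "AE x in M. convergent (\<lambda>k. F (r k) x)"
  proof eventually_elim
    fix x assume "(\<Sum>k. ennreal (norm (D k x))) \<noteq> \<infinity>"
    then have "summable (\<lambda>k. norm (D k x))"
      by (intro summable_suminf_not_top) auto
    then have "summable (\<lambda>k. D k x)" by (rule summable_norm_cancel)
    then have "convergent (\<lambda>n. F (r n) x - F (r 0) x)"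
      using sum_lessThan_telescope[of "\<lambda>k. F (r k) x"] by (simp add: summable_iff_convergent D_def)
    then show "convergent (\<lambda>k. F (r k) x)"
      using convergent_add_const_iff[of "- F (r 0) x" "\<lambda>k. F (r k) x"] by (simp add: algebra_simps)
  qed
  define f where "f x = lim (\<lambda>k. F (r k) x)" for x
  have fm: "f \<in> borel_measurable M" unfolding f_def by measurable
  have lim: "AE x in M. (\<lambda>k. F (r k) x) \<longlonglongrightarrow> f x"
    using conv by eventually_elim (simp add: f_def convergent_LIMSEQ_iff)
  show ?thesis using L2_Cauchy_AE_limit[OF F fm cauchy r lim] by blast
qed

lemma L2_convergent_imp_Cauchy:
  assumes F: "\<And>k. F k \<in> L2 M" and f: "f \<in> L2 M" and lim: "(\<lambda>k. L2_norm M (\<lambda>x. F k x - f x)) \<longlonglongrightarrow> 0" and "e > 0"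
  shows "\<exists>N. \<forall>k\<ge>N. \<forall>l\<ge>N. L2_norm M (\<lambda>x. F k x - F l x) < e"
proof -
  obtain N where N: "\<And>k. k \<ge> N \<Longrightarrow> L2_norm M (\<lambda>x. F k x - f x) < e / 2"
    using order_tendstoD(2)[OF lim, of "e/2"] \<open>e > 0\<close> by (auto simp: eventually_sequentially)
  have "L2_norm M (\<lambda>x. F k x - F l x) < e" if "k \<ge> N" "l \<ge> N" for k l
    using L2_norm_triangle_diff[OF F f F, of k l] N[OF that(1)] N[OF that(2)]
      L2_norm_diff_commute[of M f "F l"] by simp
  then show ?thesis by blast
qed

lemma L2_dominated_convergence:
  assumes w: "integrable M w" and F: "\<And>k. F k \<in> borel_measurable M" and f: "f \<in> borel_measurable M"
    and bound: "\<And>k. AE x in M. (norm (F k x))\<^sup>2 \<le> w x"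
    and lim: "AE x in M. (\<lambda>k. F k x) \<longlonglongrightarrow> f x"
  shows "f \<in> L2 M" "(\<lambda>k. L2_norm M (\<lambda>x. F k x - f x)) \<longlonglongrightarrow> 0"
proof -
  have fb: "AE x in M. (norm (f x))\<^sup>2 \<le> w x"
    using lim bound[THEN AE_all_countable[THEN iffD2, OF allI]]
  proof eventually_elim
    fix x assume *: "(\<lambda>k. F k x) \<longlonglongrightarrow> f x" "\<forall>k. (norm (F k x))\<^sup>2 \<le> w x"
    have "(\<lambda>k. (norm (F k x))\<^sup>2) \<longlonglongrightarrow> (norm (f x))\<^sup>2" using *(1) by (intro tendsto_intros)
    then show "(norm (f x))\<^sup>2 \<le> w x" using *(2) by (intro LIMSEQ_le_const2) auto
  qed
  show "f \<in> L2 M" by (rule L2_bound[OF w f fb])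
  have "(\<lambda>k. LINT x|M. (norm (F k x - f x))\<^sup>2) \<longlonglongrightarrow> (LINT x|M. 0)"
  proof (rule integral_dominated_convergence[where w="\<lambda>x. 4 * w x"])
    show "AE x in M. (\<lambda>k. (norm (F k x - f x))\<^sup>2) \<longlonglongrightarrow> 0"
      using lim
    proof eventually_elim
      fix x assume "(\<lambda>k. F k x) \<longlonglongrightarrow> f x"
      then have "(\<lambda>k. (norm (F k x - f x))\<^sup>2) \<longlonglongrightarrow> (norm (f x - f x))\<^sup>2" by (intro tendsto_intros)
      then show "(\<lambda>k. (norm (F k x - f x))\<^sup>2) \<longlonglongrightarrow> 0" by simp
    qed
    show "AE x in M. norm ((norm (F k x - f x))\<^sup>2) \<le> 4 * w x" for k
      using bound[of k] fb
    proof eventually_elim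
      fix x assume "(norm (F k x))\<^sup>2 \<le> w x" "(norm (f x))\<^sup>2 \<le> w x"
      then show "norm ((norm (F k x - f x))\<^sup>2) \<le> 4 * w x"
        using norm_add_square_le[of "F k x" "- f x"] by simp
    qed
  qed (use w F f in auto)
  then show "(\<lambda>k. L2_norm M (\<lambda>x. F k x - f x)) \<longlonglongrightarrow> 0"
    unfolding L2_norm_def using tendsto_real_sqrt by fastforce
qed

text \<open>Polarisation: the inner product is a combination of the four squared norms of \<open>f + c g\<close> with
  \<open>c = 1, -1, \<i>, -\<i>\<close>.\<close>

lemma L2_isometry_inner:
  assumes f: "f \<in> L2 M" and g: "g \<in> L2 M"
    and Tf: "f' \<in> L2 N" and Tg: "g' \<in> L2 N"
    and iso: "\<And>c. L2_norm N (\<lambda>x. f' x + c * g' x) = L2_norm M (\<lambda>x. f x + c * g x)"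
  shows "(LINT x|N. f' x * cnj (g' x)) = (LINT x|M. f x * cnj (g x))"
proof -
  have pol: "4 * (a * cnj b) = of_real ((norm (a + 1 * b))\<^sup>2) - of_real ((norm (a + (-1) * b))\<^sup>2)
      + \<i> * of_real ((norm (a + \<i> * b))\<^sup>2) - \<i> * of_real ((norm (a + (-\<i>) * b))\<^sup>2)" for a b :: complex
    unfolding cmod_power2 by (simp add: complex_eq_iff power2_eq_square algebra_simps)
  have main: "4 * (LINT x|K. p x * cnj (q x)) = of_real ((L2_norm K (\<lambda>x. p x + 1 * q x))\<^sup>2) - of_real ((L2_norm K (\<lambda>x. p x + (-1) * q x))\<^sup>2)
      + \<i> * of_real ((L2_norm K (\<lambda>x. p x + \<i> * q x))\<^sup>2) - \<i> * of_real ((L2_norm K (\<lambda>x. p x + (-\<i>) * q x))\<^sup>2)"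
    if "p \<in> L2 K" "q \<in> L2 K" for p q :: "'z \<Rightarrow> complex" and K
  proof -
    have int: "integrable K (\<lambda>x. (norm (p x + c * q x))\<^sup>2)" for c
      by (intro L2_integrable L2_add L2_cmult that)
    have int': "has_bochner_integral K (\<lambda>x. complex_of_real ((norm (p x + c * q x))\<^sup>2)) (of_real ((L2_norm K (\<lambda>x. p x + c * q x))\<^sup>2))" for c
      unfolding L2_norm_square
      by (rule has_bochner_integral_of_real, rule has_bochner_integral_integrable, rule int)
    have "has_bochner_integral K (\<lambda>x. 4 * (p x * cnj (q x)))
      (of_real ((L2_norm K (\<lambda>x. p x + 1 * q x))\<^sup>2) - of_real ((L2_norm K (\<lambda>x. p x + (-1) * q x))\<^sup>2)
      + \<i> * of_real ((L2_norm K (\<lambda>x. p x + \<i> * q x))\<^sup>2) - \<i> * of_real ((L2_norm K (\<lambda>x. p x + (-\<i>) * q x))\<^sup>2))"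
      unfolding pol
      by (rule has_bochner_integral_diff, rule has_bochner_integral_add, rule has_bochner_integral_diff,
          rule int', rule int', rule has_bochner_integral_mult_right, rule int', rule has_bochner_integral_mult_right, rule int')
    from has_bochner_integral_integral_eq[OF this]
    have ?thesis by simp
    then show ?thesis .
  qed
  have "4 * (LINT x|N. f' x * cnj (g' x)) = 4 * (LINT x|M. f x * cnj (g x))"
    using main[OF f g] main[OF Tf Tg] by (simp only: iso)
  then show ?thesis by simp
qed

text \<open>Pointwise convergence together with convergence of norms implies convergence in norm. By the
  parallelogram law the squared distance is \<open>2 \<parallel>F k\<parallel>\<^sup>2 + 2 \<parallel>f\<parallel>\<^sup>2\<close> minus the integral of a nonnegative
  function that tends to \<open>4 |f|\<^sup>2\<close>; truncating this function at its limit makes dominated convergence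
  applicable.\<close>

lemma L2_norm_limit_of_bound:
  assumes F: "\<And>k. F k \<in> L2 M" and f: "f \<in> L2 M" and lim: "AE x in M. (\<lambda>k. F k x) \<longlonglongrightarrow> f x"
    and c: "\<And>k. (L2_norm M (F k))\<^sup>2 \<le> c k * (L2_norm M f)\<^sup>2" "c \<longlonglongrightarrow> 1"
  shows "(\<lambda>k. L2_norm M (\<lambda>x. F k x - f x)) \<longlonglongrightarrow> 0"
proof -
  have [measurable]: "F k \<in> borel_measurable M" "f \<in> borel_measurable M" for k
    using F f by (auto simp: L2_def)
  define u where "u k x = 2 * (norm (F k x))\<^sup>2 + 2 * (norm (f x))\<^sup>2 - (norm (F k x - f x))\<^sup>2" for k x
  have u0: "u k x \<ge> 0" for k x
    using norm_add_square_le[of "F k x" "- f x"] by (simp add: u_def)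
  have uint: "integrable M (u k)" for k
    unfolding u_def using F f L2_diff[OF F f] by (auto simp: L2_def)
  have mlim: "(\<lambda>k. LINT x|M. min (u k x) (4 * (norm (f x))\<^sup>2)) \<longlonglongrightarrow> (LINT x|M. 4 * (norm (f x))\<^sup>2)"
  proof (rule integral_dominated_convergence[where w="\<lambda>x. 4 * (norm (f x))\<^sup>2"])
    show "AE x in M. (\<lambda>k. min (u k x) (4 * (norm (f x))\<^sup>2)) \<longlonglongrightarrow> 4 * (norm (f x))\<^sup>2"
      using lim
    proof eventually_elim
      fix x assume "(\<lambda>k. F k x) \<longlonglongrightarrow> f x"
      then have "(\<lambda>k. min (u k x) (4 * (norm (f x))\<^sup>2)) \<longlonglongrightarrow>
        min (2 * (norm (f x))\<^sup>2 + 2 * (norm (f x))\<^sup>2 - (norm (f x - f x))\<^sup>2) (4 * (norm (f x))\<^sup>2)"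
        unfolding u_def by (intro tendsto_intros)
      then show "(\<lambda>k. min (u k x) (4 * (norm (f x))\<^sup>2)) \<longlonglongrightarrow> 4 * (norm (f x))\<^sup>2" by simp
    qed
    show "AE x in M. norm (min (u k x) (4 * (norm (f x))\<^sup>2)) \<le> 4 * (norm (f x))\<^sup>2" for k
    proof (rule AE_I2)
      fix x
      have "0 \<le> min (u k x) (4 * (norm (f x))\<^sup>2)" using u0[of k x] by simp
      then show "norm (min (u k x) (4 * (norm (f x))\<^sup>2)) \<le> 4 * (norm (f x))\<^sup>2" by simp
    qed
    show "(\<lambda>x. min (u k x) (4 * (norm (f x))\<^sup>2)) \<in> borel_measurable M" for k
      unfolding u_def by measurable
  qed (use f in \<open>auto simp: L2_def\<close>)
  have mle: "(LINT x|M. min (u k x) (4 * (norm (f x))\<^sup>2)) \<le> 2 * (L2_norm M (F k))\<^sup>2 + 2 * (L2_norm M f)\<^sup>2 - (L2_norm M (\<lambda>x. F k x - f x))\<^sup>2" for k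
  proof -
    have "(LINT x|M. min (u k x) (4 * (norm (f x))\<^sup>2)) \<le> (LINT x|M. u k x)"
    proof (rule integral_mono[OF _ uint])
      show "integrable M (\<lambda>x. min (u k x) (4 * (norm (f x))\<^sup>2))"
        by (rule integrable_min[OF uint]) (use f in \<open>auto simp: L2_def\<close>)
    qed auto
    also have "\<dots> = 2 * (L2_norm M (F k))\<^sup>2 + 2 * (L2_norm M f)\<^sup>2 - (L2_norm M (\<lambda>x. F k x - f x))\<^sup>2"
      unfolding u_def L2_norm_square using F f L2_diff[OF F f] by (simp add: L2_def)
    finally show ?thesis .
  qed
  have lim0: "(\<lambda>k. 2 * (c k * (L2_norm M f)\<^sup>2) + 2 * (L2_norm M f)\<^sup>2 - (LINT x|M. min (u k x) (4 * (norm (f x))\<^sup>2)))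
     \<longlonglongrightarrow> 2 * (1 * (L2_norm M f)\<^sup>2) + 2 * (L2_norm M f)\<^sup>2 - (LINT x|M. 4 * (norm (f x))\<^sup>2)"
    by (intro tendsto_intros c(2) mlim)
  also have "2 * (1 * (L2_norm M f)\<^sup>2) + 2 * (L2_norm M f)\<^sup>2 - (LINT x|M. 4 * (norm (f x))\<^sup>2) = 0"
    by (simp add: L2_norm_square)
  finally have lim0: "(\<lambda>k. 2 * (c k * (L2_norm M f)\<^sup>2) + 2 * (L2_norm M f)\<^sup>2 - (LINT x|M. min (u k x) (4 * (norm (f x))\<^sup>2))) \<longlonglongrightarrow> 0" .
  have le: "(L2_norm M (\<lambda>x. F k x - f x))\<^sup>2 \<le> 2 * (c k * (L2_norm M f)\<^sup>2) + 2 * (L2_norm M f)\<^sup>2 - (LINT x|M. min (u k x) (4 * (norm (f x))\<^sup>2))" for k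
    using mle[of k] c(1)[of k] by linarith
  have "(\<lambda>k. (L2_norm M (\<lambda>x. F k x - f x))\<^sup>2) \<longlonglongrightarrow> 0"
    by (rule tendsto_sandwich[OF _ _ tendsto_const lim0]) (use le in auto)
  then have "(\<lambda>k. sqrt ((L2_norm M (\<lambda>x. F k x - f x))\<^sup>2)) \<longlonglongrightarrow> sqrt 0" by (rule tendsto_real_sqrt)
  then show ?thesis by simp
qed

section \<open>Gaussian integrals\<close>

lemma prod_Basis_vec:
  fixes g :: "'a::euclidean_space^'n::finite \<Rightarrow> 'b::comm_monoid_mult"
  shows "(\<Prod>b\<in>Basis. g b) = (\<Prod>j\<in>UNIV. \<Prod>u\<in>Basis. g (axis j u))"
proof -
  have eq: "(Basis :: ('a^'n) set) = (\<lambda>(j, u). axis j u) ` (UNIV \<times> Basis)"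
    by (auto simp: Basis_vec_def image_iff)
  have inj: "inj_on (\<lambda>(j::'n, u::'a). axis j u) (UNIV \<times> Basis)"
    by (auto simp: inj_on_def axis_eq_axis)
  show ?thesis
    unfolding eq prod.reindex[OF inj] by (simp add: prod.cartesian_product split_def comp_def)
qed

lemma sum_Basis_vec:
  fixes g :: "'a::euclidean_space^'n::finite \<Rightarrow> 'b::comm_monoid_add"
  shows "(\<Sum>b\<in>Basis. g b) = (\<Sum>j\<in>UNIV. \<Sum>u\<in>Basis. g (axis j u))"
proof -
  have eq: "(Basis :: ('a^'n) set) = (\<lambda>(j, u). axis j u) ` (UNIV \<times> Basis)"
    by (auto simp: Basis_vec_def image_iff)
  have inj: "inj_on (\<lambda>(j::'n, u::'a). axis j u) (UNIV \<times> Basis)"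
    by (auto simp: inj_on_def axis_eq_axis)
  show ?thesis
    unfolding eq sum.reindex[OF inj] by (simp add: sum.cartesian_product split_def comp_def)
qed

lemma continuous_imp_borel: "continuous_on UNIV f \<Longrightarrow> f \<in> borel_measurable borel"
  by (rule borel_measurable_continuous_onI)

text \<open>The exponent with complex slope \<open>b\<close> is brought to the characteristic function of the standard
  normal distribution by an affine substitution: the real part of \<open>b\<close> is absorbed by completing the
  square, the imaginary part becomes the frequency.\<close>

lemma gaussian_integral_real_line:
  fixes b :: complex
  assumes a: "a > 0"
  shows "has_bochner_integral lborel (\<lambda>x::real. exp (of_real (- a * x\<^sup>2) + of_real x * b))
    (of_real (sqrt (pi / a)) * exp (b\<^sup>2 / of_real (4 * a)))"
proof -
  define p q where "p = Re b" and "q = Im b"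
  have b: "b = Complex p q" by (simp add: p_def q_def complex_eq_iff)
  have std: "has_bochner_integral lborel (\<lambda>x. exp (- (of_real x)\<^sup>2 / 2) * exp (\<i> * of_real (t * x)))
     (of_real (sqrt (2 * pi)) * exp (- of_real (t\<^sup>2) / 2))" for t :: real
  proof -
    have e: "(\<lambda>x. std_normal_density x *\<^sub>R exp (\<i> * of_real (t * x)))
      = (\<lambda>x. (1 / of_real (sqrt (2 * pi))) * (exp (- (of_real x)\<^sup>2 / 2) * exp (\<i> * of_real (t * x))))"
      by (simp add: std_normal_density_def scaleR_conv_of_real exp_of_real[symmetric] fun_eq_iff)
    have int: "integrable lborel (\<lambda>x. std_normal_density x *\<^sub>R exp (\<i> * of_real (t * x)))"
    proof (rule Bochner_Integration.integrable_bound)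
      show "integrable lborel std_normal_density"
        by (rule integrable_normal_density) simp
      show "(\<lambda>x. std_normal_density x *\<^sub>R exp (\<i> * of_real (t * x))) \<in> borel_measurable lborel"
        unfolding std_normal_density_def by (auto intro!: continuous_imp_borel continuous_intros)
    qed (auto simp del: of_real_mult)
    have "(LINT x|lborel. std_normal_density x *\<^sub>R exp (\<i> * of_real (t * x))) = char std_normal_distribution t"
      unfolding char_def
      by (subst integral_density) (auto intro!: continuous_imp_borel continuous_intros)
    also have "\<dots> = exp (- of_real (t\<^sup>2) / 2)"
      by (simp add: char_std_normal_distribution exp_of_real[symmetric])
    finally have "has_bochner_integral lborel (\<lambda>x. std_normal_density x *\<^sub>R exp (\<i> * of_real (t * x))) (exp (- of_real (t\<^sup>2) / 2))"
      using int by (simp add: has_bochner_integral_iff)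
    from has_bochner_integral_mult_right[OF this[unfolded e], of "of_real (sqrt (2 * pi))"]
    show ?thesis by simp
  qed
  \<comment> \<open>rescaling and translation that turn the exponent into the one of the standard normal law\<close>
  define c where "c = 1 / sqrt (2 * a)"
  have c: "c > 0" "c\<^sup>2 = 1 / (2 * a)" using a by (auto simp: c_def power_divide)
  have c2: "a * (c * (c * 2)) = 1" 
  proof -
    have "a * (c * (c * 2)) = 2 * a * c\<^sup>2" by (simp add: power2_eq_square)
    then show ?thesis using a by (simp add: c(2))
  qed
  define t where "t = p / (2 * a)"
  have eq: "exp (of_real (- a * (t + c * y)\<^sup>2) + of_real (t + c * y) * b)
     = exp (of_real (- a * t\<^sup>2) + of_real t * b) * (exp (- (of_real y)\<^sup>2 / 2) * exp (\<i> * of_real ((c * q) * y)))" for y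
  proof -
    have "- a * (t + c * y)\<^sup>2 = - a * t\<^sup>2 - 2 * a * t * c * y - a * c\<^sup>2 * y\<^sup>2"
      by (simp add: power2_sum power_mult_distrib algebra_simps)
    also have "\<dots> = - a * t\<^sup>2 - p * c * y - y\<^sup>2 / 2"
      using a by (simp add: c t_def)
    finally have "of_real (- a * (t + c * y)\<^sup>2) + of_real (t + c * y) * b
      = (of_real (- a * t\<^sup>2) + of_real t * b) + (- (of_real y)\<^sup>2 / 2 + \<i> * of_real ((c * q) * y))"
      by (simp add: b complex_eq_iff algebra_simps)
    then show ?thesis by (simp only: exp_add)
  qed
  have ev: "exp (of_real (- a * t\<^sup>2) + of_real t * b) * (of_real (sqrt (2 * pi)) * exp (- of_real ((c * q)\<^sup>2) / 2))
     = (of_real (sqrt (pi / a)) * exp (b\<^sup>2 / of_real (4 * a))) /\<^sub>R \<bar>c\<bar>"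
  proof -
    have "(of_real (- a * t\<^sup>2) + of_real t * b) + (- of_real ((c * q)\<^sup>2) / 2) = b\<^sup>2 / of_real (4 * a)"
      using a by (simp add: b complex_eq_iff power_mult_distrib t_def power2_eq_square field_simps c2)
    then have "exp (of_real (- a * t\<^sup>2) + of_real t * b) * exp (- of_real ((c * q)\<^sup>2) / 2) = exp (b\<^sup>2 / of_real (4 * a))"
      by (simp only: exp_add[symmetric])
    moreover have "sqrt (pi / a) / c = sqrt (2 * pi)"
      using a by (simp add: c_def real_sqrt_divide real_sqrt_mult)
    ultimately have *: "exp (of_real (- a * t\<^sup>2) + of_real t * b) * exp (- of_real ((c * q)\<^sup>2) / 2) * of_real (sqrt (2 * pi))
       = exp (b\<^sup>2 / of_real (4 * a)) * of_real (sqrt (pi / a) / c)" by (simp only:)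
    have "\<bar>c\<bar> = c" using c(1) by simp
    have "(of_real (sqrt (pi / a)) * exp (b\<^sup>2 / of_real (4 * a))) /\<^sub>R \<bar>c\<bar> = exp (b\<^sup>2 / of_real (4 * a)) * of_real (sqrt (pi / a) / c)"
      unfolding scaleR_conv_of_real of_real_divide of_real_inverse divide_inverse[of "of_real (sqrt _)"] \<open>\<bar>c\<bar> = c\<close>
      by (simp only: mult_ac)
    with * show ?thesis by (simp only: mult_ac)
  qed
  have c0: "c \<noteq> 0" using c(1) by simp
  have "has_bochner_integral lborel (\<lambda>y. exp (of_real (- a * t\<^sup>2) + of_real t * b) * (exp (- (of_real y)\<^sup>2 / 2) * exp (\<i> * of_real ((c * q) * y))))
     (exp (of_real (- a * t\<^sup>2) + of_real t * b) * (of_real (sqrt (2 * pi)) * exp (- of_real ((c * q)\<^sup>2) / 2)))"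
    by (rule has_bochner_integral_mult_right, rule std)
  then have "has_bochner_integral lborel (\<lambda>y. exp (of_real (- a * (t + c * y)\<^sup>2) + of_real (t + c * y) * b))
     ((of_real (sqrt (pi / a)) * exp (b\<^sup>2 / of_real (4 * a))) /\<^sub>R \<bar>c\<bar>)"
    by (simp only: eq ev)
  then show ?thesis
    by (rule lborel_has_bochner_integral_real_affine_iff[OF c0, THEN iffD2])
qed

lemma has_bochner_integral_vec_prod:
  fixes f :: "'n::finite \<Rightarrow> real \<Rightarrow> complex"
  assumes f: "\<And>j. has_bochner_integral lborel (f j) (I j)"
  shows "has_bochner_integral lborel (\<lambda>x::real^'n. \<Prod>j\<in>UNIV. f j (x $ j)) (\<Prod>j\<in>UNIV. I j)"
proof -
  interpret product_sigma_finite "\<lambda>b::real^'n. lborel :: real measure" by standard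
  have [measurable]: "f j \<in> borel_measurable borel" for j
    using f[of j] by (auto simp: has_bochner_integral_iff dest: borel_measurable_integrable)
  define F :: "real^'n \<Rightarrow> real \<Rightarrow> complex" where "F b = f (SOME j. b = axis j 1)" for b
  have F: "F (axis j 1) = f j" for j
    by (simp add: F_def axis_eq_axis)
  have Fint: "integrable lborel (F b)" for b
    unfolding F_def using f by (auto simp: has_bochner_integral_iff)
  have coord: "(\<Sum>b\<in>Basis. g b *\<^sub>R b) $ j = g (axis j 1)" for g and j :: 'n
    by (subst sum_Basis_vec) (simp add: axis_def if_distrib cong: if_cong)
  have pr: "(\<Prod>b\<in>Basis. F b (g b)) = (\<Prod>j\<in>UNIV. f j ((\<Sum>b\<in>Basis. g b *\<^sub>R b) $ j))" for g
    unfolding coord by (subst prod_Basis_vec) (simp add: F)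
  have "integrable (Pi\<^sub>M Basis (\<lambda>b. lborel)) (\<lambda>x. \<Prod>b\<in>Basis. F b (x b))"
    by (rule product_integrable_prod) (auto intro: Fint)
  moreover have "(\<integral>x. (\<Prod>b\<in>Basis. F b (x b)) \<partial>Pi\<^sub>M Basis (\<lambda>b. lborel)) = (\<Prod>b\<in>Basis. integral\<^sup>L lborel (F b))"
    by (rule product_integral_prod) (auto intro: Fint)
  moreover have "(\<Prod>b\<in>Basis. integral\<^sup>L lborel (F b)) = (\<Prod>j\<in>UNIV. I j)"
    using f by (subst prod_Basis_vec) (simp add: F has_bochner_integral_iff)
  ultimately have *: "has_bochner_integral (Pi\<^sub>M Basis (\<lambda>b. lborel)) (\<lambda>x. \<Prod>j\<in>UNIV. f j ((\<Sum>b\<in>Basis. x b *\<^sub>R b) $ j)) (\<Prod>j\<in>UNIV. I j)"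
    unfolding pr has_bochner_integral_iff by simp
  have m: "(\<lambda>f. \<Sum>b\<in>Basis. f b *\<^sub>R (b :: real^'n)) \<in> measurable (Pi\<^sub>M Basis (\<lambda>b. lborel)) borel"
    by measurable
  show ?thesis
    unfolding lborel_eq[where 'a="real^'n"]
    by (rule has_bochner_integral_distr[OF _ m *]) measurable
qed

lemma norm_square_vec: "(norm (x::real^'n::finite))\<^sup>2 = (\<Sum>j\<in>UNIV. (x $ j)\<^sup>2)"
  by (simp add: norm_vec_def L2_set_def sum_nonneg)

lemma norm_square_cvec: "(norm (x::complex^'n::finite))\<^sup>2 = (\<Sum>j\<in>UNIV. (norm (x $ j))\<^sup>2)"
  by (simp add: norm_vec_def L2_set_def sum_nonneg)

text \<open>The integrand is a product of functions of one coordinate each.\<close>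

theorem gaussian_integral:
  fixes b :: "complex^'n::finite"
  assumes a: "a > 0"
  shows "has_bochner_integral lborel (\<lambda>x::real^'n. exp (of_real (- a * (norm x)\<^sup>2) + cdot (cvec x) b))
    (of_real (sqrt (pi / a) ^ CARD('n)) * exp (cdot b b / of_real (4 * a)))"
proof -
  have *: "exp (of_real (- a * (norm x)\<^sup>2) + cdot (cvec x) b)
     = (\<Prod>j\<in>UNIV. exp (of_real (- a * (x $ j)\<^sup>2) + of_real (x $ j) * b $ j))" for x :: "real^'n"
    by (simp add: exp_sum[symmetric] norm_square_vec cdot_def cvec_def sum.distrib sum_negf sum_distrib_left sum_subtractf)
  have **: "of_real (sqrt (pi / a) ^ CARD('n)) * exp (cdot b b / of_real (4 * a))
     = (\<Prod>j\<in>(UNIV::'n set). of_real (sqrt (pi / a)) * exp ((b $ j)\<^sup>2 / of_real (4 * a)))"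
    by (simp add: prod.distrib exp_sum[symmetric] cdot_def power2_eq_square sum_divide_distrib[symmetric])
  show ?thesis
    unfolding * ** by (intro has_bochner_integral_vec_prod gaussian_integral_real_line a)
qed

lemma gaussian_integral_euclidean:
  assumes a: "a > 0"
  shows "has_bochner_integral lborel (\<lambda>x::'a::euclidean_space. exp (- a * (norm x)\<^sup>2)) (sqrt (pi / a) ^ DIM('a))"
proof (rule has_bochner_integral_nn_integral)
  have 1: "exp (- a * (norm x)\<^sup>2) = (\<Prod>b\<in>Basis. exp (- a * (x \<bullet> b)\<^sup>2))" for x :: 'a
  proof -
    have "(norm x)\<^sup>2 = (\<Sum>b\<in>Basis. (x \<bullet> b)\<^sup>2)"
      using euclidean_inner[of x x] by (simp only: power2_norm_eq_inner power2_eq_square[of "x \<bullet> _"])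
    then show ?thesis by (simp add: exp_sum[symmetric] sum_negf sum_distrib_left)
  qed
  have hb: "has_bochner_integral lborel (\<lambda>x::real. exp (- a * x\<^sup>2)) (sqrt (pi / a))"
    using has_bochner_integral_Re[OF gaussian_integral_real_line[OF a, of 0]]
    by (simp add: exp_of_real flip: of_real_mult of_real_minus of_real_power)
  have 2: "(\<integral>\<^sup>+x. ennreal (exp (- a * x\<^sup>2)) \<partial>lborel) = ennreal (sqrt (pi / a))"
    using hb by (subst nn_integral_eq_integral) (auto simp: has_bochner_integral_iff)
  show "(\<integral>\<^sup>+(x::'a). ennreal (exp (- a * (norm x)\<^sup>2)) \<partial>lborel) = ennreal (sqrt (pi / a) ^ DIM('a))"
  proof -
    have "(\<integral>\<^sup>+(x::'a). ennreal (exp (- a * (norm x)\<^sup>2)) \<partial>lborel)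
        = (\<integral>\<^sup>+(x::'a). (\<Prod>b\<in>Basis. ennreal (exp (- a * (x \<bullet> b)\<^sup>2))) \<partial>lborel)"
      unfolding 1 by (subst prod_ennreal) auto
    also have "\<dots> = (\<Prod>b\<in>(Basis::'a set). \<integral>\<^sup>+x. ennreal (exp (- a * x\<^sup>2)) \<partial>lborel)"
      by (rule nn_integral_lborel_prod[of "\<lambda>b x. ennreal (exp (- a * x\<^sup>2))"]) auto
    also have "\<dots> = ennreal (sqrt (pi / a) ^ DIM('a))"
      unfolding 2 using a by (simp add: ennreal_power)
    finally show ?thesis .
  qed
qed (use a in auto)

lemma integrable_gaussian_exp_norm:
  assumes a: "a > 0"
  shows "integrable lborel (\<lambda>x::'a::euclidean_space. exp (c * norm x - a * (norm x)\<^sup>2))"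
proof (rule Bochner_Integration.integrable_bound)
  show "integrable lborel (\<lambda>x::'a. exp (c\<^sup>2 / (2 * a)) * exp (- (a / 2) * (norm x)\<^sup>2))"
    using gaussian_integral_euclidean[of "a/2", where 'a='a] a by (auto simp: has_bochner_integral_iff)
  have "c * t - a * t\<^sup>2 \<le> c\<^sup>2 / (2 * a) + (- (a / 2) * t\<^sup>2)" for t :: real
  proof -
    have "0 \<le> (a * t - c)\<^sup>2" by simp
    then have "2 * a * c * t \<le> a\<^sup>2 * t\<^sup>2 + c\<^sup>2" by (simp add: power2_diff power_mult_distrib algebra_simps)
    then have "c * t \<le> a * t\<^sup>2 / 2 + c\<^sup>2 / (2 * a)" using a by (simp add: field_simps power2_eq_square)
    then show ?thesis by simp
  qed
  then show "AE x in lborel. norm (exp (c * norm (x::'a) - a * (norm x)\<^sup>2)) \<le> norm (exp (c\<^sup>2 / (2 * a)) * exp (- (a / 2) * (norm x)\<^sup>2))"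
    by (simp add: exp_add[symmetric])
qed measurable

section \<open>Rotations of complex space\<close>

text \<open>Identifies \<open>\<complex>\<^sup>n\<close> with \<open>\<real>\<^sup>n \<times> \<real>\<^sup>n\<close>. Real and imaginary parts enter the Gaussian estimates for the
  transform in entirely different ways, so integrals over \<open>\<complex>\<^sup>n\<close> are computed in these coordinates.\<close>

definition cplx :: "real^'n::finite \<Rightarrow> real^'n \<Rightarrow> complex^'n" where
  "cplx s t = (\<chi> j. Complex (s $ j) (t $ j))"

lemma cplx_nth [simp]: "cplx s t $ j = Complex (s $ j) (t $ j)"
  by (simp add: cplx_def)

lemma continuous_on_cplx: "continuous_on UNIV (\<lambda>p. cplx (fst p) (snd p))"
  unfolding cplx_def Complex_eq by (intro continuous_intros)

lemma cplx_measurable [measurable]: "(\<lambda>p. cplx (fst p) (snd p)) \<in> borel_measurable (lborel \<Otimes>\<^sub>M lborel)"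
  using continuous_imp_borel[OF continuous_on_cplx] by (simp add: lborel_prod)

text \<open>Both measures give a box the product of its side lengths, and boxes determine the measure.\<close>

theorem distr_cplx:
  "distr (lborel \<Otimes>\<^sub>M lborel) borel (\<lambda>p. cplx (fst p) (snd p)) = (lborel :: (complex^'n::finite) measure)"
proof (rule lborel_eqI[symmetric])
  fix l u :: "complex^'n"
  define re where "re z = (\<chi> j. Re (z $ j))" for z :: "complex^'n"
  define im where "im z = (\<chi> j. Im (z $ j))" for z :: "complex^'n"
  assume le: "\<And>b. b \<in> Basis \<Longrightarrow> l \<bullet> b \<le> u \<bullet> b"
  have le': "Re (l $ j) \<le> Re (u $ j)" "Im (l $ j) \<le> Im (u $ j)" for j
    using le[of "axis j 1"] le[of "axis j \<i>"] by (auto simp: Basis_vec_def inner_axis Basis_complex_def inner_complex_def)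
  have box: "(\<lambda>p. cplx (fst p) (snd p)) -` box l u \<inter> space (lborel \<Otimes>\<^sub>M lborel) = box (re l) (re u) \<times> box (im l) (im u)"
    by (auto simp: mem_box Basis_vec_def inner_axis Basis_complex_def space_pair_measure re_def im_def inner_complex_def)
  have "emeasure (distr (lborel \<Otimes>\<^sub>M lborel) borel (\<lambda>p. cplx (fst p) (snd p))) (box l u)
      = emeasure lborel (box (re l) (re u)) * emeasure lborel (box (im l) (im u))"
    by (subst emeasure_distr) (auto simp: box lborel.emeasure_pair_measure_Times)
  also have "\<dots> = ennreal ((\<Prod>b\<in>Basis. (re u - re l) \<bullet> b) * (\<Prod>b\<in>Basis. (im u - im l) \<bullet> b))"
  proof -
    have nn: "re l \<bullet> b \<le> re u \<bullet> b" "im l \<bullet> b \<le> im u \<bullet> b" if "b \<in> Basis" for b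
      using that le' by (auto simp: Basis_vec_def inner_axis re_def im_def)
    show ?thesis
      using nn by (simp add: emeasure_lborel_box inner_diff_left prod_nonneg ennreal_mult)
  qed
  also have "(\<Prod>b\<in>Basis. (re u - re l) \<bullet> b) * (\<Prod>b\<in>Basis. (im u - im l) \<bullet> b) = (\<Prod>b\<in>Basis. (u - l) \<bullet> b)"
    by (simp add: prod_Basis_vec inner_axis Basis_complex_def prod.distrib re_def im_def inner_complex_def)
  finally show "emeasure (distr (lborel \<Otimes>\<^sub>M lborel) borel (\<lambda>p. cplx (fst p) (snd p))) (box l u) = ennreal (\<Prod>b\<in>Basis. (u - l) \<bullet> b)" .
qed simp

lemma nn_integral_lborel_translate:
  fixes f :: "'a::euclidean_space \<Rightarrow> ennreal"
  assumes [measurable]: "f \<in> borel_measurable borel"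
  shows "(\<integral>\<^sup>+x. f (x + c) \<partial>lborel) = (\<integral>\<^sup>+x. f x \<partial>lborel)"
  by (subst (2) lborel_distr_plus[of c, symmetric]) (simp add: nn_integral_distr add.commute)

lemma nn_integral_shear:
  fixes f :: "(real^'n::finite) \<times> (real^'n) \<Rightarrow> ennreal"
  assumes [measurable]: "f \<in> borel_measurable (lborel \<Otimes>\<^sub>M lborel)"
  shows "(\<integral>\<^sup>+p. f (fst p + a *\<^sub>R snd p, snd p) \<partial>(lborel \<Otimes>\<^sub>M lborel)) = (\<integral>\<^sup>+p. f p \<partial>(lborel \<Otimes>\<^sub>M lborel))" (is ?A)
    and "(\<integral>\<^sup>+p. f (fst p, snd p + a *\<^sub>R fst p) \<partial>(lborel \<Otimes>\<^sub>M lborel)) = (\<integral>\<^sup>+p. f p \<partial>(lborel \<Otimes>\<^sub>M lborel))" (is ?B)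
proof -
  have s [measurable]: "(\<lambda>x. f (x, t)) \<in> borel_measurable borel" "(\<lambda>x. f (t, x)) \<in> borel_measurable borel" for t
    using measurable_compose[OF _ assms, of "\<lambda>x. (x, t)" borel] measurable_compose[OF _ assms, of "\<lambda>x. (t, x)" borel] by auto
  show ?A
    by (subst (1 2) lborel_pair.nn_integral_snd[symmetric])
       (auto intro!: nn_integral_cong nn_integral_lborel_translate[of "\<lambda>x. f (x, _)"])
  show ?B
    by (subst (1 2) lborel.nn_integral_fst[symmetric])
       (auto intro!: nn_integral_cong nn_integral_lborel_translate[of "\<lambda>x. f (_, x)"])
qed

lemma continuous_on_vector_cmult: "continuous_on UNIV (\<lambda>z::complex^'n::finite. c *s z)"
  unfolding vector_scalar_mult_def by (intro continuous_intros)

lemma vector_cmult_measurable [measurable]: "(\<lambda>z::complex^'n::finite. c *s z) \<in> borel_measurable borel"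
  by (intro continuous_imp_borel continuous_on_vector_cmult)

text \<open>A rotation of the plane is a composition of three shears, of the real part along the imaginary
  part, conversely, and again of the real part; each shear is a translation in one variable and so
  preserves Lebesgue measure. The rotation by a half turn admits no such factorisation.\<close>

lemma nn_integral_rotate_aux:
  fixes f :: "complex^'n::finite \<Rightarrow> ennreal"
  assumes f [measurable]: "f \<in> borel_measurable borel" and c: "norm c = 1" "c \<noteq> -1"
  shows "(\<integral>\<^sup>+z. f (c *s z) \<partial>lborel) = (\<integral>\<^sup>+z. f z \<partial>lborel)"
proof -
  define C S where "C = Re c" and "S = Im c"
  have CS: "C\<^sup>2 + S\<^sup>2 = 1" using c(1) by (simp add: C_def S_def cmod_def)
  have C1: "1 + C \<noteq> 0"
  proof
    assume "1 + C = 0"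
    then have "C = -1" by simp
    with CS have "S = 0" by simp
    with \<open>C = -1\<close> c(2) show False by (simp add: C_def S_def complex_eq_iff)
  qed
  \<comment> \<open>this is minus the tangent of half the rotation angle\<close>
  define \<alpha> where "\<alpha> = - S / (1 + C)"
  have a1: "1 + S * \<alpha> = C"
  proof -
    have "(1 + S * \<alpha>) * (1 + C) = 1 + C - S\<^sup>2" using C1 by (simp add: \<alpha>_def field_simps power2_eq_square)
    also have "\<dots> = C * (1 + C)" using CS by (simp add: algebra_simps power2_eq_square)
    finally show ?thesis using C1 by simp
  qed
  have a2: "\<alpha> + \<alpha> * C = - S" 
  proof -
    have "\<alpha> + \<alpha> * C = \<alpha> * (1 + C)" by (simp add: algebra_simps)
    then show ?thesis using C1 by (simp add: \<alpha>_def)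
  qed
  define g where "g p = f (cplx (fst p) (snd p))" for p
  have g [measurable]: "g \<in> borel_measurable (lborel \<Otimes>\<^sub>M lborel)" unfolding g_def by measurable
  have to_g: "(\<integral>\<^sup>+z. h z \<partial>lborel) = (\<integral>\<^sup>+p. h (cplx (fst p) (snd p)) \<partial>(lborel \<Otimes>\<^sub>M lborel))"
    if [measurable]: "h \<in> borel_measurable borel" for h :: "complex^'n \<Rightarrow> ennreal"
    by (subst distr_cplx[symmetric]) (simp add: nn_integral_distr)
  define g1 where "g1 p = g (fst p + \<alpha> *\<^sub>R snd p, snd p)" for p
  define g2 where "g2 p = g1 (fst p, snd p + S *\<^sub>R fst p)" for p
  have [measurable]: "g1 \<in> borel_measurable (lborel \<Otimes>\<^sub>M lborel)" unfolding g1_def by measurable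
  have [measurable]: "g2 \<in> borel_measurable (lborel \<Otimes>\<^sub>M lborel)" unfolding g2_def by measurable
  have rot: "c *s cplx s t = cplx (s + \<alpha> *\<^sub>R t + \<alpha> *\<^sub>R (t + S *\<^sub>R (s + \<alpha> *\<^sub>R t))) (t + S *\<^sub>R (s + \<alpha> *\<^sub>R t))" for s t :: "real^'n"
  proof -
    have im: "S * x + C * y = y + S * (x + \<alpha> * y)" for x y
      using arg_cong[OF a1, of "\<lambda>w. w * y"] by (simp add: algebra_simps)
    have re: "C * x - S * y = (x + \<alpha> * y) + \<alpha> * (y + S * (x + \<alpha> * y))" for x y
    proof -
      have "(x + \<alpha> * y) + \<alpha> * (y + S * (x + \<alpha> * y)) = (1 + S * \<alpha>) * x + (\<alpha> + \<alpha> * (1 + S * \<alpha>)) * y"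
        by (simp add: algebra_simps)
      then show ?thesis unfolding a1 a2 by simp
    qed
    have c: "c = Complex C S" by (simp add: C_def S_def)
    show ?thesis
      unfolding vec_eq_iff
    proof (intro allI, rule complex_eqI)
      fix i
      show "Re ((c *s cplx s t) $ i) = Re (cplx (s + \<alpha> *\<^sub>R t + \<alpha> *\<^sub>R (t + S *\<^sub>R (s + \<alpha> *\<^sub>R t))) (t + S *\<^sub>R (s + \<alpha> *\<^sub>R t)) $ i)"
        using re[of "s $ i" "t $ i"] by (simp add: c)
      show "Im ((c *s cplx s t) $ i) = Im (cplx (s + \<alpha> *\<^sub>R t + \<alpha> *\<^sub>R (t + S *\<^sub>R (s + \<alpha> *\<^sub>R t))) (t + S *\<^sub>R (s + \<alpha> *\<^sub>R t)) $ i)"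
        using im[of "s $ i" "t $ i"] by (simp add: c)
    qed
  qed
  have "(\<integral>\<^sup>+z. f (c *s z) \<partial>lborel) = (\<integral>\<^sup>+p. g2 (fst p + \<alpha> *\<^sub>R snd p, snd p) \<partial>(lborel \<Otimes>\<^sub>M lborel))"
    by (subst to_g) (auto simp: rot g2_def g1_def g_def)
  also have "\<dots> = (\<integral>\<^sup>+p. g p \<partial>(lborel \<Otimes>\<^sub>M lborel))"
    by (subst nn_integral_shear(1), measurable, unfold g2_def, subst nn_integral_shear(2), measurable,
        unfold g1_def, subst nn_integral_shear(1), measurable)
  also have "\<dots> = (\<integral>\<^sup>+z. f z \<partial>lborel)" by (simp add: to_g g_def)
  finally show ?thesis .
qed

theorem lborel_rotate:
  assumes c: "norm c = 1"
  shows "distr lborel borel (\<lambda>z. c *s z) = (lborel :: (complex^'n::finite) measure)"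
proof (rule measure_eqI)
  fix A :: "(complex^'n) set" assume "A \<in> sets (distr lborel borel (\<lambda>z. c *s z))"
  then have A [measurable]: "A \<in> sets borel" by simp
  have m: "(\<lambda>z. c *s z) \<in> measurable lborel (borel :: (complex^'n) measure)" for c
    using vector_cmult_measurable by simp
  define ind :: "complex^'n \<Rightarrow> ennreal" where "ind = indicator A"
  have ind: "ind \<in> borel_measurable borel" using A by (simp add: ind_def)
  have indi: "(\<lambda>z. ind (\<i> *s z)) \<in> borel_measurable borel"
    by (rule measurable_compose[OF vector_cmult_measurable ind])
  have *: "(\<integral>\<^sup>+z. ind (c *s z) \<partial>lborel) = (\<integral>\<^sup>+z. ind z \<partial>lborel)"
  proof (cases "c = -1")
    case True
    have i1: "\<i> \<noteq> -1" by (simp add: complex_eq_iff)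
    have "(\<integral>\<^sup>+z. ind (\<i> *s (\<i> *s z)) \<partial>lborel) = (\<integral>\<^sup>+z. ind (\<i> *s z) \<partial>lborel)"
      by (rule nn_integral_rotate_aux[OF indi _ i1]) simp
    also have "\<dots> = (\<integral>\<^sup>+z. ind z \<partial>lborel)"
      by (rule nn_integral_rotate_aux[OF ind _ i1]) simp
    finally show ?thesis using True by (simp add: vector_smult_assoc)
  next
    case False
    show ?thesis by (rule nn_integral_rotate_aux[OF ind c False])
  qed
  have "emeasure (distr lborel borel (\<lambda>z. c *s z)) A = (\<integral>\<^sup>+z. ind z \<partial>(distr lborel borel (\<lambda>z. c *s z)))"
    unfolding ind_def by (rule nn_integral_indicator[symmetric]) (use A in simp)
  also have "\<dots> = (\<integral>\<^sup>+z. ind (c *s z) \<partial>lborel)"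
    by (rule nn_integral_distr[OF m]) (use ind in simp)
  also have "\<dots> = (\<integral>\<^sup>+z. ind z \<partial>lborel)" by (rule *)
  also have "\<dots> = emeasure lborel A"
    unfolding ind_def by (rule nn_integral_indicator) (use A in simp)
  finally show "emeasure (distr lborel borel (\<lambda>z. c *s z)) A = emeasure lborel A" .
qed simp

section \<open>The bilinear product\<close>

lemma cdot_commute: "cdot a b = cdot b a"
  by (simp add: cdot_def mult.commute)

lemma cdot_add_right: "cdot a (b + c) = cdot a b + cdot a c"
  by (simp add: cdot_def sum.distrib algebra_simps)

lemma cdot_add_left: "cdot (a + b) c = cdot a c + cdot b c"
  by (simp add: cdot_def sum.distrib algebra_simps)

lemma cdot_diff_right: "cdot a (b - c) = cdot a b - cdot a c"
  by (simp add: cdot_def sum_subtractf algebra_simps)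

lemma cdot_diff_left: "cdot (a - b) c = cdot a c - cdot b c"
  by (simp add: cdot_def sum_subtractf algebra_simps)

lemma cdot_smult_right: "cdot a (c *s b) = c * cdot a b"
  by (simp add: cdot_def sum_distrib_left mult_ac)

lemma cdot_smult_left: "cdot (c *s a) b = c * cdot a b"
  by (simp add: cdot_def sum_distrib_left mult_ac)

lemma cdot_scaleR_right: "cdot a (r *\<^sub>R b) = r *\<^sub>R cdot a b"
  by (simp add: cdot_def scaleR_sum_right)

lemma cdot_axis: "cdot a (axis j c) = a $ j * c"
  by (simp add: cdot_def axis_def if_distrib cong: if_cong)

lemma cdot_zero [simp]: "cdot a 0 = 0" "cdot 0 a = 0"
  by (simp_all add: cdot_def)

lemma norm_cdot_le: "norm (cdot a b) \<le> norm a * norm b"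
proof -
  have "norm (cdot a b) \<le> (\<Sum>j\<in>UNIV. norm (a $ j) * norm (b $ j))"
    unfolding cdot_def by (rule order_trans[OF norm_sum]) (simp add: norm_mult)
  also have "\<dots> \<le> L2_set (\<lambda>j. norm (a $ j)) UNIV * L2_set (\<lambda>j. norm (b $ j)) UNIV"
    using L2_set_mult_ineq[of "\<lambda>j. norm (a $ j)" "\<lambda>j. norm (b $ j)" UNIV] by simp
  finally show ?thesis by (simp add: norm_vec_def)
qed

lemma norm_vcnj [simp]: "norm (vcnj w) = norm w"
  by (simp add: vcnj_def norm_vec_def)

lemma norm_cvec [simp]: "norm (cvec x) = norm x"
  by (simp add: cvec_def norm_vec_def)

lemma vcnj_nth [simp]: "vcnj w $ j = cnj (w $ j)"
  by (simp add: vcnj_def)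

lemma cvec_nth [simp]: "cvec x $ j = of_real (x $ j)"
  by (simp add: cvec_def)

lemma cnj_cdot: "cnj (cdot a b) = cdot (vcnj a) (vcnj b)"
  by (simp add: cdot_def cnj_sum)

lemma vcnj_vcnj [simp]: "vcnj (vcnj w) = w"
  by (simp add: vec_eq_iff)

lemma vcnj_cvec [simp]: "vcnj (cvec x) = cvec x"
  by (simp add: vec_eq_iff)

lemma cdot_vcnj_self: "cdot z (vcnj z) = of_real ((norm z)\<^sup>2)"
  by (simp add: cdot_def norm_square_cvec complex_mult_cnj cmod_power2)

lemma continuous_on_cdot [continuous_intros]:
  "continuous_on S f \<Longrightarrow> continuous_on S g \<Longrightarrow> continuous_on S (\<lambda>x. cdot (f x) (g x))"
  unfolding cdot_def by (intro continuous_intros)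

lemma continuous_on_vcnj [continuous_intros]: "continuous_on S f \<Longrightarrow> continuous_on S (\<lambda>x. vcnj (f x))"
  unfolding vcnj_def by (intro continuous_intros)

lemma continuous_on_cvec [continuous_intros]: "continuous_on S f \<Longrightarrow> continuous_on S (\<lambda>x. cvec (f x))"
  unfolding cvec_def by (intro continuous_intros)

lemma continuous_on_csmult [continuous_intros]:
  fixes f :: "'a::topological_space \<Rightarrow> complex^'n::finite"
  shows "continuous_on S f \<Longrightarrow> continuous_on S (\<lambda>x. c *s f x)"
  unfolding vector_scalar_mult_def by (intro continuous_intros)

lemma vcnj_measurable [measurable]: "vcnj \<in> borel_measurable borel"
  by (intro continuous_imp_borel continuous_intros)

lemma cvec_measurable [measurable]: "cvec \<in> borel_measurable borel"
  by (intro continuous_imp_borel continuous_intros)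

lemma cdot_measurable [measurable (raw)]:
  assumes "f \<in> borel_measurable M" "g \<in> borel_measurable M"
  shows "(\<lambda>x. cdot (f x) (g x)) \<in> borel_measurable M"
proof -
  have "(\<lambda>p :: (complex^'n) \<times> (complex^'n). cdot (fst p) (snd p)) \<in> borel_measurable borel"
    by (intro continuous_imp_borel continuous_intros)
  from measurable_compose[OF borel_measurable_Pair[OF assms] this] show ?thesis by simp
qed

lemma exp_measurable_complex [measurable (raw)]:
  assumes "f \<in> borel_measurable M"
  shows "(\<lambda>x. exp (f x :: complex)) \<in> borel_measurable M"
  by (rule measurable_compose[OF assms]) (intro continuous_imp_borel continuous_intros)

lemma vec_nth_measurable [measurable (raw)]:
  assumes "f \<in> borel_measurable M"
  shows "(\<lambda>x. f x $ j :: 'a::euclidean_space) \<in> borel_measurable M"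
  by (rule measurable_compose[OF assms]) (intro continuous_imp_borel continuous_intros)

lemma cnj_measurable [measurable (raw)]:
  assumes "f \<in> borel_measurable M"
  shows "(\<lambda>x. cnj (f x)) \<in> borel_measurable M"
  by (rule measurable_compose[OF assms]) (intro continuous_imp_borel continuous_intros)

lemma csmult_measurable [measurable (raw)]:
  assumes "f \<in> borel_measurable M"
  shows "(\<lambda>x. c *s (f x :: complex^'n)) \<in> borel_measurable M"
  by (rule measurable_compose[OF assms]) (intro continuous_imp_borel continuous_intros)

section \<open>Entire functions of several variables\<close>

definition complex_derivative_at ::
  "(complex^'n::finite \<Rightarrow> complex) \<Rightarrow> (complex^'n \<Rightarrow> complex) \<Rightarrow> complex^'n \<Rightarrow> bool" where
  "complex_derivative_at f D z \<longleftrightarrow> (f has_derivative D) (at z) \<and> (\<forall>c v. D (c *s v) = c * D v)"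

lemma entire_iff: "entire f \<longleftrightarrow> (\<forall>z. \<exists>D. complex_derivative_at f D z)"
  by (simp add: entire_def complex_derivative_at_def)

lemma axis_csmult: "axis j (c::complex) = c *s axis j 1"
  by (simp add: vec_eq_iff axis_def)

lemma bounded_linear_csmult_left: "bounded_linear (\<lambda>h. h *s (v :: complex^'n::finite))"
proof (rule linear_conv_bounded_linear[THEN iffD1], rule linearI)
  fix b1 b2 :: complex show "(b1 + b2) *s v = b1 *s v + b2 *s v" by (simp add: vec_eq_iff algebra_simps)
next
  fix r :: real and b :: complex show "(r *\<^sub>R b) *s v = r *\<^sub>R (b *s v)" by (simp add: vec_eq_iff)
qed

lemma bounded_linear_csmult_right: "bounded_linear (\<lambda>v. c *s (v :: complex^'n::finite))"
proof (rule linear_conv_bounded_linear[THEN iffD1], rule linearI)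
  fix v w :: "complex^'n" show "c *s (v + w) = c *s v + c *s w" by (simp add: vec_eq_iff algebra_simps)
next
  fix r :: real and v :: "complex^'n" show "c *s (r *\<^sub>R v) = r *\<^sub>R (c *s v)" by (simp add: vec_eq_iff)
qed

text \<open>Restriction to complex lines reduces statements on entire functions to one complex variable.\<close>

lemma complex_derivative_at_line:
  assumes "complex_derivative_at f D (a + t *s v)"
  shows "((\<lambda>t. f (a + t *s v)) has_field_derivative D v) (at t)"
proof -
  have D: "(f has_derivative D) (at (a + t *s v))" "\<And>c v. D (c *s v) = c * D v"
    using assms by (auto simp: complex_derivative_at_def)
  have "((\<lambda>t. a + t *s v) has_derivative (\<lambda>h. h *s v)) (at t)"
    by (rule has_derivative_add_const[of _ _ _ a, unfolded add.commute[of _ a]], rule bounded_linear_imp_has_derivative, rule bounded_linear_csmult_left)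
  from has_derivative_compose[OF this D(1)] have "((\<lambda>t. f (a + t *s v)) has_derivative (\<lambda>h. D (h *s v))) (at t)" .
  moreover have "(\<lambda>h. D (h *s v)) = (*) (D v)" by (simp add: D(2) fun_eq_iff mult.commute)
  ultimately show ?thesis by (simp add: has_field_derivative_def)
qed

lemma cpartial_eq:
  assumes "complex_derivative_at f D z"
  shows "cpartial j f z = D (axis j 1)"
proof -
  have "(\<lambda>t. f (z + axis j t)) = (\<lambda>t. f (z + t *s axis j 1))"
    by (rule ext, subst axis_csmult) simp
  moreover have "((\<lambda>t. f (z + t *s axis j 1)) has_field_derivative D (axis j 1)) (at 0)"
    by (rule complex_derivative_at_line) (simp add: assms)
  ultimately show ?thesis
    unfolding cpartial_def by (simp add: DERIV_imp_deriv)
qed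

lemma entire_holomorphic_line:
  assumes "entire f"
  shows "(\<lambda>t. f (a + t *s v)) holomorphic_on S"
proof -
  have "\<exists>d. ((\<lambda>t. f (a + t *s v)) has_field_derivative d) (at t)" for t
    using assms complex_derivative_at_line unfolding entire_iff by blast
  then show ?thesis
    by (auto simp: holomorphic_on_def field_differentiable_def intro: has_field_derivative_at_within)
qed

lemma entire_continuous: "entire f \<Longrightarrow> continuous_on UNIV f"
  unfolding entire_def by (metis continuous_at_imp_continuous_on has_derivative_continuous)

lemma entire_measurable: "entire f \<Longrightarrow> f \<in> borel_measurable borel"
  by (intro continuous_imp_borel entire_continuous)

lemma complex_derivative_at_mult:
  assumes "complex_derivative_at f D z" "complex_derivative_at g E z"
  shows "complex_derivative_at (\<lambda>z. f z * g z) (\<lambda>v. f z * E v + D v * g z) z"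
proof -
  have D: "(f has_derivative D) (at z)" "\<And>c v. D (c *s v) = c * D v"
    and E: "(g has_derivative E) (at z)" "\<And>c v. E (c *s v) = c * E v"
    using assms by (auto simp: complex_derivative_at_def)
  from has_derivative_mult[OF D(1) E(1)] show ?thesis
    by (simp add: complex_derivative_at_def D(2) E(2) distrib_left mult.assoc mult.left_commute)
qed

lemma complex_derivative_at_cmult:
  assumes "complex_derivative_at f D z"
  shows "complex_derivative_at (\<lambda>z. k * f z) (\<lambda>v. k * D v) z"
proof -
  have D: "(f has_derivative D) (at z)" "\<And>c v. D (c *s v) = c * D v"
    using assms by (auto simp: complex_derivative_at_def)
  from has_derivative_mult_right[OF D(1), of k] show ?thesis
    by (simp add: complex_derivative_at_def D(2) mult.left_commute)
qed

lemma complex_derivative_at_compose_csmult: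
  assumes "complex_derivative_at f D (c *s z)"
  shows "complex_derivative_at (\<lambda>z. f (c *s z)) (\<lambda>v. c * D v) z"
proof -
  have D: "(f has_derivative D) (at (c *s z))" "\<And>c v. D (c *s v) = c * D v"
    using assms by (auto simp: complex_derivative_at_def)
  have "((\<lambda>z. c *s z) has_derivative (\<lambda>v. c *s v)) (at z)"
    by (rule bounded_linear_imp_has_derivative, rule bounded_linear_csmult_right)
  from has_derivative_compose[OF this D(1)] show ?thesis
    by (simp add: complex_derivative_at_def D(2))
qed

lemma complex_derivative_at_translate:
  assumes "complex_derivative_at f D (a + z)"
  shows "complex_derivative_at (\<lambda>z. f (a + z)) D z"
proof -
  have D: "(f has_derivative D) (at (a + z))" "\<And>c v. D (c *s v) = c * D v"
    using assms by (auto simp: complex_derivative_at_def)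
  have "((\<lambda>z. a + z) has_derivative (\<lambda>v. v)) (at z)"
    by (auto intro!: derivative_eq_intros)
  from has_derivative_compose[OF this D(1)] show ?thesis
    by (simp add: complex_derivative_at_def D(2))
qed

lemma entire_mult: "entire f \<Longrightarrow> entire g \<Longrightarrow> entire (\<lambda>z. f z * g z)"
  unfolding entire_iff using complex_derivative_at_mult by metis

lemma entire_comp_op: "entire f \<Longrightarrow> entire (comp_op c f)"
  unfolding entire_iff comp_op_def using complex_derivative_at_compose_csmult by metis

lemma entire_translate: "entire f \<Longrightarrow> entire (\<lambda>z. f (a + z))"
  unfolding entire_iff using complex_derivative_at_translate by metis

lemma entire_diff: "entire f \<Longrightarrow> entire g \<Longrightarrow> entire (\<lambda>z. f z - g z)"
proof -
  assume "entire f" "entire g"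
  show ?thesis unfolding entire_def
  proof
    fix z
    obtain D E where *: "(f has_derivative D) (at z)" "\<And>c v. D (c *s v) = c * D v"
       "(g has_derivative E) (at z)" "\<And>c v. E (c *s v) = c * E v"
      using \<open>entire f\<close> \<open>entire g\<close> unfolding entire_def by metis
    have "((\<lambda>z. f z - g z) has_derivative (\<lambda>v. D v - E v)) (at z)" by (intro has_derivative_diff *)
    then show "\<exists>D. ((\<lambda>z. f z - g z) has_derivative D) (at z) \<and> (\<forall>c v. D (c *s v) = c * D v)"
      using * by (intro exI[of _ "\<lambda>v. D v - E v"]) (simp add: algebra_simps)
  qed
qed

lemma entire_exp_quadratic:
  fixes a :: "complex^'n::finite"
  shows "entire (\<lambda>z. exp (cdot a z + k * cdot z z))"
  unfolding entire_def
proof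
  fix z :: "complex^'n"
  have lin: "((\<lambda>z. cdot a z) has_derivative (\<lambda>v. cdot a v)) (at z)" for a z :: "complex^'n"
    by (rule bounded_linear_imp_has_derivative, rule linear_conv_bounded_linear[THEN iffD1], rule linearI)
       (auto simp: cdot_add_right cdot_scaleR_right)
  have quad: "((\<lambda>z. cdot z z) has_derivative (\<lambda>v. 2 * cdot z v)) (at z)"
  proof -
    have "((\<lambda>z. \<Sum>j\<in>UNIV. z $ j * z $ j) has_derivative (\<lambda>v. \<Sum>j\<in>UNIV. z $ j * v $ j + v $ j * z $ j)) (at z)"
      by (intro has_derivative_sum has_derivative_mult bounded_linear_imp_has_derivative bounded_linear_vec_nth)
    then show ?thesis unfolding cdot_def
      by (simp add: sum.distrib mult.commute flip: sum_distrib_left)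
  qed
  have "((\<lambda>z. cdot a z + k * cdot z z) has_derivative (\<lambda>v. cdot a v + k * (2 * cdot z v))) (at z)"
    by (intro has_derivative_add lin has_derivative_mult_right quad)
  from has_derivative_compose[OF this, of exp "(*) (exp (cdot a z + k * cdot z z))"]
  have "((\<lambda>z. exp (cdot a z + k * cdot z z)) has_derivative (\<lambda>v. exp (cdot a z + k * cdot z z) * (cdot a v + k * (2 * cdot z v)))) (at z)"
    using DERIV_exp[of "cdot a z + k * cdot z z"] by (simp add: has_field_derivative_def)
  then show "\<exists>D. ((\<lambda>z. exp (cdot a z + k * cdot z z)) has_derivative D) (at z) \<and> (\<forall>c v. D (c *s v) = c * D v)"
    by (intro exI conjI, assumption) (simp add: cdot_smult_right algebra_simps)
qed

lemma exp_ge_self: "(t::real) \<le> exp t"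
  using exp_ge_add_one_self[of t] by linarith

text \<open>Differentiation under the integral sign for superpositions of exponentials. By Taylor's theorem
  the remainder of first order of each exponential is quadratic in the increment, with a factor that is
  integrable because \<open>P\<close> has exponential moments of all orders with respect to \<open>a\<close>. This yields
  holomorphy of the transform, of the derivatives of Fock functions, and of the preimages constructed
  later.\<close>

theorem exponential_integral_derivative:
  fixes M :: "'a measure" and P :: "'a \<Rightarrow> complex" and a :: "'a \<Rightarrow> complex^'n::finite"
  assumes P [measurable]: "P \<in> borel_measurable M" and a [measurable]: "a \<in> borel_measurable M"
    and int: "\<And>c. integrable M (\<lambda>x. norm (P x) * exp (c * norm (a x)))"
  shows "complex_derivative_at (\<lambda>z. LINT x|M. P x * exp (cdot (a x) z))
    (\<lambda>v. LINT x|M. P x * cdot (a x) v * exp (cdot (a x) z)) z"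
proof -
  have ebound: "norm (exp (cdot (a x) z)) \<le> exp (norm z * norm (a x))" for x z
  proof -
    have "norm (exp (cdot (a x) z)) \<le> exp (norm (cdot (a x) z))" by (rule norm_exp)
    also have "\<dots> \<le> exp (norm z * norm (a x))" using norm_cdot_le[of "a x" z] by (simp add: mult.commute)
    finally show ?thesis .
  qed
  have i0: "integrable M (\<lambda>x. P x * exp (cdot (a x) z))" for z
  proof (rule Bochner_Integration.integrable_bound[OF int[of "norm z"]])
    show "AE x in M. norm (P x * exp (cdot (a x) z)) \<le> norm (norm (P x) * exp (norm z * norm (a x)))"
      using ebound by (auto simp: norm_mult intro!: AE_I2 mult_left_mono)
  qed measurable
  have i1: "integrable M (\<lambda>x. P x * cdot (a x) v * exp (cdot (a x) z))" for z v
  proof (rule Bochner_Integration.integrable_bound[OF integrable_mult_right[OF int[of "norm z + 1"], of "norm v"]])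
    show "AE x in M. norm (P x * cdot (a x) v * exp (cdot (a x) z)) \<le> norm (norm v * (norm (P x) * exp ((norm z + 1) * norm (a x))))"
    proof (rule AE_I2)
      fix x
      have "norm (cdot (a x) v) * norm (exp (cdot (a x) z)) \<le> (exp (norm (a x)) * norm v) * exp (norm z * norm (a x))"
        using norm_cdot_le[of "a x" v] mult_right_mono[OF exp_ge_self[of "norm (a x)"], of "norm v"]
        by (intro mult_mono ebound) auto
      also have "\<dots> = norm v * exp ((norm z + 1) * norm (a x))" by (simp add: algebra_simps exp_add)
      finally have "norm (P x) * (norm (cdot (a x) v) * norm (exp (cdot (a x) z))) \<le> norm (P x) * (norm v * exp ((norm z + 1) * norm (a x)))"
        by (rule mult_left_mono) simp
      then show "norm (P x * cdot (a x) v * exp (cdot (a x) z)) \<le> norm (norm v * (norm (P x) * exp ((norm z + 1) * norm (a x))))"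
        by (simp add: norm_mult mult_ac)
    qed
  qed measurable
  let ?L = "\<lambda>z. LINT x|M. P x * exp (cdot (a x) z)"
  let ?D = "\<lambda>v. LINT x|M. P x * cdot (a x) v * exp (cdot (a x) z)"
  \<comment> \<open>the shift by 3 pays for the factor \<open>exp A\<close> in the Taylor remainder and for the estimate of \<open>A\<^sup>2\<close> by \<open>exp (2 A)\<close>\<close>
  define K where "K = (LINT x|M. norm (P x) * exp ((norm z + 3) * norm (a x)))"
  have lin: "bounded_linear ?D"
  proof (rule linear_conv_bounded_linear[THEN iffD1], rule linearI)
    fix v w
    have "?D (v + w) = (LINT x|M. P x * cdot (a x) v * exp (cdot (a x) z) + P x * cdot (a x) w * exp (cdot (a x) z))"
      by (simp add: cdot_add_right algebra_simps)
    then show "?D (v + w) = ?D v + ?D w" by (simp add: i1)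
  next
    fix r v
    have "?D (r *\<^sub>R v) = (LINT x|M. r *\<^sub>R (P x * cdot (a x) v * exp (cdot (a x) z)))"
      by (simp add: cdot_scaleR_right)
    then show "?D (r *\<^sub>R v) = r *\<^sub>R ?D v" by simp
  qed
  have rem: "norm ((?L y - ?L z) - ?D (y - z)) \<le> K * (norm (y - z))\<^sup>2" if "dist y z < 1" for y
  proof -
    define v where "v = y - z"
    have v: "norm v \<le> 1" using that by (simp add: v_def dist_norm)
    have y: "y = z + v" by (simp add: v_def)
    have pt: "norm (P x * exp (cdot (a x) y) - P x * exp (cdot (a x) z) - P x * cdot (a x) v * exp (cdot (a x) z))
       \<le> (norm v)\<^sup>2 * (norm (P x) * exp ((norm z + 3) * norm (a x)))" for x
    proof -
      define A where "A = norm (a x)"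
      have A: "A \<ge> 0" by (simp add: A_def)
      have c: "norm (cdot (a x) v) \<le> A * norm v" unfolding A_def by (rule norm_cdot_le)
      have "P x * exp (cdot (a x) y) - P x * exp (cdot (a x) z) - P x * cdot (a x) v * exp (cdot (a x) z)
         = P x * exp (cdot (a x) z) * (exp (cdot (a x) v) - (\<Sum>k\<le>1. cdot (a x) v ^ k / fact k))"
        by (simp add: y cdot_add_right exp_add algebra_simps)
      then have "norm (P x * exp (cdot (a x) y) - P x * exp (cdot (a x) z) - P x * cdot (a x) v * exp (cdot (a x) z))
         = norm (P x) * norm (exp (cdot (a x) z)) * norm (exp (cdot (a x) v) - (\<Sum>k\<le>1. cdot (a x) v ^ k / fact k))"
        by (simp add: norm_mult)
      also have "\<dots> \<le> norm (P x) * exp (norm z * A) * (exp A * (exp (2 * A) * (norm v)\<^sup>2))"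
      proof (intro mult_mono)
        have "norm (exp (cdot (a x) v) - (\<Sum>k\<le>1. cdot (a x) v ^ k / fact k))
          \<le> exp \<bar>Re (cdot (a x) v)\<bar> * (norm (cdot (a x) v) ^ Suc 1) / fact 1" by (rule Taylor_exp)
        also have "\<dots> \<le> exp A * (A * norm v)\<^sup>2"
        proof -
          have "\<bar>Re (cdot (a x) v)\<bar> \<le> A"
            using abs_Re_le_cmod[of "cdot (a x) v"] c mult_left_mono[OF v A] by simp
          moreover have "norm (cdot (a x) v) ^ 2 \<le> (A * norm v)\<^sup>2" using c by (intro power_mono) auto
          ultimately show ?thesis by (simp add: power2_eq_square[symmetric] mult_mono)
        qed
        also have "\<dots> \<le> exp A * (exp (2 * A) * (norm v)\<^sup>2)"
        proof -
          have "A\<^sup>2 \<le> (exp A)\<^sup>2" using A exp_ge_self[of A] by (intro power_mono) auto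
          also have "(exp A)\<^sup>2 = exp (2 * A)" by (simp add: exp_double)
          finally show ?thesis by (simp add: power_mult_distrib mult_right_mono)
        qed
        finally show "norm (exp (cdot (a x) v) - (\<Sum>k\<le>1. cdot (a x) v ^ k / fact k)) \<le> exp A * (exp (2 * A) * (norm v)\<^sup>2)" .
      qed (use ebound in \<open>auto simp: A_def\<close>)
      also have "\<dots> = (norm v)\<^sup>2 * (norm (P x) * exp ((norm z + 3) * A))"
      proof -
        have "exp ((norm z + 3) * A) = exp (norm z * A) * (exp A * exp (2 * A))"
          by (simp add: exp_add[symmetric] algebra_simps)
        then show ?thesis by (simp add: mult_ac)
      qed
      finally show ?thesis by (simp add: A_def)
    qed
    have "?L y - ?L z - ?D v = (LINT x|M. P x * exp (cdot (a x) y) - P x * exp (cdot (a x) z) - P x * cdot (a x) v * exp (cdot (a x) z))"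
      by (simp add: i0 i1)
    then have "norm (?L y - ?L z - ?D v) \<le> (LINT x|M. norm (P x * exp (cdot (a x) y) - P x * exp (cdot (a x) z) - P x * cdot (a x) v * exp (cdot (a x) z)))"
      by (simp only: integral_norm_bound)
    also have "\<dots> \<le> (LINT x|M. (norm v)\<^sup>2 * (norm (P x) * exp ((norm z + 3) * norm (a x))))"
      by (intro integral_mono pt integrable_norm Bochner_Integration.integrable_diff i0 i1 integrable_mult_right int)
    also have "\<dots> = K * (norm v)\<^sup>2" by (simp add: K_def)
    finally show ?thesis by (simp add: v_def)
  qed
  have "(?L has_derivative ?D) (at z)"
  proof (rule has_derivativeI_sandwich[where e=1 and H="\<lambda>y. K * norm (y - z)"])
    fix y assume "y \<in> UNIV" "y \<noteq> z" "dist y z < 1"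
    then show "norm ((?L y - ?L z) - ?D (y - z)) / norm (y - z) \<le> K * norm (y - z)"
      using rem[of y] by (simp add: divide_le_eq power2_eq_square mult.assoc)
  next
    have "((\<lambda>y. K * norm (y - z)) \<longlongrightarrow> K * norm (z - z)) (at z)" by (intro tendsto_intros)
    then show "((\<lambda>y. K * norm (y - z)) \<longlongrightarrow> 0) (at z)" by simp
  qed (auto intro: lin)
  moreover have "?D (c *s v) = c * ?D v" for c v
  proof -
    have "?D (c *s v) = (LINT x|M. c * (P x * cdot (a x) v * exp (cdot (a x) z)))"
      by (simp add: cdot_smult_right mult_ac)
    then show ?thesis by simp
  qed
  ultimately show ?thesis by (simp add: complex_derivative_at_def)
qed

section \<open>The Fock measure\<close>

definition fock_density :: "complex^'n::finite \<Rightarrow> real" where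
  "fock_density z = exp (- (norm z)\<^sup>2) / pi ^ CARD('n)"

lemma fock_density_nonneg [simp]: "0 \<le> fock_density z"
  by (simp add: fock_density_def)

lemma fock_density_measurable [measurable]: "fock_density \<in> borel_measurable borel"
  unfolding fock_density_def by measurable

lemma fock_measure_eq: "fock_measure = density lborel (\<lambda>z. ennreal (fock_density z))"
  by (simp add: fock_measure_def fock_density_def)

lemma sets_fock [measurable_cong, simp]: "sets fock_measure = sets borel"
  by (simp add: fock_measure_eq)

lemma space_fock [simp]: "space fock_measure = UNIV"
  by (simp add: fock_measure_eq)

lemma measurable_fock [simp]: "borel_measurable fock_measure = borel_measurable borel"
  by (rule measurable_cong_sets) auto

lemma integrable_fock_iff:
  fixes f :: "complex^'n::finite \<Rightarrow> 'b::{banach, second_countable_topology}"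
  assumes "f \<in> borel_measurable borel"
  shows "integrable fock_measure f \<longleftrightarrow> integrable lborel (\<lambda>z. fock_density z *\<^sub>R f z)"
  unfolding fock_measure_eq by (rule integrable_density) (use assms in auto)

lemma integral_fock:
  fixes f :: "complex^'n::finite \<Rightarrow> 'b::{banach, second_countable_topology}"
  assumes "f \<in> borel_measurable borel"
  shows "(LINT z|fock_measure. f z) = (LINT z|lborel. fock_density z *\<^sub>R f z)"
  unfolding fock_measure_eq by (rule integral_density) (use assms in auto)

lemma prob_space_fock: "prob_space (fock_measure :: (complex^'n::finite) measure)"
proof
  have s: "sqrt pi ^ DIM(complex^'n) = pi ^ CARD('n)"
  proof -
    have "sqrt pi ^ DIM(complex^'n) = (sqrt pi ^ 2) ^ CARD('n)"
      unfolding power_mult[symmetric] by (simp add: mult.commute)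
    then show ?thesis by simp
  qed
  have hb: "has_bochner_integral lborel (\<lambda>z::complex^'n. fock_density z) 1"
    using has_bochner_integral_divide_zero[OF gaussian_integral_euclidean[of 1, where 'a="complex^'n"], of "pi ^ CARD('n)"]
    unfolding fock_density_def s[symmetric] by simp
  have "emeasure fock_measure (space fock_measure :: (complex^'n) set) = (\<integral>\<^sup>+z. ennreal (fock_density (z::complex^'n)) \<partial>lborel)"
    by (simp add: fock_measure_eq emeasure_density)
  also have "\<dots> = 1"
    using hb by (subst nn_integral_eq_integral) (auto simp: has_bochner_integral_iff)
  finally show "emeasure fock_measure (space fock_measure :: (complex^'n) set) = 1" .
qed

interpretation fock: prob_space "fock_measure :: (complex^'n::finite) measure"
  by (rule prob_space_fock)

lemma measure_fock_UNIV [simp]: "measure (fock_measure :: (complex^'n::finite) measure) UNIV = 1"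
  using fock.prob_space by simp

lemma fock_norm_eq: "fock_norm = L2_norm fock_measure"
  by (simp add: fock_norm_def L2_norm_def fun_eq_iff)

lemma fock_space_eq: "f \<in> fock_space \<longleftrightarrow> entire f \<and> f \<in> L2 fock_measure"
  by (auto simp: fock_space_def L2_def entire_measurable)

lemma fock_space_L2: "f \<in> fock_space \<Longrightarrow> f \<in> L2 fock_measure"
  by (simp add: fock_space_eq)

lemma fock_space_entire: "f \<in> fock_space \<Longrightarrow> entire f"
  by (simp add: fock_space_eq)

text \<open>Squaring doubles the Gaussian exponent, which must stay below the one of the density; hence the
  bound \<open>1/2\<close>.\<close>

lemma L2_fock_bound:
  fixes K :: "complex^'n::finite \<Rightarrow> complex"
  assumes K [measurable]: "K \<in> borel_measurable borel" and "\<rho> < 1/2"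
    and b: "\<And>w. norm (K w) \<le> B * exp (c * norm w + \<rho> * (norm w)\<^sup>2)"
  shows "K \<in> L2 fock_measure"
proof (rule L2_bound)
  show "integrable fock_measure (\<lambda>w::complex^'n. B\<^sup>2 * exp (2 * c * norm w + 2 * \<rho> * (norm w)\<^sup>2))"
  proof (subst integrable_fock_iff)
    have "integrable lborel (\<lambda>w::complex^'n. (B\<^sup>2 / pi ^ CARD('n)) * exp ((2 * c) * norm w - (1 - 2 * \<rho>) * (norm w)\<^sup>2))"
      using integrable_gaussian_exp_norm[of "1 - 2 * \<rho>" "2 * c", where 'a="complex^'n"] assms(2) by simp
    then show "integrable lborel (\<lambda>w::complex^'n. fock_density w *\<^sub>R (B\<^sup>2 * exp (2 * c * norm w + 2 * \<rho> * (norm w)\<^sup>2)))"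
      by (rule Bochner_Integration.integrable_cong[THEN iffD1, rotated -1])
         (auto simp: fock_density_def algebra_simps exp_add[symmetric] simp flip: exp_add)
  qed measurable
  show "AE w in fock_measure. (norm (K w))\<^sup>2 \<le> B\<^sup>2 * exp (2 * c * norm w + 2 * \<rho> * (norm w)\<^sup>2)"
  proof (rule AE_I2)
    fix w
    have "(norm (K w))\<^sup>2 \<le> (B * exp (c * norm w + \<rho> * (norm w)\<^sup>2))\<^sup>2" using b by (intro power_mono) auto
    also have "\<dots> = B\<^sup>2 * exp (2 * c * norm w + 2 * \<rho> * (norm w)\<^sup>2)"
      by (simp add: power_mult_distrib exp_double[symmetric] algebra_simps)
    finally show "(norm (K w))\<^sup>2 \<le> B\<^sup>2 * exp (2 * c * norm w + 2 * \<rho> * (norm w)\<^sup>2)" .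
  qed
qed simp

lemma fock_rotate:
  assumes c: "norm c = 1"
  shows "distr fock_measure borel (\<lambda>z. c *s z) = (fock_measure :: (complex^'n::finite) measure)"
proof -
  have n: "norm (c *s z) = norm z" for z :: "complex^'n"
    using c by (simp add: norm_vec_def norm_mult)
  have "density (distr lborel borel (\<lambda>z. c *s z)) (\<lambda>z::complex^'n. ennreal (fock_density z))
      = distr (density lborel (\<lambda>z. ennreal (fock_density (c *s z)))) borel (\<lambda>z. c *s z)"
    by (rule density_distr) auto
  also have "(\<lambda>z. ennreal (fock_density (c *s z))) = (\<lambda>z::complex^'n. ennreal (fock_density z))"
    by (simp add: fock_density_def n)
  finally show ?thesis
    by (simp add: lborel_rotate[OF c] fock_measure_eq)
qed

lemma integrable_fock_rotate:
  fixes f :: "complex^'n::finite \<Rightarrow> 'b::{banach, second_countable_topology}"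
  assumes "norm c = 1" "integrable fock_measure f"
  shows "integrable fock_measure (\<lambda>z. f (c *s z))"
proof -
  have [measurable]: "f \<in> borel_measurable borel" using assms(2) by (auto dest: borel_measurable_integrable)
  have "integrable (distr fock_measure borel (\<lambda>z. c *s z)) f" using assms by (simp add: fock_rotate)
  then show ?thesis by (subst (asm) integrable_distr_eq) auto
qed

lemma integral_fock_rotate:
  fixes f :: "complex^'n::finite \<Rightarrow> 'b::{banach, second_countable_topology}"
  assumes "norm c = 1" and [measurable]: "f \<in> borel_measurable borel"
  shows "(LINT z|fock_measure. f (c *s z)) = (LINT z|fock_measure. f z)"
  by (subst (2) fock_rotate[OF assms(1), symmetric], subst integral_distr) auto

text \<open>On every circle around the origin the mean value of a holomorphic function is its value at the
  centre, and the Fock measure is invariant under rotation, so averaging over the rotations does not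
  change the integral.\<close>

theorem entire_mean_value:
  fixes H :: "complex^'n::finite \<Rightarrow> complex"
  assumes H: "entire H" and int: "integrable fock_measure H"
  shows "(LINT w|fock_measure. H w) = H 0"
proof -
  define U where "U = restrict_space (lborel :: real measure) {0..1}"
  define e where "e \<theta> = exp (2 * of_real pi * \<i> * of_real \<theta>)" for \<theta> :: real
  have en: "norm (e \<theta>) = 1" for \<theta> by (simp add: e_def)
  have ec: "continuous_on UNIV e" unfolding e_def by (intro continuous_intros)
  have [measurable]: "e \<in> borel_measurable borel" by (rule continuous_imp_borel[OF ec])
  have [measurable]: "H \<in> borel_measurable borel" by (rule entire_measurable[OF H])
  have Us [measurable_cong]: "sets U = sets (restrict_space borel {0..1})" by (simp add: U_def sets_restrict_space)
  interpret U: prob_space U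
    by standard (simp add: U_def emeasure_restrict_space space_restrict_space)
  interpret UF: pair_sigma_finite U "fock_measure :: (complex^'n) measure" ..
  have circle: "(LINT \<theta>|U. H (e \<theta> *s w)) = H 0" for w
  proof -
    define h where "h t = H (0 + t *s w)" for t
    have hol: "h holomorphic_on S" for S unfolding h_def by (rule entire_holomorphic_line[OF H])
    have "((\<lambda>u. h u / (u - 0)) has_contour_integral (2 * of_real pi * \<i> * h 0)) (circlepath 0 1)"
      by (rule Cauchy_integral_circlepath_simple) (auto intro: hol)
    then have hi0: "((\<lambda>x. h (circlepath 0 1 x) / circlepath 0 1 x * vector_derivative (circlepath 0 1) (at x within {0..1}))
        has_integral (2 * of_real pi * \<i> * h 0)) {0..1}"
      by (simp add: has_contour_integral_def)
    have eq0: "h (circlepath 0 1 x) / circlepath 0 1 x * vector_derivative (circlepath 0 1) (at x within {0..1}) = 2 * of_real pi * \<i> * h (e x)"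
      if "x \<in> {0..1}" for x
    proof -
      have "vector_derivative (circlepath 0 1) (at x within {0..1}) = 2 * of_real pi * \<i> * e x"
        using that by (simp add: vector_derivative_circlepath01 e_def)
      moreover have "circlepath 0 1 x = e x" by (simp add: circlepath e_def)
      moreover have "e x \<noteq> 0" by (simp add: e_def)
      ultimately show ?thesis by simp
    qed
    have "((\<lambda>x. 2 * of_real pi * \<i> * h (e x)) has_integral (2 * of_real pi * \<i> * h 0)) {0..1}"
      by (rule has_integral_eq[OF eq0 hi0])
    then have "((\<lambda>x. (1 / (2 * of_real pi * \<i>)) * (2 * of_real pi * \<i> * h (e x))) has_integral ((1 / (2 * of_real pi * \<i>)) * (2 * of_real pi * \<i> * h 0))) {0..1}"
      by (rule has_integral_mult_right)
    then have hi: "((\<lambda>x. h (e x)) has_integral h 0) {0..1}" by simp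
    have hc: "continuous_on {0..1} (\<lambda>x. h (e x))"
      by (rule continuous_on_compose2[OF holomorphic_on_imp_continuous_on[OF hol[of UNIV]] continuous_on_subset[OF ec]]) auto
    have "set_integrable lborel {0..1} (\<lambda>x. h (e x))"
      unfolding set_integrable_def by (rule borel_integrable_compact) (auto intro: hc)
    then have "(LINT x:{0..1}|lborel. h (e x)) = h 0"
      using set_borel_integral_eq_integral(2) hi by (metis integral_unique)
    then show ?thesis
      unfolding U_def by (simp add: integral_restrict_space set_lebesgue_integral_def h_def)
  qed
  have meas: "(\<lambda>(\<theta>, w). H (e \<theta> *s w)) \<in> borel_measurable (U \<Otimes>\<^sub>M fock_measure)"
  proof -
    have "continuous_on UNIV (\<lambda>p::real \<times> (complex^'n). H (e (fst p) *s snd p))"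
    proof (rule continuous_on_compose2[OF entire_continuous[OF H]])
      have "continuous_on UNIV (\<lambda>p::real \<times> (complex^'n). \<chi> j. e (fst p) * snd p $ j)"
        by (intro continuous_intros continuous_on_compose2[OF ec]) auto
      then show "continuous_on UNIV (\<lambda>p::real \<times> (complex^'n). e (fst p) *s snd p)" by (simp add: vector_scalar_mult_def)
    qed simp
    from continuous_imp_borel[OF this] have 1: "(\<lambda>p. H (e (fst p) *s snd p)) \<in> borel_measurable (borel \<Otimes>\<^sub>M borel)"
      by (simp add: borel_prod)
    have "(\<lambda>p. (fst p, snd p)) \<in> measurable (U \<Otimes>\<^sub>M (fock_measure :: (complex^'n) measure)) (borel \<Otimes>\<^sub>M borel)"
    proof (rule measurable_Pair)
      have "(\<lambda>x. x) \<in> measurable U borel"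
        unfolding measurable_cong_sets[OF Us refl] by (rule measurable_restrict_space1) simp
      from measurable_compose[OF measurable_fst this]
      show "fst \<in> measurable (U \<Otimes>\<^sub>M (fock_measure :: (complex^'n) measure)) borel" .
      show "snd \<in> measurable (U \<Otimes>\<^sub>M (fock_measure :: (complex^'n) measure)) borel"
        using measurable_snd[of U "fock_measure :: (complex^'n) measure"] by (simp cong: measurable_cong_sets)
    qed
    from measurable_compose[OF this 1] show ?thesis by (simp add: split_def)
  qed
  have inner: "(LINT w|fock_measure. H (e \<theta> *s w)) = (LINT w|fock_measure. H w)" for \<theta>
    by (rule integral_fock_rotate) (auto simp: en)
  have inner_norm: "(LINT w|fock_measure. norm (H (e \<theta> *s w))) = (LINT w|fock_measure. norm (H w))" for \<theta>
    by (rule integral_fock_rotate) (auto simp: en)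
  have prod_int: "integrable (U \<Otimes>\<^sub>M fock_measure) (\<lambda>(\<theta>, w). H (e \<theta> *s w))"
  proof (rule UF.Fubini_integrable[OF meas])
    show "integrable U (\<lambda>\<theta>. LINT w|fock_measure. norm (case (\<theta>, w) of (\<theta>, w) \<Rightarrow> H (e \<theta> *s w)))"
      by (simp add: inner_norm)
    show "AE \<theta> in U. integrable fock_measure (\<lambda>w. case (\<theta>, w) of (\<theta>, w) \<Rightarrow> H (e \<theta> *s w))"
      using integrable_fock_rotate[OF en int] by simp
  qed
  have "(LINT w|fock_measure. (LINT \<theta>|U. H (e \<theta> *s w))) = (LINT \<theta>|U. (LINT w|fock_measure. H (e \<theta> *s w)))"
    using UF.Fubini_integral[OF prod_int] .
  then show ?thesis by (simp add: circle inner U.prob_space)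
qed

section \<open>The reproducing property of the Fock space\<close>

lemma norm_exp_cdot_le: "norm (exp (cdot a b)) \<le> exp (norm a * norm b)"
proof -
  have "norm (exp (cdot a b)) \<le> exp (norm (cdot a b))" by (rule norm_exp)
  also have "\<dots> \<le> exp (norm a * norm b)" using norm_cdot_le[of a b] by simp
  finally show ?thesis .
qed

text \<open>The factor brought down by differentiating the reproducing kernel along a list of
  directions.\<close>

definition conj_monomial :: "'n::finite list \<Rightarrow> complex^'n \<Rightarrow> complex" where
  "conj_monomial js w = prod_list (map (\<lambda>j. cnj (w $ j)) js)"

lemma conj_monomial_measurable [measurable]: "conj_monomial js \<in> borel_measurable borel"
proof (induction js)
  case Nil
  then show ?case by (simp add: conj_monomial_def)
next
  case (Cons j js)
  have "(\<lambda>w. cnj (w $ j) * conj_monomial js w) \<in> borel_measurable borel"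
    using Cons by measurable
  then show ?case by (simp add: conj_monomial_def)
qed

text \<open>Polynomial growth is absorbed by an exponential, a form that is compatible with all Gaussian
  estimates that follow.\<close>

lemma norm_conj_monomial_le: "norm (conj_monomial js w) \<le> exp (real (length js) * norm w)"
proof (induction js)
  case Nil
  then show ?case by (simp add: conj_monomial_def)
next
  case (Cons j js)
  have "norm (conj_monomial (j # js) w) = norm (w $ j) * norm (conj_monomial js w)"
    by (simp add: conj_monomial_def norm_mult)
  also have "\<dots> \<le> exp (norm w) * exp (real (length js) * norm w)"
  proof (intro mult_mono Cons)
    show "norm (w $ j) \<le> exp (norm w)"
      using Finite_Cartesian_Product.norm_nth_le[of w j] exp_ge_self[of "norm w"] by linarith
  qed auto
  also have "\<dots> = exp (real (length (j # js)) * norm w)" by (simp add: exp_add[symmetric] algebra_simps)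
  finally show ?case .
qed

lemma L2_fock_monomial_exp:
  fixes z :: "complex^'n::finite"
  shows "(\<lambda>w. conj_monomial js w * exp (cdot z (vcnj w))) \<in> L2 fock_measure"
proof (rule L2_fock_bound[where \<rho>=0 and B=1 and c="real (length js) + norm z"])
  fix w
  have "norm (conj_monomial js w * exp (cdot z (vcnj w))) \<le> exp (real (length js) * norm w) * exp (norm z * norm w)"
    unfolding norm_mult using norm_exp_cdot_le[of z "vcnj w"] by (intro mult_mono norm_conj_monomial_le) auto
  then show "norm (conj_monomial js w * exp (cdot z (vcnj w))) \<le> 1 * exp ((real (length js) + norm z) * norm w + 0 * (norm w)\<^sup>2)"
    by (simp add: exp_add[symmetric] algebra_simps)
  show "(\<lambda>w. conj_monomial js w * exp (cdot z (vcnj w))) \<in> borel_measurable borel" by measurable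
qed simp

text \<open>After the translation by \<open>z\<close> the integrand becomes the density times an entire function whose
  value at the origin is \<open>F z\<close>, so the mean value property applies.\<close>

theorem fock_reproducing:
  assumes F: "F \<in> fock_space"
  shows "F z = (LINT w|fock_measure. F w * exp (cdot z (vcnj w)))"
proof -
  have FL: "F \<in> L2 fock_measure" and FE: "entire F" using F by (auto simp: fock_space_eq)
  have [measurable]: "F \<in> borel_measurable borel" by (rule entire_measurable[OF FE])
  define H where "H w = F (z + w) * exp (cdot (- vcnj z) w + 0 * cdot w w)" for w
  have HE: "entire H" unfolding H_def by (intro entire_mult entire_translate FE entire_exp_quadratic)
  have [measurable]: "H \<in> borel_measurable borel" by (rule entire_measurable[OF HE])
  define Q where "Q w = fock_density w *\<^sub>R (F w * exp (cdot z (vcnj w)))" for w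
  have Qm [measurable]: "Q \<in> borel_measurable borel" unfolding Q_def by measurable
  have shift: "fock_density w *\<^sub>R H w = Q (z + w)" for w
  proof -
    have "cdot z (vcnj (z + w)) = cdot z (vcnj z) + cdot z (vcnj w)"
      by (simp add: cdot_def sum.distrib algebra_simps)
    moreover have "of_real ((norm (z + w))\<^sup>2) = cdot z (vcnj z) + cdot w (vcnj w) + cdot z (vcnj w) + cdot w (vcnj z)"
      unfolding cdot_vcnj_self[symmetric] by (simp add: cdot_def sum.distrib algebra_simps)
    ultimately have "- of_real ((norm (z + w))\<^sup>2) + cdot z (vcnj (z + w)) = - of_real ((norm w)\<^sup>2) + (cdot (- vcnj z) w + 0 * cdot w w)"
      using cdot_vcnj_self[of w] by (simp add: cdot_def sum_negf mult.commute)
    then have "exp (- of_real ((norm (z + w))\<^sup>2)) * exp (cdot z (vcnj (z + w))) = exp (- of_real ((norm w)\<^sup>2)) * exp (cdot (- vcnj z) w + 0 * cdot w w)"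
      by (simp only: exp_add[symmetric])
    then have "of_real (exp (- (norm (z + w))\<^sup>2)) * exp (cdot z (vcnj (z + w))) = of_real (exp (- (norm w)\<^sup>2)) * exp (cdot (- vcnj z) w + 0 * cdot w w)"
      by (simp add: exp_of_real[symmetric])
    then show ?thesis
      by (simp add: Q_def H_def fock_density_def scaleR_conv_of_real mult_ac)
  qed
  have m: "(+) z \<in> measurable lborel borel" by simp
  have Qi: "integrable lborel Q"
    unfolding Q_def
    using L2_mult_integrable[OF FL L2_fock_monomial_exp[of "[]" z]]
    by (subst (asm) integrable_fock_iff) (auto simp: conj_monomial_def)
  have Qsi: "integrable lborel (\<lambda>w. Q (z + w))"
    by (rule integrable_distr[OF m]) (simp only: lborel_distr_plus Qi)
  have "integrable fock_measure H"
    by (subst integrable_fock_iff) (auto simp: shift Qsi)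
  from entire_mean_value[OF HE this]
  have "F z = (LINT w|fock_measure. H w)" by (simp add: H_def)
  also have "\<dots> = (LINT w|lborel. Q (z + w))" by (subst integral_fock) (auto simp: shift)
  also have "\<dots> = (LINT w|lborel. Q w)"
    using integral_distr[OF m, of Q] by (simp add: lborel_distr_plus)
  also have "\<dots> = (LINT w|fock_measure. F w * exp (cdot z (vcnj w)))"
    by (subst integral_fock) (auto simp: Q_def[abs_def])
  finally show ?thesis .
qed

text \<open>The point \<open>z\<close> occurs on the right of the reproducing formula only in the exponential kernel, so
  derivatives of \<open>F\<close> are again integrals of \<open>F\<close> against explicit kernels. Consequently they exist in
  every order and are controlled by the norm of \<open>F\<close>.\<close>

lemma foldr_cpartial_fock:
  fixes F :: "complex^'n::finite \<Rightarrow> complex"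
  assumes F: "F \<in> fock_space"
  shows "foldr cpartial js F = (\<lambda>z. LINT w|fock_measure. F w * (conj_monomial js w * exp (cdot z (vcnj w))))"
    and "entire (foldr cpartial js F)"
proof -
  have FL: "F \<in> L2 fock_measure" and FE: "entire F" using F by (auto simp: fock_space_eq)
  have [measurable]: "F \<in> borel_measurable borel" by (rule entire_measurable[OF FE])
  define T where "T js z = (LINT w|fock_measure. F w * (conj_monomial js w * exp (cdot z (vcnj w))))" for js z
  have der: "complex_derivative_at (T js) (\<lambda>v. LINT w|fock_measure. (F w * conj_monomial js w) * cdot (vcnj w) v * exp (cdot (vcnj w) z)) z" for js z
  proof -
    have "complex_derivative_at (\<lambda>z. LINT w|fock_measure. (F w * conj_monomial js w) * exp (cdot (vcnj w) z))
      (\<lambda>v. LINT w|fock_measure. (F w * conj_monomial js w) * cdot (vcnj w) v * exp (cdot (vcnj w) z)) z"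
    proof (rule exponential_integral_derivative)
      fix c :: real
      have "(\<lambda>w::complex^'n. complex_of_real (exp (c * norm w)) * conj_monomial js w) \<in> L2 fock_measure"
      proof (rule L2_fock_bound[where \<rho>=0 and B=1 and c="c + real (length js)"])
        fix w :: "complex^'n"
        show "norm (complex_of_real (exp (c * norm w)) * conj_monomial js w) \<le> 1 * exp ((c + real (length js)) * norm w + 0 * (norm w)\<^sup>2)"
          using norm_conj_monomial_le[of js w] by (simp add: norm_mult algebra_simps exp_add)
        show "(\<lambda>w::complex^'n. complex_of_real (exp (c * norm w)) * conj_monomial js w) \<in> borel_measurable borel" by measurable
      qed simp
      from L2_mult_integrable_norm[OF FL this]
      show "integrable fock_measure (\<lambda>x. norm (F x * conj_monomial js x) * exp (c * norm (vcnj x)))"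
        by (simp add: norm_mult mult_ac)
    qed measurable
    then show ?thesis unfolding T_def by (simp add: cdot_commute mult.assoc)
  qed
  have step: "cpartial j (T js) = T (j # js)" for j js
  proof
    fix z
    show "cpartial j (T js) z = T (j # js) z"
      unfolding cpartial_eq[OF der] by (simp add: T_def cdot_axis conj_monomial_def cdot_commute mult_ac)
  qed
  have "T [] = F" by (rule ext) (simp add: T_def conj_monomial_def fock_reproducing[OF F, symmetric])
  then have eq: "foldr cpartial js F = T js" for js
    by (induction js) (auto simp: step)
  then show "foldr cpartial js F = (\<lambda>z. LINT w|fock_measure. F w * (conj_monomial js w * exp (cdot z (vcnj w))))"
    by (simp add: T_def[abs_def])
  show "entire (foldr cpartial js F)"
    unfolding eq entire_iff using der by blast
qed

lemma foldr_cpartial_fock_measurable: "F \<in> fock_space \<Longrightarrow> foldr cpartial js F \<in> borel_measurable borel"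
  by (intro entire_measurable foldr_cpartial_fock)

lemma fock_space_diff: "F \<in> fock_space \<Longrightarrow> G \<in> fock_space \<Longrightarrow> (\<lambda>z. F z - G z) \<in> fock_space"
  by (auto simp: fock_space_eq intro: entire_diff L2_diff)

lemma foldr_cpartial_fock_diff:
  assumes F: "F \<in> fock_space" and G: "G \<in> fock_space"
  shows "foldr cpartial js (\<lambda>z. F z - G z) z = foldr cpartial js F z - foldr cpartial js G z"
  unfolding foldr_cpartial_fock(1)[OF F] foldr_cpartial_fock(1)[OF G] foldr_cpartial_fock(1)[OF fock_space_diff[OF F G]]
  using L2_mult_integrable[OF fock_space_L2[OF F] L2_fock_monomial_exp] L2_mult_integrable[OF fock_space_L2[OF G] L2_fock_monomial_exp]
  by (simp add: left_diff_distrib)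

lemma fock_evaluation_bound:
  assumes F: "F \<in> fock_space"
  shows "norm (foldr cpartial js F z) \<le> fock_norm F * fock_norm (\<lambda>w. conj_monomial js w * exp (cdot z (vcnj w)))"
  unfolding foldr_cpartial_fock(1)[OF F] fock_norm_eq
  by (rule L2_Cauchy_Schwarz[OF fock_space_L2[OF F] L2_fock_monomial_exp])

text \<open>Point evaluations of all derivatives are continuous on the Fock space. This is what identifies
  limits: a sequence of Fock functions that converges in norm has derivatives that converge
  pointwise.\<close>

lemma fock_convergence_pointwise:
  assumes F: "\<And>k. F k \<in> fock_space" and f: "f \<in> fock_space"
    and lim: "(\<lambda>k. fock_norm (\<lambda>z. F k z - f z)) \<longlonglongrightarrow> 0"
  shows "(\<lambda>k. foldr cpartial js (F k) z) \<longlonglongrightarrow> foldr cpartial js f z"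
proof -
  define C where "C = fock_norm (\<lambda>w. conj_monomial js w * exp (cdot z (vcnj w)))"
  have "(\<lambda>k. foldr cpartial js (F k) z - foldr cpartial js f z) \<longlonglongrightarrow> 0"
  proof (rule tendsto_norm_zero_cancel, rule tendsto_sandwich[OF _ _ tendsto_const])
    show "(\<lambda>k. fock_norm (\<lambda>z. F k z - f z) * C) \<longlonglongrightarrow> 0"
      using tendsto_mult_left_zero[OF lim] .
    show "\<forall>\<^sub>F k in sequentially. norm (foldr cpartial js (F k) z - foldr cpartial js f z) \<le> fock_norm (\<lambda>z. F k z - f z) * C"
      using fock_evaluation_bound[OF fock_space_diff[OF F f], of js _ z] foldr_cpartial_fock_diff[OF F f, of js _ z]
      by (simp add: C_def)
  qed auto
  then show ?thesis by (simp add: LIM_zero_iff)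
qed

section \<open>Multi-indices as lists of directions\<close>

text \<open>The order of the coordinates is the one used by \<^const>\<open>multi_deriv\<close>, so that a derivative with
  a multi-index is an iteration along one list; this makes induction over the list available.\<close>

definition directions :: "('n::finite \<Rightarrow> nat) \<Rightarrow> 'n list" where
  "directions \<alpha> = concat (map (\<lambda>j. replicate (\<alpha> j) j) (SOME js. distinct js \<and> set js = UNIV))"

lemma multi_deriv_eq: "multi_deriv D \<alpha> f = foldr D (directions \<alpha>) f"
proof -
  have rep: "foldr D (replicate k j) = D j ^^ k" for k j
    by (induction k) auto
  have "foldr (\<lambda>j. D j ^^ \<alpha> j) js f = foldr D (concat (map (\<lambda>j. replicate (\<alpha> j) j) js)) f" for js
    by (induction js) (auto simp: rep)
  then show ?thesis by (simp add: multi_deriv_def directions_def)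
qed

lemma directions_zero [simp]: "directions (\<lambda>j. 0) = []"
  by (simp add: directions_def)

lemma zero_in_multi_indices [simp]: "(\<lambda>j. 0) \<in> multi_indices m"
  by (simp add: multi_indices_def)

lemma fock_sobolev_subset: "F \<in> fock_sobolev m \<Longrightarrow> F \<in> fock_space"
proof -
  assume *: "F \<in> fock_sobolev m"
  then have "integrable fock_measure (\<lambda>z. (norm (multi_deriv cpartial (\<lambda>j. 0) F z))\<^sup>2)"
    unfolding fock_sobolev_def using zero_in_multi_indices[of m] by blast
  with * show "F \<in> fock_space" by (simp add: fock_sobolev_def fock_space_def multi_deriv_eq)
qed

lemma fock_sobolev_iff:
  "F \<in> fock_sobolev m \<longleftrightarrow> F \<in> fock_space \<and> (\<forall>\<alpha>\<in>multi_indices m. foldr cpartial (directions \<alpha>) F \<in> L2 fock_measure)"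
proof -
  have "F \<in> fock_sobolev m \<longleftrightarrow> F \<in> fock_space \<and> F \<in> fock_sobolev m"
    using fock_sobolev_subset by blast
  also have "\<dots> \<longleftrightarrow> F \<in> fock_space \<and> (\<forall>\<alpha>\<in>multi_indices m. foldr cpartial (directions \<alpha>) F \<in> L2 fock_measure)"
    by (auto simp: fock_sobolev_def multi_deriv_eq L2_def foldr_cpartial_fock_measurable fock_space_entire)
  finally show ?thesis .
qed

lemma fock_sobolev_norm_eq:
  "fock_sobolev_norm m F = (\<Sum>\<alpha>\<in>multi_indices m. L2_norm fock_measure (foldr cpartial (directions \<alpha>) F))"
  by (simp add: fock_sobolev_norm_def multi_deriv_eq fock_norm_eq)

lemma fock_norm_le_sobolev: "fock_norm F \<le> fock_sobolev_norm m F"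
proof -
  have "L2_norm fock_measure (foldr cpartial (directions (\<lambda>j. 0)) F) \<le> fock_sobolev_norm m F"
    unfolding fock_sobolev_norm_eq by (rule member_le_sum) (auto simp: finite_multi_indices)
  then show ?thesis by (simp add: fock_norm_eq)
qed

section \<open>Rotations and dilations of Fock functions\<close>

lemma cpartial_comp_op:
  assumes "entire g"
  shows "cpartial j (\<lambda>z. k * comp_op c g z) = (\<lambda>z. (c * k) * comp_op c (cpartial j g) z)"
proof
  fix z
  obtain D where D: "complex_derivative_at g D (c *s z)" using assms by (auto simp: entire_iff)
  have "complex_derivative_at (\<lambda>z. k * comp_op c g z) (\<lambda>v. k * (c * D v)) z"
    unfolding comp_op_def by (intro complex_derivative_at_cmult complex_derivative_at_compose_csmult D)
  from cpartial_eq[OF this, of j] cpartial_eq[OF D, of j]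
  show "cpartial j (\<lambda>z. k * comp_op c g z) z = (c * k) * comp_op c (cpartial j g) z"
    by (simp add: comp_op_def)
qed

lemma foldr_cpartial_comp_op:
  assumes F: "F \<in> fock_space"
  shows "foldr cpartial js (comp_op c F) = (\<lambda>z. c ^ length js * comp_op c (foldr cpartial js F) z)"
proof (induction js)
  case (Cons j js)
  then show ?case by (simp add: cpartial_comp_op foldr_cpartial_fock(2)[OF F])
qed (simp add: fun_eq_iff)

lemma L2_comp_op_rotate:
  assumes c: "norm c = 1" and h: "h \<in> L2 fock_measure"
  shows "comp_op c h \<in> L2 fock_measure" "L2_norm fock_measure (comp_op c h) = L2_norm fock_measure h"
proof -
  have [measurable]: "h \<in> borel_measurable borel" using h by (simp add: L2_def)
  show "comp_op c h \<in> L2 fock_measure"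
    using integrable_fock_rotate[OF c L2_integrable[OF h]] by (simp add: L2_def comp_op_def[abs_def])
  show "L2_norm fock_measure (comp_op c h) = L2_norm fock_measure h"
    using integral_fock_rotate[OF c, of "\<lambda>z. (norm (h z))\<^sup>2"] by (simp add: L2_norm_def comp_op_def)
qed

lemma comp_op_rotate_fock_space:
  assumes c: "norm c = 1" and F: "F \<in> fock_space"
  shows "comp_op c F \<in> fock_space"
  using L2_comp_op_rotate(1)[OF c fock_space_L2[OF F]] entire_comp_op[OF fock_space_entire[OF F]]
  by (simp add: fock_space_eq)

text \<open>Composition with a rotation multiplies each derivative by a number of modulus one and
  leaves the Fock measure invariant. So \<open>C\<^sub>\<i>\<close> and its inverse are isometries of the Fock-Sobolev space
  and do not affect boundedness.\<close>

lemma comp_op_rotate_fock_sobolev: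
  assumes c: "norm c = 1" and F: "F \<in> fock_sobolev m"
  shows "comp_op c F \<in> fock_sobolev m" "fock_sobolev_norm m (comp_op c F) = fock_sobolev_norm m F"
proof -
  have FS: "F \<in> fock_space" by (rule fock_sobolev_subset[OF F])
  have FL: "foldr cpartial (directions \<alpha>) F \<in> L2 fock_measure" if "\<alpha> \<in> multi_indices m" for \<alpha>
    using F that by (simp add: fock_sobolev_iff)
  show "comp_op c F \<in> fock_sobolev m"
    unfolding fock_sobolev_iff
    by (auto simp: foldr_cpartial_comp_op[OF FS] intro!: comp_op_rotate_fock_space c FS L2_cmult L2_comp_op_rotate FL)
  show "fock_sobolev_norm m (comp_op c F) = fock_sobolev_norm m F"
    unfolding fock_sobolev_norm_eq
  proof (rule sum.cong)
    fix \<alpha> :: "'a \<Rightarrow> nat" assume "\<alpha> \<in> multi_indices m"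
    then show "L2_norm fock_measure (foldr cpartial (directions \<alpha>) (comp_op c F)) = L2_norm fock_measure (foldr cpartial (directions \<alpha>) F)"
      unfolding foldr_cpartial_comp_op[OF FS] by (simp add: L2_norm_cmult norm_power c L2_comp_op_rotate(2) FL)
  qed simp
qed

lemma nn_integral_lborel_scale:
  fixes f :: "'a::euclidean_space \<Rightarrow> ennreal"
  assumes [measurable]: "f \<in> borel_measurable borel" and r: "r > 0"
  shows "(\<integral>\<^sup>+x. f x \<partial>lborel) = ennreal (r ^ DIM('a)) * (\<integral>\<^sup>+x. f (r *\<^sub>R x) \<partial>lborel)"
proof -
  have "(\<integral>\<^sup>+x. f x \<partial>lborel) = (\<integral>\<^sup>+x. f x \<partial>(density (distr lborel borel (\<lambda>x. 0 + r *\<^sub>R x)) (\<lambda>_. ennreal (\<bar>r\<bar> ^ DIM('a)))))"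
    using lborel_affine[of r "0::'a"] r by simp
  also have "\<dots> = ennreal (r ^ DIM('a)) * (\<integral>\<^sup>+x. f (r *\<^sub>R x) \<partial>lborel)"
    using r by (simp add: nn_integral_density nn_integral_distr nn_integral_cmult)
  finally show ?thesis .
qed

text \<open>The change of variables \<open>z \<mapsto> r z\<close> costs the Jacobian determinant and turns the weight into one
  that is smaller than the original. The constant tends to 1 with \<open>r\<close>, as the convergence in norm of
  the dilations requires.\<close>

lemma L2_dilate:
  fixes h :: "complex^'n::finite \<Rightarrow> complex"
  assumes r: "0 < r" "r \<le> 1" and h: "h \<in> L2 fock_measure"
  shows "comp_op (of_real r) h \<in> L2 fock_measure"
    and "(L2_norm fock_measure (comp_op (of_real r) h))\<^sup>2 \<le> (1 / r ^ DIM(complex^'n)) * (L2_norm fock_measure h)\<^sup>2"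
proof -
  have [measurable]: "h \<in> borel_measurable borel" using h by (simp add: L2_def)
  have sc: "of_real r *s z = r *\<^sub>R z" for z :: "complex^'n"
    by (simp add: vec_eq_iff complex_eq_iff)
  have m: "comp_op (of_real r) h \<in> borel_measurable borel" unfolding comp_op_def[abs_def] by measurable
  define q where "q z = ennreal (fock_density z * (norm (h z))\<^sup>2)" for z
  have [measurable]: "q \<in> borel_measurable borel" unfolding q_def by measurable
  have nn: "(\<integral>\<^sup>+z. ennreal ((norm (g z))\<^sup>2) \<partial>fock_measure) = (\<integral>\<^sup>+z. ennreal (fock_density z * (norm (g z))\<^sup>2) \<partial>lborel)"
    if [measurable]: "g \<in> borel_measurable borel" for g :: "complex^'n \<Rightarrow> complex"
    by (simp add: fock_measure_eq nn_integral_density ennreal_mult)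
  have "(\<integral>\<^sup>+z. ennreal ((norm (comp_op (of_real r) h z))\<^sup>2) \<partial>fock_measure) = (\<integral>\<^sup>+z. ennreal (fock_density z * (norm (h (r *\<^sub>R z)))\<^sup>2) \<partial>lborel)"
    by (subst nn[OF m]) (simp add: comp_op_def sc)
  also have "\<dots> \<le> (\<integral>\<^sup>+z. q (r *\<^sub>R z) \<partial>lborel)"
  proof (intro nn_integral_mono)
    fix z :: "complex^'n"
    have "(norm (r *\<^sub>R z))\<^sup>2 \<le> (norm z)\<^sup>2"
      using r by (intro power_mono) (auto simp: mult_left_le_one_le)
    then have "fock_density z \<le> fock_density (r *\<^sub>R z)"
      unfolding fock_density_def by (intro divide_right_mono) auto
    then show "ennreal (fock_density z * (norm (h (r *\<^sub>R z)))\<^sup>2) \<le> q (r *\<^sub>R z)"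
      unfolding q_def by (intro ennreal_leI mult_right_mono) auto
  qed
  also have "\<dots> = ennreal (1 / r ^ DIM(complex^'n)) * (\<integral>\<^sup>+z. q z \<partial>lborel)"
    using r by (subst nn_integral_lborel_scale[of q r])
      (auto simp: mult.assoc[symmetric] ennreal_mult[symmetric] simp del: DIM_cart DIM_complex)
  also have "(\<integral>\<^sup>+z. q z \<partial>lborel) = ennreal ((L2_norm fock_measure h)\<^sup>2)"
  proof -
    have "(\<integral>\<^sup>+z. q z \<partial>lborel) = (\<integral>\<^sup>+z. ennreal ((norm (h z))\<^sup>2) \<partial>fock_measure)"
      by (subst nn) (auto simp: q_def[abs_def])
    also have "\<dots> = ennreal ((L2_norm fock_measure h)\<^sup>2)"
      unfolding L2_norm_square by (rule nn_integral_eq_integral) (use h in \<open>auto simp: L2_def\<close>)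
    finally show ?thesis .
  qed
  also have "ennreal (1 / r ^ DIM(complex^'n)) * ennreal ((L2_norm fock_measure h)\<^sup>2) = ennreal ((1 / r ^ DIM(complex^'n)) * (L2_norm fock_measure h)\<^sup>2)"
    using r by (intro ennreal_mult[symmetric]) auto
  finally have le: "(\<integral>\<^sup>+z. ennreal ((norm (comp_op (of_real r) h z))\<^sup>2) \<partial>fock_measure) \<le> ennreal ((1 / r ^ DIM(complex^'n)) * (L2_norm fock_measure h)\<^sup>2)" .
  have "integrable fock_measure (\<lambda>z. (norm (comp_op (of_real r) h z))\<^sup>2)"
    by (intro integrableI_bounded) (use m le in \<open>auto simp: less_top top_unique elim: le_less_trans\<close>)
  then show L: "comp_op (of_real r) h \<in> L2 fock_measure" using m by (simp add: L2_def)
  have "ennreal ((L2_norm fock_measure (comp_op (of_real r) h))\<^sup>2) \<le> ennreal ((1 / r ^ DIM(complex^'n)) * (L2_norm fock_measure h)\<^sup>2)"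
    using le unfolding L2_norm_square by (subst (asm) nn_integral_eq_integral[OF L2_integrable[OF L]]) auto
  then show "(L2_norm fock_measure (comp_op (of_real r) h))\<^sup>2 \<le> (1 / r ^ DIM(complex^'n)) * (L2_norm fock_measure h)\<^sup>2"
    using r by (subst (asm) ennreal_le_iff) auto
qed

text \<open>The dilations converge pointwise, and their norms are asymptotically bounded by the norm of the
  limit.\<close>

lemma dilation_converges:
  fixes F :: "complex^'n::finite \<Rightarrow> complex"
  assumes F: "F \<in> fock_space" and DF: "foldr cpartial js F \<in> L2 fock_measure"
    and r: "\<And>k. 0 < r k" "\<And>k. r k \<le> 1" "r \<longlonglongrightarrow> 1"
  shows "(\<lambda>k. L2_norm fock_measure (\<lambda>z. foldr cpartial js (comp_op (of_real (r k)) F) z - foldr cpartial js F z)) \<longlonglongrightarrow> 0"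
proof -
  define h where "h = foldr cpartial js F"
  have hL: "h \<in> L2 fock_measure" and hE: "entire h" using DF foldr_cpartial_fock(2)[OF F] by (auto simp: h_def)
  define H where "H k z = of_real (r k) ^ length js * comp_op (of_real (r k)) h z" for k z
  have eq: "foldr cpartial js (comp_op (of_real (r k)) F) = H k" for k
    unfolding foldr_cpartial_comp_op[OF F] by (simp add: H_def[abs_def] h_def)
  have "(\<lambda>k. L2_norm fock_measure (\<lambda>z. H k z - h z)) \<longlonglongrightarrow> 0"
  proof (rule L2_norm_limit_of_bound[where c="\<lambda>k. 1 / r k ^ DIM(complex^'n)"])
    show "H k \<in> L2 fock_measure" for k
      unfolding H_def[abs_def] by (intro L2_cmult L2_dilate r hL)
    show "h \<in> L2 fock_measure" by (rule hL)
    show "AE z in fock_measure. (\<lambda>k. H k z) \<longlonglongrightarrow> h z"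
    proof (rule AE_I2)
      fix z :: "complex^'n"
      have "(\<lambda>k. of_real (r k) *s z) \<longlonglongrightarrow> z"
      proof (rule vec_tendstoI)
        fix i
        have "(\<lambda>k. of_real (r k) * z $ i) \<longlonglongrightarrow> of_real 1 * z $ i" by (intro tendsto_intros r)
        then show "(\<lambda>k. (of_real (r k) *s z) $ i) \<longlonglongrightarrow> z $ i" by simp
      qed
      then have "(\<lambda>k. h (of_real (r k) *s z)) \<longlonglongrightarrow> h z"
        by (rule continuous_on_tendsto_compose[OF entire_continuous[OF hE]]) auto
      then have "(\<lambda>k. of_real (r k) ^ length js * h (of_real (r k) *s z)) \<longlonglongrightarrow> of_real 1 ^ length js * h z"
        by (intro tendsto_intros r)
      then show "(\<lambda>k. H k z) \<longlonglongrightarrow> h z" by (simp add: H_def comp_op_def)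
    qed
    show "(L2_norm fock_measure (H k))\<^sup>2 \<le> (1 / r k ^ DIM(complex^'n)) * (L2_norm fock_measure h)\<^sup>2" for k
    proof -
      have "L2_norm fock_measure (H k) = r k ^ length js * L2_norm fock_measure (comp_op (of_real (r k)) h)"
        unfolding H_def[abs_def] L2_norm_cmult using r(1)[of k] by (simp add: norm_power)
      also have "\<dots> \<le> L2_norm fock_measure (comp_op (of_real (r k)) h)"
        using r(1,2)[of k] by (intro mult_left_le_one_le) (auto intro: power_le_one less_imp_le)
      finally have "(L2_norm fock_measure (H k))\<^sup>2 \<le> (L2_norm fock_measure (comp_op (of_real (r k)) h))\<^sup>2"
        by (intro power_mono) auto
      also have "\<dots> \<le> (1 / r k ^ DIM(complex^'n)) * (L2_norm fock_measure h)\<^sup>2"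
        by (rule L2_dilate(2)[OF r(1,2) hL])
      finally show ?thesis .
    qed
    have "(\<lambda>k. 1 / r k ^ DIM(complex^'n)) \<longlonglongrightarrow> 1 / 1 ^ DIM(complex^'n)"
      by (intro tendsto_intros r) simp
    then show "(\<lambda>k. 1 / r k ^ DIM(complex^'n)) \<longlonglongrightarrow> 1" by simp
  qed
  then show ?thesis by (simp add: eq h_def)
qed

section \<open>The Gauss measure\<close>

definition gauss_density :: "real^'n::finite \<Rightarrow> real" where
  "gauss_density x = exp (- (norm x)\<^sup>2 / 2) / sqrt (2 * pi) ^ CARD('n)"

lemma powr_half_card: "(c::real) > 0 \<Longrightarrow> c powr (real n / 2) = sqrt c ^ n"
  by (simp add: powr_half_sqrt[symmetric] powr_powr powr_realpow[symmetric])

lemma gauss_density_pos [simp]: "0 < gauss_density x"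
  by (simp add: gauss_density_def)

lemma gauss_density_nonneg [simp]: "0 \<le> gauss_density x"
  by (simp add: less_imp_le)

lemma gauss_density_measurable [measurable]: "gauss_density \<in> borel_measurable borel"
  unfolding gauss_density_def by measurable

lemma gauss_measure_eq: "gauss_measure = density lborel (\<lambda>x. ennreal (gauss_density x))"
  by (simp add: gauss_measure_def gauss_density_def powr_half_card)

lemma sets_gauss [measurable_cong, simp]: "sets gauss_measure = sets borel"
  by (simp add: gauss_measure_eq)

lemma space_gauss [simp]: "space gauss_measure = UNIV"
  by (simp add: gauss_measure_eq)

lemma measurable_gauss [simp]: "borel_measurable gauss_measure = borel_measurable borel"
  by (rule measurable_cong_sets) auto

lemma AE_gauss_iff: "(AE x in gauss_measure. P x) \<longleftrightarrow> (AE x in lborel. P x)"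
  unfolding gauss_measure_eq by (subst AE_density) (auto simp: ennreal_zero_less_one)

lemma integrable_gauss_iff:
  fixes f :: "real^'n::finite \<Rightarrow> 'b::{banach, second_countable_topology}"
  assumes "f \<in> borel_measurable borel"
  shows "integrable gauss_measure f \<longleftrightarrow> integrable lborel (\<lambda>x. gauss_density x *\<^sub>R f x)"
  unfolding gauss_measure_eq by (rule integrable_density) (use assms in auto)

lemma integral_gauss:
  fixes f :: "real^'n::finite \<Rightarrow> 'b::{banach, second_countable_topology}"
  assumes "f \<in> borel_measurable borel"
  shows "(LINT x|gauss_measure. f x) = (LINT x|lborel. gauss_density x *\<^sub>R f x)"
  unfolding gauss_measure_eq by (rule integral_density) (use assms in auto)

lemma gauss_exponential:
  fixes b :: "complex^'n::finite"
  shows "has_bochner_integral gauss_measure (\<lambda>x. exp (cdot (cvec x) b)) (exp (cdot b b / 2))"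
proof -
  have c: "complex_of_real (sqrt (2 * pi)) ^ CARD('n) \<noteq> 0" by simp
  have "has_bochner_integral lborel (\<lambda>x::real^'n. exp (of_real (- (1/2) * (norm x)\<^sup>2) + cdot (cvec x) b) / of_real (sqrt (2 * pi) ^ CARD('n)))
    (of_real (sqrt (pi / (1/2)) ^ CARD('n)) * exp (cdot b b / of_real (4 * (1/2))) / of_real (sqrt (2 * pi) ^ CARD('n)))"
    by (rule has_bochner_integral_divide_zero, rule gaussian_integral) simp
  moreover have "of_real (sqrt (pi / (1/2)) ^ CARD('n)) * exp (cdot b b / of_real (4 * (1/2))) / of_real (sqrt (2 * pi) ^ CARD('n)) = exp (cdot b b / 2)"
    using c by (simp add: mult.commute)
  moreover have "exp (of_real (- (1/2) * (norm x)\<^sup>2) + cdot (cvec x) b) / of_real (sqrt (2 * pi) ^ CARD('n)) = gauss_density x *\<^sub>R exp (cdot (cvec x) b)" for x :: "real^'n"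
  proof -
    have e: "exp (complex_of_real (- (1/2) * (norm x)\<^sup>2)) = of_real (exp (- (norm x)\<^sup>2 / 2))"
      by (simp add: exp_of_real[symmetric])
    show ?thesis unfolding exp_add e by (simp add: gauss_density_def scaleR_conv_of_real)
  qed
  ultimately have hb: "has_bochner_integral lborel (\<lambda>x::real^'n. gauss_density x *\<^sub>R exp (cdot (cvec x) b)) (exp (cdot b b / 2))"
    by simp
  have m: "(\<lambda>x::real^'n. exp (cdot (cvec x) b)) \<in> borel_measurable borel" by measurable
  show ?thesis
    using hb unfolding has_bochner_integral_iff integrable_gauss_iff[OF m] integral_gauss[OF m] .
qed

lemma prob_space_gauss: "prob_space (gauss_measure :: (real^'n::finite) measure)"
proof
  have hb: "has_bochner_integral gauss_measure (\<lambda>x::real^'n. 1::complex) 1"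
    using gauss_exponential[of "0 :: complex^'n"] by simp
  have "has_bochner_integral gauss_measure (\<lambda>x::real^'n. 1::real) 1"
    using has_bochner_integral_Re[OF hb] by simp
  then have "(\<integral>\<^sup>+x. ennreal 1 \<partial>(gauss_measure :: (real^'n) measure)) = ennreal 1"
    by (subst nn_integral_eq_integral) (auto simp: has_bochner_integral_iff)
  then show "emeasure (gauss_measure :: (real^'n) measure) (space gauss_measure) = 1" by simp
qed

interpretation gauss: prob_space "gauss_measure :: (real^'n::finite) measure"
  by (rule prob_space_gauss)

lemma gauss_L2_eq: "gauss_L2 = L2 gauss_measure"
  by (auto simp: gauss_L2_def L2_def)

lemma gauss_L2_norm_eq: "gauss_L2_norm = L2_norm gauss_measure"
  by (simp add: gauss_L2_norm_def L2_norm_def fun_eq_iff)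

text \<open>The Gauss density is \<open>exp (- |x|\<^sup>2 / 2)\<close> up to a constant and the function is squared; hence the
  bound \<open>1/4\<close>.\<close>

lemma L2_gauss_bound:
  fixes K :: "real^'n::finite \<Rightarrow> complex"
  assumes K [measurable]: "K \<in> borel_measurable borel" and "\<rho> < 1/4"
    and b: "\<And>x. norm (K x) \<le> B * exp (c * norm x + \<rho> * (norm x)\<^sup>2)"
  shows "K \<in> L2 gauss_measure"
proof (rule L2_bound)
  show "integrable gauss_measure (\<lambda>x::real^'n. B\<^sup>2 * exp (2 * c * norm x + 2 * \<rho> * (norm x)\<^sup>2))"
  proof (subst integrable_gauss_iff)
    have "integrable lborel (\<lambda>x::real^'n. (B\<^sup>2 / sqrt (2 * pi) ^ CARD('n)) * exp ((2 * c) * norm x - (1/2 - 2 * \<rho>) * (norm x)\<^sup>2))"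
      using integrable_gaussian_exp_norm[of "1/2 - 2 * \<rho>" "2 * c", where 'a="real^'n"] assms(2) by simp
    moreover have "(B\<^sup>2 / sqrt (2 * pi) ^ CARD('n)) * exp ((2 * c) * norm x - (1/2 - 2 * \<rho>) * (norm x)\<^sup>2)
      = gauss_density x *\<^sub>R (B\<^sup>2 * exp (2 * c * norm x + 2 * \<rho> * (norm x)\<^sup>2))" for x :: "real^'n"
    proof -
      have "(2 * c) * norm x - (1/2 - 2 * \<rho>) * (norm x)\<^sup>2 = - (norm x)\<^sup>2 / 2 + (2 * c * norm x + 2 * \<rho> * (norm x)\<^sup>2)"
        by (simp add: algebra_simps)
      then have "exp ((2 * c) * norm x - (1/2 - 2 * \<rho>) * (norm x)\<^sup>2) = exp (- (norm x)\<^sup>2 / 2) * exp (2 * c * norm x + 2 * \<rho> * (norm x)\<^sup>2)"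
        by (simp only: exp_add)
      then show ?thesis by (simp add: gauss_density_def)
    qed
    ultimately show "integrable lborel (\<lambda>x::real^'n. gauss_density x *\<^sub>R (B\<^sup>2 * exp (2 * c * norm x + 2 * \<rho> * (norm x)\<^sup>2)))"
      by (simp only:)
  qed measurable
  show "AE w in gauss_measure. (norm (K w))\<^sup>2 \<le> B\<^sup>2 * exp (2 * c * norm w + 2 * \<rho> * (norm w)\<^sup>2)"
  proof (rule AE_I2)
    fix w
    have "(norm (K w))\<^sup>2 \<le> (B * exp (c * norm w + \<rho> * (norm w)\<^sup>2))\<^sup>2" using b by (intro power_mono) auto
    also have "\<dots> = B\<^sup>2 * exp (2 * c * norm w + 2 * \<rho> * (norm w)\<^sup>2)"
      by (simp add: power_mult_distrib exp_double[symmetric] algebra_simps)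
    finally show "(norm (K w))\<^sup>2 \<le> B\<^sup>2 * exp (2 * c * norm w + 2 * \<rho> * (norm w)\<^sup>2)" .
  qed
qed simp

section \<open>Continuous functions of compact support\<close>

definition compactly_supported :: "(real^'n::finite \<Rightarrow> complex) \<Rightarrow> bool" where
  "compactly_supported h \<longleftrightarrow> continuous_on UNIV h \<and> (\<exists>R. \<forall>x. norm x > R \<longrightarrow> h x = 0)"

lemma compactly_supported_measurable: "compactly_supported h \<Longrightarrow> h \<in> borel_measurable borel"
  by (simp add: compactly_supported_def continuous_imp_borel)

lemma compactly_supported_bounded:
  assumes "compactly_supported h"
  obtains B where "B \<ge> 0" "\<And>x. norm (h x) \<le> B"
proof -
  obtain R where R: "\<And>x. norm x > R \<Longrightarrow> h x = 0" and c: "continuous_on UNIV h"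
    using assms by (auto simp: compactly_supported_def)
  have "compact (h ` cball 0 R)"
    by (rule compact_continuous_image[OF continuous_on_subset[OF c]]) auto
  then have "bounded (h ` cball 0 R)" by (rule compact_imp_bounded)
  then obtain B where "\<forall>y\<in>h ` cball 0 R. norm y \<le> B"
    unfolding bounded_iff by (elim exE)
  then have B: "norm x \<le> R \<Longrightarrow> norm (h x) \<le> B" for x by simp
  have "norm (h x) \<le> max B 0" for x
    using B[of x] R[of x] by (cases "norm x \<le> R") auto
  then show ?thesis using that[of "max B 0"] by auto
qed

text \<open>Radial truncation at modulus \<open>N\<close>, written without case distinction so that continuity is
  evident.\<close>

definition clip :: "real \<Rightarrow> complex \<Rightarrow> complex" where
  "clip N z = (N / max N (norm z)) *\<^sub>R z"

lemma norm_clip_le: "N > 0 \<Longrightarrow> norm (clip N z) \<le> N"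
  by (simp add: clip_def field_simps max_def)

lemma norm_clip_le_self: "N > 0 \<Longrightarrow> norm (clip N z) \<le> norm z"
proof -
  assume "N > 0"
  then have "N / max N (norm z) \<le> 1" by (simp add: divide_le_eq)
  then have "(N / max N (norm z)) * norm z \<le> 1 * norm z" by (rule mult_right_mono) simp
  moreover have "norm (clip N z) = (N / max N (norm z)) * norm z"
    unfolding clip_def norm_scaleR using \<open>N > 0\<close> by simp
  ultimately show ?thesis by simp
qed

lemma clip_eq: "N > 0 \<Longrightarrow> norm z \<le> N \<Longrightarrow> clip N z = z"
  by (simp add: clip_def max_def)

lemma continuous_on_clip: "N > 0 \<Longrightarrow> continuous_on UNIV (clip N)"
  unfolding clip_def by (intro continuous_intros) auto

lemma clip_measurable: "N > 0 \<Longrightarrow> clip N \<in> borel_measurable borel"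
  by (intro continuous_imp_borel continuous_on_clip)

text \<open>A measurable function is an almost everywhere limit of continuous functions; clipping their values
  and multiplying by a cutoff that is 1 on growing balls preserves the limit.\<close>

lemma bounded_approximation:
  fixes f :: "real^'n::finite \<Rightarrow> complex"
  assumes f: "f \<in> borel_measurable borel" and N: "N > 0" "\<And>x. norm (f x) \<le> N"
  shows "\<exists>h. (\<forall>k. compactly_supported (h k) \<and> (\<forall>x. norm (h k x) \<le> N)) \<and> (AE x in lborel. (\<lambda>k. h k x) \<longlonglongrightarrow> f x)"
proof -
  have "f \<in> borel_measurable lebesgue" by (rule measurable_completion) (use f in simp)
  then have "f measurable_on UNIV" by (rule lebesgue_measurable_imp_measurable_on) simp
  then obtain Z g where Z: "negligible Z" and "\<forall>n. continuous_on UNIV (g n)"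
      and "\<forall>x. x \<notin> Z \<longrightarrow> (\<lambda>n. g n x) \<longlonglongrightarrow> (if x \<in> UNIV then f x else 0)"
    unfolding measurable_on_def by (elim exE conjE) (erule (2) that)
  then have g: "continuous_on UNIV (g n)" and lim: "x \<notin> Z \<Longrightarrow> (\<lambda>n. g n x) \<longlonglongrightarrow> f x" for n x
    by simp_all
  define \<theta> where "\<theta> k x = max 0 (min 1 (real k + 1 - norm x))" for k :: nat and x :: "real^'n"
  define h where "h k x = \<theta> k x *\<^sub>R clip N (g k x)" for k x
  have th: "0 \<le> \<theta> k x" "\<theta> k x \<le> 1" for k x by (auto simp: \<theta>_def)
  have "compactly_supported (h k)" for k
  proof -
    have "continuous_on UNIV (h k)"
      unfolding h_def \<theta>_def
      by (intro continuous_intros continuous_on_compose2[OF continuous_on_clip[OF N(1)] g]) auto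
    moreover have "h k x = 0" if "norm x > real k + 1" for x
      using that by (simp add: h_def \<theta>_def max_def min_def)
    ultimately show ?thesis unfolding compactly_supported_def by blast
  qed
  moreover have "norm (h k x) \<le> N" for k x
  proof -
    have "norm (h k x) \<le> 1 * N"
      unfolding h_def norm_scaleR using th[of k x] norm_clip_le[OF N(1)] by (intro mult_mono) auto
    then show ?thesis by simp
  qed
  moreover have "AE x in lborel. (\<lambda>k. h k x) \<longlonglongrightarrow> f x"
  proof -
    have "AE x in lebesgue. x \<notin> Z" using Z by (intro AE_not_in) (simp add: negligible_iff_null_sets)
    then have "AE x in lborel. x \<notin> Z" by (simp add: AE_completion_iff)
    then show ?thesis
    proof eventually_elim
      fix x assume "x \<notin> Z"
      have "(\<lambda>k. clip N (g k x)) \<longlonglongrightarrow> clip N (f x)"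
        by (rule continuous_on_tendsto_compose[OF continuous_on_clip[OF N(1)] lim[OF \<open>x \<notin> Z\<close>]]) auto
      moreover have "(\<lambda>k. \<theta> k x) \<longlonglongrightarrow> 1"
      proof (rule tendsto_eventually)
        obtain K :: nat where "norm x \<le> real K" using real_arch_simple by blast
        then show "\<forall>\<^sub>F k in sequentially. \<theta> k x = 1"
          unfolding eventually_sequentially by (intro exI[of _ K]) (auto simp: \<theta>_def)
      qed
      ultimately have "(\<lambda>k. \<theta> k x *\<^sub>R clip N (g k x)) \<longlonglongrightarrow> 1 *\<^sub>R clip N (f x)" by (intro tendsto_intros)
      then show "(\<lambda>k. h k x) \<longlonglongrightarrow> f x" using N by (simp add: h_def clip_eq)
    qed
  qed
  ultimately show ?thesis by blast
qed

text \<open>The function is first truncated in modulus and then approximated almost everywhere; dominated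
  convergence applies in both steps.\<close>

theorem compactly_supported_dense:
  fixes f :: "real^'n::finite \<Rightarrow> complex"
  assumes f: "f \<in> L2 gauss_measure" and e: "e > 0"
  shows "\<exists>h. compactly_supported h \<and> h \<in> L2 gauss_measure \<and> L2_norm gauss_measure (\<lambda>x. h x - f x) < e"
proof -
  have [measurable]: "f \<in> borel_measurable borel" using f by (simp add: L2_def)
  have cm [measurable]: "(\<lambda>x. clip N (f x)) \<in> borel_measurable borel" if "N > 0" for N
    using measurable_compose[OF _ clip_measurable[OF that], of f borel] by simp
  have cL: "(\<lambda>x. clip (real (Suc k)) (f x)) \<in> L2 gauss_measure" for k
    by (rule L2_bound[OF L2_integrable[OF f]]) (auto intro!: AE_I2 power_mono norm_clip_le_self cm)
  have "(\<lambda>k. L2_norm gauss_measure (\<lambda>x. clip (real (Suc k)) (f x) - f x)) \<longlonglongrightarrow> 0"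
  proof (rule L2_dominated_convergence(2)[OF L2_integrable[OF f]])
    show "AE x in gauss_measure. (norm (clip (real (Suc k)) (f x)))\<^sup>2 \<le> (norm (f x))\<^sup>2" for k
      by (auto intro!: AE_I2 power_mono norm_clip_le_self)
    show "AE x in gauss_measure. (\<lambda>k. clip (real (Suc k)) (f x)) \<longlonglongrightarrow> f x"
    proof (intro AE_I2 tendsto_eventually)
      fix x
      obtain K :: nat where "norm (f x) \<le> real K" using real_arch_simple by blast
      then show "\<forall>\<^sub>F k in sequentially. clip (real (Suc k)) (f x) = f x"
        unfolding eventually_sequentially by (intro exI[of _ K]) (auto intro!: clip_eq)
    qed
  qed (auto intro: cm)
  from order_tendstoD(2)[OF this, of "e/2"] e obtain k where
    k: "L2_norm gauss_measure (\<lambda>x. clip (real (Suc k)) (f x) - f x) < e / 2"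
    by (auto simp: eventually_sequentially)
  define N where "N = real (Suc k)"
  have N: "N > 0" by (simp add: N_def)
  obtain h where h: "\<And>k. compactly_supported (h k)" "\<And>k x. norm (h k x) \<le> N" and lim: "AE x in lborel. (\<lambda>k. h k x) \<longlonglongrightarrow> clip N (f x)"
    using bounded_approximation[OF cm[OF N] N norm_clip_le[OF N]] by blast
  have hL: "h k \<in> L2 gauss_measure" for k
    by (rule L2_bound[where w="\<lambda>x. N\<^sup>2"]) (auto intro!: AE_I2 power_mono h compactly_supported_measurable)
  have "(\<lambda>k. L2_norm gauss_measure (\<lambda>x. h k x - clip N (f x))) \<longlonglongrightarrow> 0"
    by (rule L2_dominated_convergence(2)[where w="\<lambda>x. N\<^sup>2"])
       (use lim in \<open>auto intro!: AE_I2 power_mono h compactly_supported_measurable cm N simp: AE_gauss_iff\<close>)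
  from order_tendstoD(2)[OF this, of "e/2"] e obtain l where
    l: "L2_norm gauss_measure (\<lambda>x. h l x - clip N (f x)) < e / 2"
    by (auto simp: eventually_sequentially)
  have "L2_norm gauss_measure (\<lambda>x. h l x - f x) < e"
    using L2_norm_triangle_diff[OF hL[of l] cL[of k] f] k l by (simp add: N_def)
  then show ?thesis using h(1)[of l] hL[of l] by blast
qed

section \<open>The heat kernel and uniqueness of Fourier transforms\<close>

lemma lborel_integral_affine:
  fixes f :: "'a::euclidean_space \<Rightarrow> 'b::{banach, second_countable_topology}"
  assumes [measurable]: "f \<in> borel_measurable borel" and c: "c > 0"
  shows "(LINT x|lborel. f x) = (c ^ DIM('a)) *\<^sub>R (LINT x|lborel. f (t + c *\<^sub>R x))"
proof -
  have "(LINT x|lborel. f x) = (LINT x|density (distr lborel borel (\<lambda>x. t + c *\<^sub>R x)) (\<lambda>_. ennreal (\<bar>c\<bar> ^ DIM('a))). f x)"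
    by (rule arg_cong[of lborel _ "\<lambda>M. integral\<^sup>L M f"]) (rule lborel_affine, use c in simp)
  also have "\<dots> = (c ^ DIM('a)) *\<^sub>R (LINT x|lborel. f (t + c *\<^sub>R x))"
    using c by (subst integral_density) (auto simp: integral_distr)
  finally show ?thesis .
qed

text \<open>Convolution with the normalised Gaussian \<open>exp (- \<tau> |x|\<^sup>2)\<close>, that is, the heat semigroup at time
  \<open>1 / (4 \<tau>)\<close>.\<close>

definition heat :: "real \<Rightarrow> (real^'n::finite \<Rightarrow> complex) \<Rightarrow> real^'n \<Rightarrow> complex" where
  "heat \<tau> h x = of_real (sqrt (\<tau> / pi) ^ CARD('n)) * (LINT y|lborel. h y * of_real (exp (- \<tau> * (norm (x - y))\<^sup>2)))"

lemma heat_eq: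
  fixes h :: "real^'n::finite \<Rightarrow> complex"
  assumes [measurable]: "h \<in> borel_measurable borel" and t: "\<tau> > 0"
  shows "heat \<tau> h x = of_real (1 / sqrt pi ^ CARD('n)) * (LINT v|lborel. h (x + (1 / sqrt \<tau>) *\<^sub>R v) * of_real (exp (- (norm v)\<^sup>2)))"
proof -
  have e: "\<tau> * (norm (x - (x + (1 / sqrt \<tau>) *\<^sub>R v)))\<^sup>2 = (norm v)\<^sup>2" for v :: "real^'n"
    using t by (simp add: power_mult_distrib power_divide)
  have "(LINT y|lborel. h y * of_real (exp (- \<tau> * (norm (x - y))\<^sup>2)))
     = ((1 / sqrt \<tau>) ^ DIM(real^'n)) *\<^sub>R (LINT v|lborel. h (x + (1 / sqrt \<tau>) *\<^sub>R v) * of_real (exp (- \<tau> * (norm (x - (x + (1 / sqrt \<tau>) *\<^sub>R v)))\<^sup>2)))"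
    by (rule lborel_integral_affine) (use t in auto)
  also have "\<dots> = of_real ((1 / sqrt \<tau>) ^ CARD('n)) * (LINT v|lborel. h (x + (1 / sqrt \<tau>) *\<^sub>R v) * of_real (exp (- (norm v)\<^sup>2)))"
    by (simp only: mult_minus_left e) (simp add: scaleR_conv_of_real)
  finally have "heat \<tau> h x = of_real (sqrt (\<tau> / pi) ^ CARD('n) * (1 / sqrt \<tau>) ^ CARD('n)) * (LINT v|lborel. h (x + (1 / sqrt \<tau>) *\<^sub>R v) * of_real (exp (- (norm v)\<^sup>2)))"
    by (simp only: heat_def of_real_mult mult.assoc)
  moreover have "sqrt (\<tau> / pi) ^ CARD('n) * (1 / sqrt \<tau>) ^ CARD('n) = 1 / sqrt pi ^ CARD('n)"
    using t by (simp add: real_sqrt_divide power_divide)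
  ultimately show ?thesis by simp
qed

lemma integrable_gaussian_mult:
  fixes h :: "real^'n::finite \<Rightarrow> complex"
  assumes [measurable]: "h \<in> borel_measurable borel" and "\<And>x. norm (h x) \<le> B" and "\<tau> > 0"
  shows "integrable lborel (\<lambda>y. h y * of_real (exp (- \<tau> * (norm y)\<^sup>2)))"
proof (rule Bochner_Integration.integrable_bound)
  show "integrable lborel (\<lambda>y::real^'n. B * exp (- \<tau> * (norm y)\<^sup>2))"
    using gaussian_integral_euclidean[OF assms(3), where 'a="real^'n"] by (simp add: has_bochner_integral_iff)
  show "AE x in lborel. norm (h x * of_real (exp (- \<tau> * (norm x)\<^sup>2))) \<le> norm (B * exp (- \<tau> * (norm x)\<^sup>2))"
    using assms(2) by (auto intro!: AE_I2 mult_right_mono simp: norm_mult abs_mult intro: order_trans[OF _ abs_ge_self])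
qed measurable

lemma heat_bound:
  fixes h :: "real^'n::finite \<Rightarrow> complex"
  assumes [measurable]: "h \<in> borel_measurable borel" and B: "\<And>x. norm (h x) \<le> B" and t: "\<tau> > 0"
  shows "norm (heat \<tau> h x) \<le> B"
proof -
  have i: "integrable lborel (\<lambda>v::real^'n. exp (- 1 * (norm v)\<^sup>2))" "(LINT v|lborel. exp (- 1 * (norm (v::real^'n))\<^sup>2)) = sqrt pi ^ CARD('n)"
    using gaussian_integral_euclidean[of 1, where 'a="real^'n"] by (auto simp: has_bochner_integral_iff)
  have "norm (LINT v|lborel. h (x + (1 / sqrt \<tau>) *\<^sub>R v) * of_real (exp (- (norm v)\<^sup>2))) \<le> (LINT v|lborel. norm (h (x + (1 / sqrt \<tau>) *\<^sub>R v) * of_real (exp (- (norm v)\<^sup>2))))"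
    by (rule integral_norm_bound)
  also have "\<dots> \<le> (LINT v|lborel. B * exp (- 1 * (norm (v::real^'n))\<^sup>2))"
  proof (rule integral_mono)
    have "integrable lborel (\<lambda>v. h (x + (1 / sqrt \<tau>) *\<^sub>R v) * of_real (exp (- 1 * (norm v)\<^sup>2)))"
      by (rule integrable_gaussian_mult[where B=B]) (auto intro: B)
    then show "integrable lborel (\<lambda>v. norm (h (x + (1 / sqrt \<tau>) *\<^sub>R v) * of_real (exp (- (norm v)\<^sup>2))))"
      by (intro integrable_norm) simp
    show "integrable lborel (\<lambda>v::real^'n. B * exp (- 1 * (norm v)\<^sup>2))" using i(1) by simp
    show "norm (h (x + (1 / sqrt \<tau>) *\<^sub>R v) * of_real (exp (- (norm v)\<^sup>2))) \<le> B * exp (- 1 * (norm v)\<^sup>2)" for v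
      using B by (auto simp: norm_mult intro: mult_right_mono)
  qed
  also have "\<dots> = B * sqrt pi ^ CARD('n)" using i by simp
  finally have *: "norm (LINT v|lborel. h (x + (1 / sqrt \<tau>) *\<^sub>R v) * of_real (exp (- (norm v)\<^sup>2))) \<le> B * sqrt pi ^ CARD('n)" .
  have "norm (heat \<tau> h x) = (1 / sqrt pi ^ CARD('n)) * norm (LINT v|lborel. h (x + (1 / sqrt \<tau>) *\<^sub>R v) * of_real (exp (- (norm v)\<^sup>2)))"
    unfolding heat_eq[OF assms(1) t] norm_mult by (simp add: norm_power norm_divide)
  also have "\<dots> \<le> (1 / sqrt pi ^ CARD('n)) * (B * sqrt pi ^ CARD('n))"
    by (rule mult_left_mono[OF *]) simp
  finally show ?thesis by simp
qed

text \<open>In the variable \<open>v\<close> of the rescaled form, the argument of \<open>h\<close> tends to \<open>x\<close> as \<open>\<tau>\<close> grows, and the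
  remaining Gaussian has total mass one.\<close>

lemma heat_tendsto:
  fixes h :: "real^'n::finite \<Rightarrow> complex"
  assumes h: "compactly_supported h" and t: "\<And>k. \<tau> k > 0" "filterlim \<tau> at_top sequentially"
  shows "(\<lambda>k. heat (\<tau> k) h x) \<longlonglongrightarrow> h x"
proof -
  have [measurable]: "h \<in> borel_measurable borel" by (rule compactly_supported_measurable[OF h])
  have hc: "continuous_on UNIV h" using h by (simp add: compactly_supported_def)
  obtain B where B: "B \<ge> 0" "\<And>x. norm (h x) \<le> B" using compactly_supported_bounded[OF h] by blast
  have i: "has_bochner_integral lborel (\<lambda>v::real^'n. exp (- 1 * (norm v)\<^sup>2)) (sqrt pi ^ CARD('n))"
    using gaussian_integral_euclidean[of 1, where 'a="real^'n"] by simp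
  have inv: "(\<lambda>k. 1 / sqrt (\<tau> k)) \<longlonglongrightarrow> 0"
    using t(2) by (intro real_tendsto_divide_at_top[OF tendsto_const] filterlim_compose[OF sqrt_at_top])
  have "(\<lambda>k. LINT v|lborel. h (x + (1 / sqrt (\<tau> k)) *\<^sub>R v) * of_real (exp (- (norm v)\<^sup>2)))
     \<longlonglongrightarrow> (LINT v|lborel. h x * of_real (exp (- (norm (v::real^'n))\<^sup>2)))"
  proof (rule integral_dominated_convergence[where w="\<lambda>v. B * exp (- 1 * (norm v)\<^sup>2)"])
    show "integrable lborel (\<lambda>v::real^'n. B * exp (- 1 * (norm v)\<^sup>2))" using i by (simp add: has_bochner_integral_iff)
    show "AE v in lborel. (\<lambda>k. h (x + (1 / sqrt (\<tau> k)) *\<^sub>R v) * of_real (exp (- (norm v)\<^sup>2))) \<longlonglongrightarrow> h x * of_real (exp (- (norm v)\<^sup>2))"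
    proof (rule AE_I2)
      fix v :: "real^'n"
      have "(\<lambda>k. x + (1 / sqrt (\<tau> k)) *\<^sub>R v) \<longlonglongrightarrow> x + 0 *\<^sub>R v" by (intro tendsto_intros inv)
      then have "(\<lambda>k. h (x + (1 / sqrt (\<tau> k)) *\<^sub>R v)) \<longlonglongrightarrow> h (x + 0 *\<^sub>R v)"
        by (rule continuous_on_tendsto_compose[OF hc]) auto
      then show "(\<lambda>k. h (x + (1 / sqrt (\<tau> k)) *\<^sub>R v) * of_real (exp (- (norm v)\<^sup>2))) \<longlonglongrightarrow> h x * of_real (exp (- (norm v)\<^sup>2))"
        by (intro tendsto_intros) simp
    qed
    show "AE v in lborel. norm (h (x + (1 / sqrt (\<tau> k)) *\<^sub>R v) * of_real (exp (- (norm v)\<^sup>2))) \<le> B * exp (- 1 * (norm v)\<^sup>2)" for k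
      using B by (auto intro!: AE_I2 simp: norm_mult intro: mult_right_mono)
  qed measurable
  moreover have "(LINT v|lborel. h x * of_real (exp (- (norm (v::real^'n))\<^sup>2))) = h x * of_real (sqrt pi ^ CARD('n))"
    using has_bochner_integral_integral_eq[OF i] by simp
  ultimately have lim: "(\<lambda>k. LINT v|lborel. h (x + (1 / sqrt (\<tau> k)) *\<^sub>R v) * of_real (exp (- (norm v)\<^sup>2)))
     \<longlonglongrightarrow> h x * of_real (sqrt pi ^ CARD('n))"
    by (simp only:)
  have "(\<lambda>k. of_real (1 / sqrt pi ^ CARD('n)) * (LINT v|lborel. h (x + (1 / sqrt (\<tau> k)) *\<^sub>R v) * of_real (exp (- (norm v)\<^sup>2))))
     \<longlonglongrightarrow> of_real (1 / sqrt pi ^ CARD('n)) * (h x * of_real (sqrt pi ^ CARD('n)))"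
    by (rule tendsto_mult[OF tendsto_const lim])
  then show ?thesis by (simp add: heat_eq t(1))
qed

text \<open>Gaussians are superpositions of characters, so \<open>f\<close> integrates to zero against all translated
  Gaussians, hence against every function smoothed by the heat kernel, and in the limit against every
  continuous function of compact support. Approximating the conjugate phase of \<open>f\<close> by such functions
  gives \<open>\<integral>|f| = 0\<close>.\<close>

theorem fourier_uniqueness:
  fixes f :: "real^'n::finite \<Rightarrow> complex"
  assumes f: "integrable lborel f" and zero: "\<And>y. (LINT x|lborel. f x * exp (\<i> * cdot (cvec x) (cvec y))) = 0"
  shows "AE x in lborel. f x = 0"
proof -
  have fm [measurable]: "f \<in> borel_measurable borel" using f by (auto dest: borel_measurable_integrable)
  have gauss0: "(LINT x|lborel. f x * of_real (exp (- \<tau> * (norm (x - y))\<^sup>2))) = 0" if t: "\<tau> > 0" for \<tau> and y :: "real^'n"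
  proof -
    define a where "a = 1 / (4 * \<tau>)"
    have a: "a > 0" using t by (simp add: a_def)
    define E where "E x u = exp (of_real (- a * (norm u)\<^sup>2) + cdot (cvec u) (\<i> *s cvec (x - y)))" for x u :: "real^'n"
    have hb: "has_bochner_integral lborel (E x) (of_real (sqrt (pi / a) ^ CARD('n)) * of_real (exp (- \<tau> * (norm (x - y))\<^sup>2)))" for x
    proof -
      have "cdot (\<i> *s cvec (x - y)) (\<i> *s cvec (x - y)) = - of_real ((norm (x - y))\<^sup>2)"
        using cdot_vcnj_self[of "cvec (x - y)"] by (simp add: cdot_smult_left cdot_smult_right mult.assoc[symmetric])
      then have "cdot (\<i> *s cvec (x - y)) (\<i> *s cvec (x - y)) / of_real (4 * a) = of_real (- \<tau> * (norm (x - y))\<^sup>2)"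
        using t by (simp add: a_def)
      then show ?thesis
        using gaussian_integral[OF a, of "\<i> *s cvec (x - y)"] unfolding E_def by (simp add: exp_of_real[symmetric])
    qed
    have En: "norm (E x u) = exp (- a * (norm u)\<^sup>2)" for x u
    proof -
      have "cdot (cvec u) (cvec (x - y)) = of_real (\<Sum>j\<in>UNIV. u $ j * (x - y) $ j)"
        by (simp add: cdot_def)
      then have "Re (cdot (cvec u) (\<i> *s cvec (x - y))) = 0" by (simp add: cdot_smult_right)
      then show ?thesis by (simp add: E_def)
    qed
    have Em: "(\<lambda>p. E (fst p) (snd p)) \<in> borel_measurable (lborel \<Otimes>\<^sub>M lborel)"
      unfolding E_def lborel_prod by (auto intro!: continuous_imp_borel continuous_intros)
    have pm: "(\<lambda>(x, u). f x * E x u) \<in> borel_measurable (lborel \<Otimes>\<^sub>M lborel)"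
    proof -
      have fm': "f \<in> borel_measurable lborel" using fm by simp
      from borel_measurable_times[OF measurable_compose[OF measurable_fst fm'] Em] show ?thesis
        by (simp add: split_def)
    qed
    have ig: "integrable lborel (\<lambda>u::real^'n. exp (- a * (norm u)\<^sup>2))"
      using gaussian_integral_euclidean[OF a, where 'a="real^'n"] by (simp add: has_bochner_integral_iff)
    have pint: "integrable (lborel \<Otimes>\<^sub>M lborel) (\<lambda>(x, u). f x * E x u)"
    proof (rule lborel_pair.Fubini_integrable[OF pm])
      have "integrable lborel (\<lambda>x. norm (f x) * (LINT u|lborel. exp (- a * (norm (u::real^'n))\<^sup>2)))" using f by simp
      then show "integrable lborel (\<lambda>x. LINT u|lborel. norm (case (x, u) of (x, u) \<Rightarrow> f x * E x u))"
        by (simp add: norm_mult En)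
      show "AE x in lborel. integrable lborel (\<lambda>u. case (x, u) of (x, u) \<Rightarrow> f x * E x u)"
        using hb by (auto simp: has_bochner_integral_iff)
    qed
    have swap: "(LINT u|lborel. (LINT x|lborel. f x * E x u)) = (LINT x|lborel. (LINT u|lborel. f x * E x u))"
      using lborel_pair.Fubini_integral[OF pint] .
    have "(LINT x|lborel. f x * E x u) = 0" for u
    proof -
      have "f x * E x u = exp (of_real (- a * (norm u)\<^sup>2) - \<i> * cdot (cvec u) (cvec y)) * (f x * exp (\<i> * cdot (cvec x) (cvec u)))" for x
      proof -
        have cd: "cdot (cvec u) (\<i> *s cvec (x - y)) = - \<i> * cdot (cvec u) (cvec y) + \<i> * cdot (cvec x) (cvec u)"
          by (simp add: cdot_def sum_distrib_left sum_negf sum.distrib[symmetric] algebra_simps flip: sum_subtractf)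
        then have "E x u = exp ((of_real (- a * (norm u)\<^sup>2) - \<i> * cdot (cvec u) (cvec y)) + \<i> * cdot (cvec x) (cvec u))"
          by (simp only: E_def cd, simp add: algebra_simps)
        then show ?thesis by (simp only: exp_add mult_ac)
      qed
      then show ?thesis by (simp only: integral_mult_right_zero zero mult_zero_right)
    qed
    then have "0 = (LINT x|lborel. (LINT u|lborel. f x * E x u))" using swap by simp
    also have "\<dots> = (LINT x|lborel. of_real (sqrt (pi / a) ^ CARD('n)) * (f x * of_real (exp (- \<tau> * (norm (x - y))\<^sup>2))))"
      using has_bochner_integral_integral_eq[OF hb] by (simp add: mult_ac)
    also have "\<dots> = of_real (sqrt (pi / a) ^ CARD('n)) * (LINT x|lborel. f x * of_real (exp (- \<tau> * (norm (x - y))\<^sup>2)))"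
      by (rule integral_mult_right_zero)
    finally show ?thesis using a by simp
  qed
  have test0: "(LINT x|lborel. f x * h x) = 0" if h: "compactly_supported h" for h
  proof -
    have hm [measurable]: "h \<in> borel_measurable borel" by (rule compactly_supported_measurable[OF h])
    obtain B where B: "B \<ge> 0" "\<And>x. norm (h x) \<le> B" using compactly_supported_bounded[OF h] by blast
    have heat0: "(LINT x|lborel. f x * heat \<tau> h x) = 0" if t: "\<tau> > 0" for \<tau>
    proof -
      have pm: "(\<lambda>(x, u). f x * (h u * of_real (exp (- \<tau> * (norm (x - u))\<^sup>2)))) \<in> borel_measurable (lborel \<Otimes>\<^sub>M lborel)"
        by measurable
      have gi: "has_bochner_integral lborel (\<lambda>u::real^'n. exp (- \<tau> * (norm (x - u))\<^sup>2)) (sqrt (pi / \<tau>) ^ CARD('n))" for x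
      proof -
        have e: "integrable lborel (\<lambda>u::real^'n. exp (- \<tau> * (norm u)\<^sup>2))" "(LINT u|lborel. exp (- \<tau> * (norm (u::real^'n))\<^sup>2)) = sqrt (pi / \<tau>) ^ CARD('n)"
          using gaussian_integral_euclidean[OF t, where 'a="real^'n"] by (auto simp: has_bochner_integral_iff)
        have m: "(+) (- x) \<in> measurable lborel borel" by simp
        have "integrable lborel (\<lambda>u::real^'n. exp (- \<tau> * (norm (- x + u))\<^sup>2))"
          by (rule integrable_distr[OF m]) (simp only: lborel_distr_plus e)
        moreover have "(LINT u|lborel. exp (- \<tau> * (norm (- x + u))\<^sup>2)) = sqrt (pi / \<tau>) ^ CARD('n)"
          using integral_distr[OF m, of "\<lambda>u. exp (- \<tau> * (norm u)\<^sup>2)"] e(2) by (simp add: lborel_distr_plus)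
        moreover have "norm (- x + u) = norm (x - u)" for u :: "real^'n" by (metis add.commute norm_minus_commute uminus_add_conv_diff)
        ultimately show ?thesis by (simp add: has_bochner_integral_iff)
      qed
      have iu: "integrable lborel (\<lambda>u. h u * of_real (exp (- \<tau> * (norm (x - u))\<^sup>2)))" for x
        by (rule Bochner_Integration.integrable_bound[OF integrable_mult_right[of B, OF gi[of x, THEN integrable.intros]]])
           (use B in \<open>auto simp: norm_mult intro!: AE_I2 mult_right_mono intro: order_trans\<close>)
      have pint: "integrable (lborel \<Otimes>\<^sub>M lborel) (\<lambda>(x, u). f x * (h u * of_real (exp (- \<tau> * (norm (x - u))\<^sup>2))))"
      proof (rule lborel_pair.Fubini_integrable[OF pm])
        show "AE x in lborel. integrable lborel (\<lambda>u. case (x, u) of (x, u) \<Rightarrow> f x * (h u * of_real (exp (- \<tau> * (norm (x - u))\<^sup>2))))"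
          by (rule AE_I2) (simp only: prod.case integrable_mult_right[OF iu])
        show "integrable lborel (\<lambda>x. LINT u|lborel. norm (case (x, u) of (x, u) \<Rightarrow> f x * (h u * of_real (exp (- \<tau> * (norm (x - u))\<^sup>2)))))"
        proof (rule Bochner_Integration.integrable_bound)
          show "integrable lborel (\<lambda>x. norm (f x) * (B * sqrt (pi / \<tau>) ^ CARD('n)))" using f by simp
          show "(\<lambda>x. LINT u|lborel. norm (case (x, u) of (x, u) \<Rightarrow> f x * (h u * of_real (exp (- \<tau> * (norm (x - u))\<^sup>2))))) \<in> borel_measurable lborel"
            by measurable
          show "AE x in lborel. norm (LINT u|lborel. norm (case (x, u) of (x, u) \<Rightarrow> f x * (h u * of_real (exp (- \<tau> * (norm (x - u))\<^sup>2)))))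
            \<le> norm (norm (f x) * (B * sqrt (pi / \<tau>) ^ CARD('n)))"
          proof (rule AE_I2)
            fix x
            have "(LINT u|lborel. norm (h u * of_real (exp (- \<tau> * (norm (x - u))\<^sup>2)))) \<le> (LINT u|lborel. B * exp (- \<tau> * (norm (x - u))\<^sup>2))"
              using B gi[of x] by (intro integral_mono integrable_norm iu) (auto simp: norm_mult has_bochner_integral_iff intro: mult_right_mono)
            also have "\<dots> = B * sqrt (pi / \<tau>) ^ CARD('n)" using has_bochner_integral_integral_eq[OF gi[of x]] by simp
            finally have "norm (f x) * (LINT u|lborel. norm (h u * of_real (exp (- \<tau> * (norm (x - u))\<^sup>2)))) \<le> norm (f x) * (B * sqrt (pi / \<tau>) ^ CARD('n))"
              by (rule mult_left_mono) simp
            moreover have "(LINT u|lborel. norm (case (x, u) of (x, u) \<Rightarrow> f x * (h u * of_real (exp (- \<tau> * (norm (x - u))\<^sup>2)))))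
              = norm (f x) * (LINT u|lborel. norm (h u * of_real (exp (- \<tau> * (norm (x - u))\<^sup>2))))"
              by (simp add: norm_mult)
            moreover have "0 \<le> (LINT u|lborel. norm (h u * of_real (exp (- \<tau> * (norm (x - u))\<^sup>2))))" by simp
            ultimately show "norm (LINT u|lborel. norm (case (x, u) of (x, u) \<Rightarrow> f x * (h u * of_real (exp (- \<tau> * (norm (x - u))\<^sup>2)))))
            \<le> norm (norm (f x) * (B * sqrt (pi / \<tau>) ^ CARD('n)))" by simp
          qed
        qed
      qed
      have "(LINT x|lborel. f x * heat \<tau> h x) = (LINT x|lborel. of_real (sqrt (\<tau> / pi) ^ CARD('n)) * (LINT u|lborel. f x * (h u * of_real (exp (- \<tau> * (norm (x - u))\<^sup>2)))))"
        unfolding heat_def by (simp add: mult_ac)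
      also have "\<dots> = of_real (sqrt (\<tau> / pi) ^ CARD('n)) * (LINT x|lborel. (LINT u|lborel. f x * (h u * of_real (exp (- \<tau> * (norm (x - u))\<^sup>2)))))"
        by (rule integral_mult_right_zero)
      also have "(LINT x|lborel. (LINT u|lborel. f x * (h u * of_real (exp (- \<tau> * (norm (x - u))\<^sup>2))))) =
          (LINT u|lborel. (LINT x|lborel. f x * (h u * of_real (exp (- \<tau> * (norm (x - u))\<^sup>2)))))"
        using lborel_pair.Fubini_integral[OF pint] by simp
      also have "\<dots> = (LINT u|lborel. h u * (LINT x|lborel. f x * of_real (exp (- \<tau> * (norm (x - u))\<^sup>2))))"
        by (simp only: mult.left_commute[of "f _"] integral_mult_right_zero)
      also have "\<dots> = 0" by (simp only: gauss0[OF t] mult_zero_right integral_zero)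
      finally show ?thesis by simp
    qed
    have hmeas: "(\<lambda>x. heat \<tau> h x) \<in> borel_measurable borel" for \<tau>
      unfolding heat_def by measurable
    have "(\<lambda>k. LINT x|lborel. f x * heat (real (Suc k)) h x) \<longlonglongrightarrow> (LINT x|lborel. f x * h x)"
    proof (rule integral_dominated_convergence[where w="\<lambda>x. norm (f x) * B"])
      show "AE x in lborel. (\<lambda>k. f x * heat (real (Suc k)) h x) \<longlonglongrightarrow> f x * h x"
        by (intro AE_I2 tendsto_intros heat_tendsto h filterlim_compose[OF filterlim_real_sequentially filterlim_Suc]) auto
      show "AE x in lborel. norm (f x * heat (real (Suc k)) h x) \<le> norm (f x) * B" for k
        using B heat_bound[OF hm B(2)] by (auto simp: norm_mult intro!: AE_I2 mult_left_mono)
      show "(\<lambda>x. f x * heat (real (Suc k)) h x) \<in> borel_measurable lborel" for k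
        using hmeas by measurable
    qed (use f in auto)
    then show ?thesis using heat0 by (simp add: LIMSEQ_const_iff)
  qed
  define \<sigma> where "\<sigma> x = cnj (f x) / of_real (norm (f x))" for x
  have sm: "\<sigma> \<in> borel_measurable borel" unfolding \<sigma>_def by measurable
  have s1: "norm (\<sigma> x) \<le> 1" for x by (simp add: \<sigma>_def norm_divide)
  obtain h where h: "\<And>k. compactly_supported (h k)" "\<And>k x. norm (h k x) \<le> 1" and lim: "AE x in lborel. (\<lambda>k. h k x) \<longlonglongrightarrow> \<sigma> x"
    using bounded_approximation[OF sm _ s1] by auto
  have "(\<lambda>k. LINT x|lborel. f x * h k x) \<longlonglongrightarrow> (LINT x|lborel. f x * \<sigma> x)"
  proof (rule integral_dominated_convergence[where w="\<lambda>x. norm (f x)"])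
    show "AE x in lborel. (\<lambda>k. f x * h k x) \<longlonglongrightarrow> f x * \<sigma> x"
      using lim by eventually_elim (intro tendsto_intros)
    show "AE x in lborel. norm (f x * h k x) \<le> norm (f x)" for k
      using h(2)[of k] by (auto simp: norm_mult intro!: AE_I2 mult_left_le)
    show "(\<lambda>x. f x * h k x) \<in> borel_measurable lborel" for k
      using compactly_supported_measurable[OF h(1)] by measurable
  qed (use f sm in auto)
  then have "(LINT x|lborel. f x * \<sigma> x) = 0"
    using test0[OF h(1)] by (simp add: LIMSEQ_const_iff)
  moreover have "f x * \<sigma> x = of_real (norm (f x))" for x
  proof -
    have "f x * \<sigma> x = (of_real (norm (f x)))\<^sup>2 / of_real (norm (f x))"
      unfolding of_real_power[symmetric] complex_norm_square by (simp add: \<sigma>_def)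
    then show ?thesis by (simp add: power2_eq_square)
  qed
  ultimately have "(LINT x|lborel. norm (f x)) = 0" by simp
  then show ?thesis
    using integral_nonneg_eq_0_iff_AE[of lborel "\<lambda>x. norm (f x)"] f by simp
qed

section \<open>The Gauss-Bargmann transform on square integrable functions\<close>

lemma (in pair_sigma_finite) integral_tensor:
  fixes f h :: "_ \<Rightarrow> _::{real_normed_field, banach, second_countable_topology}"
  assumes f: "integrable M1 f" and h: "integrable M2 h"
  shows "integrable (M1 \<Otimes>\<^sub>M M2) (\<lambda>p. f (fst p) * h (snd p))"
    and "(LINT p|(M1 \<Otimes>\<^sub>M M2). f (fst p) * h (snd p)) = (LINT x|M1. f x) * (LINT y|M2. h y)"
proof -
  have [measurable]: "f \<in> borel_measurable M1" "h \<in> borel_measurable M2"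
    using f h by (auto dest: borel_measurable_integrable)
  show i: "integrable (M1 \<Otimes>\<^sub>M M2) (\<lambda>p. f (fst p) * h (snd p))"
  proof (rule Fubini_integrable)
    have "integrable M1 (\<lambda>x. norm (f x) * (LINT y|M2. norm (h y)))" using f by simp
    then show "integrable M1 (\<lambda>x. LINT y|M2. norm (f (fst (x, y)) * h (snd (x, y))))"
      by (simp add: norm_mult)
  qed (use h in auto)
  show "(LINT p|(M1 \<Otimes>\<^sub>M M2). f (fst p) * h (snd p)) = (LINT x|M1. f x) * (LINT y|M2. h y)"
    using integral_fst'[OF i] by simp
qed

definition bargmann_kernel :: "real^'n::finite \<Rightarrow> complex^'n \<Rightarrow> complex" where
  "bargmann_kernel x z = exp (cdot (cvec x) z - cdot z z / 2)"

lemma gauss_bargmann_eq: "gauss_bargmann f z = (LINT x|gauss_measure. f x * bargmann_kernel x z)"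
  by (simp add: gauss_bargmann_def bargmann_kernel_def)

lemma bargmann_kernel_measurable [measurable]: "(\<lambda>x. bargmann_kernel x z) \<in> borel_measurable borel"
  unfolding bargmann_kernel_def by measurable

lemma L2_bargmann_kernel: "(\<lambda>x. bargmann_kernel x z) \<in> L2 gauss_measure"
proof (rule L2_gauss_bound[where \<rho>=0 and B="norm (exp (- cdot z z / 2))" and c="norm z"])
  fix x
  have "bargmann_kernel x z = exp (- cdot z z / 2) * exp (cdot (cvec x) z)"
    by (simp add: bargmann_kernel_def exp_add[symmetric])
  then have "norm (bargmann_kernel x z) = norm (exp (- cdot z z / 2)) * norm (exp (cdot (cvec x) z))"
    by (simp only: norm_mult)
  also have "\<dots> \<le> norm (exp (- cdot z z / 2)) * exp (norm z * norm x + 0 * (norm x)\<^sup>2)"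
    using norm_exp_cdot_le[of "cvec x" z] by (intro mult_left_mono) (auto simp: mult.commute)
  finally show "norm (bargmann_kernel x z) \<le> norm (exp (- cdot z z / 2)) * exp (norm z * norm x + 0 * (norm x)\<^sup>2)" .
  show "(\<lambda>x. bargmann_kernel x z) \<in> borel_measurable borel" by measurable
qed simp

lemma gauss_bargmann_integrable:
  "f \<in> L2 gauss_measure \<Longrightarrow> integrable gauss_measure (\<lambda>x. f x * bargmann_kernel x z)"
  by (rule L2_mult_integrable[OF _ L2_bargmann_kernel])

lemma gauss_bargmann_bound:
  "f \<in> L2 gauss_measure \<Longrightarrow>
    norm (gauss_bargmann f z) \<le> L2_norm gauss_measure f * L2_norm gauss_measure (\<lambda>x. bargmann_kernel x z)"
  unfolding gauss_bargmann_eq by (rule L2_Cauchy_Schwarz[OF _ L2_bargmann_kernel])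

lemma gauss_bargmann_add:
  assumes "f \<in> L2 gauss_measure" "g \<in> L2 gauss_measure"
  shows "gauss_bargmann (\<lambda>x. f x + c * g x) z = gauss_bargmann f z + c * gauss_bargmann g z"
  using gauss_bargmann_integrable[OF assms(1), of z] gauss_bargmann_integrable[OF assms(2), of z]
  by (simp add: gauss_bargmann_eq distrib_right mult.assoc)

lemma gauss_bargmann_diff:
  assumes "f \<in> L2 gauss_measure" "g \<in> L2 gauss_measure"
  shows "gauss_bargmann (\<lambda>x. f x - g x) z = gauss_bargmann f z - gauss_bargmann g z"
  using gauss_bargmann_integrable[OF assms(1), of z] gauss_bargmann_integrable[OF assms(2), of z]
  by (simp add: gauss_bargmann_eq left_diff_distrib)

lemma gauss_bargmann_cong_AE:
  assumes "f \<in> borel_measurable borel" "g \<in> borel_measurable borel" "AE x in lborel. f x = g x"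
  shows "gauss_bargmann f = gauss_bargmann g"
proof
  fix z
  show "gauss_bargmann f z = gauss_bargmann g z"
    unfolding gauss_bargmann_eq
    by (rule integral_cong_AE) (use assms in \<open>auto simp: AE_gauss_iff\<close>)
qed

text \<open>The kernel factors into an exponential that is linear in \<open>z\<close> and an entire factor independent of
  \<open>x\<close>.\<close>

lemma gauss_bargmann_entire:
  fixes f :: "real^'n::finite \<Rightarrow> complex"
  assumes f: "f \<in> L2 gauss_measure"
  shows "entire (gauss_bargmann f)"
proof -
  have [measurable]: "f \<in> borel_measurable borel" using f by (simp add: L2_def)
  have "entire (\<lambda>z. LINT x|gauss_measure. f x * exp (cdot (cvec x) z))"
    unfolding entire_iff
  proof (intro allI exI, rule exponential_integral_derivative)
    fix c :: real
    have "(\<lambda>x::real^'n. complex_of_real (exp (c * norm x))) \<in> L2 gauss_measure"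
      by (rule L2_gauss_bound[where \<rho>=0 and B=1 and c=c]) auto
    from L2_mult_integrable_norm[OF f this]
    show "integrable gauss_measure (\<lambda>x. norm (f x) * exp (c * norm (cvec x)))" by simp
  qed measurable
  moreover have "entire (\<lambda>z::complex^'n. exp (cdot 0 z + (- 1 / 2) * cdot z z))"
    by (rule entire_exp_quadratic)
  ultimately have "entire (\<lambda>z. exp (cdot 0 z + (- 1 / 2) * cdot z z) * (LINT x|gauss_measure. f x * exp (cdot (cvec x) z)))"
    by (rule entire_mult[rotated])
  moreover have "exp (cdot 0 z + (- 1 / 2) * cdot z z) * (LINT x|gauss_measure. f x * exp (cdot (cvec x) z)) = gauss_bargmann f z" for z
  proof -
    have "f x * bargmann_kernel x z = exp (cdot 0 z + (- 1 / 2) * cdot z z) * (f x * exp (cdot (cvec x) z))" for x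
    proof -
      have "bargmann_kernel x z = exp (cdot 0 z + (- 1 / 2) * cdot z z) * exp (cdot (cvec x) z)"
        by (simp add: bargmann_kernel_def exp_add[symmetric])
      then show ?thesis by (simp only: mult_ac)
    qed
    then show ?thesis unfolding gauss_bargmann_eq by (simp only: integral_mult_right_zero)
  qed
  ultimately show ?thesis by simp
qed

lemma cdot_cplx: "cdot (cvec x) (cplx s t) = cdot (cvec x) (cvec s) + \<i> * cdot (cvec x) (cvec t)"
  by (simp add: cdot_def Complex_eq sum.distrib sum_distrib_left algebra_simps)

lemma norm_cplx: "(norm (cplx s t))\<^sup>2 = (norm s)\<^sup>2 + (norm t)\<^sup>2"
  by (simp add: norm_square_cvec norm_square_vec cmod_power2 sum.distrib)

lemma norm_cvec_cdot: "cdot (cvec x) (cvec x) = of_real ((norm x)\<^sup>2)"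
  using cdot_vcnj_self[of "cvec x"] by simp

lemma Im_cdot_cvec [simp]: "Im (cdot (cvec x) (cvec y)) = 0"
  by (simp add: cdot_def)

lemma cvec_add: "cvec (x + y) = cvec x + cvec y"
  by (simp add: vec_eq_iff)

lemma cvec_diff: "cvec (x - y) = cvec x - cvec y"
  by (simp add: vec_eq_iff)

lemma Re_cdot_cplx: "Re (cdot (cplx s t) (cplx s t)) = (norm s)\<^sup>2 - (norm t)\<^sup>2"
  unfolding norm_square_vec by (simp add: cdot_def sum_subtractf power2_eq_square)

text \<open>Real and imaginary parts of \<open>z\<close> separate: the product is a Gaussian in \<open>s\<close> times a Gaussian in
  \<open>t\<close> that oscillates with frequency \<open>x - y\<close>. With \<open>e = 0\<close> there is no decay in \<open>t\<close>.\<close>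

lemma kernel_product:
  fixes x y s t :: "real^'n::finite"
  shows "bargmann_kernel x (cplx s t) * cnj (bargmann_kernel y (cplx s t)) * of_real (exp (- (norm (cplx s t))\<^sup>2 - e * (norm t)\<^sup>2))
    = exp (of_real (- 2 * (norm s)\<^sup>2) + cdot (cvec s) (cvec x + cvec y)) * exp (of_real (- e * (norm t)\<^sup>2) + cdot (cvec t) (\<i> *s (cvec x - cvec y)))"
proof -
  have r: "cnj (cdot (cvec a) (cvec b)) = cdot (cvec a) (cvec b)" for a b :: "real^'n"
    by (simp add: cnj_cdot)
  have zz: "cdot (cplx s t) (cplx s t) / 2 + cnj (cdot (cplx s t) (cplx s t)) / 2 = of_real ((norm s)\<^sup>2) - of_real ((norm t)\<^sup>2)"
  proof -
    have "cdot (cplx s t) (cplx s t) + cnj (cdot (cplx s t) (cplx s t)) = of_real (2 * Re (cdot (cplx s t) (cplx s t)))"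
      by (simp add: complex_add_cnj)
    moreover have "Re (cdot (cplx s t) (cplx s t)) = (norm s)\<^sup>2 - (norm t)\<^sup>2"
      by (rule Re_cdot_cplx)
    ultimately show ?thesis by (simp add: add_divide_distrib[symmetric])
  qed
  have "(cdot (cvec x) (cplx s t) - cdot (cplx s t) (cplx s t) / 2) + cnj (cdot (cvec y) (cplx s t) - cdot (cplx s t) (cplx s t) / 2)
      + of_real (- (norm (cplx s t))\<^sup>2 - e * (norm t)\<^sup>2)
    = cdot (cvec x) (cplx s t) + cnj (cdot (cvec y) (cplx s t)) - (cdot (cplx s t) (cplx s t) / 2 + cnj (cdot (cplx s t) (cplx s t)) / 2)
      + of_real (- (norm (cplx s t))\<^sup>2 - e * (norm t)\<^sup>2)"
    by simp
  also have "\<dots> = (of_real (- 2 * (norm s)\<^sup>2) + cdot (cvec s) (cvec x + cvec y)) + (of_real (- e * (norm t)\<^sup>2) + cdot (cvec t) (\<i> *s (cvec x - cvec y)))"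
    unfolding zz cdot_cplx norm_cplx
    by (simp add: r cdot_add_right cdot_smult_right cdot_diff_right cdot_commute[of "cvec x"] cdot_commute[of "cvec y"] algebra_simps)
  finally show ?thesis
    unfolding bargmann_kernel_def exp_cnj exp_of_real[symmetric] by (simp only: exp_add[symmetric])
qed

lemma norm_kernel_cplx: "norm (bargmann_kernel x (cplx s t)) = exp (x \<bullet> s - ((norm s)\<^sup>2 - (norm t)\<^sup>2) / 2)"
proof -
  have "Re (cdot (cvec x) (cplx s t)) = x \<bullet> s" by (simp add: cdot_def inner_vec_def)
  moreover have "Re (cdot (cplx s t) (cplx s t)) = (norm s)\<^sup>2 - (norm t)\<^sup>2"
    by (rule Re_cdot_cplx)
  ultimately show ?thesis by (simp add: bargmann_kernel_def)
qed

lemma bargmann_kernel_joint_measurable: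
  "(\<lambda>p. bargmann_kernel (fst p) (cplx (fst (snd p)) (snd (snd p)))) \<in> borel_measurable (borel \<Otimes>\<^sub>M (borel \<Otimes>\<^sub>M borel))"
proof -
  have "continuous_on UNIV (\<lambda>p::(real^'n) \<times> (real^'n) \<times> (real^'n). cplx (fst (snd p)) (snd (snd p)))"
    unfolding cplx_def Complex_eq by (intro continuous_intros)
  then have "continuous_on UNIV (\<lambda>p::(real^'n) \<times> (real^'n) \<times> (real^'n). bargmann_kernel (fst p) (cplx (fst (snd p)) (snd (snd p))))"
    unfolding bargmann_kernel_def by (intro continuous_intros) auto
  from continuous_imp_borel[OF this] show ?thesis by (simp add: borel_prod)
qed

text \<open>Writing \<open>|G g|\<^sup>2\<close> as a double integral over \<open>x\<close> and \<open>y\<close> and integrating over \<open>z\<close> first is not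
  justified, since the integrand does not decay in the imaginary part \<open>t\<close> of \<open>z\<close>. The factor
  \<open>exp (- e |t|\<^sup>2)\<close> repairs this. The integrals over \<open>s\<close> and \<open>t\<close>, together with the two Gauss densities,
  leave the exponent \<open>- (|x|\<^sup>2 + |y|\<^sup>2) / 4 - \<tau> |x - y|\<^sup>2\<close>. The first part is absorbed in \<open>p\<close>, the second
  is a heat kernel that concentrates on the diagonal as \<open>e\<close> tends to 0.\<close>

lemma bargmann_regularized:
  fixes g :: "real^'n::finite \<Rightarrow> complex"
  assumes g: "compactly_supported g" and e: "e > 0"
  defines "p \<equiv> \<lambda>x. g x * of_real (exp (- (norm x)\<^sup>2 / 4))"
  defines "\<tau> \<equiv> 1 / 8 + 1 / (4 * e)"
  shows "has_bochner_integral (lborel \<Otimes>\<^sub>M lborel)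
    (\<lambda>(s, t). of_real ((norm (gauss_bargmann g (cplx s t)))\<^sup>2 * exp (- (norm (cplx s t))\<^sup>2 - e * (norm t)\<^sup>2)))
    (of_real ((sqrt (pi / 2) * sqrt (pi / e) * sqrt (pi / \<tau>) / (2 * pi)) ^ CARD('n)) * (LINT x|lborel. p x * heat \<tau> (\<lambda>x. cnj (p x)) x))"
proof -
  have gm [measurable]: "g \<in> borel_measurable borel" by (rule compactly_supported_measurable[OF g])
  obtain B where B: "B \<ge> 0" "\<And>x. norm (g x) \<le> B" using compactly_supported_bounded[OF g] by blast
  obtain R0 where R0: "\<And>x. norm x > R0 \<Longrightarrow> g x = 0" using g by (auto simp: compactly_supported_def)
  define R where "R = max R0 0"
  have R: "R \<ge> 0" "\<And>x. norm x > R \<Longrightarrow> g x = 0" using R0 by (auto simp: R_def)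
  have gL: "g \<in> L2 gauss_measure" by (rule L2_bound[where w="\<lambda>x. B\<^sup>2"]) (auto intro!: AE_I2 power_mono B)
  define P where "P = (gauss_measure :: (real^'n) measure) \<Otimes>\<^sub>M (gauss_measure :: (real^'n) measure)"
  define Q where "Q = (lborel :: (real^'n) measure) \<Otimes>\<^sub>M (lborel :: (real^'n) measure)"
  interpret GG: pair_prob_space "gauss_measure :: (real^'n) measure" "gauss_measure :: (real^'n) measure" ..
  interpret P: prob_space P unfolding P_def by (rule GG.P.prob_space_axioms)
  interpret Q: sigma_finite_measure Q unfolding Q_def by (rule lborel_pair.P.sigma_finite_measure_axioms) 
  interpret PQ: pair_sigma_finite P Q ..
  define w where "w q = exp (- (norm (cplx (fst q) (snd q)))\<^sup>2 - e * (norm (snd q))\<^sup>2)" for q :: "(real^'n) \<times> (real^'n)"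
  define K where "K x q = bargmann_kernel x (cplx (fst q) (snd q))" for x and q :: "(real^'n) \<times> (real^'n)"
  define \<Phi> where "\<Phi> r = (g (fst (fst r)) * K (fst (fst r)) (snd r)) * cnj (g (snd (fst r)) * K (snd (fst r)) (snd r)) * of_real (w (snd r))"
    for r :: "((real^'n) \<times> (real^'n)) \<times> ((real^'n) \<times> (real^'n))"
  have Ps [measurable_cong]: "sets P = sets (borel \<Otimes>\<^sub>M borel)" unfolding P_def by (intro sets_pair_measure_cong) auto
  have Qs [measurable_cong]: "sets Q = sets (borel \<Otimes>\<^sub>M borel)" unfolding Q_def by (intro sets_pair_measure_cong) auto
  have wm [measurable]: "w \<in> borel_measurable (borel \<Otimes>\<^sub>M borel)"
  proof -
    have "continuous_on UNIV w" unfolding w_def norm_cplx by (intro continuous_intros)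
    from continuous_imp_borel[OF this] show ?thesis by (simp add: borel_prod)
  qed
  have Km: "(\<lambda>p. K (fst p) (snd p)) \<in> borel_measurable (borel \<Otimes>\<^sub>M (borel \<Otimes>\<^sub>M borel))"
    unfolding K_def by (rule bargmann_kernel_joint_measurable)
  have K1: "(\<lambda>r. K (fst (fst r)) (snd r)) \<in> borel_measurable (P \<Otimes>\<^sub>M Q)"
  proof -
    have "(\<lambda>r. (fst (fst r), snd r)) \<in> measurable (P \<Otimes>\<^sub>M Q) (borel \<Otimes>\<^sub>M (borel \<Otimes>\<^sub>M borel))" by measurable
    from measurable_compose[OF this Km] show ?thesis by simp
  qed
  have K2: "(\<lambda>r. K (snd (fst r)) (snd r)) \<in> borel_measurable (P \<Otimes>\<^sub>M Q)"
  proof -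
    have "(\<lambda>r. (snd (fst r), snd r)) \<in> measurable (P \<Otimes>\<^sub>M Q) (borel \<Otimes>\<^sub>M (borel \<Otimes>\<^sub>M borel))" by measurable
    from measurable_compose[OF this Km] show ?thesis by simp
  qed
  have \<Phi>m: "\<Phi> \<in> borel_measurable (P \<Otimes>\<^sub>M Q)" unfolding \<Phi>_def using K1 K2 by measurable
  define W where "W q = exp (2 * R * norm (fst q) - 2 * (norm (fst q))\<^sup>2) * exp (0 * norm (snd q) - e * (norm (snd q))\<^sup>2)" for q :: "(real^'n) \<times> (real^'n)"
  have Wi: "integrable Q W" unfolding Q_def W_def
    by (rule lborel_pair.integral_tensor) (use integrable_gaussian_exp_norm[of 2 "2 * R", where 'a="real^'n"] integrable_gaussian_exp_norm[of e 0, where 'a="real^'n"] e in auto)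
  have \<Phi>b: "norm (\<Phi> ((x, y), q)) \<le> B\<^sup>2 * W q" for x y q
  proof (cases "norm x \<le> R \<and> norm y \<le> R")
    case True
    obtain s t where q: "q = (s, t)" by (cases q)
    have in_le: "x \<bullet> s \<le> R * norm s" if "norm x \<le> R" for x :: "real^'n"
      using norm_cauchy_schwarz[of x s] mult_right_mono[OF that, of "norm s"] by simp
    have "norm (\<Phi> ((x, y), q)) = (norm (g x) * norm (g y)) * (norm (K x q) * norm (K y q) * w q)"
      by (simp add: \<Phi>_def norm_mult w_def mult_ac)
    also have "norm (K x q) * norm (K y q) * w q = exp (x \<bullet> s + y \<bullet> s - 2 * (norm s)\<^sup>2 - e * (norm t)\<^sup>2)"
    proof -
      have "norm (K x q) * norm (K y q) * w q = exp ((x \<bullet> s - ((norm s)\<^sup>2 - (norm t)\<^sup>2) / 2) + (y \<bullet> s - ((norm s)\<^sup>2 - (norm t)\<^sup>2) / 2) + (- ((norm s)\<^sup>2 + (norm t)\<^sup>2) - e * (norm t)\<^sup>2))"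
        unfolding K_def w_def q by (simp only: fst_conv snd_conv norm_kernel_cplx norm_cplx exp_add)
      also have "(x \<bullet> s - ((norm s)\<^sup>2 - (norm t)\<^sup>2) / 2) + (y \<bullet> s - ((norm s)\<^sup>2 - (norm t)\<^sup>2) / 2) + (- ((norm s)\<^sup>2 + (norm t)\<^sup>2) - e * (norm t)\<^sup>2) = x \<bullet> s + y \<bullet> s - 2 * (norm s)\<^sup>2 - e * (norm t)\<^sup>2"
        by (simp add: field_simps)
      finally show ?thesis .
    qed
    also have "(norm (g x) * norm (g y)) * exp (x \<bullet> s + y \<bullet> s - 2 * (norm s)\<^sup>2 - e * (norm t)\<^sup>2) \<le> (B * B) * exp (2 * R * norm s - 2 * (norm s)\<^sup>2 - e * (norm t)\<^sup>2)"
      using in_le[of x] in_le[of y] True B by (intro mult_mono) auto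
    also have "\<dots> = B\<^sup>2 * W q" by (simp add: W_def q power2_eq_square[of B] exp_add[symmetric])
    finally show ?thesis .
  next
    case False
    then have "\<Phi> ((x, y), q) = 0" using R(2)[of x] R(2)[of y] by (auto simp: \<Phi>_def not_le)
    then show ?thesis using B by (simp add: W_def)
  qed
  have sect: "integrable Q (\<lambda>q. \<Phi> (xy, q))" if "xy \<in> space P" for xy
  proof (rule Bochner_Integration.integrable_bound[OF integrable_mult_right[OF Wi, of "B\<^sup>2"]])
    show "(\<lambda>q. \<Phi> (xy, q)) \<in> borel_measurable Q" using measurable_Pair2[OF \<Phi>m that] .
    show "AE q in Q. norm (\<Phi> (xy, q)) \<le> norm (B\<^sup>2 * W q)"
      using \<Phi>b[of "fst xy" "snd xy"] B by (auto intro!: AE_I2 simp: W_def)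
  qed
  have \<Phi>i: "integrable (P \<Otimes>\<^sub>M Q) \<Phi>"
  proof (rule PQ.Fubini_integrable[OF \<Phi>m])
    show "AE xy in P. integrable Q (\<lambda>q. \<Phi> (xy, q))" using sect by (rule AE_I2)
    show "integrable P (\<lambda>xy. LINT q|Q. norm (\<Phi> (xy, q)))"
    proof (rule P.integrable_const_bound[where B="B\<^sup>2 * (LINT q|Q. W q)"])
      show "AE xy in P. norm (LINT q|Q. norm (\<Phi> (xy, q))) \<le> B\<^sup>2 * (LINT q|Q. W q)"
      proof (rule AE_I2)
        fix xy assume xy: "xy \<in> space P"
        have "(LINT q|Q. norm (\<Phi> (xy, q))) \<le> (LINT q|Q. B\<^sup>2 * W q)"
          using \<Phi>b[of "fst xy" "snd xy"] by (intro integral_mono integrable_norm sect[OF xy] integrable_mult_right Wi) auto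
        then show "norm (LINT q|Q. norm (\<Phi> (xy, q))) \<le> B\<^sup>2 * (LINT q|Q. W q)" by simp
      qed
      show "(\<lambda>xy. LINT q|Q. norm (\<Phi> (xy, q))) \<in> borel_measurable P"
        using \<Phi>m by measurable
    qed
  qed
  \<comment> \<open>integrating over \<open>x\<close> and \<open>y\<close> first gives the regularised square of the transform\<close>
  have innerP: "(LINT xy|P. \<Phi> (xy, q)) = of_real ((norm (gauss_bargmann g (cplx (fst q) (snd q))))\<^sup>2 * w q)" for q
  proof -
    have gk: "integrable gauss_measure (\<lambda>x. g x * K x q)"
      unfolding K_def by (rule gauss_bargmann_integrable[OF gL])
    then have gk': "integrable gauss_measure (\<lambda>x. cnj (g x * K x q))"
      unfolding complex_integrable_cnj .
    have "(LINT xy|P. \<Phi> (xy, q)) = (LINT xy|P. (g (fst xy) * K (fst xy) q) * cnj (g (snd xy) * K (snd xy) q)) * of_real (w q)"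
      by (simp add: \<Phi>_def)
    also have "(LINT xy|P. (g (fst xy) * K (fst xy) q) * cnj (g (snd xy) * K (snd xy) q)) = (LINT x|gauss_measure. g x * K x q) * (LINT x|gauss_measure. cnj (g x * K x q))"
      unfolding P_def by (rule GG.integral_tensor(2)[OF gk gk'])
    also have "\<dots> = gauss_bargmann g (cplx (fst q) (snd q)) * cnj (gauss_bargmann g (cplx (fst q) (snd q)))"
      by (simp add: gauss_bargmann_eq K_def del: complex_cnj_mult)
    also have "\<dots> = of_real ((norm (gauss_bargmann g (cplx (fst q) (snd q))))\<^sup>2)"
      by (rule complex_norm_square[symmetric])
    finally show ?thesis by simp
  qed
  \<comment> \<open>integrating over \<open>z\<close> first gives two Gaussian integrals in closed form\<close>
  have innerQ: "(LINT q|Q. \<Phi> ((x, y), q)) = (g x * cnj (g y)) * of_real (sqrt (pi / 2) ^ CARD('n) * sqrt (pi / e) ^ CARD('n) * exp ((norm (x + y))\<^sup>2 / 8 - (norm (x - y))\<^sup>2 / (4 * e)))" for x y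
  proof -
    define a where "a s = exp (of_real (- 2 * (norm s)\<^sup>2) + cdot (cvec s) (cvec x + cvec y))" for s :: "real^'n"
    define b where "b t = exp (of_real (- e * (norm t)\<^sup>2) + cdot (cvec t) (\<i> *s (cvec x - cvec y)))" for t :: "real^'n"
    have ha: "has_bochner_integral lborel a (of_real (sqrt (pi / 2) ^ CARD('n)) * exp (cdot (cvec x + cvec y) (cvec x + cvec y) / of_real (4 * 2)))"
      unfolding a_def by (rule gaussian_integral) simp
    have hb: "has_bochner_integral lborel b (of_real (sqrt (pi / e) ^ CARD('n)) * exp (cdot (\<i> *s (cvec x - cvec y)) (\<i> *s (cvec x - cvec y)) / of_real (4 * e)))"
      unfolding b_def by (rule gaussian_integral[OF e])
    have "\<Phi> ((x, y), q) = (g x * cnj (g y)) * (a (fst q) * b (snd q))" for q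
    proof -
      have "\<Phi> ((x, y), q) = (g x * cnj (g y)) * (K x q * cnj (K y q) * of_real (w q))" by (simp add: \<Phi>_def mult_ac)
      then show ?thesis unfolding K_def w_def kernel_product a_def b_def .
    qed
    then have "(LINT q|Q. \<Phi> ((x, y), q)) = (g x * cnj (g y)) * (LINT q|Q. a (fst q) * b (snd q))" by simp
    also have "(LINT q|Q. a (fst q) * b (snd q)) = (LINT s|lborel. a s) * (LINT t|lborel. b t)"
      unfolding Q_def by (rule lborel_pair.integral_tensor(2)) (use ha hb in \<open>auto simp: has_bochner_integral_iff\<close>)
    also have "\<dots> = (of_real (sqrt (pi / 2) ^ CARD('n)) * exp (cdot (cvec x + cvec y) (cvec x + cvec y) / of_real (4 * 2)))
       * (of_real (sqrt (pi / e) ^ CARD('n)) * exp (cdot (\<i> *s (cvec x - cvec y)) (\<i> *s (cvec x - cvec y)) / of_real (4 * e)))"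
      using ha hb by (simp add: has_bochner_integral_iff)
    also have "cdot (cvec x + cvec y) (cvec x + cvec y) / of_real (4 * 2) = of_real ((norm (x + y))\<^sup>2 / 8)"
      unfolding cvec_add[symmetric] norm_cvec_cdot by simp
    also have "cdot (\<i> *s (cvec x - cvec y)) (\<i> *s (cvec x - cvec y)) / of_real (4 * e) = of_real (- (norm (x - y))\<^sup>2 / (4 * e))"
      unfolding cvec_diff[symmetric] cdot_smult_left cdot_smult_right norm_cvec_cdot by (simp add: mult.assoc[symmetric])
    also have "(of_real (sqrt (pi / 2) ^ CARD('n)) * exp (of_real ((norm (x + y))\<^sup>2 / 8))) * (of_real (sqrt (pi / e) ^ CARD('n)) * exp (of_real (- (norm (x - y))\<^sup>2 / (4 * e))))
       = complex_of_real (sqrt (pi / 2) ^ CARD('n) * sqrt (pi / e) ^ CARD('n) * exp ((norm (x + y))\<^sup>2 / 8 - (norm (x - y))\<^sup>2 / (4 * e)))"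
    proof -
      have "exp ((norm (x + y))\<^sup>2 / 8 - (norm (x - y))\<^sup>2 / (4 * e)) = exp ((norm (x + y))\<^sup>2 / 8) * exp (- (norm (x - y))\<^sup>2 / (4 * e))"
        by (simp add: exp_add[symmetric])
      then show ?thesis by (simp only: of_real_mult exp_of_real mult_ac)
    qed
    finally show ?thesis .
  qed
  have step1: "has_bochner_integral Q (\<lambda>q. of_real ((norm (gauss_bargmann g (cplx (fst q) (snd q))))\<^sup>2 * w q)) (LINT r|(P \<Otimes>\<^sub>M Q). \<Phi> r)"
  proof -
    have i: "integrable (P \<Otimes>\<^sub>M Q) (case_prod (\<lambda>xy q. \<Phi> (xy, q)))" using \<Phi>i by simp
    show ?thesis
      using PQ.integrable_snd[OF i] PQ.integral_snd[OF i] by (simp add: has_bochner_integral_iff innerP)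
  qed
  have "(LINT r|(P \<Otimes>\<^sub>M Q). \<Phi> r) = (LINT xy|P. (LINT q|Q. \<Phi> (xy, q)))"
    using PQ.integral_fst'[OF \<Phi>i] by simp
  also have "\<dots> = (LINT x|gauss_measure. (LINT y|gauss_measure. (LINT q|Q. \<Phi> ((x, y), q))))"
    using GG.integral_fst'[of "\<lambda>xy. LINT q|Q. \<Phi> (xy, q)"] PQ.integrable_fst'[OF \<Phi>i] by (simp add: P_def)
  also have "\<dots> = of_real ((sqrt (pi / 2) * sqrt (pi / e) * sqrt (pi / \<tau>) / (2 * pi)) ^ CARD('n)) * (LINT x|lborel. p x * heat \<tau> (\<lambda>x. cnj (p x)) x)"
  proof -
    have t0: "\<tau> > 0" using e by (simp add: \<tau>_def add_pos_pos)
    have pm: "p \<in> borel_measurable borel" unfolding p_def by measurable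
    define c where "c = sqrt (pi / 2) ^ CARD('n) * sqrt (pi / e) ^ CARD('n) / (sqrt (2 * pi) ^ CARD('n) * sqrt (2 * pi) ^ CARD('n))"
    have par: "exp (- (norm x)\<^sup>2 / 2) * exp (- (norm y)\<^sup>2 / 2) * exp ((norm (x + y))\<^sup>2 / 8 - (norm (x - y))\<^sup>2 / (4 * e))
       = exp (- (norm x)\<^sup>2 / 4) * exp (- (norm y)\<^sup>2 / 4) * exp (- \<tau> * (norm (x - y))\<^sup>2)" for x y :: "real^'n"
    proof -
      have pl: "(norm (x + y))\<^sup>2 + (norm (x - y))\<^sup>2 = 2 * (norm x)\<^sup>2 + 2 * (norm y)\<^sup>2"
        by (simp add: power2_norm_eq_inner inner_add_left inner_add_right inner_diff_left inner_diff_right)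
      have ta: "\<tau> * (norm (x - y))\<^sup>2 = (norm (x - y))\<^sup>2 / 8 + (norm (x - y))\<^sup>2 / (4 * e)"
        by (simp add: \<tau>_def algebra_simps)
      have "- (norm x)\<^sup>2 / 2 + - (norm y)\<^sup>2 / 2 + ((norm (x + y))\<^sup>2 / 8 - (norm (x - y))\<^sup>2 / (4 * e))
        = - (norm x)\<^sup>2 / 4 + - (norm y)\<^sup>2 / 4 + - \<tau> * (norm (x - y))\<^sup>2"
        using pl ta by simp
      then show ?thesis by (simp only: exp_add[symmetric])
    qed
    have in1: "(LINT y|gauss_measure. (LINT q|Q. \<Phi> ((x, y), q))) = (LINT y|lborel. gauss_density y *\<^sub>R ((g x * cnj (g y)) * of_real (sqrt (pi / 2) ^ CARD('n) * sqrt (pi / e) ^ CARD('n) * exp ((norm (x + y))\<^sup>2 / 8 - (norm (x - y))\<^sup>2 / (4 * e)))))" for x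
      unfolding innerQ by (rule integral_gauss) measurable
    have in2: "gauss_density x *\<^sub>R (LINT y|lborel. gauss_density y *\<^sub>R ((g x * cnj (g y)) * of_real (sqrt (pi / 2) ^ CARD('n) * sqrt (pi / e) ^ CARD('n) * exp ((norm (x + y))\<^sup>2 / 8 - (norm (x - y))\<^sup>2 / (4 * e)))))
       = of_real c * (p x * (LINT y|lborel. cnj (p y) * of_real (exp (- \<tau> * (norm (x - y))\<^sup>2))))" for x
    proof -
      have "gauss_density x *\<^sub>R (LINT y|lborel. gauss_density y *\<^sub>R ((g x * cnj (g y)) * of_real (sqrt (pi / 2) ^ CARD('n) * sqrt (pi / e) ^ CARD('n) * exp ((norm (x + y))\<^sup>2 / 8 - (norm (x - y))\<^sup>2 / (4 * e)))))
        = (LINT y|lborel. (of_real c * p x) * (cnj (p y) * of_real (exp (- \<tau> * (norm (x - y))\<^sup>2))))"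
      proof (subst integral_scaleR_right[symmetric], rule Bochner_Integration.integral_cong[OF refl])
        fix y
        have "gauss_density x * gauss_density y * (sqrt (pi / 2) ^ CARD('n) * sqrt (pi / e) ^ CARD('n) * exp ((norm (x + y))\<^sup>2 / 8 - (norm (x - y))\<^sup>2 / (4 * e)))
          = c * (exp (- (norm x)\<^sup>2 / 2) * exp (- (norm y)\<^sup>2 / 2) * exp ((norm (x + y))\<^sup>2 / 8 - (norm (x - y))\<^sup>2 / (4 * e)))"
          by (simp add: gauss_density_def c_def)
        also have "\<dots> = c * (exp (- (norm x)\<^sup>2 / 4) * exp (- (norm y)\<^sup>2 / 4) * exp (- \<tau> * (norm (x - y))\<^sup>2))"
          by (simp only: par)
        finally have r: "gauss_density x * gauss_density y * (sqrt (pi / 2) ^ CARD('n) * sqrt (pi / e) ^ CARD('n) * exp ((norm (x + y))\<^sup>2 / 8 - (norm (x - y))\<^sup>2 / (4 * e)))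
           = c * (exp (- (norm x)\<^sup>2 / 4) * exp (- (norm y)\<^sup>2 / 4) * exp (- \<tau> * (norm (x - y))\<^sup>2))" .
        have "gauss_density x *\<^sub>R gauss_density y *\<^sub>R ((g x * cnj (g y)) * of_real (sqrt (pi / 2) ^ CARD('n) * sqrt (pi / e) ^ CARD('n) * exp ((norm (x + y))\<^sup>2 / 8 - (norm (x - y))\<^sup>2 / (4 * e))))
          = (g x * cnj (g y)) * of_real (gauss_density x * gauss_density y * (sqrt (pi / 2) ^ CARD('n) * sqrt (pi / e) ^ CARD('n) * exp ((norm (x + y))\<^sup>2 / 8 - (norm (x - y))\<^sup>2 / (4 * e))))"
          by (simp only: scaleR_conv_of_real of_real_mult mult_ac)
        also have "\<dots> = (of_real c * p x) * (cnj (p y) * of_real (exp (- \<tau> * (norm (x - y))\<^sup>2)))"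
          unfolding r p_def by (simp only: of_real_mult complex_cnj_mult complex_cnj_complex_of_real mult_ac)
        finally show "gauss_density x *\<^sub>R gauss_density y *\<^sub>R ((g x * cnj (g y)) * of_real (sqrt (pi / 2) ^ CARD('n) * sqrt (pi / e) ^ CARD('n) * exp ((norm (x + y))\<^sup>2 / 8 - (norm (x - y))\<^sup>2 / (4 * e))))
          = (of_real c * p x) * (cnj (p y) * of_real (exp (- \<tau> * (norm (x - y))\<^sup>2)))" .
      qed
      then show ?thesis by (simp only: integral_mult_right_zero mult.assoc)
    qed
    have om: "(\<lambda>x. LINT y|lborel. gauss_density y *\<^sub>R ((g x * cnj (g y)) * of_real (sqrt (pi / 2) ^ CARD('n) * sqrt (pi / e) ^ CARD('n) * exp ((norm (x + y))\<^sup>2 / 8 - (norm (x - y))\<^sup>2 / (4 * e))))) \<in> borel_measurable borel"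
      by measurable
    have hh: "of_real c * (p x * (LINT y|lborel. cnj (p y) * of_real (exp (- \<tau> * (norm (x - y))\<^sup>2))))
       = of_real (c / sqrt (\<tau> / pi) ^ CARD('n)) * (p x * heat \<tau> (\<lambda>x. cnj (p x)) x)" for x
    proof -
      have "complex_of_real (sqrt (\<tau> / pi)) ^ CARD('n) \<noteq> 0" using t0 by simp
      then show ?thesis by (simp add: heat_def)
    qed
    have cc: "c / sqrt (\<tau> / pi) ^ CARD('n) = (sqrt (pi / 2) * sqrt (pi / e) * sqrt (pi / \<tau>) / (2 * pi)) ^ CARD('n)"
    proof -
      have "sqrt (2 * pi) ^ CARD('n) * sqrt (2 * pi) ^ CARD('n) = (2 * pi) ^ CARD('n)"
        unfolding power_mult_distrib[symmetric] by simp
      moreover have "1 / sqrt (\<tau> / pi) = sqrt (pi / \<tau>)" by (simp add: real_sqrt_divide)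
      then have "1 / sqrt (\<tau> / pi) ^ CARD('n) = sqrt (pi / \<tau>) ^ CARD('n)" by (simp add: power_one_over[symmetric])
      then have "c / sqrt (\<tau> / pi) ^ CARD('n) = c * sqrt (pi / \<tau>) ^ CARD('n)" by (simp add: divide_inverse)
      ultimately show ?thesis by (simp add: c_def power_mult_distrib power_divide)
    qed
    have "(LINT x|gauss_measure. (LINT y|gauss_measure. (LINT q|Q. \<Phi> ((x, y), q)))) = (LINT x|lborel. of_real (c / sqrt (\<tau> / pi) ^ CARD('n)) * (p x * heat \<tau> (\<lambda>x. cnj (p x)) x))"
      unfolding in1 integral_gauss[OF om] in2 hh ..
    then show ?thesis unfolding cc integral_mult_right_zero .
  qed
  finally have "(LINT r|(P \<Otimes>\<^sub>M Q). \<Phi> r) = of_real ((sqrt (pi / 2) * sqrt (pi / e) * sqrt (pi / \<tau>) / (2 * pi)) ^ CARD('n)) * (LINT x|lborel. p x * heat \<tau> (\<lambda>x. cnj (p x)) x)" .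
  with step1 show ?thesis by (simp add: Q_def w_def split_def)
qed

lemma compactly_supported_diff:
  assumes "compactly_supported f" "compactly_supported g"
  shows "compactly_supported (\<lambda>x. f x - g x)"
proof -
  obtain R S where "\<And>x. norm x > R \<Longrightarrow> f x = 0" "\<And>x. norm x > S \<Longrightarrow> g x = 0"
    using assms by (auto simp: compactly_supported_def)
  then have "\<forall>x. norm x > max R S \<longrightarrow> f x - g x = 0" by simp
  moreover have "continuous_on UNIV (\<lambda>x. f x - g x)"
    using assms by (intro continuous_on_diff) (auto simp: compactly_supported_def)
  ultimately show ?thesis unfolding compactly_supported_def by blast
qed

lemma compactly_supported_L2:
  assumes "compactly_supported g"
  shows "g \<in> L2 gauss_measure"
proof -
  obtain B where "B \<ge> 0" "\<And>x. norm (g x) \<le> B" using compactly_supported_bounded[OF assms] by blast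
  then show ?thesis
    by (intro L2_bound[where w="\<lambda>x. B\<^sup>2"]) (auto intro!: AE_I2 power_mono compactly_supported_measurable[OF assms])
qed

text \<open>As the regularisation is removed, the left side increases to the squared Fock norm while the heat
  kernel on the right tends to the identity.\<close>

lemma gauss_bargmann_isometry_compactly_supported:
  fixes g :: "real^'n::finite \<Rightarrow> complex"
  assumes g: "compactly_supported g"
  shows "gauss_bargmann g \<in> L2 fock_measure"
    and "L2_norm fock_measure (gauss_bargmann g) = L2_norm gauss_measure g"
proof -
  have gL: "g \<in> L2 gauss_measure" by (rule compactly_supported_L2[OF g])
  have gm [measurable]: "g \<in> borel_measurable borel" by (rule compactly_supported_measurable[OF g])
  have Gm [measurable]: "gauss_bargmann g \<in> borel_measurable borel"
    by (rule entire_measurable[OF gauss_bargmann_entire[OF gL]])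
  define p where "p x = g x * of_real (exp (- (norm x)\<^sup>2 / 4))" for x
  have pc: "compactly_supported p"
    using g unfolding compactly_supported_def p_def by (auto intro!: continuous_intros)
  have pm [measurable]: "p \<in> borel_measurable borel" by (rule compactly_supported_measurable[OF pc])
  have pcc: "compactly_supported (\<lambda>x. cnj (p x))"
    using pc unfolding compactly_supported_def by (auto intro!: continuous_intros)
  obtain B where B: "B \<ge> 0" "\<And>x. norm (p x) \<le> B" using compactly_supported_bounded[OF pc] by blast
  have density: "of_real ((norm (p x))\<^sup>2) = of_real (sqrt (2 * pi) ^ CARD('n)) * complex_of_real (gauss_density x * (norm (g x))\<^sup>2)" for x
  proof -
    have "exp (- (norm x)\<^sup>2 / 4) ^ 2 = exp (- (norm x)\<^sup>2 / 2)" by (simp add: exp_double[symmetric])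
    then have "(norm (p x))\<^sup>2 = (norm (g x))\<^sup>2 * exp (- (norm x)\<^sup>2 / 2)"
      by (simp add: p_def norm_mult power_mult_distrib)
    also have "\<dots> = sqrt (2 * pi) ^ CARD('n) * (gauss_density x * (norm (g x))\<^sup>2)"
      by (simp add: gauss_density_def)
    finally show ?thesis by (simp only: of_real_mult)
  qed
  have gi: "integrable lborel (\<lambda>x. gauss_density x * (norm (g x))\<^sup>2)"
    using L2_integrable[OF gL] by (subst (asm) integrable_gauss_iff) auto
  have p2i: "integrable lborel (\<lambda>x. (norm (p x))\<^sup>2)"
  proof -
    have "(norm (p x))\<^sup>2 = sqrt (2 * pi) ^ CARD('n) * (gauss_density x * (norm (g x))\<^sup>2)" for x
      using density[of x] unfolding of_real_mult[symmetric] of_real_eq_iff .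
    then show ?thesis using gi by simp
  qed
  have p2: "(LINT x|lborel. p x * cnj (p x)) = of_real (sqrt (2 * pi) ^ CARD('n) * (L2_norm gauss_measure g)\<^sup>2)"
  proof -
    have "(LINT x|lborel. p x * cnj (p x)) = (LINT x|lborel. of_real (sqrt (2 * pi) ^ CARD('n)) * complex_of_real (gauss_density x * (norm (g x))\<^sup>2))"
      by (simp only: complex_norm_square[symmetric] density)
    also have "\<dots> = of_real (sqrt (2 * pi) ^ CARD('n)) * of_real (LINT x|lborel. gauss_density x * (norm (g x))\<^sup>2)"
      by (simp only: integral_mult_right_zero integral_complex_of_real)
    also have "(LINT x|lborel. gauss_density x * (norm (g x))\<^sup>2) = (L2_norm gauss_measure g)\<^sup>2"
      unfolding L2_norm_square by (subst integral_gauss) auto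
    finally show ?thesis by simp
  qed
  have pi1: "integrable lborel (\<lambda>x. norm (p x))"
  proof -
    obtain R where R: "\<And>x. norm x > R \<Longrightarrow> p x = 0" using pc by (auto simp: compactly_supported_def)
    have "integrable lborel (\<lambda>x. indicator (cball 0 R) x *\<^sub>R norm (p x))"
      using pc by (intro borel_integrable_compact) (auto simp: compactly_supported_def intro!: continuous_intros elim: continuous_on_subset)
    moreover have "indicator (cball 0 R) x *\<^sub>R norm (p x) = norm (p x)" for x
      using R[of x] by (cases "norm x \<le> R") auto
    ultimately show ?thesis by (simp only:)
  qed
  \<comment> \<open>with this choice \<open>\<tau>\<close> is \<open>1/8\<close> plus a positive integer\<close>
  define e where "e k = 1 / (4 * real (Suc k))" for k
  define \<tau> where "\<tau> k = 1 / 8 + 1 / (4 * e k)" for k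
  have e0: "e k > 0" for k by (simp add: e_def)
  have tau: "\<tau> k = 1 / 8 + real (Suc k)" for k by (simp add: \<tau>_def e_def field_simps)
  have t0: "\<tau> k > 0" for k by (simp add: tau add_pos_nonneg)
  have elim: "e \<longlonglongrightarrow> 0"
  proof -
    have "(\<lambda>k. (1 / 4) * (1 / real (Suc k))) \<longlonglongrightarrow> (1 / 4) * 0"
      by (intro tendsto_intros LIMSEQ_Suc[OF lim_1_over_n])
    then show ?thesis by (simp add: e_def[abs_def])
  qed
  have tlim: "filterlim \<tau> at_top sequentially"
    unfolding tau[abs_def]
    by (intro filterlim_tendsto_add_at_top[OF tendsto_const] filterlim_compose[OF filterlim_real_sequentially filterlim_Suc])
  define V where "V k = of_real ((sqrt (pi / 2) * sqrt (pi / e k) * sqrt (pi / \<tau> k) / (2 * pi)) ^ CARD('n)) * (LINT x|lborel. p x * heat (\<tau> k) (\<lambda>x. cnj (p x)) x)" for k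
  have heatlim: "(\<lambda>k. LINT x|lborel. p x * heat (\<tau> k) (\<lambda>x. cnj (p x)) x) \<longlonglongrightarrow> (LINT x|lborel. p x * cnj (p x))"
  proof (rule integral_dominated_convergence[where w="\<lambda>x. norm (p x) * B"])
    show "AE x in lborel. (\<lambda>k. p x * heat (\<tau> k) (\<lambda>x. cnj (p x)) x) \<longlonglongrightarrow> p x * cnj (p x)"
      by (intro AE_I2 tendsto_intros heat_tendsto pcc t0 tlim)
    have "norm (heat (\<tau> k) (\<lambda>x. cnj (p x)) x) \<le> B" for k x
      by (rule heat_bound) (use B t0 in auto)
    then show "AE x in lborel. norm (p x * heat (\<tau> k) (\<lambda>x. cnj (p x)) x) \<le> norm (p x) * B" for k
      by (auto simp: norm_mult intro!: AE_I2 mult_left_mono)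
    show "(\<lambda>x. p x * heat (\<tau> k) (\<lambda>x. cnj (p x)) x) \<in> borel_measurable lborel" for k
      unfolding heat_def by measurable
  qed (use pi1 in auto)
  have base: "sqrt (pi / 2) * sqrt (pi / e k) * sqrt (pi / \<tau> k) / (2 * pi) = sqrt (pi / 2) / (2 * sqrt (e k / 8 + 1 / 4))" for k
  proof -
    have "e k * \<tau> k = e k / 8 + 1 / 4" using e0[of k] by (simp add: \<tau>_def field_simps)
    then have "sqrt (e k / 8 + 1 / 4) = sqrt (e k) * sqrt (\<tau> k)" by (simp only: real_sqrt_mult[symmetric])
    moreover have "sqrt pi * sqrt pi = pi" by simp
    ultimately show ?thesis using e0[of k] t0[of k]
      by (simp add: real_sqrt_divide field_simps)
  qed
  have Vlim: "V \<longlonglongrightarrow> of_real (sqrt (pi / 2) ^ CARD('n)) * of_real (sqrt (2 * pi) ^ CARD('n) * (L2_norm gauss_measure g)\<^sup>2)"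
  proof -
    have s4: "sqrt (1 / 4) = (1 / 2 :: real)" by (simp add: real_sqrt_divide)
    have "(\<lambda>k. sqrt (pi / 2) / (2 * sqrt (e k / 8 + 1 / 4))) \<longlonglongrightarrow> sqrt (pi / 2) / (2 * sqrt (0 / 8 + 1 / 4))"
      by (intro tendsto_intros elim) auto
    then have "(\<lambda>k. sqrt (pi / 2) / (2 * sqrt (e k / 8 + 1 / 4))) \<longlonglongrightarrow> sqrt (pi / 2)" by (simp add: s4)
    then have "(\<lambda>k. complex_of_real ((sqrt (pi / 2) / (2 * sqrt (e k / 8 + 1 / 4))) ^ CARD('n))) \<longlonglongrightarrow> of_real (sqrt (pi / 2) ^ CARD('n))"
      by (intro tendsto_intros)
    from tendsto_mult[OF this heatlim] show ?thesis
      unfolding p2 V_def base .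
  qed
  have Vlim': "(\<lambda>k. Re (V k)) \<longlonglongrightarrow> pi ^ CARD('n) * (L2_norm gauss_measure g)\<^sup>2"
  proof -
    have "sqrt (pi / 2) ^ CARD('n) * sqrt (2 * pi) ^ CARD('n) = pi ^ CARD('n)"
      unfolding power_mult_distrib[symmetric] real_sqrt_mult[symmetric] by simp
    then have eq: "of_real (sqrt (pi / 2) ^ CARD('n)) * of_real (sqrt (2 * pi) ^ CARD('n) * (L2_norm gauss_measure g)\<^sup>2) = complex_of_real (pi ^ CARD('n) * (L2_norm gauss_measure g)\<^sup>2)"
      by (simp only: of_real_mult[symmetric] mult.assoc[symmetric])
    from tendsto_Re[OF Vlim[unfolded eq]] show ?thesis unfolding Re_complex_of_real .
  qed
  define f where "f k q = (norm (gauss_bargmann g (cplx (fst q) (snd q))))\<^sup>2 * exp (- (norm (cplx (fst q) (snd q)))\<^sup>2 - e k * (norm (snd q))\<^sup>2)" for k and q :: "(real^'n) \<times> (real^'n)"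
  have hb: "has_bochner_integral (lborel \<Otimes>\<^sub>M lborel) (f k) (Re (V k))" for k
    using has_bochner_integral_Re[OF bargmann_regularized[OF g e0[of k]]]
    by (simp add: V_def p_def[abs_def] \<tau>_def split_def f_def[abs_def])
  define u where "u q = (norm (gauss_bargmann g (cplx (fst q) (snd q))))\<^sup>2 * exp (- (norm (cplx (fst q) (snd q)))\<^sup>2)" for q :: "(real^'n) \<times> (real^'n)"
  have um: "u \<in> borel_measurable (lborel \<Otimes>\<^sub>M lborel)"
  proof -
    have m: "(\<lambda>z. (norm (gauss_bargmann g z))\<^sup>2 * exp (- (norm z)\<^sup>2)) \<in> borel_measurable borel" by measurable
    from measurable_compose[OF cplx_measurable this] show ?thesis by (simp add: u_def[abs_def])
  qed
  have fmono: "AE q in lborel \<Otimes>\<^sub>M lborel. mono (\<lambda>k. f k q)"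
  proof (intro AE_I2 incseq_SucI)
    fix q :: "(real^'n) \<times> (real^'n)" and k
    have "e (Suc k) \<le> e k" by (simp add: e_def field_simps)
    then have "e (Suc k) * (norm (snd q))\<^sup>2 \<le> e k * (norm (snd q))\<^sup>2" by (intro mult_right_mono) auto
    then show "f k q \<le> f (Suc k) q" unfolding f_def by (intro mult_left_mono) auto
  qed
  have flim: "AE q in lborel \<Otimes>\<^sub>M lborel. (\<lambda>k. f k q) \<longlonglongrightarrow> u q"
  proof (rule AE_I2)
    fix q :: "(real^'n) \<times> (real^'n)"
    have "(\<lambda>k. f k q) \<longlonglongrightarrow> (norm (gauss_bargmann g (cplx (fst q) (snd q))))\<^sup>2 * exp (- (norm (cplx (fst q) (snd q)))\<^sup>2 - 0 * (norm (snd q))\<^sup>2)"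
      unfolding f_def by (intro tendsto_intros elim)
    then show "(\<lambda>k. f k q) \<longlonglongrightarrow> u q" by (simp add: u_def)
  qed
  have ilim: "(\<lambda>k. LINT q|(lborel \<Otimes>\<^sub>M lborel). f k q) \<longlonglongrightarrow> pi ^ CARD('n) * (L2_norm gauss_measure g)\<^sup>2"
    using Vlim' has_bochner_integral_integral_eq[OF hb] by simp
  have fi: "integrable (lborel \<Otimes>\<^sub>M lborel) (f k)" for k using hb by (simp add: has_bochner_integral_iff)
  have ui: "integrable (lborel \<Otimes>\<^sub>M lborel) u" "integral\<^sup>L (lborel \<Otimes>\<^sub>M lborel) u = pi ^ CARD('n) * (L2_norm gauss_measure g)\<^sup>2"
    using integrable_monotone_convergence[OF fi fmono flim ilim um] integral_monotone_convergence[OF fi fmono flim ilim um] by auto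
  define U where "U z = fock_density z * (norm (gauss_bargmann g z))\<^sup>2" for z
  have Um: "U \<in> borel_measurable borel" unfolding U_def by measurable
  have Uu: "U (cplx (fst q) (snd q)) = u q / pi ^ CARD('n)" for q
    by (simp add: U_def u_def fock_density_def)
  have Ui: "integrable lborel U" "integral\<^sup>L lborel U = (L2_norm gauss_measure g)\<^sup>2"
  proof -
    have "integrable (lborel \<Otimes>\<^sub>M lborel) (\<lambda>q. U (cplx (fst q) (snd q)))" unfolding Uu using ui(1) by simp
    then have "integrable (distr (lborel \<Otimes>\<^sub>M lborel) borel (\<lambda>p. cplx (fst p) (snd p))) U"
      by (subst integrable_distr_eq) (auto intro: Um cplx_measurable)
    then show "integrable lborel U" by (simp only: distr_cplx)
    have "integral\<^sup>L (distr (lborel \<Otimes>\<^sub>M lborel) borel (\<lambda>p. cplx (fst p) (snd p))) U = (LINT q|(lborel \<Otimes>\<^sub>M lborel). U (cplx (fst q) (snd q)))"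
      by (subst integral_distr) (auto intro: Um cplx_measurable)
    then show "integral\<^sup>L lborel U = (L2_norm gauss_measure g)\<^sup>2" unfolding Uu by (simp add: distr_cplx ui(2))
  qed
  have "integrable fock_measure (\<lambda>z. (norm (gauss_bargmann g z))\<^sup>2)"
    by (subst integrable_fock_iff) (use Ui(1) in \<open>auto simp: U_def[abs_def]\<close>)
  then show "gauss_bargmann g \<in> L2 fock_measure" by (simp add: L2_def)
  have "(L2_norm fock_measure (gauss_bargmann g))\<^sup>2 = (L2_norm gauss_measure g)\<^sup>2"
    unfolding Ui(2)[symmetric] L2_norm_square[of fock_measure] by (subst integral_fock) (auto simp: U_def[abs_def])
  then show "L2_norm fock_measure (gauss_bargmann g) = L2_norm gauss_measure g"
    by (simp add: power2_eq_iff_nonneg)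
qed

text \<open>Density of the continuous functions of compact support extends the isometry. The limit in the Fock
  space is the transform itself, because for each fixed \<open>z\<close> the transform is continuous in \<open>f\<close>.\<close>

theorem gauss_bargmann_isometry:
  fixes f :: "real^'n::finite \<Rightarrow> complex"
  assumes f: "f \<in> L2 gauss_measure"
  shows "gauss_bargmann f \<in> fock_space"
    and "L2_norm fock_measure (gauss_bargmann f) = L2_norm gauss_measure f"
proof -
  have "\<exists>h. compactly_supported h \<and> h \<in> L2 gauss_measure \<and> L2_norm gauss_measure (\<lambda>x. h x - f x) < 1 / real (Suc k)" for k
    by (rule compactly_supported_dense[OF f]) simp
  then obtain h where h: "\<And>k. compactly_supported (h k)" "\<And>k. h k \<in> L2 gauss_measure"
    and hf: "\<And>k. L2_norm gauss_measure (\<lambda>x. h k x - f x) < 1 / real (Suc k)" by metis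
  have hlim: "(\<lambda>k. L2_norm gauss_measure (\<lambda>x. h k x - f x)) \<longlonglongrightarrow> 0"
    by (rule tendsto_sandwich[OF _ _ tendsto_const LIMSEQ_Suc[OF lim_1_over_n]])
       (use hf in \<open>auto intro!: always_eventually less_imp_le simp del: of_nat_Suc\<close>)
  have GL: "gauss_bargmann (h k) \<in> L2 fock_measure" for k
    by (rule gauss_bargmann_isometry_compactly_supported[OF h(1)])
  have Gd: "L2_norm fock_measure (\<lambda>z. gauss_bargmann (h k) z - gauss_bargmann (h l) z) = L2_norm gauss_measure (\<lambda>x. h k x - h l x)" for k l
    using gauss_bargmann_isometry_compactly_supported(2)[OF compactly_supported_diff[OF h(1) h(1)], of k l]
    by (simp add: gauss_bargmann_diff[OF h(2) h(2), abs_def])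
  have fE: "entire (gauss_bargmann f)" by (rule gauss_bargmann_entire[OF f])
  have pw: "(\<lambda>k. gauss_bargmann (h k) z) \<longlonglongrightarrow> gauss_bargmann f z" for z
  proof -
    have "(\<lambda>k. gauss_bargmann (h k) z - gauss_bargmann f z) \<longlonglongrightarrow> 0"
    proof (rule tendsto_norm_zero_cancel, rule tendsto_sandwich[OF _ _ tendsto_const])
      show "(\<lambda>k. L2_norm gauss_measure (\<lambda>x. h k x - f x) * L2_norm gauss_measure (\<lambda>x. bargmann_kernel x z)) \<longlonglongrightarrow> 0"
        by (rule tendsto_mult_left_zero[OF hlim])
      show "\<forall>\<^sub>F k in sequentially. norm (gauss_bargmann (h k) z - gauss_bargmann f z) \<le> L2_norm gauss_measure (\<lambda>x. h k x - f x) * L2_norm gauss_measure (\<lambda>x. bargmann_kernel x z)"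
        using gauss_bargmann_bound[OF L2_diff[OF h(2) f]] by (simp add: gauss_bargmann_diff[OF h(2) f])
    qed auto
    then show ?thesis by (simp add: LIM_zero_iff)
  qed
  have cau: "\<exists>N. \<forall>k\<ge>N. \<forall>l\<ge>N. L2_norm fock_measure (\<lambda>z. gauss_bargmann (h k) z - gauss_bargmann (h l) z) < e" if "e > 0" for e
    unfolding Gd by (rule L2_convergent_imp_Cauchy[OF h(2) f hlim that])
  have AE: "AE z in fock_measure. (\<lambda>k. gauss_bargmann (h (id k)) z) \<longlonglongrightarrow> gauss_bargmann f z"
    using pw by simp
  have fm: "gauss_bargmann f \<in> borel_measurable fock_measure" using entire_measurable[OF fE] by simp
  have fL: "gauss_bargmann f \<in> L2 fock_measure" "(\<lambda>k. L2_norm fock_measure (\<lambda>z. gauss_bargmann (h k) z - gauss_bargmann f z)) \<longlonglongrightarrow> 0"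
    using L2_Cauchy_AE_limit[OF GL fm cau strict_mono_id AE] by auto
  then show "gauss_bargmann f \<in> fock_space" using fE by (simp add: fock_space_eq)
  have "(\<lambda>k. L2_norm fock_measure (gauss_bargmann (h k))) \<longlonglongrightarrow> L2_norm fock_measure (gauss_bargmann f)"
    by (rule L2_norm_tendsto[OF GL fL])
  moreover have "(\<lambda>k. L2_norm fock_measure (gauss_bargmann (h k))) \<longlonglongrightarrow> L2_norm gauss_measure f"
    using L2_norm_tendsto[OF h(2) f hlim] by (simp add: gauss_bargmann_isometry_compactly_supported(2)[OF h(1)])
  ultimately show "L2_norm fock_measure (gauss_bargmann f) = L2_norm gauss_measure f"
    by (rule LIMSEQ_unique)
qed

lemma gauss_bargmann_L2: "f \<in> L2 gauss_measure \<Longrightarrow> gauss_bargmann f \<in> L2 fock_measure"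
  using gauss_bargmann_isometry(1) by (rule fock_space_L2)

lemma gauss_bargmann_inner:
  assumes f: "f \<in> L2 gauss_measure" and g: "g \<in> L2 gauss_measure"
  shows "(LINT z|fock_measure. gauss_bargmann f z * cnj (gauss_bargmann g z)) = (LINT x|gauss_measure. f x * cnj (g x))"
proof (rule L2_isometry_inner[OF f g gauss_bargmann_L2[OF f] gauss_bargmann_L2[OF g]])
  fix c
  show "L2_norm fock_measure (\<lambda>x. gauss_bargmann f x + c * gauss_bargmann g x) = L2_norm gauss_measure (\<lambda>x. f x + c * g x)"
    using gauss_bargmann_isometry(2)[OF L2_add[OF f L2_cmult[OF g, of c]]]
    by (simp add: gauss_bargmann_add[OF f g, abs_def])
qed

text \<open>On the imaginary subspace \<open>\<i> \<real>\<^sup>n\<close> the transform is, up to a Gaussian factor, the Fourier transform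
  of \<open>f\<close> times the density.\<close>

lemma gauss_bargmann_fourier:
  fixes f :: "real^'n::finite \<Rightarrow> complex"
  assumes f: "integrable gauss_measure f"
  shows "gauss_bargmann f (\<i> *s cvec y) = exp (of_real ((norm y)\<^sup>2 / 2)) * (LINT x|lborel. (gauss_density x *\<^sub>R f x) * exp (\<i> * cdot (cvec x) (cvec y)))"
proof -
  have [measurable]: "f \<in> borel_measurable borel" using f by (auto dest: borel_measurable_integrable)
  have "bargmann_kernel x (\<i> *s cvec y) = exp (of_real ((norm y)\<^sup>2 / 2)) * exp (\<i> * cdot (cvec x) (cvec y))" for x
  proof -
    have "cdot (cvec x) (\<i> *s cvec y) - cdot (\<i> *s cvec y) (\<i> *s cvec y) / 2 = of_real ((norm y)\<^sup>2 / 2) + \<i> * cdot (cvec x) (cvec y)"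
      by (simp add: cdot_smult_left cdot_smult_right norm_cvec_cdot mult.assoc[symmetric])
    then show ?thesis unfolding bargmann_kernel_def by (simp only: exp_add)
  qed
  then have "gauss_bargmann f (\<i> *s cvec y) = (LINT x|gauss_measure. exp (of_real ((norm y)\<^sup>2 / 2)) * (f x * exp (\<i> * cdot (cvec x) (cvec y))))"
    unfolding gauss_bargmann_eq by (simp only: mult_ac)
  also have "\<dots> = exp (of_real ((norm y)\<^sup>2 / 2)) * (LINT x|gauss_measure. f x * exp (\<i> * cdot (cvec x) (cvec y)))"
    by (rule integral_mult_right_zero)
  also have "(LINT x|gauss_measure. f x * exp (\<i> * cdot (cvec x) (cvec y))) = (LINT x|lborel. (gauss_density x *\<^sub>R f x) * exp (\<i> * cdot (cvec x) (cvec y)))"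
    by (subst integral_gauss) auto
  finally show ?thesis .
qed

text \<open>Integrability suffices, and only values on \<open>\<i> \<real>\<^sup>n\<close> enter. Both matter below: a product of two square
  integrable functions is merely integrable, and its transform is known a priori only on that
  subspace.\<close>

theorem gauss_bargmann_unique:
  fixes f g :: "real^'n::finite \<Rightarrow> complex"
  assumes f: "integrable gauss_measure f" and g: "integrable gauss_measure g"
    and eq: "\<And>y. gauss_bargmann f (\<i> *s cvec y) = gauss_bargmann g (\<i> *s cvec y)"
  shows "AE x in lborel. f x = g x"
proof -
  have [measurable]: "f \<in> borel_measurable borel" "g \<in> borel_measurable borel"
    using f g by (auto dest: borel_measurable_integrable)
  have fi: "integrable lborel (\<lambda>x. gauss_density x *\<^sub>R f x)" and gi: "integrable lborel (\<lambda>x. gauss_density x *\<^sub>R g x)"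
    using f g by (auto simp: integrable_gauss_iff)
  have ie: "integrable lborel (\<lambda>x. h x * exp (\<i> * cdot (cvec x) (cvec y)))" if h: "integrable lborel h" for h :: "real^'n \<Rightarrow> complex" and y
  proof (rule Bochner_Integration.integrable_bound[OF h])
    have [measurable]: "h \<in> borel_measurable borel" using h by (auto dest: borel_measurable_integrable)
    show "(\<lambda>x. h x * exp (\<i> * cdot (cvec x) (cvec y))) \<in> borel_measurable lborel" by measurable
    show "AE x in lborel. norm (h x * exp (\<i> * cdot (cvec x) (cvec y))) \<le> norm (h x)"
      by (simp add: norm_mult)
  qed
  have "AE x in lborel. gauss_density x *\<^sub>R f x - gauss_density x *\<^sub>R g x = 0"
  proof (rule fourier_uniqueness)
    show "integrable lborel (\<lambda>x. gauss_density x *\<^sub>R f x - gauss_density x *\<^sub>R g x)" using fi gi by simp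
    fix y
    have "(LINT x|lborel. (gauss_density x *\<^sub>R f x) * exp (\<i> * cdot (cvec x) (cvec y))) = (LINT x|lborel. (gauss_density x *\<^sub>R g x) * exp (\<i> * cdot (cvec x) (cvec y)))"
      using eq[of y] unfolding gauss_bargmann_fourier[OF f] gauss_bargmann_fourier[OF g] by simp
    then show "(LINT x|lborel. (gauss_density x *\<^sub>R f x - gauss_density x *\<^sub>R g x) * exp (\<i> * cdot (cvec x) (cvec y))) = 0"
      using ie[OF fi, of y] ie[OF gi, of y] by (simp add: left_diff_distrib)
  qed
  then show ?thesis
  proof eventually_elim
    fix x assume "gauss_density x *\<^sub>R f x - gauss_density x *\<^sub>R g x = 0"
    then have "gauss_density x *\<^sub>R (f x - g x) = 0" by (simp add: scaleR_diff_right)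
    then show "f x = g x" using gauss_density_pos[of x] by simp
  qed
qed

section \<open>Smooth functions of several real variables\<close>

definition axis_differentiable :: "(real^'n::finite \<Rightarrow> complex) \<Rightarrow> bool" where
  "axis_differentiable f \<longleftrightarrow> (\<forall>j x. (\<lambda>t. f (x + axis j t)) differentiable (at 0))"

text \<open>The regularity required of \<^const>\<open>test_functions\<close>, without the condition on the support.\<close>

definition smooth :: "(real^'n::finite \<Rightarrow> complex) \<Rightarrow> bool" where
  "smooth f \<longleftrightarrow> (\<forall>js. continuous_on UNIV (foldr rpartial js f) \<and> axis_differentiable (foldr rpartial js f))"

lemma test_functions_iff: "f \<in> test_functions \<longleftrightarrow> compact (closure {x. f x \<noteq> 0}) \<and> smooth f"
  by (simp add: test_functions_def smooth_def axis_differentiable_def)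

lemma smooth_continuous: "smooth f \<Longrightarrow> continuous_on UNIV f"
  unfolding smooth_def by (metis foldr.simps(1) id_apply)

lemma smooth_axis_differentiable: "smooth f \<Longrightarrow> axis_differentiable f"
  unfolding smooth_def by (metis foldr.simps(1) id_apply)

lemma smooth_rpartial: "smooth f \<Longrightarrow> smooth (rpartial j f)"
  unfolding smooth_def
proof
  fix js assume *: "\<forall>js. continuous_on UNIV (foldr rpartial js f) \<and> axis_differentiable (foldr rpartial js f)"
  have "foldr rpartial js (rpartial j f) = foldr rpartial (js @ [j]) f" by simp
  then show "continuous_on UNIV (foldr rpartial js (rpartial j f)) \<and> axis_differentiable (foldr rpartial js (rpartial j f))"
    using * by metis
qed

lemma smooth_foldr_rpartial: "smooth f \<Longrightarrow> smooth (foldr rpartial js f)"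
  by (induction js) (auto intro: smooth_rpartial)

text \<open>Smoothness is the largest property that implies continuity and differentiability along the axes
  and passes to partial derivatives.\<close>

lemma smooth_coinduct:
  assumes "A f" and "\<And>f. A f \<Longrightarrow> continuous_on UNIV f \<and> axis_differentiable f \<and> (\<forall>j. A (rpartial j f))"
  shows "smooth f"
proof -
  have "A (foldr rpartial js f)" for js
    by (induction js) (use assms in auto)
  then show ?thesis using assms(2) by (auto simp: smooth_def)
qed

lemma axis_add: "axis j (s + t) = axis j s + axis j (t::real)"
  by (simp add: vec_eq_iff axis_def)

lemma rpartial_derivative:
  assumes "axis_differentiable f"
  shows "((\<lambda>t. f (x + axis j t)) has_vector_derivative rpartial j f (x + axis j s)) (at s)"
proof -
  have "((\<lambda>t. f ((x + axis j s) + axis j t)) has_vector_derivative rpartial j f (x + axis j s)) (at 0)"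
    using assms unfolding axis_differentiable_def rpartial_def by (simp add: vector_derivative_works)
  then have "((\<lambda>t. f ((x + axis j s) + axis j t)) has_vector_derivative rpartial j f (x + axis j s)) (at (s - s))"
    by simp
  moreover have "((\<lambda>t. t - s) has_vector_derivative 1) (at s)"
    by (auto intro!: derivative_eq_intros)
  ultimately have "((\<lambda>t. f ((x + axis j s) + axis j t)) \<circ> (\<lambda>t. t - s) has_vector_derivative 1 *\<^sub>R rpartial j f (x + axis j s)) (at s)"
    by (rule vector_diff_chain_at[rotated])
  moreover have "(x + axis j s) + axis j (t - s) = x + axis j t" for t
    using axis_add[of j s "t - s"] by (simp add: add.assoc)
  ultimately show ?thesis by (simp add: comp_def)
qed

lemma rpartial_derivative_0:
  fixes f :: "real^'n::finite \<Rightarrow> complex"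
  assumes "axis_differentiable f"
  shows "((\<lambda>t. f (x + axis j t)) has_vector_derivative rpartial j f x) (at 0)"
proof -
  have a0: "axis j (0::real) = (0 :: real^'n)" by (simp add: vec_eq_iff axis_def)
  show ?thesis using rpartial_derivative[OF assms, of x j 0] unfolding a0 by simp
qed

lemma rpartial_eq:
  assumes "((\<lambda>t. f (x + axis j t)) has_vector_derivative d) (at 0)"
  shows "rpartial j f x = d"
  unfolding rpartial_def by (rule vector_derivative_at[OF assms])

lemma axis_differentiableI:
  assumes "\<And>j x. ((\<lambda>t. f (x + axis j t)) has_vector_derivative d j x) (at 0)"
  shows "axis_differentiable f"
  unfolding axis_differentiable_def using assms differentiableI_vector by blast

lemma rpartial_add:
  assumes "axis_differentiable f" "axis_differentiable g"
  shows "axis_differentiable (\<lambda>x. f x + g x)" "rpartial j (\<lambda>x. f x + g x) = (\<lambda>x. rpartial j f x + rpartial j g x)"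
proof -
  have d: "((\<lambda>t. f (x + axis j t) + g (x + axis j t)) has_vector_derivative (rpartial j f x + rpartial j g x)) (at 0)" for j x
    by (intro has_vector_derivative_add rpartial_derivative_0 assms)
  show "axis_differentiable (\<lambda>x. f x + g x)" using d by (rule axis_differentiableI)
  show "rpartial j (\<lambda>x. f x + g x) = (\<lambda>x. rpartial j f x + rpartial j g x)" by (rule ext) (rule rpartial_eq[OF d])
qed

lemma rpartial_diff:
  assumes "axis_differentiable f" "axis_differentiable g"
  shows "axis_differentiable (\<lambda>x. f x - g x)" "rpartial j (\<lambda>x. f x - g x) = (\<lambda>x. rpartial j f x - rpartial j g x)"
proof -
  have d: "((\<lambda>t. f (x + axis j t) - g (x + axis j t)) has_vector_derivative (rpartial j f x - rpartial j g x)) (at 0)" for j x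
    by (intro has_vector_derivative_diff rpartial_derivative_0 assms)
  show "axis_differentiable (\<lambda>x. f x - g x)" using d by (rule axis_differentiableI)
  show "rpartial j (\<lambda>x. f x - g x) = (\<lambda>x. rpartial j f x - rpartial j g x)" by (rule ext) (rule rpartial_eq[OF d])
qed

lemma rpartial_mult:
  assumes "axis_differentiable f" "axis_differentiable g"
  shows "axis_differentiable (\<lambda>x. f x * g x)" "rpartial j (\<lambda>x. f x * g x) = (\<lambda>x. rpartial j f x * g x + f x * rpartial j g x)"
proof -
  have a0: "axis j (0::real) = 0" for j :: 'a by (simp add: vec_eq_iff axis_def)
  have d: "((\<lambda>t. f (x + axis j t) * g (x + axis j t)) has_vector_derivative (rpartial j f x * g x + f x * rpartial j g x)) (at 0)" for j x
    using has_vector_derivative_mult[OF rpartial_derivative_0[OF assms(1)] rpartial_derivative_0[OF assms(2)], of x j x j]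
    by (simp add: a0 add.commute)
  show "axis_differentiable (\<lambda>x. f x * g x)" using d by (rule axis_differentiableI)
  show "rpartial j (\<lambda>x. f x * g x) = (\<lambda>x. rpartial j f x * g x + f x * rpartial j g x)" by (rule ext) (rule rpartial_eq[OF d])
qed

lemma foldr_rpartial_add:
  assumes "smooth f" "smooth g"
  shows "foldr rpartial js (\<lambda>x. f x + g x) = (\<lambda>x. foldr rpartial js f x + foldr rpartial js g x)"
  by (induction js) (use assms in \<open>auto simp: rpartial_add smooth_axis_differentiable smooth_foldr_rpartial\<close>)

lemma foldr_rpartial_diff:
  assumes "smooth f" "smooth g"
  shows "foldr rpartial js (\<lambda>x. f x - g x) = (\<lambda>x. foldr rpartial js f x - foldr rpartial js g x)"
  by (induction js) (use assms in \<open>auto simp: rpartial_diff smooth_axis_differentiable smooth_foldr_rpartial\<close>)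

text \<open>The smallest class that contains the products of smooth functions and is closed under partial
  derivatives; by Leibniz' rule sums have to be admitted.\<close>

inductive product_sum :: "(real^'n::finite \<Rightarrow> complex) \<Rightarrow> bool" where
  product: "smooth f \<Longrightarrow> smooth g \<Longrightarrow> product_sum (\<lambda>x. f x * g x)"
| sum: "product_sum f \<Longrightarrow> product_sum g \<Longrightarrow> product_sum (\<lambda>x. f x + g x)"

lemma smooth_mult:
  assumes "smooth f" "smooth g"
  shows "smooth (\<lambda>x. f x * g x)"
proof (rule smooth_coinduct[of product_sum])
  show "product_sum (\<lambda>x. f x * g x)" by (rule product_sum.product[OF assms])
  fix h :: "real^'a \<Rightarrow> complex" assume "product_sum h"
  then show "continuous_on UNIV h \<and> axis_differentiable h \<and> (\<forall>j. product_sum (rpartial j h))"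
  proof induction
    case (product f g)
    then show ?case
      by (auto simp: rpartial_mult smooth_axis_differentiable smooth_continuous
          intro!: continuous_on_mult product_sum.intros smooth_rpartial)
  next
    case (sum f g)
    then show ?case
      by (auto simp: rpartial_add intro!: continuous_on_add product_sum.sum)
  qed
qed

section \<open>Cutoff functions\<close>

text \<open>Every derivative of \<open>exp (- 1 / x)\<close>, continued by 0, is of this form for some polynomial.\<close>

definition flat :: "real poly \<Rightarrow> real \<Rightarrow> real" where
  "flat p x = (if x > 0 then poly p (1 / x) * exp (- 1 / x) else 0)"

lemma poly_exp_tendsto_0: "((\<lambda>y. poly p y * exp (- y)) \<longlongrightarrow> (0::real)) at_top"
proof (induction p)
  case 0
  then show ?case by simp
next
  case (pCons a p)
  have 1: "((\<lambda>y::real. a * exp (- y)) \<longlongrightarrow> 0) at_top" by real_asymp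
  have "((\<lambda>y. y * poly p y * exp (- y)) \<longlongrightarrow> 0) at_top"
  proof -
    have "((\<lambda>y::real. \<Sum>i\<le>degree p. coeff p i * (y ^ Suc i / exp y)) \<longlongrightarrow> (\<Sum>i\<le>degree p. coeff p i * 0)) at_top"
      by (intro tendsto_intros tendsto_power_div_exp_0)
    moreover have "(\<Sum>i\<le>degree p. coeff p i * (y ^ Suc i / exp y)) = y * poly p y * exp (- y)" for y :: real
      by (simp add: poly_altdef sum_distrib_left sum_distrib_right exp_minus field_simps)
    ultimately show ?thesis by simp
  qed
  from tendsto_add[OF 1 this] show ?case by (simp add: algebra_simps)
qed

lemma flat_derivative:
  "(flat p has_real_derivative flat ([:0, 0, 1:] * (p - pderiv p)) x) (at x)"
proof (cases x "0::real" rule: linorder_cases)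
  case less
  have "((\<lambda>x. 0) has_real_derivative 0) (at x)" by simp
  then have "(flat p has_real_derivative 0) (at x)"
    by (rule has_field_derivative_transform_within_open[of _ _ _ "{..<0}"]) (use less in \<open>auto simp: flat_def\<close>)
  with less show ?thesis by (simp add: flat_def)
next
  case equal
  have lim: "((\<lambda>h. flat p h / h) \<longlongrightarrow> 0) (at 0)"
    unfolding filterlim_at_split
  proof
    show "((\<lambda>h. flat p h / h) \<longlongrightarrow> 0) (at_left 0)"
      by (rule tendsto_eventually) (auto simp: flat_def eventually_at_filter intro!: always_eventually)
    have "((\<lambda>h. poly (pCons 0 p) (1 / h) * exp (- (1 / h))) \<longlongrightarrow> 0) (at_right 0)"
      by (rule filterlim_compose[OF poly_exp_tendsto_0]) real_asymp
    moreover have "\<forall>\<^sub>F h in at_right (0::real). poly (pCons 0 p) (1 / h) * exp (- (1 / h)) = flat p h / h"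
      by (auto simp: flat_def eventually_at_filter intro!: always_eventually)
    ultimately show "((\<lambda>h. flat p h / h) \<longlongrightarrow> 0) (at_right 0)" by (rule Lim_transform_eventually)
  qed
  then have "((\<lambda>h. (flat p (0 + h) - flat p 0) / h) \<longlongrightarrow> 0) (at 0)" by (simp add: flat_def)
  then have "(flat p has_real_derivative 0) (at 0)" by (simp add: DERIV_def)
  with equal show ?thesis by (simp add: flat_def)
next
  case greater
  have "((\<lambda>x. poly p (1 / x) * exp (- 1 / x)) has_real_derivative flat ([:0, 0, 1:] * (p - pderiv p)) x) (at x)"
    using greater
    by (auto intro!: derivative_eq_intros DERIV_chain2[OF poly_DERIV] simp: flat_def power2_eq_square field_simps)
  then show ?thesis
    by (rule has_field_derivative_transform_within_open[of _ _ _ "{0<..}"]) (use greater in \<open>auto simp: flat_def\<close>)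
qed

text \<open>A class of functions supported in \<open>[-1, 1]\<close> that is closed under differentiation.\<close>

inductive bump_like :: "(real \<Rightarrow> real) \<Rightarrow> bool" where
  base: "bump_like (\<lambda>t. flat p (1 - t) * flat q (1 + t))"
| add: "bump_like f \<Longrightarrow> bump_like g \<Longrightarrow> bump_like (\<lambda>t. f t + g t)"
| neg: "bump_like f \<Longrightarrow> bump_like (\<lambda>t. - f t)"

lemma bump_like_derivative: "bump_like f \<Longrightarrow> \<exists>g. bump_like g \<and> (\<forall>t. (f has_real_derivative g t) (at t))"
proof (induction rule: bump_like.induct)
  case (base p q)
  let ?D = "\<lambda>p. [:0, 0, 1:] * (p - pderiv p)"
  have 1: "((\<lambda>t. flat p (1 - t)) has_real_derivative - flat (?D p) (1 - t)) (at t)" for t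
  proof -
    have "((\<lambda>t. 1 - t) has_real_derivative -1) (at t)" by (auto intro!: derivative_eq_intros)
    from DERIV_chain2[OF flat_derivative this] show ?thesis by simp
  qed
  have 2: "((\<lambda>t. flat q (1 + t)) has_real_derivative flat (?D q) (1 + t)) (at t)" for t
  proof -
    have "((\<lambda>t. 1 + t) has_real_derivative 1) (at t)" by (auto intro!: derivative_eq_intros)
    from DERIV_chain2[OF flat_derivative this] show ?thesis by simp
  qed
  have d: "((\<lambda>t. flat p (1 - t) * flat q (1 + t)) has_real_derivative
      - (flat (?D p) (1 - t) * flat q (1 + t)) + flat p (1 - t) * flat (?D q) (1 + t)) (at t)" for t
    using DERIV_mult[OF 1 2, of t] by (simp add: algebra_simps)
  moreover have "bump_like (\<lambda>t. - (flat (?D p) (1 - t) * flat q (1 + t)) + flat p (1 - t) * flat (?D q) (1 + t))"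
    by (intro bump_like.add bump_like.neg bump_like.base)
  ultimately show ?case by blast
next
  case (add f g)
  then obtain f' g' where "bump_like f'" "\<forall>t. (f has_real_derivative f' t) (at t)" "bump_like g'" "\<forall>t. (g has_real_derivative g' t) (at t)"
    by blast
  then show ?case by (intro exI[of _ "\<lambda>t. f' t + g' t"]) (auto intro!: bump_like.intros derivative_intros)
next
  case (neg f)
  then obtain f' where "bump_like f'" "\<forall>t. (f has_real_derivative f' t) (at t)" by blast
  then show ?case by (intro exI[of _ "\<lambda>t. - f' t"]) (auto intro!: bump_like.intros derivative_intros)
qed

lemma bump_like_support: "bump_like f \<Longrightarrow> \<bar>t\<bar> > 1 \<Longrightarrow> f t = 0"
  by (induction rule: bump_like.induct) (auto simp: flat_def)

text \<open>A function together with the sequence of all its derivatives. The factor \<open>exp 2\<close> in the proof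
  normalises the value at the origin.\<close>

theorem bump_family:
  obtains \<psi> :: "nat \<Rightarrow> real \<Rightarrow> real"
  where "\<And>d t. (\<psi> d has_real_derivative \<psi> (Suc d) t) (at t)" "\<And>d t. \<bar>t\<bar> > 1 \<Longrightarrow> \<psi> d t = 0" "\<psi> 0 0 = 1"
proof -
  define f0 where "f0 t = flat [:exp 2:] (1 - t) * flat 1 (1 + t)" for t
  have f0: "bump_like f0" unfolding f0_def by (rule bump_like.base)
  have "\<exists>\<psi>. \<forall>d. (bump_like (\<psi> d) \<and> (d = 0 \<longrightarrow> \<psi> d = f0)) \<and> (\<forall>t. (\<psi> d has_real_derivative \<psi> (Suc d) t) (at t))"
    by (rule dependent_nat_choice) (use f0 bump_like_derivative in auto)
  then obtain \<psi> where \<psi>: "\<And>d. bump_like (\<psi> d)" "\<psi> 0 = f0" "\<And>d t. (\<psi> d has_real_derivative \<psi> (Suc d) t) (at t)"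
    by blast
  have "f0 0 = exp 2 * (exp (- 1) * exp (- 1))" by (simp add: f0_def flat_def)
  also have "\<dots> = 1" by (simp add: exp_add[symmetric])
  finally show ?thesis using that[of \<psi>] \<psi> bump_like_support by auto
qed

section \<open>Derivatives of the transform\<close>

lemma has_vector_derivative_quotient:
  assumes "(f has_vector_derivative d) (at (0::real))"
  shows "((\<lambda>h. (f h - f 0) /\<^sub>R h) \<longlongrightarrow> d) (at 0)"
proof -
  have "(\<lambda>h. norm (f (0 + h) - f 0 - h *\<^sub>R d) / norm h) \<midarrow>0\<rightarrow> 0"
    using assms by (simp add: has_vector_derivative_def has_derivative_at)
  moreover have "\<forall>\<^sub>F h in at 0. norm (f (0 + h) - f 0 - h *\<^sub>R d) / norm h = norm ((f h - f 0) /\<^sub>R h - d)"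
  proof -
    have "norm (f (0 + h) - f 0 - h *\<^sub>R d) / norm h = norm ((f h - f 0) /\<^sub>R h - d)" if "h \<noteq> 0" for h
    proof -
      have "(f h - f 0) /\<^sub>R h - d = (f (0 + h) - f 0 - h *\<^sub>R d) /\<^sub>R h"
        using that by (simp add: scaleR_diff_right)
      then show ?thesis by (simp add: divide_inverse mult.commute)
    qed
    then show ?thesis by (auto simp: eventually_at_filter)
  qed
  ultimately have "(\<lambda>h. norm ((f h - f 0) /\<^sub>R h - d)) \<midarrow>0\<rightarrow> 0" by (rule Lim_transform_eventually)
  then have "(\<lambda>h. (f h - f 0) /\<^sub>R h - d) \<midarrow>0\<rightarrow> 0" by (rule tendsto_norm_zero_cancel)
  then show ?thesis by (rule LIM_zero_cancel)
qed

lemma vector_derivative_norm_bound: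
  fixes f :: "real \<Rightarrow> complex"
  assumes d: "\<And>s. (f has_vector_derivative f' s) (at s)" and B: "\<And>s. norm (f' s) \<le> B"
  shows "norm (f t - f 0) \<le> B * \<bar>t\<bar>"
proof -
  have B0: "0 \<le> B" using B[of 0] norm_ge_zero[of "f' 0"] by linarith
  have "norm (f t - f 0) \<le> B * norm (t - 0)"
  proof (rule differentiable_bound[where S=UNIV and f'="\<lambda>s h. h *\<^sub>R f' s"])
    show "(f has_derivative (\<lambda>h. h *\<^sub>R f' s)) (at s within UNIV)" for s
      using d[of s] by (simp add: has_vector_derivative_def)
    show "onorm (\<lambda>h. h *\<^sub>R f' s) \<le> B" for s
    proof (rule onorm_bound[OF B0])
      fix h :: real
      show "norm (h *\<^sub>R f' s) \<le> B * norm h"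
        using mult_right_mono[OF B[of s], of "\<bar>h\<bar>"] by (simp add: mult.commute)
    qed
  qed auto
  then show ?thesis by simp
qed

text \<open>Density and kernel together depend on \<open>x - z\<close> only: they form the Gaussian
  \<open>exp (- (x - z) \<cdot> (x - z) / 2)\<close>. A real shift of \<open>z\<close> can therefore be moved to \<open>T\<close>, and difference
  quotients of the transform are transforms of difference quotients of \<open>T\<close>, dominated by the bound on
  the derivative.\<close>

theorem cpartial_gauss_bargmann:
  fixes T :: "real^'n::finite \<Rightarrow> complex"
  assumes T: "axis_differentiable T" and TL: "T \<in> L2 gauss_measure"
    and c: "continuous_on UNIV (rpartial j T)" and B: "\<And>x. norm (rpartial j T x) \<le> B"
  shows "cpartial j (gauss_bargmann T) z = gauss_bargmann (rpartial j T) z"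
proof -
  have Tm [measurable]: "T \<in> borel_measurable borel" using TL by (simp add: L2_def)
  have dTm [measurable]: "rpartial j T \<in> borel_measurable borel" by (rule continuous_imp_borel[OF c])
  define \<kappa> where "\<kappa> x w = gauss_density x *\<^sub>R bargmann_kernel x w" for x :: "real^'n" and w
  have \<kappa>m [measurable]: "(\<lambda>x. \<kappa> x w) \<in> borel_measurable borel" for w unfolding \<kappa>_def by measurable
  have one: "(\<lambda>x. 1) \<in> L2 gauss_measure" by (simp add: L2_def)
  have \<kappa>i: "integrable lborel (\<lambda>x. \<kappa> x w)" for w
    using gauss_bargmann_integrable[OF one, of w] unfolding \<kappa>_def by (subst (asm) integrable_gauss_iff) auto
  have G\<kappa>: "gauss_bargmann f w = (LINT x|lborel. f x * \<kappa> x w)" if [measurable]: "f \<in> borel_measurable borel" for f w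
    unfolding gauss_bargmann_eq \<kappa>_def by (subst integral_gauss) auto
  have T\<kappa>i: "integrable lborel (\<lambda>x. T x * \<kappa> x w)" for w
    using gauss_bargmann_integrable[OF TL, of w] unfolding \<kappa>_def by (subst (asm) integrable_gauss_iff) auto
  have cax: "cvec (axis j t) = axis j (of_real t)" for t
    by (simp add: vec_eq_iff axis_def)
  have shift: "\<kappa> (axis j t + x) (z + axis j (of_real t)) = \<kappa> x z" for x t
  proof -
    have full: "\<kappa> x w = (1 / of_real (sqrt (2 * pi) ^ CARD('n))) * exp (- cdot (cvec x - w) (cvec x - w) / 2)" for x w
    proof -
      have "- of_real ((norm x)\<^sup>2) / 2 + (cdot (cvec x) w - cdot w w / 2) = - cdot (cvec x - w) (cvec x - w) / 2"
        unfolding norm_cvec_cdot[symmetric] by (simp add: cdot_diff_left cdot_diff_right cdot_commute[of w "cvec x"] field_simps)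
      then have "exp (- of_real ((norm x)\<^sup>2) / 2) * exp (cdot (cvec x) w - cdot w w / 2) = exp (- cdot (cvec x - w) (cvec x - w) / 2)"
        by (simp only: exp_add[symmetric])
      moreover have "exp (- of_real ((norm x)\<^sup>2) / 2) = complex_of_real (exp (- (norm x)\<^sup>2 / 2))"
        by (simp add: exp_of_real[symmetric])
      ultimately show ?thesis by (simp add: \<kappa>_def gauss_density_def bargmann_kernel_def scaleR_conv_of_real)
    qed
    have s: "cvec (axis j t + x) - (z + axis j (of_real t)) = cvec x - z" by (simp add: cvec_add cax)
    show ?thesis unfolding full s ..
  qed
  have shift2: "\<kappa> (x + axis j t) (z + axis j (of_real t)) = \<kappa> x z" for x t
    using shift[of t x] by (simp only: add.commute)
  have Gshift: "gauss_bargmann T (z + axis j (of_real t)) = (LINT x|lborel. T (x + axis j t) * \<kappa> x z)"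
    and Ishift: "integrable lborel (\<lambda>x. T (x + axis j t) * \<kappa> x z)" for t
  proof -
    have m: "(+) (axis j t) \<in> measurable lborel (borel :: (real^'n) measure)" by simp
    have "gauss_bargmann T (z + axis j (of_real t)) = (LINT x|lborel. T x * \<kappa> x (z + axis j (of_real t)))" by (rule G\<kappa>[OF Tm])
    also have "\<dots> = (LINT x|lborel. T (axis j t + x) * \<kappa> (axis j t + x) (z + axis j (of_real t)))"
      using integral_distr[OF m, of "\<lambda>x. T x * \<kappa> x (z + axis j (of_real t))"] by (simp add: lborel_distr_plus)
    finally show "gauss_bargmann T (z + axis j (of_real t)) = (LINT x|lborel. T (x + axis j t) * \<kappa> x z)"
      by (simp only: add.commute[of "axis j t"] shift2)
    have "integrable lborel (\<lambda>x. T (axis j t + x) * \<kappa> (axis j t + x) (z + axis j (of_real t)))"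
      by (rule integrable_distr[OF m]) (simp only: lborel_distr_plus T\<kappa>i)
    then show "integrable lborel (\<lambda>x. T (x + axis j t) * \<kappa> x z)" by (simp only: add.commute[of "axis j t"] shift2)
  qed
  define t where "t k = 1 / real (Suc k)" for k
  have t0: "t k \<noteq> 0" for k by (simp add: t_def)
  have tlim: "filterlim t (at 0) sequentially"
  proof -
    have "t \<longlonglongrightarrow> 0" unfolding t_def[abs_def] by (rule LIMSEQ_Suc[OF lim_1_over_n])
    then show ?thesis unfolding filterlim_at by (simp add: t0)
  qed
  have tlimc: "filterlim (\<lambda>k. complex_of_real (t k)) (at 0) sequentially"
  proof -
    have "(\<lambda>k. complex_of_real (t k)) \<longlonglongrightarrow> of_real 0"
      by (rule tendsto_of_real) (use tlim in \<open>simp add: filterlim_at\<close>)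
    then show ?thesis unfolding filterlim_at by (simp add: t0)
  qed
  obtain D where D: "complex_derivative_at (gauss_bargmann T) D z"
    using gauss_bargmann_entire[OF TL] by (auto simp: entire_iff)
  have "((\<lambda>h. gauss_bargmann T (z + h *s axis j 1)) has_field_derivative D (axis j 1)) (at 0)"
    by (rule complex_derivative_at_line) (simp add: D)
  then have q: "((\<lambda>h. (gauss_bargmann T (z + (0 + h) *s axis j 1) - gauss_bargmann T (z + 0 *s axis j 1)) / h) \<longlongrightarrow> D (axis j 1)) (at 0)"
    by (simp only: DERIV_def)
  have "((\<lambda>h. (gauss_bargmann T (z + axis j h) - gauss_bargmann T z) / h) \<longlongrightarrow> cpartial j (gauss_bargmann T) z) (at 0)"
  proof -
    have a0: "axis j (0::complex) = (0 :: complex^'n)" by (simp add: vec_eq_iff axis_def)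
    show ?thesis using q unfolding cpartial_eq[OF D] by (simp add: axis_csmult[symmetric] a0)
  qed
  from filterlim_compose[OF this tlimc]
  have lim1: "(\<lambda>k. (gauss_bargmann T (z + axis j (of_real (t k))) - gauss_bargmann T z) / of_real (t k)) \<longlonglongrightarrow> cpartial j (gauss_bargmann T) z" .
  have z0: "gauss_bargmann T z = (LINT x|lborel. T x * \<kappa> x z)" by (rule G\<kappa>[OF Tm])
  have quot: "(gauss_bargmann T (z + axis j (of_real (t k))) - gauss_bargmann T z) / of_real (t k)
    = (LINT x|lborel. ((T (x + axis j (t k)) - T x) /\<^sub>R t k) * \<kappa> x z)" for k
  proof -
    have "(LINT x|lborel. ((T (x + axis j (t k)) - T x) /\<^sub>R t k) * \<kappa> x z) = (LINT x|lborel. (T (x + axis j (t k)) * \<kappa> x z - T x * \<kappa> x z) /\<^sub>R t k)"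
      by (simp add: left_diff_distrib)
    also have "\<dots> = ((LINT x|lborel. T (x + axis j (t k)) * \<kappa> x z) - (LINT x|lborel. T x * \<kappa> x z)) /\<^sub>R t k"
      using Ishift[of "t k"] T\<kappa>i[of z] by simp
    finally show ?thesis unfolding Gshift z0 by (simp add: scaleR_conv_of_real divide_inverse mult.commute)
  qed
  have "(\<lambda>k. LINT x|lborel. ((T (x + axis j (t k)) - T x) /\<^sub>R t k) * \<kappa> x z) \<longlonglongrightarrow> (LINT x|lborel. rpartial j T x * \<kappa> x z)"
  proof (rule integral_dominated_convergence[where w="\<lambda>x. B * norm (\<kappa> x z)"])
    show "AE x in lborel. (\<lambda>k. ((T (x + axis j (t k)) - T x) /\<^sub>R t k) * \<kappa> x z) \<longlonglongrightarrow> rpartial j T x * \<kappa> x z"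
    proof (rule AE_I2)
      fix x :: "real^'n"
      have a0: "axis j (0::real) = (0 :: real^'n)" by (simp add: vec_eq_iff axis_def)
      have "((\<lambda>h. (T (x + axis j h) - T (x + axis j 0)) /\<^sub>R h) \<longlongrightarrow> rpartial j T x) (at 0)"
        by (rule has_vector_derivative_quotient[OF rpartial_derivative_0[OF T]])
      from filterlim_compose[OF this tlim] have "(\<lambda>k. (T (x + axis j (t k)) - T x) /\<^sub>R t k) \<longlonglongrightarrow> rpartial j T x"
        unfolding a0 by simp
      then show "(\<lambda>k. ((T (x + axis j (t k)) - T x) /\<^sub>R t k) * \<kappa> x z) \<longlonglongrightarrow> rpartial j T x * \<kappa> x z"
        by (intro tendsto_intros)
    qed
    show "AE x in lborel. norm (((T (x + axis j (t k)) - T x) /\<^sub>R t k) * \<kappa> x z) \<le> B * norm (\<kappa> x z)" for k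
    proof (rule AE_I2)
      fix x :: "real^'n"
      have a0: "axis j (0::real) = (0 :: real^'n)" by (simp add: vec_eq_iff axis_def)
      have "norm (T (x + axis j (t k)) - T (x + axis j 0)) \<le> B * \<bar>t k\<bar>"
        by (rule vector_derivative_norm_bound[OF rpartial_derivative[OF T] B])
      then have le: "norm (T (x + axis j (t k)) - T x) \<le> B * \<bar>t k\<bar>" unfolding a0 by simp
      have "norm ((T (x + axis j (t k)) - T x) /\<^sub>R t k) = norm (T (x + axis j (t k)) - T x) / \<bar>t k\<bar>"
        by (simp add: divide_inverse mult.commute)
      also have "\<dots> \<le> B" using le t0[of k] by (simp add: divide_le_eq)
      finally have "norm ((T (x + axis j (t k)) - T x) /\<^sub>R t k) \<le> B" .
      then show "norm (((T (x + axis j (t k)) - T x) /\<^sub>R t k) * \<kappa> x z) \<le> B * norm (\<kappa> x z)"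
        unfolding norm_mult by (rule mult_right_mono) simp
    qed
    show "integrable lborel (\<lambda>x. B * norm (\<kappa> x z))" using \<kappa>i by simp
  qed measurable
  then have "(\<lambda>k. (gauss_bargmann T (z + axis j (of_real (t k))) - gauss_bargmann T z) / of_real (t k)) \<longlonglongrightarrow> gauss_bargmann (rpartial j T) z"
    unfolding quot G\<kappa>[OF dTm] .
  from LIMSEQ_unique[OF lim1 this] show ?thesis .
qed

section \<open>Test functions\<close>

lemma rpartial_vanishes:
  fixes f :: "real^'n::finite \<Rightarrow> complex"
  assumes "\<And>x. norm x > R \<Longrightarrow> f x = 0" and x: "norm x > R"
  shows "rpartial j f x = 0"
proof (rule rpartial_eq)
  define S where "S = {t. norm (x + axis j t) > R}"
  have ca: "continuous_on UNIV (\<lambda>t::real. x + axis j t)"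
  proof -
    have sc: "axis j t = t *\<^sub>R axis j 1" for t :: real by (simp add: vec_eq_iff axis_def)
    have "continuous_on UNIV (\<lambda>t::real. x + t *\<^sub>R axis j 1)" by (intro continuous_intros)
    then show ?thesis by (simp only: sc[symmetric])
  qed
  have "open S" unfolding S_def
    by (intro open_Collect_less continuous_intros ca)
  moreover have "0 \<in> S"
  proof -
    have a0: "axis j (0::real) = (0 :: real^'n)" by (simp add: vec_eq_iff axis_def)
    show ?thesis unfolding S_def mem_Collect_eq a0 using x by simp
  qed
  ultimately show "((\<lambda>t. f (x + axis j t)) has_vector_derivative 0) (at 0)"
    by (intro has_vector_derivative_transform_within_open[OF has_vector_derivative_const]) (use assms(1) in \<open>auto simp: S_def\<close>)
qed

lemma foldr_rpartial_vanishes: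
  assumes "\<And>x. norm x > R \<Longrightarrow> f x = 0"
  shows "norm x > R \<Longrightarrow> foldr rpartial js f x = 0"
proof (induction js arbitrary: x)
  case Nil
  then show ?case using assms by simp
next
  case (Cons j js)
  show ?case using rpartial_vanishes[of R "foldr rpartial js f" x j] Cons by simp
qed

lemma test_functionI:
  assumes "smooth f" "\<And>x. norm x > R \<Longrightarrow> f x = 0"
  shows "f \<in> test_functions"
proof -
  have "{x. f x \<noteq> 0} \<subseteq> cball 0 R" using assms(2) by (auto simp: not_less[symmetric])
  then have "bounded {x. f x \<noteq> 0}" by (rule bounded_subset[OF bounded_cball])
  then have "compact (closure {x. f x \<noteq> 0})" by (simp add: compact_closure)
  with assms(1) show ?thesis by (simp add: test_functions_iff)
qed

lemma test_function_support:
  assumes "f \<in> test_functions"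
  shows "\<exists>R. \<forall>x. norm x > R \<longrightarrow> f x = 0"
proof -
  have "bounded (closure {x. f x \<noteq> 0})" using assms by (intro compact_imp_bounded) (simp add: test_functions_iff)
  then obtain R where R: "\<forall>x\<in>closure {x. f x \<noteq> 0}. norm x \<le> R" unfolding bounded_iff by (elim exE)
  have "f x = 0" if "norm x > R" for x
  proof (rule ccontr)
    assume "f x \<noteq> 0"
    then have "x \<in> closure {x. f x \<noteq> 0}" by (intro subsetD[OF closure_subset]) simp
    then have "norm x \<le> R" by (rule bspec[OF R])
    with that show False by simp
  qed
  then show ?thesis by (intro exI allI impI)
qed

lemma test_function_smooth: "f \<in> test_functions \<Longrightarrow> smooth f"
  by (simp add: test_functions_iff)

lemma test_function_derivative_compactly_supported:
  assumes f: "f \<in> test_functions"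
  shows "compactly_supported (foldr rpartial js f)"
proof -
  obtain R where "\<forall>x. norm x > R \<longrightarrow> f x = 0" using test_function_support[OF f] by (elim exE)
  then have R: "norm x > R \<Longrightarrow> f x = 0" for x by simp
  show ?thesis
    unfolding compactly_supported_def
  proof (intro conjI exI allI impI)
    show "continuous_on UNIV (foldr rpartial js f)"
      by (rule smooth_continuous[OF smooth_foldr_rpartial[OF test_function_smooth[OF f]]])
    show "foldr rpartial js f x = 0" if "norm x > R" for x
      by (rule foldr_rpartial_vanishes[OF R that])
  qed
qed

text \<open>Contains the test functions and the preimages of dilated Fock functions; the rule for derivatives
  of the transform holds on this class.\<close>

definition smooth_L2 :: "(real^'n::finite \<Rightarrow> complex) \<Rightarrow> bool" where
  "smooth_L2 h \<longleftrightarrow> smooth h \<and> (\<forall>js. foldr rpartial js h \<in> L2 gauss_measure)"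

lemma smooth_L2_test_function: "f \<in> test_functions \<Longrightarrow> smooth_L2 f"
  by (simp add: smooth_L2_def test_function_smooth compactly_supported_L2 test_function_derivative_compactly_supported)

lemma smooth_L2_rpartial: "smooth_L2 h \<Longrightarrow> smooth_L2 (rpartial j h)"
  unfolding smooth_L2_def
proof (intro conjI allI, goal_cases)
  case (2 js)
  have "foldr rpartial js (rpartial j h) = foldr rpartial (js @ [j]) h" by simp
  with 2 show ?case by metis
qed (simp add: smooth_rpartial)

lemma smooth_L2_L2: "smooth_L2 h \<Longrightarrow> foldr rpartial js h \<in> L2 gauss_measure"
  by (simp add: smooth_L2_def)

lemma smooth_L2_L2': "smooth_L2 h \<Longrightarrow> h \<in> L2 gauss_measure"
  using smooth_L2_L2[of h "[]"] by simp

lemma foldr_cpartial_gauss_bargmann_test: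
  assumes f: "f \<in> test_functions"
  shows "foldr cpartial js (gauss_bargmann f) = gauss_bargmann (foldr rpartial js f)"
proof (induction js)
  case (Cons j js)
  have c: "compactly_supported (foldr rpartial js f)" "compactly_supported (rpartial j (foldr rpartial js f))"
    using test_function_derivative_compactly_supported[OF f, of js] test_function_derivative_compactly_supported[OF f, of "j # js"] by auto
  obtain B where B: "\<And>x. norm (rpartial j (foldr rpartial js f) x) \<le> B" using compactly_supported_bounded[OF c(2)] by blast
  have "cpartial j (gauss_bargmann (foldr rpartial js f)) = gauss_bargmann (rpartial j (foldr rpartial js f))"
  proof
    fix z
    have sm: "smooth (foldr rpartial js f)" by (intro smooth_foldr_rpartial test_function_smooth f)
    show "cpartial j (gauss_bargmann (foldr rpartial js f)) z = gauss_bargmann (rpartial j (foldr rpartial js f)) z"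
      by (rule cpartial_gauss_bargmann[OF smooth_axis_differentiable[OF sm] compactly_supported_L2[OF c(1)] _ B])
         (use c(2) in \<open>simp add: compactly_supported_def\<close>)
  qed
  with Cons show ?case by simp
qed simp

section \<open>Cutting off smooth functions\<close>

text \<open>\<open>\<theta> k a\<close> is the derivative of order \<open>a\<close> of a product of rescaled bump functions. Rescaling by \<open>k + 1\<close>
  keeps every derivative bounded uniformly in \<open>k\<close> and lets all of them except the function itself tend
  to 0.\<close>

lemma cutoff_family:
  obtains \<theta> :: "nat \<Rightarrow> ('n::finite \<Rightarrow> nat) \<Rightarrow> real^'n \<Rightarrow> complex"
  where "\<And>k a. smooth (\<theta> k a)"
    and "\<And>k a i. rpartial i (\<theta> k a) = \<theta> k (a(i := Suc (a i)))"
    and "\<And>k a. \<exists>R. \<forall>x. norm x > R \<longrightarrow> \<theta> k a x = 0"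
    and "\<And>a. \<exists>B. \<forall>k x. norm (\<theta> k a x) \<le> B"
    and "\<And>a x. (\<lambda>k. \<theta> k a x) \<longlonglongrightarrow> (\<Prod>j\<in>UNIV. if a j = 0 then 1 else 0)"
proof -
  obtain \<psi> :: "nat \<Rightarrow> real \<Rightarrow> real" where \<psi>: "\<And>d t. (\<psi> d has_real_derivative \<psi> (Suc d) t) (at t)"
    and supp: "\<And>d t. \<bar>t\<bar> > 1 \<Longrightarrow> \<psi> d t = 0" and \<psi>0: "\<psi> 0 0 = 1"
    by (rule bump_family) (rule that; assumption)
  have \<psi>c: "continuous_on UNIV (\<psi> d)" for d
    using \<psi>[of d] by (intro continuous_at_imp_continuous_on) (auto intro: DERIV_isCont)
  have "\<exists>M. \<forall>t. \<bar>\<psi> d t\<bar> \<le> M" for d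
  proof -
    have "compact (\<psi> d ` {-1..1})" by (rule compact_continuous_image[OF continuous_on_subset[OF \<psi>c]]) auto
    then have "bounded (\<psi> d ` {-1..1})" by (rule compact_imp_bounded)
    then obtain M where M: "\<forall>y\<in>\<psi> d ` {-1..1}. norm y \<le> M" unfolding bounded_iff by (elim exE)
    have "\<bar>\<psi> d t\<bar> \<le> max M 0" for t
    proof (cases "\<bar>t\<bar> > 1")
      case False
      then have "t \<in> {-1..1}" by auto
      with M have "norm (\<psi> d t) \<le> M" by blast
      then show ?thesis by simp
    qed (simp add: supp)
    then show ?thesis by blast
  qed
  then obtain M where M: "\<And>d t. \<bar>\<psi> d t\<bar> \<le> M d" by metis
  define K where "K k = real (Suc k)" for k
  have K1: "K k \<ge> 1" for k by (simp add: K_def)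
  define f where "f k d t = \<psi> d (t / K k) / K k ^ d" for k d t
  have fd: "((\<lambda>t. f k d (c + t)) has_real_derivative f k (Suc d) c) (at 0)" for k d c
  proof -
    have "((\<lambda>t. \<psi> d ((c + t) / K k)) has_real_derivative \<psi> (Suc d) ((c + 0) / K k) * (1 / K k)) (at 0)"
      by (rule DERIV_chain2[OF \<psi>]) (use K1[of k] in \<open>auto intro!: derivative_eq_intros\<close>)
    then have "((\<lambda>t. \<psi> d ((c + t) / K k) / K k ^ d) has_real_derivative (\<psi> (Suc d) ((c + 0) / K k) * (1 / K k)) / K k ^ d) (at 0)"
      by (rule DERIV_cdivide)
    then show ?thesis by (simp add: f_def)
  qed
  have fc: "continuous_on UNIV (f k d)" for k d
    unfolding f_def using K1[of k] by (intro continuous_intros continuous_on_compose2[OF \<psi>c]) auto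
  have fb: "\<bar>f k d t\<bar> \<le> M d / K k ^ d" for k d t
    unfolding f_def abs_divide using K1[of k] M[of d "t / K k"] by (simp add: divide_right_mono)
  have fb1: "\<bar>f k d t\<bar> \<le> M d" for k d t
  proof -
    have "0 \<le> M d" using M[of d 0] by linarith
    have "M d / K k ^ d \<le> M d / 1" using K1[of k] \<open>0 \<le> M d\<close> by (intro divide_left_mono) auto
    then show ?thesis using fb[of k d t] by simp
  qed
  have Klim: "(\<lambda>k. 1 / K k) \<longlonglongrightarrow> 0" unfolding K_def by (rule LIMSEQ_Suc[OF lim_1_over_n])
  have flim: "(\<lambda>k. f k d t) \<longlonglongrightarrow> (if d = 0 then 1 else 0)" for d t
  proof (cases d)
    case 0
    have "(\<lambda>k. t * (1 / K k)) \<longlonglongrightarrow> t * 0" by (intro tendsto_intros Klim)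
    then have "(\<lambda>k. \<psi> 0 (t * (1 / K k))) \<longlonglongrightarrow> \<psi> 0 (t * 0)" by (rule continuous_on_tendsto_compose[OF \<psi>c]) auto
    with 0 show ?thesis by (simp add: f_def \<psi>0)
  next
    case (Suc e)
    have "(\<lambda>k. M d * (1 / K k) ^ d) \<longlonglongrightarrow> M d * 0 ^ d" by (intro tendsto_intros Klim)
    then have Mlim: "(\<lambda>k. M d * (1 / K k) ^ d) \<longlonglongrightarrow> 0" using Suc by simp
    have "\<bar>f k d t\<bar> \<le> M d * (1 / K k) ^ d" for k
      using fb[of k d t] by (simp add: power_one_over divide_inverse power_inverse)
    then have le: "\<forall>\<^sub>F k in sequentially. \<bar>f k d t\<bar> \<le> M d * (1 / K k) ^ d" by (rule always_eventually[OF allI])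
    have ge: "\<forall>\<^sub>F k in sequentially. 0 \<le> \<bar>f k d t\<bar>" by simp
    have "(\<lambda>k. \<bar>f k d t\<bar>) \<longlonglongrightarrow> 0" by (rule tendsto_sandwich[OF ge le tendsto_const Mlim])
    then have "(\<lambda>k. f k d t) \<longlonglongrightarrow> 0" by (rule tendsto_rabs_zero_cancel)
    with Suc show ?thesis by simp
  qed
  define \<theta> :: "nat \<Rightarrow> ('n \<Rightarrow> nat) \<Rightarrow> real^'n \<Rightarrow> complex" where "\<theta> k a x = of_real (\<Prod>j\<in>UNIV. f k (a j) (x $ j))" for k a x
  have deriv: "((\<lambda>t. \<theta> k a (x + axis i t)) has_vector_derivative \<theta> k (a(i := Suc (a i))) x) (at 0)" for k a x i
  proof -
    define c where "c = (\<Prod>j\<in>UNIV - {i}. f k (a j) (x $ j))"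
    have eq1: "(\<Prod>j\<in>UNIV. f k (a j) ((x + axis i t) $ j)) = f k (a i) (x $ i + t) * c" for t
    proof -
      have "(\<Prod>j\<in>UNIV - {i}. f k (a j) ((x + axis i t) $ j)) = c"
        unfolding c_def by (rule prod.cong) (auto simp: axis_def)
      then show ?thesis by (subst prod.remove[of _ i]) (auto simp: axis_def)
    qed
    have eq2: "(\<Prod>j\<in>UNIV. f k ((a(i := Suc (a i))) j) (x $ j)) = f k (Suc (a i)) (x $ i) * c"
    proof -
      have "(\<Prod>j\<in>UNIV - {i}. f k ((a(i := Suc (a i))) j) (x $ j)) = c"
        unfolding c_def by (rule prod.cong) auto
      then show ?thesis by (subst prod.remove[of _ i]) auto
    qed
    have d: "((\<lambda>t. f k (a i) (x $ i + t) * c) has_vector_derivative f k (Suc (a i)) (x $ i) * c) (at 0)"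
      using DERIV_cmult_right[OF fd] by (simp add: has_real_derivative_iff_has_vector_derivative)
    show ?thesis
      unfolding \<theta>_def eq1 eq2 by (rule bounded_linear.has_vector_derivative[OF bounded_linear_of_real d])
  qed
  have rp: "rpartial i (\<theta> k a) = \<theta> k (a(i := Suc (a i)))" for k a i
    by (rule ext, rule rpartial_eq, rule deriv)
  have ad: "axis_differentiable (\<theta> k a)" for k a using deriv by (rule axis_differentiableI)
  have tc: "continuous_on UNIV (\<theta> k a)" for k a
    unfolding \<theta>_def by (intro continuous_intros continuous_on_compose2[OF fc]) auto
  have A1: "smooth (\<theta> k a)" for k a
    by (rule smooth_coinduct[of "\<lambda>g. \<exists>a. g = \<theta> k a"]) (auto simp: ad tc rp)
  have A2: "\<exists>R. \<forall>x. norm x > R \<longrightarrow> \<theta> k a x = 0" for k a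
  proof (intro exI allI impI)
    fix x :: "real^'n" assume x: "norm x > real CARD('n) * K k"
    have "\<exists>j. \<bar>x $ j\<bar> > K k"
    proof (rule ccontr)
      assume "\<not> (\<exists>j. \<bar>x $ j\<bar> > K k)"
      then have "(\<Sum>j\<in>UNIV. \<bar>x $ j\<bar>) \<le> (\<Sum>j\<in>(UNIV::'n set). K k)" by (intro sum_mono) (auto simp: not_less)
      with norm_le_l1_cart[of x] x show False by simp
    qed
    then obtain j where "\<bar>x $ j\<bar> > K k" by blast
    then have "\<bar>x $ j / K k\<bar> > 1" using K1[of k] by (simp add: abs_divide)
    then have "f k (a j) (x $ j) = 0" by (simp add: f_def supp)
    then show "\<theta> k a x = 0" by (auto simp: \<theta>_def intro!: prod_zero bexI[of _ j])
  qed
  have A3: "\<exists>B. \<forall>k x. norm (\<theta> k a x) \<le> B" for a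
  proof (intro exI allI)
    fix k and x :: "real^'n"
    show "norm (\<theta> k a x) \<le> (\<Prod>j\<in>UNIV. M (a j))"
      unfolding \<theta>_def norm_of_real abs_prod by (intro prod_mono) (auto intro: fb1)
  qed
  have A4: "(\<lambda>k. \<theta> k a x) \<longlonglongrightarrow> (\<Prod>j\<in>UNIV. if a j = 0 then 1 else 0)" for a x
  proof -
    have "(\<lambda>k. \<theta> k a x) \<longlonglongrightarrow> of_real (\<Prod>j\<in>UNIV. if a j = 0 then 1 else 0)"
      unfolding \<theta>_def by (intro tendsto_intros flim)
    moreover have "complex_of_real (\<Prod>j\<in>UNIV. if a j = 0 then 1 else 0) = (\<Prod>j\<in>UNIV. if a j = 0 then 1 else 0)"
      unfolding of_real_prod by (rule prod.cong) auto
    ultimately show ?thesis by simp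
  qed
  show ?thesis by (rule that[of \<theta>, OF A1 rp A2 A3 A4])
qed

text \<open>By Leibniz' rule the derivatives of \<open>\<theta> k 0 h\<close> involve derivatives of the cutoff, which tend to 0.
  The induction over the derivative treats all orders \<open>a\<close> of the cutoff at once, with the limit \<open>L a\<close> that
  is 1 for \<open>a = 0\<close> and 0 otherwise.\<close>

theorem smooth_L2_approximation:
  fixes h :: "real^'n::finite \<Rightarrow> complex"
  assumes h: "smooth_L2 h"
  obtains T where "\<And>k. T k \<in> test_functions"
    and "\<And>js. (\<lambda>k. L2_norm gauss_measure (\<lambda>x. foldr rpartial js (T k) x - foldr rpartial js h x)) \<longlonglongrightarrow> 0"
proof -
  obtain \<theta> :: "nat \<Rightarrow> ('n \<Rightarrow> nat) \<Rightarrow> real^'n \<Rightarrow> complex"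
    where th: "\<And>k a. smooth (\<theta> k a)"
    and rp: "\<And>k a i. rpartial i (\<theta> k a) = \<theta> k (a(i := Suc (a i)))"
    and supp: "\<And>k a. \<exists>R. \<forall>x. norm x > R \<longrightarrow> \<theta> k a x = 0"
    and bd: "\<And>a. \<exists>B. \<forall>k x. norm (\<theta> k a x) \<le> B"
    and lim: "\<And>a x. (\<lambda>k. \<theta> k a x) \<longlonglongrightarrow> (\<Prod>j\<in>UNIV. if a j = 0 then 1 else 0)"
    by (rule cutoff_family) (rule that; assumption)
  define L where "L a = (\<Prod>j\<in>(UNIV::'n set). if a j = (0::nat) then 1 else (0::complex))" for a
  have test: "(\<lambda>x. \<theta> k a x * h x) \<in> test_functions" if "smooth h" for k a h
  proof -
    obtain R where R: "\<forall>x. norm x > R \<longrightarrow> \<theta> k a x = 0" using supp[of k a] by (elim exE)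
    show ?thesis
    proof (rule test_functionI[where R=R])
      show "smooth (\<lambda>x. \<theta> k a x * h x)" by (intro smooth_mult th that)
      show "\<theta> k a x * h x = 0" if "norm x > R" for x using that R by simp
    qed
  qed
  have tL: "foldr rpartial js (\<lambda>x. \<theta> k a x * h x) \<in> L2 gauss_measure" if "smooth h" for k a h js
    by (rule smooth_L2_L2[OF smooth_L2_test_function[OF test[OF that]]])
  have conv: "(\<lambda>k. L2_norm gauss_measure (\<lambda>x. foldr rpartial js (\<lambda>x. \<theta> k a x * h x) x - L a * foldr rpartial js h x)) \<longlonglongrightarrow> 0"
    if "smooth_L2 h" for js a h
    using that
  proof (induction js arbitrary: a h rule: rev_induct)
    case Nil
    obtain B where B: "\<And>k x. norm (\<theta> k a x) \<le> B" using bd by blast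
    have hL: "h \<in> L2 gauss_measure" by (rule smooth_L2_L2'[OF Nil])
    have "(\<lambda>k. L2_norm gauss_measure (\<lambda>x. \<theta> k a x * h x - L a * h x)) \<longlonglongrightarrow> 0"
    proof (rule L2_dominated_convergence(2)[where w="\<lambda>x. B\<^sup>2 * (norm (h x))\<^sup>2"])
      show "integrable gauss_measure (\<lambda>x. B\<^sup>2 * (norm (h x))\<^sup>2)" using L2_integrable[OF hL] by simp
      show "AE x in gauss_measure. (norm (\<theta> k a x * h x))\<^sup>2 \<le> B\<^sup>2 * (norm (h x))\<^sup>2" for k
        using B by (auto intro!: AE_I2 mult_right_mono power_mono simp: norm_mult power_mult_distrib)
      show "AE x in gauss_measure. (\<lambda>k. \<theta> k a x * h x) \<longlonglongrightarrow> L a * h x"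
        unfolding L_def by (intro AE_I2 tendsto_intros lim)
      show "(\<lambda>x. \<theta> k a x * h x) \<in> borel_measurable gauss_measure" for k
        using L2_measurable[OF tL[of h "[]" k a]] Nil by (simp add: smooth_L2_def)
      show "(\<lambda>x. L a * h x) \<in> borel_measurable gauss_measure" using L2_measurable[OF L2_cmult[OF hL]] .
    qed
    then show ?case by simp
  next
    case (snoc i js)
    have hs: "smooth h" using snoc.prems by (simp add: smooth_L2_def)
    have h': "smooth_L2 (rpartial i h)" by (rule smooth_L2_rpartial[OF snoc.prems])
    define a' where "a' = a(i := Suc (a i))"
    have L0: "L a' = 0" unfolding L_def a'_def by (rule prod_zero) (auto intro!: bexI[of _ i])
    have split: "foldr rpartial (js @ [i]) (\<lambda>x. \<theta> k a x * h x) = (\<lambda>x. foldr rpartial js (\<lambda>x. \<theta> k a' x * h x) x + foldr rpartial js (\<lambda>x. \<theta> k a x * rpartial i h x) x)" for k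
    proof -
      have "foldr rpartial (js @ [i]) (\<lambda>x. \<theta> k a x * h x) = foldr rpartial js (\<lambda>x. \<theta> k a' x * h x + \<theta> k a x * rpartial i h x)"
        by (simp add: rpartial_mult[OF smooth_axis_differentiable[OF th] smooth_axis_differentiable[OF hs]] rp a'_def)
      also have "\<dots> = (\<lambda>x. foldr rpartial js (\<lambda>x. \<theta> k a' x * h x) x + foldr rpartial js (\<lambda>x. \<theta> k a x * rpartial i h x) x)"
        by (intro foldr_rpartial_add smooth_mult th hs smooth_rpartial)
      finally show ?thesis .
    qed
    have 1: "(\<lambda>k. L2_norm gauss_measure (\<lambda>x. foldr rpartial js (\<lambda>x. \<theta> k a' x * h x) x)) \<longlonglongrightarrow> 0"
      using snoc.IH[OF snoc.prems, of a'] by (simp add: L0)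
    have 2: "(\<lambda>k. L2_norm gauss_measure (\<lambda>x. foldr rpartial js (\<lambda>x. \<theta> k a x * rpartial i h x) x - L a * foldr rpartial js (rpartial i h) x)) \<longlonglongrightarrow> 0"
      by (rule snoc.IH[OF h'])
    show ?case
    proof (rule tendsto_sandwich[OF _ _ tendsto_const])
      show "(\<lambda>k. L2_norm gauss_measure (\<lambda>x. foldr rpartial js (\<lambda>x. \<theta> k a' x * h x) x) + L2_norm gauss_measure (\<lambda>x. foldr rpartial js (\<lambda>x. \<theta> k a x * rpartial i h x) x - L a * foldr rpartial js (rpartial i h) x)) \<longlonglongrightarrow> 0"
        using tendsto_add[OF 1 2] by simp
      have "L2_norm gauss_measure (\<lambda>x. foldr rpartial (js @ [i]) (\<lambda>x. \<theta> k a x * h x) x - L a * foldr rpartial (js @ [i]) h x)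
         \<le> L2_norm gauss_measure (\<lambda>x. foldr rpartial js (\<lambda>x. \<theta> k a' x * h x) x) + L2_norm gauss_measure (\<lambda>x. foldr rpartial js (\<lambda>x. \<theta> k a x * rpartial i h x) x - L a * foldr rpartial js (rpartial i h) x)" for k
        using L2_norm_triangle[OF tL[OF hs, of js k a'] L2_diff[OF tL[OF smooth_rpartial[OF hs], of js k a] L2_cmult[OF smooth_L2_L2[OF h'], of "L a" js]]]
        unfolding split by (simp add: add_diff_eq)
      then show "\<forall>\<^sub>F k in sequentially. L2_norm gauss_measure (\<lambda>x. foldr rpartial (js @ [i]) (\<lambda>x. \<theta> k a x * h x) x - L a * foldr rpartial (js @ [i]) h x)
         \<le> L2_norm gauss_measure (\<lambda>x. foldr rpartial js (\<lambda>x. \<theta> k a' x * h x) x) + L2_norm gauss_measure (\<lambda>x. foldr rpartial js (\<lambda>x. \<theta> k a x * rpartial i h x) x - L a * foldr rpartial js (rpartial i h) x)"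
        by simp
    qed simp
  qed
  have "L (\<lambda>j. 0) = 1" by (simp add: L_def)
  then show ?thesis
    using that[of "\<lambda>k x. \<theta> k (\<lambda>j. 0) x * h x"] test[of h] conv[OF h, of _ "\<lambda>j. 0"] h by (simp add: smooth_L2_def)
qed

text \<open>Both sides are continuous along the approximation by test functions: the left one since point
  evaluations of derivatives are continuous on the Fock space, the right one by the isometry.\<close>

theorem foldr_cpartial_gauss_bargmann:
  fixes h :: "real^'n::finite \<Rightarrow> complex"
  assumes h: "smooth_L2 h"
  shows "foldr cpartial js (gauss_bargmann h) = gauss_bargmann (foldr rpartial js h)"
proof
  fix z
  obtain T where T: "\<And>k. T k \<in> test_functions"
    and lim: "\<And>js. (\<lambda>k. L2_norm gauss_measure (\<lambda>x. foldr rpartial js (T k) x - foldr rpartial js h x)) \<longlonglongrightarrow> 0"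
    by (rule smooth_L2_approximation[OF h]) (rule that; assumption)
  have hL: "foldr rpartial js h \<in> L2 gauss_measure" for js by (rule smooth_L2_L2[OF h])
  have TL: "foldr rpartial js (T k) \<in> L2 gauss_measure" for js k by (rule smooth_L2_L2[OF smooth_L2_test_function[OF T]])
  have diff: "L2_norm fock_measure (\<lambda>z. gauss_bargmann (foldr rpartial js (T k)) z - gauss_bargmann (foldr rpartial js h) z)
     = L2_norm gauss_measure (\<lambda>x. foldr rpartial js (T k) x - foldr rpartial js h x)" for js k
    using gauss_bargmann_isometry(2)[OF L2_diff[OF TL hL]] by (simp add: gauss_bargmann_diff[OF TL hL, abs_def])
  have conv: "(\<lambda>k. fock_norm (\<lambda>z. gauss_bargmann (foldr rpartial js (T k)) z - gauss_bargmann (foldr rpartial js h) z)) \<longlonglongrightarrow> 0" for js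
    unfolding fock_norm_eq diff by (rule lim)
  have "(\<lambda>k. foldr cpartial js (gauss_bargmann (T k)) z) \<longlonglongrightarrow> foldr cpartial js (gauss_bargmann h) z"
    using fock_convergence_pointwise[OF gauss_bargmann_isometry(1)[OF TL] gauss_bargmann_isometry(1)[OF hL] conv, of js "[]" z]
    by simp
  moreover have "(\<lambda>k. gauss_bargmann (foldr rpartial js (T k)) z) \<longlonglongrightarrow> gauss_bargmann (foldr rpartial js h) z"
    using fock_convergence_pointwise[OF gauss_bargmann_isometry(1)[OF TL] gauss_bargmann_isometry(1)[OF hL] conv, of "[]" js z]
    by simp
  ultimately show "foldr cpartial js (gauss_bargmann h) z = gauss_bargmann (foldr rpartial js h) z"
    unfolding foldr_cpartial_gauss_bargmann_test[OF T] by (rule LIMSEQ_unique)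
qed

section \<open>Transform preimages of dilated Fock functions\<close>

text \<open>Completing the square in the real part of \<open>w\<close>; the parameter \<open>\<kappa>\<close> distributes the mixed term between
  the growth in \<open>x\<close> and the growth in \<open>w\<close>.\<close>

lemma norm_exp_bargmann_inverse:
  fixes w :: "complex^'n::finite" and x :: "real^'n"
  assumes k: "\<kappa> > 0"
  shows "norm (exp (of_real (- (r\<^sup>2) / 2) * cdot (vcnj w) (vcnj w) + cdot (of_real r *s vcnj w) (cvec x)))
    \<le> exp (\<kappa> * (norm x)\<^sup>2 + max (r\<^sup>2 / 2) (r\<^sup>2 / (4 * \<kappa>) - r\<^sup>2 / 2) * (norm w)\<^sup>2)"
proof -
  define s where "s = (\<chi> j. Re (w $ j))"
  define t where "t = (\<chi> j. Im (w $ j))"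
  have w: "w = cplx s t" by (simp add: s_def t_def vec_eq_iff)
  define \<rho> where "\<rho> = max (r\<^sup>2 / 2) (r\<^sup>2 / (4 * \<kappa>) - r\<^sup>2 / 2)"
  have "Re (cdot (vcnj w) (vcnj w)) = (norm s)\<^sup>2 - (norm t)\<^sup>2"
    unfolding cnj_cdot[symmetric] complex_cnj w by (simp add: Re_cdot_cplx)
  moreover have "Re (cdot (of_real r *s vcnj w) (cvec x)) = r * (s \<bullet> x)"
    unfolding w by (simp add: cdot_def inner_vec_def sum_distrib_left mult.assoc)
  ultimately have re: "Re (of_real (- (r\<^sup>2) / 2) * cdot (vcnj w) (vcnj w) + cdot (of_real r *s vcnj w) (cvec x)) = - (r\<^sup>2) / 2 * ((norm s)\<^sup>2 - (norm t)\<^sup>2) + r * (s \<bullet> x)"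
    by simp
  have "0 \<le> (norm ((2 * \<kappa>) *\<^sub>R x - r *\<^sub>R s))\<^sup>2" by simp
  also have "\<dots> = 4 * \<kappa>\<^sup>2 * (norm x)\<^sup>2 - 4 * \<kappa> * (r * (s \<bullet> x)) + r\<^sup>2 * (norm s)\<^sup>2"
    unfolding power2_norm_eq_inner
    by (simp add: inner_diff_left inner_diff_right inner_commute power2_eq_square algebra_simps)
  finally have "4 * \<kappa> * (r * (s \<bullet> x)) \<le> 4 * \<kappa>\<^sup>2 * (norm x)\<^sup>2 + r\<^sup>2 * (norm s)\<^sup>2" by simp
  then have in_le: "r * (s \<bullet> x) \<le> \<kappa> * (norm x)\<^sup>2 + r\<^sup>2 / (4 * \<kappa>) * (norm s)\<^sup>2"
    using k by (simp add: field_simps power2_eq_square)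
  have le_s: "(r\<^sup>2 / (4 * \<kappa>) - r\<^sup>2 / 2) * (norm s)\<^sup>2 \<le> \<rho> * (norm s)\<^sup>2"
    unfolding \<rho>_def by (intro mult_right_mono) simp_all
  have le_t: "r\<^sup>2 / 2 * (norm t)\<^sup>2 \<le> \<rho> * (norm t)\<^sup>2"
    unfolding \<rho>_def by (intro mult_right_mono) simp_all
  have "r * (s \<bullet> x) - r\<^sup>2 / 2 * (norm s)\<^sup>2 \<le> (\<kappa> * (norm x)\<^sup>2 + r\<^sup>2 / (4 * \<kappa>) * (norm s)\<^sup>2) - r\<^sup>2 / 2 * (norm s)\<^sup>2"
    by (rule diff_right_mono[OF in_le])
  also have "\<dots> = \<kappa> * (norm x)\<^sup>2 + (r\<^sup>2 / (4 * \<kappa>) - r\<^sup>2 / 2) * (norm s)\<^sup>2"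
    by (simp only: left_diff_distrib add_diff_eq)
  also have "\<dots> \<le> \<kappa> * (norm x)\<^sup>2 + \<rho> * (norm s)\<^sup>2" by (rule add_left_mono[OF le_s])
  finally have "r\<^sup>2 / 2 * (norm t)\<^sup>2 + (r * (s \<bullet> x) - r\<^sup>2 / 2 * (norm s)\<^sup>2) \<le> \<rho> * (norm t)\<^sup>2 + (\<kappa> * (norm x)\<^sup>2 + \<rho> * (norm s)\<^sup>2)"
    by (rule add_mono[OF le_t])
  moreover have "- (r\<^sup>2) / 2 * ((norm s)\<^sup>2 - (norm t)\<^sup>2) + r * (s \<bullet> x) = r\<^sup>2 / 2 * (norm t)\<^sup>2 + (r * (s \<bullet> x) - r\<^sup>2 / 2 * (norm s)\<^sup>2)"
    by (simp add: algebra_simps)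
  moreover have "\<rho> * (norm t)\<^sup>2 + (\<kappa> * (norm x)\<^sup>2 + \<rho> * (norm s)\<^sup>2) = \<kappa> * (norm x)\<^sup>2 + \<rho> * (norm w)\<^sup>2"
    by (simp add: w norm_cplx algebra_simps)
  ultimately have "- (r\<^sup>2) / 2 * ((norm s)\<^sup>2 - (norm t)\<^sup>2) + r * (s \<bullet> x) \<le> \<kappa> * (norm x)\<^sup>2 + \<rho> * (norm w)\<^sup>2"
    by (simp only:)
  then show ?thesis unfolding norm_exp_eq_Re re \<rho>_def by simp
qed

text \<open>The adjoint kernel suggests the inversion formula
  \<open>g x = \<integral> F w exp (x \<cdot> cnj w - (cnj w) \<cdot> (cnj w) / 2) d\<lambda> w\<close>, whose integral diverges in general. With \<open>r cnj w\<close> for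
  \<open>cnj w\<close> it converges absolutely, defines a smooth function, and grows slowly enough for all derivatives
  to be square integrable. Transforming it, by Fubini's theorem and the Gaussian integral, gives the
  reproducing formula for \<open>F\<close> at the point \<open>r z\<close>.\<close>

theorem dilation_preimage:
  fixes F :: "complex^'n::finite \<Rightarrow> complex"
  assumes F: "F \<in> fock_space" and r: "0 < r" "r < 1"
  shows "\<exists>g. smooth_L2 g \<and> gauss_bargmann g = comp_op (of_real r) F"
proof -
  have FL: "F \<in> L2 fock_measure" by (rule fock_space_L2[OF F])
  have Fm [measurable]: "F \<in> borel_measurable borel" by (rule entire_measurable[OF fock_space_entire[OF F]])
  have r2: "r\<^sup>2 < 1" using r by (simp add: power_less_one_iff)
  have r20: "0 < r\<^sup>2" using r by simp
  have rp: "0 < 2 * (1 + r\<^sup>2)" by (intro mult_pos_pos add_pos_pos r20) simp_all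
  \<comment> \<open>\<open>\<kappa> < 1/4\<close> makes the preimage square integrable; the lower bound on \<open>\<kappa>\<close> makes \<open>\<rho> < 1/2\<close>, so that the kernel is square integrable in \<open>w\<close>; both are possible because \<open>r < 1\<close>\<close>
  have "r\<^sup>2 / (2 * (1 + r\<^sup>2)) < 1 / 4" unfolding pos_divide_less_eq[OF rp] using r2 by simp
  then obtain \<kappa> where kk: "r\<^sup>2 / (2 * (1 + r\<^sup>2)) < \<kappa>" "\<kappa> < 1 / 4" using dense by blast
  have "0 < r\<^sup>2 / (2 * (1 + r\<^sup>2))" by (rule divide_pos_pos[OF r20 rp])
  then have k0: "\<kappa> > 0" using kk by linarith
  define \<rho> where "\<rho> = max (r\<^sup>2 / 2) (r\<^sup>2 / (4 * \<kappa>) - r\<^sup>2 / 2)"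
  have rho: "\<rho> < 1 / 2"
  proof -
    have "r\<^sup>2 < \<kappa> * (2 * (1 + r\<^sup>2))" using kk(1) unfolding pos_divide_less_eq[OF rp] .
    then have "r\<^sup>2 / (4 * \<kappa>) < (1 + r\<^sup>2) / 2" using k0 by (simp add: divide_less_eq mult_ac)
    then have "r\<^sup>2 / (4 * \<kappa>) - r\<^sup>2 / 2 < (1 + r\<^sup>2) / 2 - r\<^sup>2 / 2" by (rule diff_strict_right_mono)
    also have "(1 + r\<^sup>2) / 2 - r\<^sup>2 / 2 = 1 / 2" by (simp add: add_divide_distrib)
    finally have "r\<^sup>2 / (4 * \<kappa>) - r\<^sup>2 / 2 < 1 / 2" .
    moreover have "r\<^sup>2 / 2 < 1 / 2" by (rule divide_strict_right_mono[OF r2]) simp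
    ultimately show ?thesis unfolding \<rho>_def max_less_iff_conj by (intro conjI)
  qed
  define a where "a w = of_real r *s vcnj w" for w :: "complex^'n"
  define q where "q w = exp (of_real (- (r\<^sup>2) / 2) * cdot (vcnj w) (vcnj w))" for w :: "complex^'n"
  define mono where "mono js w = of_real r ^ length js * conj_monomial js w" for js and w :: "complex^'n"
  define P where "P js w = F w * (q w * mono js w)" for js w
  define L where "L js z = (LINT w|fock_measure. P js w * exp (cdot (a w) z))" for js z
  have am [measurable]: "a \<in> borel_measurable borel" unfolding a_def by measurable
  have qm [measurable]: "q \<in> borel_measurable borel" unfolding q_def by measurable
  have mm [measurable]: "mono js \<in> borel_measurable borel" for js unfolding mono_def by measurable
  have Pm [measurable]: "P js \<in> borel_measurable borel" for js unfolding P_def by measurable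
  have an: "norm (a w) = r * norm w" for w
  proof -
    have "a w = r *\<^sub>R vcnj w" by (simp add: a_def vec_eq_iff complex_eq_iff)
    then show ?thesis using r by simp
  qed
  have mono_le: "norm (mono js w) \<le> exp (real (length js) * norm w)" for js w
  proof -
    have "norm (mono js w) = r ^ length js * norm (conj_monomial js w)" using r by (simp add: mono_def norm_mult norm_power)
    also have "\<dots> \<le> 1 * norm (conj_monomial js w)" using r by (intro mult_right_mono power_le_one) auto
    finally show ?thesis using norm_conj_monomial_le[of js w] by simp
  qed
  have qe: "norm (q w * exp (cdot (a w) (cvec x))) \<le> exp (\<kappa> * (norm x)\<^sup>2 + \<rho> * (norm w)\<^sup>2)" for w x
    unfolding q_def a_def exp_add[symmetric] \<rho>_def by (rule norm_exp_bargmann_inverse[OF k0])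
  have q_le: "norm (q w) \<le> exp (\<rho> * (norm w)\<^sup>2)" for w
    using qe[of w 0] by (simp add: norm_mult cvec_def[of 0] zero_vec_def[symmetric])
  have K2: "(\<lambda>w. q w * mono js w * of_real (exp (c * norm (a w)))) \<in> L2 fock_measure" for js c
  proof (rule L2_fock_bound[where \<rho>=\<rho> and B=1 and c="real (length js) + c * r"])
    show "(\<lambda>w. q w * mono js w * of_real (exp (c * norm (a w)))) \<in> borel_measurable borel" by measurable
    fix w
    have "norm (q w * mono js w * of_real (exp (c * norm (a w)))) \<le> exp (\<rho> * (norm w)\<^sup>2) * exp (real (length js) * norm w) * exp (c * (r * norm w))"
      unfolding norm_mult an by (intro mult_mono q_le mono_le) auto
    also have "\<dots> = 1 * exp ((real (length js) + c * r) * norm w + \<rho> * (norm w)\<^sup>2)"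
      by (simp add: exp_add[symmetric] algebra_simps)
    finally show "norm (q w * mono js w * of_real (exp (c * norm (a w)))) \<le> 1 * exp ((real (length js) + c * r) * norm w + \<rho> * (norm w)\<^sup>2)" .
  qed (rule rho)
  have der: "complex_derivative_at (L js) (\<lambda>v. LINT w|fock_measure. P js w * cdot (a w) v * exp (cdot (a w) z)) z" for js z
    unfolding L_def[abs_def]
  proof (rule exponential_integral_derivative)
    show "integrable fock_measure (\<lambda>w. norm (P js w) * exp (c * norm (a w)))" for c
      using L2_mult_integrable_norm[OF FL K2[of js c]] by (simp add: P_def norm_mult mult_ac)
  qed (simp_all add: Pm am)
  have LE: "entire (L js)" for js unfolding entire_iff using der by (intro allI exI)
  define g where "g js x = L js (cvec x)" for js x
  have gder: "((\<lambda>t. g js (x + axis i t)) has_vector_derivative g (i # js) x) (at 0)" for js x i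
  proof -
    have "((\<lambda>t. L js (cvec x + t *s axis i 1)) has_field_derivative (LINT w|fock_measure. P js w * cdot (a w) (axis i 1) * exp (cdot (a w) (cvec x)))) (at (of_real 0))"
      using complex_derivative_at_line[of "L js" _ "cvec x" 0 "axis i 1"] der[of js "cvec x"] by simp
    moreover have "(LINT w|fock_measure. P js w * cdot (a w) (axis i 1) * exp (cdot (a w) (cvec x))) = g (i # js) x"
      unfolding g_def L_def by (intro Bochner_Integration.integral_cong) (simp_all add: P_def mono_def conj_monomial_def cdot_axis a_def mult_ac)
    ultimately have fd: "((\<lambda>t. L js (cvec x + t *s axis i 1)) has_field_derivative g (i # js) x) (at (of_real 0))"
      by (simp only:)
    have "((\<lambda>t. L js (cvec x + of_real t *s axis i 1)) has_vector_derivative g (i # js) x) (at 0)"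
      by (rule has_vector_derivative_real_field[OF fd])
    moreover have "cvec (x + axis i t) = cvec x + of_real t *s axis i 1" for t
      by (simp add: vec_eq_iff axis_def)
    ultimately show ?thesis by (simp only: g_def)
  qed
  have grp: "rpartial i (g js) = g (i # js)" for i js by (rule ext, rule rpartial_eq, rule gder)
  have gad: "axis_differentiable (g js)" for js using gder by (rule axis_differentiableI)
  have gc: "continuous_on UNIV (g js)" for js
    unfolding g_def by (rule continuous_on_compose2[OF entire_continuous[OF LE]]) (auto intro!: continuous_intros)
  have gs: "smooth (g [])"
  proof (rule smooth_coinduct[of "\<lambda>f. f \<in> range g"])
    fix f assume "f \<in> range g"
    then obtain js where f: "f = g js" by (elim rangeE)
    show "continuous_on UNIV f \<and> axis_differentiable f \<and> (\<forall>j. rpartial j f \<in> range g)"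
      unfolding f grp using gc gad by simp
  qed simp
  have gf: "foldr rpartial js (g []) = g js" for js by (induction js) (simp_all add: grp)
  define C where "C js = (LINT w|fock_measure. norm (F w) * norm (mono js w * of_real (exp (\<rho> * (norm w)\<^sup>2))))" for js
  have KC: "(\<lambda>w. mono js w * of_real (exp (\<rho> * (norm w)\<^sup>2))) \<in> L2 fock_measure" for js
  proof (rule L2_fock_bound[where \<rho>=\<rho> and B=1 and c="real (length js)"])
    show "(\<lambda>w. mono js w * of_real (exp (\<rho> * (norm w)\<^sup>2))) \<in> borel_measurable borel" by measurable
    fix w
    show "norm (mono js w * of_real (exp (\<rho> * (norm w)\<^sup>2))) \<le> 1 * exp (real (length js) * norm w + \<rho> * (norm w)\<^sup>2)"
      using mono_le[of js w] by (simp add: norm_mult exp_add)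
  qed (rule rho)
  have CI: "integrable fock_measure (\<lambda>w. norm (F w) * norm (mono js w * of_real (exp (\<rho> * (norm w)\<^sup>2))))" for js
    by (rule L2_mult_integrable_norm[OF FL KC])
  have Pb: "norm (P js w * exp (cdot (a w) (cvec x))) \<le> exp (\<kappa> * (norm x)\<^sup>2) * (norm (F w) * norm (mono js w * of_real (exp (\<rho> * (norm w)\<^sup>2))))" for js w x
  proof -
    have "norm (P js w * exp (cdot (a w) (cvec x))) = (norm (F w) * norm (mono js w)) * norm (q w * exp (cdot (a w) (cvec x)))"
      by (simp add: P_def norm_mult mult_ac)
    also have "\<dots> \<le> (norm (F w) * norm (mono js w)) * exp (\<kappa> * (norm x)\<^sup>2 + \<rho> * (norm w)\<^sup>2)"
      by (rule mult_left_mono[OF qe]) simp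
    also have "\<dots> = exp (\<kappa> * (norm x)\<^sup>2) * (norm (F w) * norm (mono js w * of_real (exp (\<rho> * (norm w)\<^sup>2))))"
      by (simp add: norm_mult exp_add mult_ac)
    finally show ?thesis .
  qed
  have Pi: "integrable fock_measure (\<lambda>w. P js w * exp (cdot (a w) (cvec x)))" for js x
  proof (rule Bochner_Integration.integrable_bound)
    show "integrable fock_measure (\<lambda>w. exp (\<kappa> * (norm x)\<^sup>2) * (norm (F w) * norm (mono js w * of_real (exp (\<rho> * (norm w)\<^sup>2)))))"
      by (rule integrable_mult_right[OF CI])
    show "(\<lambda>w. P js w * exp (cdot (a w) (cvec x))) \<in> borel_measurable fock_measure" by measurable
    show "AE w in fock_measure. norm (P js w * exp (cdot (a w) (cvec x))) \<le> norm (exp (\<kappa> * (norm x)\<^sup>2) * (norm (F w) * norm (mono js w * of_real (exp (\<rho> * (norm w)\<^sup>2)))))"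
      by (rule AE_I2, rule order_trans[OF Pb]) (simp only: real_norm_def abs_ge_self)
  qed
  have Pn: "(LINT w|fock_measure. norm (P js w * exp (cdot (a w) (cvec x)))) \<le> C js * exp (\<kappa> * (norm x)\<^sup>2)" for js x
  proof -
    have "(LINT w|fock_measure. norm (P js w * exp (cdot (a w) (cvec x)))) \<le> (LINT w|fock_measure. exp (\<kappa> * (norm x)\<^sup>2) * (norm (F w) * norm (mono js w * of_real (exp (\<rho> * (norm w)\<^sup>2)))))"
      by (intro integral_mono integrable_norm Pi integrable_mult_right CI Pb)
    also have "\<dots> = C js * exp (\<kappa> * (norm x)\<^sup>2)" by (simp only: integral_mult_right_zero C_def mult.commute)
    finally show ?thesis .
  qed
  have gb: "norm (g js x) \<le> C js * exp (0 * norm x + \<kappa> * (norm x)\<^sup>2)" for js x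
    using order_trans[OF integral_norm_bound Pn[of js x]] by (simp add: g_def L_def)
  have gL: "g js \<in> L2 gauss_measure" for js
    by (rule L2_gauss_bound[OF continuous_imp_borel[OF gc] kk(2) gb])
  have sg: "smooth_L2 (g [])" unfolding smooth_L2_def gf using gs gL by simp
  have "gauss_bargmann (g []) z = comp_op (of_real r) F z" for z
  proof -
    interpret GF: pair_sigma_finite "gauss_measure :: (real^'n) measure" "fock_measure :: (complex^'n) measure" ..
    define f where "f x w = P [] w * exp (cdot (a w) (cvec x)) * bargmann_kernel x z" for x w
    have fm: "(\<lambda>(x, w). f x w) \<in> borel_measurable (gauss_measure \<Otimes>\<^sub>M fock_measure)"
    proof -
      have 1: "(\<lambda>p. P [] (snd p)) \<in> borel_measurable (gauss_measure \<Otimes>\<^sub>M fock_measure)"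
        by (rule measurable_compose[OF measurable_snd]) simp
      have 2: "(\<lambda>p. a (snd p)) \<in> borel_measurable (gauss_measure \<Otimes>\<^sub>M fock_measure)"
        by (rule measurable_compose[OF measurable_snd]) simp
      have 3: "(\<lambda>p. cvec (fst p)) \<in> borel_measurable (gauss_measure \<Otimes>\<^sub>M fock_measure)"
        by (rule measurable_compose[OF measurable_fst]) simp
      have 4: "(\<lambda>p. bargmann_kernel (fst p) z) \<in> borel_measurable (gauss_measure \<Otimes>\<^sub>M fock_measure)"
        by (rule measurable_compose[OF measurable_fst]) simp
      show ?thesis unfolding f_def split_def
        by (intro borel_measurable_times exp_measurable_complex cdot_measurable 1 2 3 4)
    qed
    have fn: "(LINT w|fock_measure. norm (f x w)) \<le> (C [] * exp (\<kappa> * (norm x)\<^sup>2)) * norm (bargmann_kernel x z)" for x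
    proof -
      have "(LINT w|fock_measure. norm (f x w)) = (LINT w|fock_measure. norm (P [] w * exp (cdot (a w) (cvec x)))) * norm (bargmann_kernel x z)"
        unfolding f_def norm_mult[of _ "bargmann_kernel x z"] by (rule integral_mult_left_zero)
      then show ?thesis using mult_right_mono[OF Pn[of "[]" x], of "norm (bargmann_kernel x z)"] by simp
    qed
    have fint: "integrable (gauss_measure \<Otimes>\<^sub>M fock_measure) (\<lambda>(x, w). f x w)"
    proof (rule GF.Fubini_integrable[OF fm])
      show "AE x in gauss_measure. integrable fock_measure (\<lambda>w. case (x, w) of (x, w) \<Rightarrow> f x w)"
        unfolding prod.case f_def by (rule AE_I2, rule integrable_mult_left[OF Pi])
      show "integrable gauss_measure (\<lambda>x. LINT w|fock_measure. norm (case (x, w) of (x, w) \<Rightarrow> f x w))"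
        unfolding prod.case
      proof (rule Bochner_Integration.integrable_bound)
        have e2: "(\<lambda>x::real^'n. complex_of_real (C [] * exp (\<kappa> * (norm x)\<^sup>2))) \<in> L2 gauss_measure"
        proof (rule L2_gauss_bound[where \<rho>=\<kappa> and c=0 and B="\<bar>C []\<bar>"])
          show "norm (complex_of_real (C [] * exp (\<kappa> * (norm x)\<^sup>2))) \<le> \<bar>C []\<bar> * exp (0 * norm x + \<kappa> * (norm x)\<^sup>2)" for x :: "real^'n"
            unfolding norm_of_real abs_mult by simp
          show "(\<lambda>x::real^'n. complex_of_real (C [] * exp (\<kappa> * (norm x)\<^sup>2))) \<in> borel_measurable borel" by measurable
        qed (rule kk(2))
        show "integrable gauss_measure (\<lambda>x. norm (complex_of_real (C [] * exp (\<kappa> * (norm x)\<^sup>2))) * norm (bargmann_kernel x z))"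
          by (rule L2_mult_integrable_norm[OF e2 L2_bargmann_kernel])
        show "(\<lambda>x. LINT w|fock_measure. norm (f x w)) \<in> borel_measurable gauss_measure"
        proof (rule fock.borel_measurable_lebesgue_integral)
          show "(\<lambda>(x, w). norm (f x w)) \<in> borel_measurable (gauss_measure \<Otimes>\<^sub>M fock_measure)"
            using measurable_compose[OF fm borel_measurable_norm] by (simp add: split_def)
        qed
        show "AE x in gauss_measure. norm (LINT w|fock_measure. norm (f x w)) \<le> norm (norm (complex_of_real (C [] * exp (\<kappa> * (norm x)\<^sup>2))) * norm (bargmann_kernel x z))"
        proof (rule AE_I2)
          fix x :: "real^'n"
          have "0 \<le> (LINT w|fock_measure. norm (f x w))" by simp
          moreover have "(C [] * exp (\<kappa> * (norm x)\<^sup>2)) * norm (bargmann_kernel x z) \<le> norm (complex_of_real (C [] * exp (\<kappa> * (norm x)\<^sup>2))) * norm (bargmann_kernel x z)"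
            unfolding norm_of_real by (intro mult_right_mono abs_ge_self) simp
          ultimately show "norm (LINT w|fock_measure. norm (f x w)) \<le> norm (norm (complex_of_real (C [] * exp (\<kappa> * (norm x)\<^sup>2))) * norm (bargmann_kernel x z))"
            using fn[of x] by simp
        qed
      qed
    qed
    have "gauss_bargmann (g []) z = (LINT x|gauss_measure. (LINT w|fock_measure. f x w))"
      unfolding gauss_bargmann_eq f_def g_def L_def by (simp only: integral_mult_left_zero)
    also have "\<dots> = (LINT w|fock_measure. (LINT x|gauss_measure. f x w))"
      using GF.Fubini_integral[OF fint] by simp
    also have "\<dots> = (LINT w|fock_measure. F w * exp (cdot (of_real r *s z) (vcnj w)))"
    proof (rule Bochner_Integration.integral_cong[OF refl])
      fix w
      have "f x w = (P [] w * exp (- cdot z z / 2)) * exp (cdot (cvec x) (a w + z))" for x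
      proof -
        have "exp (cdot (a w) (cvec x)) * bargmann_kernel x z = exp (- cdot z z / 2) * exp (cdot (cvec x) (a w + z))"
          unfolding bargmann_kernel_def exp_add[symmetric] by (simp add: cdot_add_right cdot_commute[of "a w"] algebra_simps)
        then show ?thesis by (simp only: f_def mult.assoc)
      qed
      then have "(LINT x|gauss_measure. f x w) = (P [] w * exp (- cdot z z / 2)) * (LINT x|gauss_measure. exp (cdot (cvec x) (a w + z)))"
        by (simp only: integral_mult_right_zero)
      also have "\<dots> = (P [] w * exp (- cdot z z / 2)) * exp (cdot (a w + z) (a w + z) / 2)"
        by (simp only: has_bochner_integral_integral_eq[OF gauss_exponential])
      also have "\<dots> = F w * (q w * exp (- cdot z z / 2) * exp (cdot (a w + z) (a w + z) / 2))"
        by (simp add: P_def mono_def conj_monomial_def)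
      also have "q w * exp (- cdot z z / 2) * exp (cdot (a w + z) (a w + z) / 2) = exp (cdot (of_real r *s z) (vcnj w))"
      proof -
        have "cdot (a w + z) (a w + z) = of_real (r\<^sup>2) * cdot (vcnj w) (vcnj w) + 2 * (of_real r * cdot z (vcnj w)) + cdot z z"
          by (simp add: a_def cdot_add_left cdot_add_right cdot_smult_left cdot_smult_right cdot_commute[of "vcnj w" z] power2_eq_square algebra_simps)
        then have "of_real (- (r\<^sup>2) / 2) * cdot (vcnj w) (vcnj w) + - cdot z z / 2 + cdot (a w + z) (a w + z) / 2 = cdot (of_real r *s z) (vcnj w)"
          by (simp add: cdot_smult_left add_divide_distrib)
        then show ?thesis unfolding q_def by (simp only: exp_add[symmetric])
      qed
      finally show "(LINT x|gauss_measure. f x w) = F w * exp (cdot (of_real r *s z) (vcnj w))" .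
    qed
    also have "\<dots> = F (of_real r *s z)" by (rule fock_reproducing[OF F, symmetric])
    finally show ?thesis by (simp add: comp_op_def)
  qed
  then have "gauss_bargmann (g []) = comp_op (of_real r) F" by (rule ext)
  with sg show ?thesis by (intro exI conjI)
qed

section \<open>The transform between the Sobolev spaces\<close>

lemma gauss_sobolev_approx_iff:
  "gauss_sobolev_approx m T f \<longleftrightarrow> (\<forall>k. T k \<in> test_functions) \<and>
     (\<forall>e>0. \<exists>N. \<forall>k\<ge>N. \<forall>l\<ge>N. test_norm m (\<lambda>x. T k x - T l x) < e) \<and>
     f \<in> L2 gauss_measure \<and> (\<lambda>k. L2_norm gauss_measure (\<lambda>x. T k x - f x)) \<longlonglongrightarrow> 0"
  by (simp add: gauss_sobolev_approx_def gauss_L2_eq gauss_L2_norm_eq)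

lemma test_norm_eq: "test_norm m f = (\<Sum>\<alpha>\<in>multi_indices m. L2_norm gauss_measure (foldr rpartial (directions \<alpha>) f))"
  by (simp add: test_norm_def multi_deriv_eq gauss_L2_norm_eq)

lemma test_function_L2: "f \<in> test_functions \<Longrightarrow> foldr rpartial js f \<in> L2 gauss_measure"
  by (intro smooth_L2_L2 smooth_L2_test_function)

lemma test_function_L2': "f \<in> test_functions \<Longrightarrow> f \<in> L2 gauss_measure"
  by (intro smooth_L2_L2' smooth_L2_test_function)

lemma L2_norm_cpartial_diff:
  assumes f: "f \<in> test_functions" and g: "smooth_L2 g"
  shows "L2_norm fock_measure (\<lambda>z. foldr cpartial js (gauss_bargmann f) z - foldr cpartial js (gauss_bargmann g) z)
    = L2_norm gauss_measure (\<lambda>x. foldr rpartial js f x - foldr rpartial js g x)"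
  unfolding foldr_cpartial_gauss_bargmann[OF smooth_L2_test_function[OF f]] foldr_cpartial_gauss_bargmann[OF g]
  using gauss_bargmann_isometry(2)[OF L2_diff[OF test_function_L2[OF f] smooth_L2_L2[OF g]]]
  by (simp add: gauss_bargmann_diff[OF test_function_L2[OF f] smooth_L2_L2[OF g], abs_def])

text \<open>A Cauchy sequence for the Sobolev norm has transforms whose derivatives are Cauchy in \<open>L\<^sup>2\<close> of the
  Fock measure. Their limits are the derivatives of \<open>G f\<close>, because these are already the pointwise limits.
  In particular the limit of the norms depends only on \<open>f\<close>.\<close>

lemma gauss_sobolev_approx_transform:
  assumes appr: "gauss_sobolev_approx m T f"
  shows "gauss_bargmann f \<in> fock_sobolev m" "(\<lambda>k. test_norm m (T k)) \<longlonglongrightarrow> fock_sobolev_norm m (gauss_bargmann f)"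
proof -
  have T: "\<And>k. T k \<in> test_functions" and cau: "\<And>e. e > 0 \<Longrightarrow> \<exists>N. \<forall>k\<ge>N. \<forall>l\<ge>N. test_norm m (\<lambda>x. T k x - T l x) < e"
    and f: "f \<in> L2 gauss_measure" and lim: "(\<lambda>k. L2_norm gauss_measure (\<lambda>x. T k x - f x)) \<longlonglongrightarrow> 0"
    using appr by (auto simp: gauss_sobolev_approx_iff)
  have TF: "gauss_bargmann (T k) \<in> fock_space" for k by (rule gauss_bargmann_isometry(1)[OF test_function_L2'[OF T]])
  have fF: "gauss_bargmann f \<in> fock_space" by (rule gauss_bargmann_isometry(1)[OF f])
  have Glim: "(\<lambda>k. fock_norm (\<lambda>z. gauss_bargmann (T k) z - gauss_bargmann f z)) \<longlonglongrightarrow> 0"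
  proof -
    have "fock_norm (\<lambda>z. gauss_bargmann (T k) z - gauss_bargmann f z) = L2_norm gauss_measure (\<lambda>x. T k x - f x)" for k
      using gauss_bargmann_isometry(2)[OF L2_diff[OF test_function_L2'[OF T] f]]
      by (simp add: fock_norm_eq gauss_bargmann_diff[OF test_function_L2'[OF T] f, abs_def])
    then show ?thesis using lim by simp
  qed
  have DL: "foldr cpartial js (gauss_bargmann (T k)) \<in> L2 fock_measure" for js k
    unfolding foldr_cpartial_gauss_bargmann[OF smooth_L2_test_function[OF T]] by (rule gauss_bargmann_L2[OF test_function_L2[OF T]])
  have Dn: "L2_norm fock_measure (foldr cpartial js (gauss_bargmann (T k))) = L2_norm gauss_measure (foldr rpartial js (T k))" for js k
    unfolding foldr_cpartial_gauss_bargmann[OF smooth_L2_test_function[OF T]] by (rule gauss_bargmann_isometry(2)[OF test_function_L2[OF T]])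
  have main: "foldr cpartial (directions \<alpha>) (gauss_bargmann f) \<in> L2 fock_measure
     \<and> (\<lambda>k. L2_norm fock_measure (\<lambda>z. foldr cpartial (directions \<alpha>) (gauss_bargmann (T k)) z - foldr cpartial (directions \<alpha>) (gauss_bargmann f) z)) \<longlonglongrightarrow> 0"
    if \<alpha>: "\<alpha> \<in> multi_indices m" for \<alpha>
  proof -
    have c: "\<exists>N. \<forall>k\<ge>N. \<forall>l\<ge>N. L2_norm fock_measure (\<lambda>z. foldr cpartial (directions \<alpha>) (gauss_bargmann (T k)) z - foldr cpartial (directions \<alpha>) (gauss_bargmann (T l)) z) < e" if e: "e > 0" for e
    proof -
      have "L2_norm fock_measure (\<lambda>z. foldr cpartial (directions \<alpha>) (gauss_bargmann (T k)) z - foldr cpartial (directions \<alpha>) (gauss_bargmann (T l)) z)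
         \<le> test_norm m (\<lambda>x. T k x - T l x)" for k l
      proof -
        have "L2_norm gauss_measure (foldr rpartial (directions \<alpha>) (\<lambda>x. T k x - T l x)) \<le> test_norm m (\<lambda>x. T k x - T l x)"
          unfolding test_norm_eq by (rule member_le_sum[OF \<alpha>]) (auto simp: finite_multi_indices)
        then show ?thesis
          unfolding L2_norm_cpartial_diff[OF T smooth_L2_test_function[OF T]] foldr_rpartial_diff[OF test_function_smooth[OF T] test_function_smooth[OF T]] .
      qed
      moreover obtain N where "\<forall>k\<ge>N. \<forall>l\<ge>N. test_norm m (\<lambda>x. T k x - T l x) < e" using cau[OF e] by (elim exE)
      ultimately show ?thesis by (meson order_le_less_trans)
    qed
    have m: "foldr cpartial (directions \<alpha>) (gauss_bargmann f) \<in> borel_measurable fock_measure"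
      using foldr_cpartial_fock_measurable[OF fF] by simp
    have ae: "AE z in fock_measure. (\<lambda>k. foldr cpartial (directions \<alpha>) (gauss_bargmann (T (id k))) z) \<longlonglongrightarrow> foldr cpartial (directions \<alpha>) (gauss_bargmann f) z"
      using fock_convergence_pointwise[OF TF fF Glim] by simp
    show ?thesis using L2_Cauchy_AE_limit[OF DL m c strict_mono_id ae] by blast
  qed
  show "gauss_bargmann f \<in> fock_sobolev m" unfolding fock_sobolev_iff using fF main by blast
  have "(\<lambda>k. \<Sum>\<alpha>\<in>multi_indices m. L2_norm fock_measure (foldr cpartial (directions \<alpha>) (gauss_bargmann (T k)))) \<longlonglongrightarrow> fock_sobolev_norm m (gauss_bargmann f)"
    unfolding fock_sobolev_norm_eq
    by (intro tendsto_sum L2_norm_tendsto DL) (use main in blast)+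
  then show "(\<lambda>k. test_norm m (T k)) \<longlonglongrightarrow> fock_sobolev_norm m (gauss_bargmann f)"
    unfolding Dn test_norm_eq .
qed

theorem gauss_bargmann_sobolev_isometry:
  assumes f: "f \<in> gauss_sobolev m"
  shows "gauss_bargmann f \<in> fock_sobolev m" "gauss_sobolev_norm m f = fock_sobolev_norm m (gauss_bargmann f)"
proof -
  obtain T where T: "gauss_sobolev_approx m T f" using f by (auto simp: gauss_sobolev_def)
  show "gauss_bargmann f \<in> fock_sobolev m" by (rule gauss_sobolev_approx_transform(1)[OF T])
  show "gauss_sobolev_norm m f = fock_sobolev_norm m (gauss_bargmann f)"
    unfolding gauss_sobolev_norm_def
  proof (rule the_equality)
    show "\<forall>T. gauss_sobolev_approx m T f \<longrightarrow> (\<lambda>k. test_norm m (T k)) \<longlonglongrightarrow> fock_sobolev_norm m (gauss_bargmann f)"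
      using gauss_sobolev_approx_transform(2) by blast
    fix l assume "\<forall>T. gauss_sobolev_approx m T f \<longrightarrow> (\<lambda>k. test_norm m (T k)) \<longlonglongrightarrow> l"
    then have "(\<lambda>k. test_norm m (T k)) \<longlonglongrightarrow> l" using T by blast
    then show "l = fock_sobolev_norm m (gauss_bargmann f)"
      by (rule LIMSEQ_unique[OF _ gauss_sobolev_approx_transform(2)[OF T]])
  qed
qed

lemma gauss_sobolev_L2: "f \<in> gauss_sobolev m \<Longrightarrow> f \<in> L2 gauss_measure"
  by (auto simp: gauss_sobolev_def gauss_sobolev_approx_iff)

lemma gauss_sobolev_cong_AE:
  assumes f: "f \<in> gauss_sobolev m" and g: "g \<in> borel_measurable borel" and ae: "AE x in lborel. f x = g x"
  shows "g \<in> gauss_sobolev m"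
proof -
  obtain T where T: "gauss_sobolev_approx m T f" using f by (auto simp: gauss_sobolev_def)
  have fL: "f \<in> L2 gauss_measure" by (rule gauss_sobolev_L2[OF f])
  have aeg: "AE x in gauss_measure. f x = g x" using ae by (simp add: AE_gauss_iff)
  have gL: "g \<in> L2 gauss_measure" by (rule L2_AE_eq[OF fL _ aeg]) (use g in simp)
  have "L2_norm gauss_measure (\<lambda>x. T k x - g x) = L2_norm gauss_measure (\<lambda>x. T k x - f x)" for k
  proof (rule L2_norm_cong_AE)
    have Tk: "T k \<in> L2 gauss_measure" using T by (simp add: gauss_sobolev_approx_iff test_function_L2')
    show "(\<lambda>x. T k x - g x) \<in> borel_measurable gauss_measure" using L2_measurable[OF L2_diff[OF Tk gL]] .
    show "(\<lambda>x. T k x - f x) \<in> borel_measurable gauss_measure" using L2_measurable[OF L2_diff[OF Tk fL]] .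
    show "AE x in gauss_measure. T k x - g x = T k x - f x" using aeg by eventually_elim simp
  qed
  then have "gauss_sobolev_approx m T g" using T gL by (simp add: gauss_sobolev_approx_iff)
  then show ?thesis by (auto simp: gauss_sobolev_def)
qed

text \<open>The dilations of \<open>F\<close> converge to \<open>F\<close> in the Fock-Sobolev space and have smooth preimages, each of
  which is approximated by test functions. By the isometry a diagonal sequence is Cauchy for the Sobolev
  norm, and the transform of its limit is \<open>F\<close>.\<close>

theorem gauss_bargmann_surjective:
  fixes F :: "complex^'n::finite \<Rightarrow> complex"
  assumes F: "F \<in> fock_sobolev m"
  shows "\<exists>g\<in>gauss_sobolev m. gauss_bargmann g = F"
proof -
  have FF: "F \<in> fock_space" by (rule fock_sobolev_subset[OF F])
  have DF: "foldr cpartial (directions \<alpha>) F \<in> L2 fock_measure" if "\<alpha> \<in> multi_indices m" for \<alpha>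
    using F that by (simp add: fock_sobolev_iff)
  define r where "r k = 1 - 1 / real (k + 2)" for k
  have r0: "0 < r k" "r k < 1" for k by (simp_all add: r_def)
  have r1: "r k \<le> 1" for k using r0(2)[of k] by simp
  have rlim: "r \<longlonglongrightarrow> 1"
  proof -
    have "(\<lambda>k. 1 - 1 / real (k + 2)) \<longlonglongrightarrow> 1 - 0"
      by (intro tendsto_intros LIMSEQ_ignore_initial_segment[OF lim_1_over_n])
    then show ?thesis by (simp add: r_def[abs_def])
  qed
  have "\<exists>h. \<forall>k. smooth_L2 (h k) \<and> gauss_bargmann (h k) = comp_op (of_real (r k)) F"
    by (rule choice, rule allI, rule dilation_preimage[OF FF r0])
  then obtain h where hh: "\<forall>k. smooth_L2 (h k) \<and> gauss_bargmann (h k) = comp_op (of_real (r k)) F"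
    by (elim exE)
  have h: "smooth_L2 (h k)" and Gh: "gauss_bargmann (h k) = comp_op (of_real (r k)) F" for k
    using hh by simp_all
  have "\<exists>T\<in>test_functions. \<forall>\<alpha>\<in>multi_indices m. L2_norm gauss_measure (\<lambda>x. foldr rpartial (directions \<alpha>) T x - foldr rpartial (directions \<alpha>) (h k) x) < 1 / real (Suc k)" for k
  proof -
    obtain T where T: "\<And>l. T l \<in> test_functions"
      and lim: "\<And>js. (\<lambda>l. L2_norm gauss_measure (\<lambda>x. foldr rpartial js (T l) x - foldr rpartial js (h k) x)) \<longlonglongrightarrow> 0"
      by (rule smooth_L2_approximation[OF h[of k]]) (rule that; assumption)
    have "\<forall>\<^sub>F l in sequentially. \<forall>\<alpha>\<in>multi_indices m. L2_norm gauss_measure (\<lambda>x. foldr rpartial (directions \<alpha>) (T l) x - foldr rpartial (directions \<alpha>) (h k) x) < 1 / real (Suc k)"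
      by (rule eventually_ball_finite[OF finite_multi_indices], rule ballI, rule order_tendstoD(2)[OF lim]) simp
    then obtain l where "\<forall>\<alpha>\<in>multi_indices m. L2_norm gauss_measure (\<lambda>x. foldr rpartial (directions \<alpha>) (T l) x - foldr rpartial (directions \<alpha>) (h k) x) < 1 / real (Suc k)"
      by (auto simp: eventually_sequentially)
    then show ?thesis using T[of l] by (intro bexI)
  qed
  then have "\<exists>T. \<forall>k. T k \<in> test_functions \<and> (\<forall>\<alpha>\<in>multi_indices m. L2_norm gauss_measure (\<lambda>x. foldr rpartial (directions \<alpha>) (T k) x - foldr rpartial (directions \<alpha>) (h k) x) < 1 / real (Suc k))"
    by (intro choice allI) (simp add: Bex_def)
  then obtain T where TT: "\<forall>k. T k \<in> test_functions \<and> (\<forall>\<alpha>\<in>multi_indices m. L2_norm gauss_measure (\<lambda>x. foldr rpartial (directions \<alpha>) (T k) x - foldr rpartial (directions \<alpha>) (h k) x) < 1 / real (Suc k))"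
    by (elim exE)
  have T: "T k \<in> test_functions" for k using TT by (elim allE[of _ k] conjE)
  have Th: "L2_norm gauss_measure (\<lambda>x. foldr rpartial (directions \<alpha>) (T k) x - foldr rpartial (directions \<alpha>) (h k) x) < 1 / real (Suc k)"
    if "\<alpha> \<in> multi_indices m" for k \<alpha>
    using TT that by blast
  have DL: "foldr cpartial js (gauss_bargmann f) \<in> L2 fock_measure" if "smooth_L2 f" for js and f :: "real^'n \<Rightarrow> complex"
    unfolding foldr_cpartial_gauss_bargmann[OF that] by (rule gauss_bargmann_L2[OF smooth_L2_L2[OF that]])
  have Dlim: "(\<lambda>k. L2_norm fock_measure (\<lambda>z. foldr cpartial (directions \<alpha>) (gauss_bargmann (T k)) z - foldr cpartial (directions \<alpha>) F z)) \<longlonglongrightarrow> 0"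
    if \<alpha>: "\<alpha> \<in> multi_indices m" for \<alpha>
  proof (rule tendsto_sandwich[OF _ _ tendsto_const])
    have 1: "(\<lambda>k. 1 / real (Suc k)) \<longlonglongrightarrow> 0" by (rule LIMSEQ_Suc[OF lim_1_over_n])
    have 2: "(\<lambda>k. L2_norm fock_measure (\<lambda>z. foldr cpartial (directions \<alpha>) (comp_op (of_real (r k)) F) z - foldr cpartial (directions \<alpha>) F z)) \<longlonglongrightarrow> 0"
      by (rule dilation_converges[OF FF DF[OF \<alpha>] r0(1) r1 rlim])
    show "(\<lambda>k. 1 / real (Suc k) + L2_norm fock_measure (\<lambda>z. foldr cpartial (directions \<alpha>) (comp_op (of_real (r k)) F) z - foldr cpartial (directions \<alpha>) F z)) \<longlonglongrightarrow> 0"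
      using tendsto_add[OF 1 2] by simp
    have "L2_norm fock_measure (\<lambda>z. foldr cpartial (directions \<alpha>) (gauss_bargmann (T k)) z - foldr cpartial (directions \<alpha>) F z)
      \<le> 1 / real (Suc k) + L2_norm fock_measure (\<lambda>z. foldr cpartial (directions \<alpha>) (comp_op (of_real (r k)) F) z - foldr cpartial (directions \<alpha>) F z)" for k
      using L2_norm_triangle_diff[OF DL[OF smooth_L2_test_function[OF T], of "directions \<alpha>" k] DL[OF h, of "directions \<alpha>" k] DF[OF \<alpha>]]
        Th[OF \<alpha>, of k] L2_norm_cpartial_diff[OF T h, of "directions \<alpha>" k k]
      unfolding Gh by linarith
    then show "\<forall>\<^sub>F k in sequentially. L2_norm fock_measure (\<lambda>z. foldr cpartial (directions \<alpha>) (gauss_bargmann (T k)) z - foldr cpartial (directions \<alpha>) F z)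
      \<le> 1 / real (Suc k) + L2_norm fock_measure (\<lambda>z. foldr cpartial (directions \<alpha>) (comp_op (of_real (r k)) F) z - foldr cpartial (directions \<alpha>) F z)"
      by (rule always_eventually[OF allI])
  qed simp
  have Rcau: "\<exists>N. \<forall>k\<ge>N. \<forall>l\<ge>N. L2_norm gauss_measure (\<lambda>x. foldr rpartial (directions \<alpha>) (T k) x - foldr rpartial (directions \<alpha>) (T l) x) < e"
    if "\<alpha> \<in> multi_indices m" "e > 0" for \<alpha> e
    using L2_convergent_imp_Cauchy[OF DL[OF smooth_L2_test_function[OF T]] DF[OF that(1)] Dlim[OF that(1)] that(2)]
    unfolding L2_norm_cpartial_diff[OF T smooth_L2_test_function[OF T]] .
  have cau: "\<exists>N. \<forall>k\<ge>N. \<forall>l\<ge>N. test_norm m (\<lambda>x. T k x - T l x) < e" if e: "e > 0" for e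
  proof -
    define c where "c = card (multi_indices m :: ('n \<Rightarrow> nat) set)"
    define d where "d = e / real (Suc c)"
    have d: "d > 0" using e by (simp add: d_def)
    have "\<forall>\<alpha>\<in>multi_indices m. \<exists>N. \<forall>k\<ge>N. \<forall>l\<ge>N. L2_norm gauss_measure (\<lambda>x. foldr rpartial (directions \<alpha>) (T k) x - foldr rpartial (directions \<alpha>) (T l) x) < d"
      using Rcau[OF _ d] by (intro ballI)
    from bchoice[OF this] obtain N where N: "\<forall>\<alpha>\<in>multi_indices m. \<forall>k\<ge>N \<alpha>. \<forall>l\<ge>N \<alpha>. L2_norm gauss_measure (\<lambda>x. foldr rpartial (directions \<alpha>) (T k) x - foldr rpartial (directions \<alpha>) (T l) x) < d"
      by (elim exE)
    define N0 where "N0 = Max (N ` multi_indices m)"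
    have N0: "N \<alpha> \<le> N0" if "\<alpha> \<in> multi_indices m" for \<alpha>
      unfolding N0_def using that by (intro Max_ge) (auto simp: finite_multi_indices)
    have "test_norm m (\<lambda>x. T k x - T l x) < e" if "k \<ge> N0" "l \<ge> N0" for k l
    proof -
      have "test_norm m (\<lambda>x. T k x - T l x) = (\<Sum>\<alpha>\<in>multi_indices m. L2_norm gauss_measure (\<lambda>x. foldr rpartial (directions \<alpha>) (T k) x - foldr rpartial (directions \<alpha>) (T l) x))"
        unfolding test_norm_eq foldr_rpartial_diff[OF test_function_smooth[OF T] test_function_smooth[OF T]] ..
      also have "\<dots> \<le> (\<Sum>\<alpha>\<in>(multi_indices m :: ('n \<Rightarrow> nat) set). d)"
      proof (rule sum_mono)
        fix \<alpha> :: "'n \<Rightarrow> nat" assume \<alpha>: "\<alpha> \<in> multi_indices m"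
        have "k \<ge> N \<alpha>" "l \<ge> N \<alpha>" using N0[OF \<alpha>] that by auto
        then show "L2_norm gauss_measure (\<lambda>x. foldr rpartial (directions \<alpha>) (T k) x - foldr rpartial (directions \<alpha>) (T l) x) \<le> d"
          using bspec[OF N \<alpha>] by (intro less_imp_le) simp
      qed
      also have "\<dots> = real c * d" by (simp add: c_def)
      also have "\<dots> < real (Suc c) * d" using d by simp
      also have "\<dots> = e" by (simp add: d_def)
      finally show ?thesis .
    qed
    then show ?thesis by (intro exI[of _ N0]) simp
  qed
  have TL: "T k \<in> L2 gauss_measure" for k by (rule test_function_L2'[OF T])
  have "\<exists>g\<in>L2 gauss_measure. (\<lambda>k. L2_norm gauss_measure (\<lambda>x. T k x - g x)) \<longlonglongrightarrow> 0"
    by (rule gauss.L2_complete[OF TL]) (use Rcau[OF zero_in_multi_indices] in simp)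
  then obtain g where g: "g \<in> L2 gauss_measure" and glim: "(\<lambda>k. L2_norm gauss_measure (\<lambda>x. T k x - g x)) \<longlonglongrightarrow> 0" by (elim bexE)
  have appr: "gauss_sobolev_approx m T g" unfolding gauss_sobolev_approx_iff using T cau g glim by blast
  have TF: "gauss_bargmann (T k) \<in> fock_space" for k by (rule gauss_bargmann_isometry(1)[OF TL])
  have gF: "gauss_bargmann g \<in> fock_space" by (rule gauss_bargmann_isometry(1)[OF g])
  have "gauss_bargmann g z = F z" for z
  proof -
    have "fock_norm (\<lambda>z. gauss_bargmann (T k) z - gauss_bargmann g z) = L2_norm gauss_measure (\<lambda>x. T k x - g x)" for k
      using gauss_bargmann_isometry(2)[OF L2_diff[OF TL g]]
      by (simp add: fock_norm_eq gauss_bargmann_diff[OF TL g, abs_def])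
    then have 1: "(\<lambda>k. fock_norm (\<lambda>z. gauss_bargmann (T k) z - gauss_bargmann g z)) \<longlonglongrightarrow> 0" using glim by simp
    have 2: "(\<lambda>k. fock_norm (\<lambda>z. gauss_bargmann (T k) z - F z)) \<longlonglongrightarrow> 0"
      using Dlim[OF zero_in_multi_indices] by (simp add: fock_norm_eq)
    show ?thesis
      using LIMSEQ_unique[OF fock_convergence_pointwise[OF TF gF 1, of "[]" z] fock_convergence_pointwise[OF TF FF 2, of "[]" z]]
      by simp
  qed
  then have "gauss_bargmann g = F" by (rule ext)
  moreover have "g \<in> gauss_sobolev m" using appr by (auto simp: gauss_sobolev_def)
  ultimately show ?thesis by (rule bexI)
qed

section \<open>The integral operator as a multiplication\<close>

lemma ii_mult: "\<i> * (\<i> * x) = - x"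
  by (simp add: mult.assoc[symmetric])

text \<open>The factor \<open>exp (z \<cdot> cnj w) \<phi> (z - cnj w)\<close> of the integrand, with \<open>w\<close> rotated by \<open>\<i>\<close>, is the conjugate of the
  transform of an explicit function \<open>v\<close>, which is \<open>u\<close> times an exponential up to conjugation. So
  \<open>S\<^sub>\<phi> f z\<close> is an inner product of two transforms. As \<open>G\<close> preserves inner products, it equals the integral
  of \<open>g\<close> against \<open>cnj v\<close>, which is the transform of \<open>u g\<close> at \<open>\<i> z\<close>. The argument needs \<open>v\<close> to be square
  integrable.\<close>

lemma S_op_transform:
  fixes g u :: "real^'n::finite \<Rightarrow> complex"
  assumes g: "g \<in> L2 gauss_measure" and u: "u \<in> L2 gauss_measure"
    and uz: "(\<lambda>x. u x * exp (\<i> * cdot (cvec x) z)) \<in> L2 gauss_measure"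
  shows "integrable fock_measure (S_integrand (comp_op \<i> (gauss_bargmann u)) (comp_op \<i> (gauss_bargmann g)) z)"
    and "S_op (comp_op \<i> (gauss_bargmann u)) (comp_op \<i> (gauss_bargmann g)) z = gauss_bargmann (mult_op u g) (\<i> *s z)"
proof -
  define v where "v x = cnj (exp (cdot z z / 2) * (u x * exp (\<i> * cdot (cvec x) z)))" for x
  have v: "v \<in> L2 gauss_measure" unfolding v_def by (intro L2_cnj L2_cmult uz)
  have Gv: "cnj (gauss_bargmann v w) = exp (\<i> * cdot z (vcnj w)) * gauss_bargmann u (\<i> *s z + vcnj w)" for w
  proof -
    have ck: "cnj (bargmann_kernel x w) = bargmann_kernel x (vcnj w)" for x
      by (simp add: bargmann_kernel_def exp_cnj cnj_cdot)
    have "cnj (v x * bargmann_kernel x w) = exp (\<i> * cdot z (vcnj w)) * (u x * bargmann_kernel x (\<i> *s z + vcnj w))" for x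
    proof -
      have "cdot z z / 2 + \<i> * cdot (cvec x) z + (cdot (cvec x) (vcnj w) - cdot (vcnj w) (vcnj w) / 2)
        = \<i> * cdot z (vcnj w) + (cdot (cvec x) (\<i> *s z + vcnj w) - cdot (\<i> *s z + vcnj w) (\<i> *s z + vcnj w) / 2)"
        by (simp add: cdot_add_left cdot_add_right cdot_smult_left cdot_smult_right cdot_commute[of "vcnj w" z] ii_mult field_simps)
      then have "exp (cdot z z / 2) * exp (\<i> * cdot (cvec x) z) * bargmann_kernel x (vcnj w) = exp (\<i> * cdot z (vcnj w)) * bargmann_kernel x (\<i> *s z + vcnj w)"
        unfolding bargmann_kernel_def by (simp only: exp_add[symmetric])
      moreover have "cnj (v x * bargmann_kernel x w) = u x * (exp (cdot z z / 2) * exp (\<i> * cdot (cvec x) z) * bargmann_kernel x (vcnj w))"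
        unfolding complex_cnj_mult ck v_def complex_cnj_cnj by (simp only: mult_ac)
      ultimately show ?thesis by (simp only: mult_ac)
    qed
    then have "(LINT x|gauss_measure. cnj (v x * bargmann_kernel x w)) = exp (\<i> * cdot z (vcnj w)) * gauss_bargmann u (\<i> *s z + vcnj w)"
      unfolding gauss_bargmann_eq by (simp only: integral_mult_right_zero)
    then show ?thesis unfolding gauss_bargmann_eq Bochner_Integration.integral_cnj .
  qed
  define Q where "Q w = gauss_bargmann g w * cnj (gauss_bargmann v w)" for w
  have SQ: "S_integrand (comp_op \<i> (gauss_bargmann u)) (comp_op \<i> (gauss_bargmann g)) z w = Q (\<i> *s w)" for w
  proof -
    have vi: "vcnj (\<i> *s w) = (- \<i>) *s vcnj w" by (simp add: vec_eq_iff)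
    have "\<i> * cdot z (vcnj (\<i> *s w)) = cdot z (vcnj w)"
      unfolding vi cdot_smult_right by (simp add: mult.assoc[symmetric])
    moreover have "\<i> *s z + vcnj (\<i> *s w) = \<i> *s (z - vcnj w)"
      unfolding vi by (simp add: vec_eq_iff algebra_simps)
    ultimately show ?thesis unfolding Q_def Gv S_integrand_def comp_op_def by (simp only: mult.assoc)
  qed
  have Qi: "integrable fock_measure Q"
    unfolding Q_def by (rule L2_mult_integrable[OF gauss_bargmann_L2[OF g] L2_cnj[OF gauss_bargmann_L2[OF v]]])
  have Qm: "Q \<in> borel_measurable borel" using borel_measurable_integrable[OF Qi] by simp
  show "integrable fock_measure (S_integrand (comp_op \<i> (gauss_bargmann u)) (comp_op \<i> (gauss_bargmann g)) z)"
    unfolding SQ[abs_def] by (rule integrable_fock_rotate[OF _ Qi]) simp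
  have "S_op (comp_op \<i> (gauss_bargmann u)) (comp_op \<i> (gauss_bargmann g)) z = (LINT w|fock_measure. Q (\<i> *s w))"
    unfolding S_op_def SQ ..
  also have "\<dots> = (LINT w|fock_measure. Q w)" by (rule integral_fock_rotate[OF _ Qm]) simp
  also have "\<dots> = (LINT x|gauss_measure. g x * cnj (v x))" unfolding Q_def by (rule gauss_bargmann_inner[OF g v])
  also have "\<dots> = gauss_bargmann (mult_op u g) (\<i> *s z)"
    unfolding gauss_bargmann_eq
  proof (rule Bochner_Integration.integral_cong[OF refl])
    fix x
    have "cdot z z / 2 + \<i> * cdot (cvec x) z = cdot (cvec x) (\<i> *s z) - cdot (\<i> *s z) (\<i> *s z) / 2"
      by (simp add: cdot_smult_left cdot_smult_right mult.assoc[symmetric])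
    then have "exp (cdot z z / 2) * exp (\<i> * cdot (cvec x) z) = bargmann_kernel x (\<i> *s z)"
      unfolding bargmann_kernel_def by (simp only: exp_add[symmetric])
    then show "g x * cnj (v x) = mult_op u g x * bargmann_kernel x (\<i> *s z)"
      unfolding v_def complex_cnj_cnj mult_op_def by (simp only: mult_ac)
  qed
  finally show "S_op (comp_op \<i> (gauss_bargmann u)) (comp_op \<i> (gauss_bargmann g)) z = gauss_bargmann (mult_op u g) (\<i> *s z)" .
qed

text \<open>For real \<open>y\<close> the exponential has modulus one, so at real points the identity above holds for every
  square integrable \<open>u\<close>.\<close>

lemma L2_mult_character:
  assumes u: "u \<in> L2 gauss_measure"
  shows "(\<lambda>x. u x * exp (\<i> * cdot (cvec x) (cvec y))) \<in> L2 gauss_measure"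
proof -
  have "(\<lambda>x. exp (\<i> * cdot (cvec x) (cvec y)) * u x) \<in> L2 gauss_measure"
  proof (rule L2_mult_bounded[OF u, where B=1])
    have "(\<lambda>x. exp (\<i> * cdot (cvec x) (cvec y))) \<in> borel_measurable borel" by measurable
    then show "(\<lambda>x. exp (\<i> * cdot (cvec x) (cvec y))) \<in> borel_measurable gauss_measure" by simp
    show "norm (exp (\<i> * cdot (cvec x) (cvec y))) \<le> 1" for x by simp
  qed
  then show ?thesis by (simp only: mult.commute)
qed

lemma comp_op_comp_op: "comp_op c (comp_op d f) = comp_op (d * c) f"
  by (simp add: comp_op_def fun_eq_iff vector_smult_assoc)

lemma comp_op_one: "comp_op 1 f = f"
  by (simp add: comp_op_def fun_eq_iff)

lemma comp_op_inverse: "comp_op \<i> (comp_op (- \<i>) f) = f" "comp_op (- \<i>) (comp_op \<i> f) = f"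
  by (simp_all add: comp_op_comp_op comp_op_one)

lemma norm_ii: "norm \<i> = 1" "norm (- \<i>) = 1"
  by simp_all

lemma fock_space_sobolev_0: "F \<in> fock_space \<Longrightarrow> F \<in> fock_sobolev 0"
proof -
  assume F: "F \<in> fock_space"
  have "foldr cpartial (directions \<alpha>) F \<in> L2 fock_measure" if "\<alpha> \<in> multi_indices 0" for \<alpha>
  proof -
    have "\<alpha> = (\<lambda>j. 0)" using that by (auto simp: multi_indices_def fun_eq_iff)
    then show ?thesis using fock_space_L2[OF F] by simp
  qed
  with F show ?thesis by (simp add: fock_sobolev_iff)
qed

lemma mult_op_measurable:
  "u \<in> L2 gauss_measure \<Longrightarrow> g \<in> L2 gauss_measure \<Longrightarrow> mult_op u g \<in> borel_measurable borel"
  unfolding mult_op_def[abs_def] by (intro borel_measurable_times) (simp_all add: L2_def)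

lemma mult_op_integrable:
  "u \<in> L2 gauss_measure \<Longrightarrow> g \<in> L2 gauss_measure \<Longrightarrow> integrable gauss_measure (mult_op u g)"
  unfolding mult_op_def[abs_def] by (rule L2_mult_integrable)

text \<open>On a compact set the Gauss density is bounded below by a positive constant.\<close>

lemma gauss_L2_locally_integrable:
  fixes u :: "real^'n::finite \<Rightarrow> complex"
  assumes u: "u \<in> L2 gauss_measure"
  shows "locally_integrable u"
  unfolding locally_integrable_def
proof (intro allI impI)
  fix K :: "(real^'n) set" assume K: "compact K"
  have um: "u \<in> borel_measurable borel" using u by (simp add: L2_def)
  have ui: "integrable lborel (\<lambda>x. gauss_density x *\<^sub>R u x)"
    using gauss.integrable_L2[OF u] integrable_gauss_iff[OF um] by simp
  have "compact (norm ` K)" by (rule compact_continuous_image[OF continuous_on_norm_id K])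
  then have "bounded (norm ` K)" by (rule compact_imp_bounded)
  then obtain R where R: "\<forall>y\<in>norm ` K. norm y \<le> R" unfolding bounded_iff by (elim exE)
  define c where "c = exp (R\<^sup>2 / 2) * sqrt (2 * pi) ^ CARD('n)"
  have c: "1 \<le> c * gauss_density x" if "x \<in> K" for x
  proof -
    have "norm x \<le> R" using R that by simp
    then have "(norm x)\<^sup>2 \<le> R\<^sup>2" by (intro power_mono) simp_all
    then have "1 \<le> exp (R\<^sup>2 / 2 + - (norm x)\<^sup>2 / 2)" by simp
    also have "\<dots> = c * gauss_density x" unfolding exp_add by (simp add: c_def gauss_density_def)
    finally show ?thesis .
  qed
  have Km: "K \<in> sets borel" by (rule borel_compact[OF K])
  show "set_integrable lborel K u"
    unfolding set_integrable_def
  proof (rule Bochner_Integration.integrable_bound[OF integrable_mult_right[OF integrable_norm[OF ui], of c]])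
    show "(\<lambda>x. indicat_real K x *\<^sub>R u x) \<in> borel_measurable lborel" using um Km by simp
    show "AE x in lborel. norm (indicat_real K x *\<^sub>R u x) \<le> norm (c * norm (gauss_density x *\<^sub>R u x))"
    proof (rule AE_I2)
      fix x
      show "norm (indicat_real K x *\<^sub>R u x) \<le> norm (c * norm (gauss_density x *\<^sub>R u x))"
      proof (cases "x \<in> K")
        case True
        have "1 * norm (u x) \<le> (c * gauss_density x) * norm (u x)" by (rule mult_right_mono[OF c[OF True]]) simp
        moreover have "(c * gauss_density x) * norm (u x) \<le> \<bar>c * norm (gauss_density x *\<^sub>R u x)\<bar>"
          by (simp add: abs_of_pos)
        ultimately show ?thesis using True by simp
      qed simp
    qed
  qed
qed

lemma gauss_bargmann_inv:
  fixes F :: "complex^'n::finite \<Rightarrow> complex"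
  assumes "F \<in> fock_sobolev m"
  shows "gauss_bargmann_inv m F \<in> gauss_sobolev m" "gauss_bargmann (gauss_bargmann_inv m F) = F"
proof -
  obtain g where g: "g \<in> gauss_sobolev m" "gauss_bargmann g = F"
    using gauss_bargmann_surjective[OF assms] by (elim bexE)
  have "F \<in> gauss_bargmann ` gauss_sobolev m" unfolding g(2)[symmetric] by (rule imageI[OF g(1)])
  then show "gauss_bargmann_inv m F \<in> gauss_sobolev m" "gauss_bargmann (gauss_bargmann_inv m F) = F"
    unfolding gauss_bargmann_inv_def by (rule inv_into_into, rule f_inv_into_f)
qed

text \<open>The symbol determines \<open>u\<close> as the preimage of \<open>C\<^sub>-\<^sub>\<i> \<phi>\<close>, which is only known to be square integrable. For
  \<open>g\<close> in the Sobolev space, boundedness of \<open>S\<^sub>\<phi>\<close> provides a function \<open>h\<close> in the Sobolev space whose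
  transform is \<open>C\<^sub>-\<^sub>\<i> S\<^sub>\<phi> C\<^sub>\<i> G g\<close>. The transforms of \<open>h\<close> and of \<open>u g\<close> agree on \<open>\<i> \<real>\<^sup>n\<close>, which forces
  \<open>h = u g\<close> almost everywhere.\<close>

theorem bounded_imp_multiplier:
  fixes \<phi> :: "complex^'n::finite \<Rightarrow> complex"
  assumes \<phi>: "\<phi> \<in> fock_space" and S: "S_bounded m \<phi>"
  shows "\<exists>u. multiplier m u \<and> S_represented_by m \<phi> u"
proof -
  obtain C where SC: "\<And>f. f \<in> fock_sobolev m \<Longrightarrow> S_op \<phi> f \<in> fock_sobolev m \<and> fock_sobolev_norm m (S_op \<phi> f) \<le> C * fock_sobolev_norm m f"
    using S unfolding S_bounded_def bounded_op_def by auto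
  obtain u where uW: "u \<in> gauss_sobolev 0" and Gu: "gauss_bargmann u = comp_op (- \<i>) \<phi>"
    using gauss_bargmann_surjective[OF fock_space_sobolev_0[OF comp_op_rotate_fock_space[OF norm_ii(2) \<phi>]]] by (elim bexE)
  have u: "u \<in> L2 gauss_measure" by (rule gauss_sobolev_L2[OF uW])
  have \<phi>u: "\<phi> = comp_op \<i> (gauss_bargmann u)" by (simp add: Gu comp_op_inverse)
  have key: "mult_op u g \<in> gauss_sobolev m \<and> gauss_bargmann (mult_op u g) = comp_op (- \<i>) (S_op \<phi> (comp_op \<i> (gauss_bargmann g)))"
    if gW: "g \<in> gauss_sobolev m" for g :: "real^'n \<Rightarrow> complex"
  proof -
    have g: "g \<in> L2 gauss_measure" by (rule gauss_sobolev_L2[OF gW])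
    define f where "f = comp_op \<i> (gauss_bargmann g)"
    have f: "f \<in> fock_sobolev m"
      unfolding f_def by (rule comp_op_rotate_fock_sobolev(1)[OF norm_ii(1) gauss_bargmann_sobolev_isometry(1)[OF gW]])
    have Sf: "comp_op (- \<i>) (S_op \<phi> f) \<in> fock_sobolev m"
      by (rule comp_op_rotate_fock_sobolev(1)[OF norm_ii(2)]) (use SC[OF f] in simp)
    obtain h where hW: "h \<in> gauss_sobolev m" and Gh: "gauss_bargmann h = comp_op (- \<i>) (S_op \<phi> f)"
      using gauss_bargmann_surjective[OF Sf] by (elim bexE)
    have h: "h \<in> L2 gauss_measure" by (rule gauss_sobolev_L2[OF hW])
    have "AE x in lborel. h x = mult_op u g x"
    proof (rule gauss_bargmann_unique[OF gauss.integrable_L2[OF h] mult_op_integrable[OF u g]])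
      fix y :: "real^'n"
      have "gauss_bargmann h (\<i> *s cvec y) = S_op \<phi> f (cvec y)"
        unfolding Gh comp_op_def by (simp add: vector_smult_assoc)
      also have "\<dots> = gauss_bargmann (mult_op u g) (\<i> *s cvec y)"
        unfolding \<phi>u f_def by (rule S_op_transform(2)[OF g u L2_mult_character[OF u]])
      finally show "gauss_bargmann h (\<i> *s cvec y) = gauss_bargmann (mult_op u g) (\<i> *s cvec y)" .
    qed
    then have "mult_op u g \<in> gauss_sobolev m" "gauss_bargmann (mult_op u g) = gauss_bargmann h"
      using gauss_sobolev_cong_AE[OF hW mult_op_measurable[OF u g]]
        gauss_bargmann_cong_AE[of h "mult_op u g"] mult_op_measurable[OF u g] h by (simp_all add: L2_def)
    then show ?thesis by (simp add: Gh f_def)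
  qed
  have "bounded_op (gauss_sobolev m) (gauss_sobolev_norm m) (mult_op u)"
    unfolding bounded_op_def
  proof (intro exI ballI conjI)
    fix g :: "real^'n \<Rightarrow> complex" assume gW: "g \<in> gauss_sobolev m"
    have G: "gauss_bargmann g \<in> fock_sobolev m" by (rule gauss_bargmann_sobolev_isometry(1)[OF gW])
    have f: "comp_op \<i> (gauss_bargmann g) \<in> fock_sobolev m" by (rule comp_op_rotate_fock_sobolev(1)[OF norm_ii(1) G])
    show "mult_op u g \<in> gauss_sobolev m" using key[OF gW] by simp
    then have "gauss_sobolev_norm m (mult_op u g) = fock_sobolev_norm m (comp_op (- \<i>) (S_op \<phi> (comp_op \<i> (gauss_bargmann g))))"
      using key[OF gW] by (simp add: gauss_bargmann_sobolev_isometry(2))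
    also have "\<dots> = fock_sobolev_norm m (S_op \<phi> (comp_op \<i> (gauss_bargmann g)))"
      by (rule comp_op_rotate_fock_sobolev(2)[OF norm_ii(2)]) (use SC[OF f] in simp)
    also have "\<dots> \<le> C * fock_sobolev_norm m (comp_op \<i> (gauss_bargmann g))" using SC[OF f] by simp
    also have "\<dots> = C * gauss_sobolev_norm m g"
      by (simp add: comp_op_rotate_fock_sobolev(2)[OF norm_ii(1) G] gauss_bargmann_sobolev_isometry(2)[OF gW])
    finally show "gauss_sobolev_norm m (mult_op u g) \<le> C * gauss_sobolev_norm m g" .
  qed
  then have "multiplier m u" by (simp add: multiplier_def gauss_L2_locally_integrable[OF u])
  moreover have "S_represented_by m \<phi> u"
    unfolding S_represented_by_def
  proof
    fix f :: "complex^'n \<Rightarrow> complex" assume f: "f \<in> fock_sobolev m"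
    define g where "g = gauss_bargmann_inv m (comp_op (- \<i>) f)"
    have gW: "g \<in> gauss_sobolev m" and Gg: "gauss_bargmann g = comp_op (- \<i>) f"
      unfolding g_def by (rule gauss_bargmann_inv[OF comp_op_rotate_fock_sobolev(1)[OF norm_ii(2) f]])+
    show "S_op \<phi> f = (comp_op \<i> \<circ> gauss_bargmann \<circ> mult_op u \<circ> gauss_bargmann_inv m \<circ> comp_op (- \<i>)) f"
      using key[OF gW] by (simp add: g_def[symmetric] Gg comp_op_inverse)
  qed
  ultimately show ?thesis by blast
qed

section \<open>Multipliers are essentially bounded\<close>

lemma gauss_bargmann_one: "gauss_bargmann (\<lambda>x. 1) = (\<lambda>z. 1)"
proof
  fix z
  have "bargmann_kernel x z = exp (- cdot z z / 2) * exp (cdot (cvec x) z)" for x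
    by (simp add: bargmann_kernel_def exp_add[symmetric])
  then have "gauss_bargmann (\<lambda>x. 1) z = exp (- cdot z z / 2) * (LINT x|gauss_measure. exp (cdot (cvec x) z))"
    unfolding gauss_bargmann_eq by (simp only: mult_1 integral_mult_right_zero)
  also have "\<dots> = exp (- cdot z z / 2) * exp (cdot z z / 2)"
    by (simp only: has_bochner_integral_integral_eq[OF gauss_exponential])
  also have "\<dots> = 1" by (simp add: exp_add[symmetric])
  finally show "gauss_bargmann (\<lambda>x. 1) z = 1" .
qed

lemma one_gauss_L2: "(\<lambda>x. 1) \<in> L2 (gauss_measure :: (real^'n::finite) measure)"
  by (simp add: L2_def)

lemma one_fock_sobolev: "(\<lambda>z. 1) \<in> fock_sobolev m"
proof -
  have "(\<lambda>z::complex^'a. 1) \<in> fock_space" using gauss_bargmann_isometry(1)[OF one_gauss_L2] by (simp add: gauss_bargmann_one)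
  moreover have "foldr cpartial js (\<lambda>z::complex^'a. 1) \<in> L2 fock_measure" for js
  proof -
    have "\<exists>c. foldr cpartial js (\<lambda>z::complex^'a. 1) = (\<lambda>z. c)"
      by (induction js) (auto simp: cpartial_def[abs_def])
    then obtain c where "foldr cpartial js (\<lambda>z::complex^'a. 1) = (\<lambda>z. c)" by (elim exE)
    then show ?thesis by (simp add: L2_def)
  qed
  ultimately show ?thesis by (simp add: fock_sobolev_iff)
qed

lemma one_gauss_sobolev: "(\<lambda>x::real^'n::finite. 1) \<in> gauss_sobolev m"
proof -
  define g where "g = gauss_bargmann_inv m (\<lambda>z::complex^'n. 1)"
  have g: "g \<in> gauss_sobolev m" "gauss_bargmann g = (\<lambda>z. 1)"
    unfolding g_def by (rule gauss_bargmann_inv[OF one_fock_sobolev])+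
  have "AE x in lborel. g x = 1"
    by (rule gauss_bargmann_unique[OF gauss.integrable_L2[OF gauss_sobolev_L2[OF g(1)]] gauss.integrable_L2[OF one_gauss_L2]])
       (simp add: g(2) gauss_bargmann_one)
  then show ?thesis by (intro gauss_sobolev_cong_AE[OF g(1)]) simp_all
qed

text \<open>Evaluate the representation at the constant function 1. Its preimage is 1 almost everywhere, so
  the right side is \<open>C\<^sub>\<i> G u\<close>, whereas the left side at real points is \<open>C\<^sub>\<i> G u'\<close> for the preimage \<open>u'\<close> of
  \<open>C\<^sub>-\<^sub>\<i> \<phi>\<close>. Uniqueness on \<open>\<i> \<real>\<^sup>n\<close> identifies \<open>u\<close> and \<open>u'\<close>.\<close>

theorem represented_symbol:
  fixes \<phi> :: "complex^'n::finite \<Rightarrow> complex"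
  assumes \<phi>: "\<phi> \<in> fock_space" and u: "multiplier m u" and rep: "S_represented_by m \<phi> u"
  shows "u \<in> L2 gauss_measure" "\<phi> = comp_op \<i> (gauss_bargmann u)"
proof -
  have "mult_op u (\<lambda>x. 1) \<in> gauss_sobolev m"
    using u one_gauss_sobolev[of m] unfolding multiplier_def bounded_op_def by blast
  then have "u \<in> gauss_sobolev m" by (simp add: mult_op_def[abs_def])
  then show uL: "u \<in> L2 gauss_measure" by (rule gauss_sobolev_L2)
  obtain u' where u'W: "u' \<in> gauss_sobolev 0" and Gu': "gauss_bargmann u' = comp_op (- \<i>) \<phi>"
    using gauss_bargmann_surjective[OF fock_space_sobolev_0[OF comp_op_rotate_fock_space[OF norm_ii(2) \<phi>]]] by (elim bexE)
  have u'L: "u' \<in> L2 gauss_measure" by (rule gauss_sobolev_L2[OF u'W])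
  have \<phi>u': "\<phi> = comp_op \<i> (gauss_bargmann u')" by (simp add: Gu' comp_op_inverse)
  have one: "comp_op c (\<lambda>z::complex^'n. 1) = (\<lambda>z. 1)" for c by (simp add: comp_op_def[abs_def])
  define g where "g = gauss_bargmann_inv m (\<lambda>z::complex^'n. 1)"
  have gW: "g \<in> gauss_sobolev m" and Gg: "gauss_bargmann g = (\<lambda>z. 1)"
    unfolding g_def by (rule gauss_bargmann_inv[OF one_fock_sobolev])+
  have gL: "g \<in> L2 gauss_measure" by (rule gauss_sobolev_L2[OF gW])
  have "AE x in lborel. g x = 1"
    by (rule gauss_bargmann_unique[OF gauss.integrable_L2[OF gL] gauss.integrable_L2[OF one_gauss_L2]])
       (simp add: Gg gauss_bargmann_one)
  then have "AE x in lborel. mult_op u g x = u x" by eventually_elim (simp add: mult_op_def)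
  then have Gug: "gauss_bargmann (mult_op u g) = gauss_bargmann u"
    by (intro gauss_bargmann_cong_AE mult_op_measurable uL gL) (use uL in \<open>simp add: L2_def\<close>)
  have "S_op \<phi> (\<lambda>z. 1) = (comp_op \<i> \<circ> gauss_bargmann \<circ> mult_op u \<circ> gauss_bargmann_inv m \<circ> comp_op (- \<i>)) (\<lambda>z. 1)"
    using rep one_fock_sobolev[of m] unfolding S_represented_by_def by blast
  then have S1: "S_op \<phi> (\<lambda>z. 1) = comp_op \<i> (gauss_bargmann u)"
    by (simp add: one g_def[symmetric] Gug)
  have "AE x in lborel. u x = u' x"
  proof (rule gauss_bargmann_unique[OF gauss.integrable_L2[OF uL] gauss.integrable_L2[OF u'L]])
    fix y :: "real^'n"
    have "gauss_bargmann u (\<i> *s cvec y) = S_op \<phi> (\<lambda>z. 1) (cvec y)" by (simp add: S1 comp_op_def)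
    also have "(\<lambda>z::complex^'n. 1) = comp_op \<i> (gauss_bargmann (\<lambda>x. 1))" by (simp add: gauss_bargmann_one one)
    also have "S_op \<phi> (comp_op \<i> (gauss_bargmann (\<lambda>x. 1))) (cvec y) = gauss_bargmann (mult_op u' (\<lambda>x. 1)) (\<i> *s cvec y)"
      unfolding \<phi>u' by (rule S_op_transform(2)[OF one_gauss_L2 u'L L2_mult_character[OF u'L]])
    also have "mult_op u' (\<lambda>x. 1) = u'" by (simp add: mult_op_def fun_eq_iff)
    finally show "gauss_bargmann u (\<i> *s cvec y) = gauss_bargmann u' (\<i> *s cvec y)" .
  qed
  then have "gauss_bargmann u = gauss_bargmann u'"
    by (intro gauss_bargmann_cong_AE) (use uL u'L in \<open>simp_all add: L2_def\<close>)
  then show "\<phi> = comp_op \<i> (gauss_bargmann u)" by (simp add: \<phi>u')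
qed

lemma L2_norm_le_gauss_sobolev_norm:
  assumes "g \<in> gauss_sobolev m"
  shows "L2_norm gauss_measure g \<le> gauss_sobolev_norm m g"
  using fock_norm_le_sobolev[of "gauss_bargmann g" m] gauss_bargmann_isometry(2)[OF gauss_sobolev_L2[OF assms]]
  by (simp add: fock_norm_eq gauss_bargmann_sobolev_isometry(2)[OF assms])

text \<open>If \<open>C\<close> bounds multiplication by \<open>u\<close>, then \<open>\<parallel>u ^ k\<parallel>\<close> is at most \<open>C ^ k\<close> times the norm of 1, for every \<open>k\<close>.
  On the set where \<open>|u|\<close> exceeds \<open>2 C\<close> these powers grow faster, so its measure is zero.\<close>

theorem multiplier_essentially_bounded:
  fixes u :: "real^'n::finite \<Rightarrow> complex"
  assumes u: "multiplier m u" and uL: "u \<in> L2 gauss_measure"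
  shows "\<exists>B>0. AE x in lborel. norm (u x) \<le> B"
proof -
  have um [measurable]: "u \<in> borel_measurable borel" using uL by (simp add: L2_def)
  obtain C0 where C0: "\<And>g. g \<in> gauss_sobolev m \<Longrightarrow> mult_op u g \<in> gauss_sobolev m \<and> gauss_sobolev_norm m (mult_op u g) \<le> C0 * gauss_sobolev_norm m g"
    using u unfolding multiplier_def bounded_op_def by auto
  define C where "C = max C0 1"
  have C1: "C \<ge> 1" by (simp add: C_def)
  define N1 where "N1 = gauss_sobolev_norm m (\<lambda>x::real^'n. 1)"
  have pow: "(\<lambda>x. u x ^ k) \<in> gauss_sobolev m \<and> gauss_sobolev_norm m (\<lambda>x. u x ^ k) \<le> C ^ k * N1" for k
  proof (induction k)
    case 0
    then show ?case using one_gauss_sobolev[of m] by (simp add: N1_def)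
  next
    case (Suc k)
    then have W: "(\<lambda>x. u x ^ k) \<in> gauss_sobolev m" by simp
    have nn: "0 \<le> gauss_sobolev_norm m (\<lambda>x. u x ^ k)"
      using L2_norm_le_gauss_sobolev_norm[OF W] L2_norm_nonneg[of gauss_measure "\<lambda>x. u x ^ k"] by linarith
    have eq: "mult_op u (\<lambda>x. u x ^ k) = (\<lambda>x. u x ^ Suc k)" by (simp add: mult_op_def fun_eq_iff)
    have "gauss_sobolev_norm m (\<lambda>x. u x ^ Suc k) \<le> C0 * gauss_sobolev_norm m (\<lambda>x. u x ^ k)"
      using C0[OF W] unfolding eq by simp
    also have "\<dots> \<le> C * gauss_sobolev_norm m (\<lambda>x. u x ^ k)"
      by (rule mult_right_mono[OF _ nn]) (simp add: C_def)
    also have "\<dots> \<le> C * (C ^ k * N1)" using Suc C1 by (intro mult_left_mono) simp_all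
    also have "\<dots> = C ^ Suc k * N1" by simp
    finally show ?case using C0[OF W] unfolding eq by simp
  qed
  define A where "A = {x. norm (u x) > 2 * C}"
  have Am: "A \<in> sets borel" unfolding A_def by measurable
  have bound: "4 ^ k * measure gauss_measure A \<le> N1\<^sup>2" for k :: nat
  proof -
    have pL: "(\<lambda>x. u x ^ k) \<in> L2 gauss_measure" using pow[of k] gauss_sobolev_L2 by blast
    have Ai: "integrable gauss_measure (indicat_real A)" by (rule integrable_real_indicator) (use Am in \<open>simp_all add: gauss.emeasure_eq_measure\<close>)
    have "((2 * C) ^ k)\<^sup>2 * measure gauss_measure A = (LINT x|gauss_measure. ((2 * C) ^ k)\<^sup>2 * indicat_real A x)"
      using Am by simp
    also have "\<dots> \<le> (LINT x|gauss_measure. (norm (u x ^ k))\<^sup>2)"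
    proof (rule integral_mono[OF integrable_mult_right[OF Ai] L2_integrable[OF pL]])
      fix x
      show "((2 * C) ^ k)\<^sup>2 * indicat_real A x \<le> (norm (u x ^ k))\<^sup>2"
      proof (cases "x \<in> A")
        case True
        then have "2 * C \<le> norm (u x)" by (simp add: A_def)
        then have "(2 * C) ^ k \<le> norm (u x) ^ k" by (rule power_mono) (use C1 in simp)
        then have "((2 * C) ^ k)\<^sup>2 \<le> (norm (u x) ^ k)\<^sup>2" by (rule power_mono) (use C1 in simp)
        with True show ?thesis by (simp add: norm_power)
      qed simp
    qed
    also have "\<dots> = (L2_norm gauss_measure (\<lambda>x. u x ^ k))\<^sup>2" by (rule L2_norm_square[symmetric])
    also have "\<dots> \<le> (C ^ k * N1)\<^sup>2"
      using L2_norm_le_gauss_sobolev_norm[of "\<lambda>x. u x ^ k" m] pow[of k] by (intro power_mono) simp_all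
    finally have "((2 * C) ^ k)\<^sup>2 * measure gauss_measure A \<le> (C ^ k * N1)\<^sup>2" .
    moreover have "((2 * C) ^ k)\<^sup>2 = (C ^ k)\<^sup>2 * 4 ^ k"
    proof -
      have "(2 ^ k)\<^sup>2 = (2::real) ^ (2 * k)" by (rule power_even_eq[symmetric])
      also have "\<dots> = (2\<^sup>2) ^ k" by (rule power_mult)
      finally show ?thesis by (simp add: power_mult_distrib)
    qed
    ultimately have "(C ^ k)\<^sup>2 * (4 ^ k * measure gauss_measure A) \<le> (C ^ k)\<^sup>2 * N1\<^sup>2"
      unfolding power_mult_distrib[of "C ^ k" N1] by (simp only: mult.assoc)
    moreover have "0 < (C ^ k)\<^sup>2" using C1 by simp
    ultimately show ?thesis by (rule mult_left_le_imp_le)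
  qed
  have "measure gauss_measure A = 0"
  proof (rule ccontr)
    assume "measure gauss_measure A \<noteq> 0"
    then have pos: "measure gauss_measure A > 0" using zero_less_measure_iff by blast
    obtain k where "N1\<^sup>2 / measure gauss_measure A < 4 ^ k" using real_arch_pow[of 4 "N1\<^sup>2 / measure gauss_measure A"] by auto
    then have "N1\<^sup>2 < 4 ^ k * measure gauss_measure A" using pos by (simp add: divide_less_eq)
    with bound[of k] show False by simp
  qed
  then have "A \<in> null_sets gauss_measure" using Am by (simp add: null_sets_def gauss.emeasure_eq_measure)
  then have "AE x in gauss_measure. x \<notin> A" by (rule AE_not_in)
  then have "AE x in lborel. x \<notin> A" by (simp add: AE_gauss_iff)
  then have "AE x in lborel. norm (u x) \<le> 2 * C" by eventually_elim (simp add: A_def)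
  then show ?thesis using C1 by (intro exI[of _ "2 * C"]) simp
qed

text \<open>The function \<open>u\<close> is bounded only almost everywhere, so the pointwise estimate is carried out for the
  truncation, which agrees with \<open>u\<close> almost everywhere.\<close>

lemma L2_mult_exponential:
  assumes uL: "u \<in> L2 gauss_measure" and B: "B > 0" "AE x in lborel. norm (u x) \<le> B"
  shows "(\<lambda>x. u x * exp (\<i> * cdot (cvec x) z)) \<in> L2 gauss_measure"
proof (rule L2_AE_eq)
  have um: "u \<in> borel_measurable borel" using uL by (simp add: L2_def)
  have cm [measurable]: "(\<lambda>x. clip B (u x)) \<in> borel_measurable borel"
    by (rule measurable_compose[OF um clip_measurable[OF B(1)]])
  show "(\<lambda>x. clip B (u x) * exp (\<i> * cdot (cvec x) z)) \<in> L2 gauss_measure"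
  proof (rule L2_gauss_bound[where \<rho>=0 and B=B and c="norm z"])
    show "(\<lambda>x. clip B (u x) * exp (\<i> * cdot (cvec x) z)) \<in> borel_measurable borel" by measurable
    fix x
    have "norm (exp (\<i> * cdot (cvec x) z)) \<le> exp (norm x * norm z)"
    proof -
      have "norm (exp (\<i> * cdot (cvec x) z)) \<le> exp (norm (\<i> * cdot (cvec x) z))" by (rule norm_exp)
      also have "\<dots> \<le> exp (norm x * norm z)" using norm_cdot_le[of "cvec x" z] by (simp add: norm_mult)
      finally show ?thesis .
    qed
    then have "norm (clip B (u x) * exp (\<i> * cdot (cvec x) z)) \<le> B * exp (norm x * norm z)"
      unfolding norm_mult using norm_clip_le[OF B(1)] B(1) by (intro mult_mono) simp_all
    then show "norm (clip B (u x) * exp (\<i> * cdot (cvec x) z)) \<le> B * exp (norm z * norm x + 0 * (norm x)\<^sup>2)"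
      by (simp add: mult.commute)
  qed simp
  have "(\<lambda>x. exp (\<i> * cdot (cvec x) z)) \<in> borel_measurable borel" by measurable
  then show "(\<lambda>x. u x * exp (\<i> * cdot (cvec x) z)) \<in> borel_measurable gauss_measure"
    using um by (simp add: borel_measurable_times)
  show "AE x in gauss_measure. clip B (u x) * exp (\<i> * cdot (cvec x) z) = u x * exp (\<i> * cdot (cvec x) z)"
    unfolding AE_gauss_iff using B(2) by eventually_elim (simp add: clip_eq[OF B(1)])
qed

text \<open>Boundedness of the operator is immediate from the representation, since all the other factors are
  isometries. What has to be proved is absolute convergence of the defining integral at complex points.
  There the exponential that multiplies \<open>u\<close> is unbounded, and essential boundedness of \<open>u\<close> is
  needed.\<close>

theorem multiplier_imp_bounded:
  fixes \<phi> :: "complex^'n::finite \<Rightarrow> complex"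
  assumes \<phi>: "\<phi> \<in> fock_space" and u: "multiplier m u" and rep: "S_represented_by m \<phi> u"
  shows "S_bounded m \<phi>"
proof -
  have uL: "u \<in> L2 gauss_measure" and \<phi>u: "\<phi> = comp_op \<i> (gauss_bargmann u)"
    using represented_symbol[OF \<phi> u rep] by simp_all
  obtain B where B: "B > 0" "AE x in lborel. norm (u x) \<le> B"
    using multiplier_essentially_bounded[OF u uL] by (elim exE conjE)
  obtain C where C: "\<And>g. g \<in> gauss_sobolev m \<Longrightarrow> mult_op u g \<in> gauss_sobolev m \<and> gauss_sobolev_norm m (mult_op u g) \<le> C * gauss_sobolev_norm m g"
    using u unfolding multiplier_def bounded_op_def by auto
  have pre: "gauss_bargmann_inv m (comp_op (- \<i>) f) \<in> gauss_sobolev m \<and> gauss_bargmann (gauss_bargmann_inv m (comp_op (- \<i>) f)) = comp_op (- \<i>) f"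
    if f: "f \<in> fock_sobolev m" for f :: "complex^'n \<Rightarrow> complex"
    using gauss_bargmann_inv[OF comp_op_rotate_fock_sobolev(1)[OF norm_ii(2) f]] by (rule conjI)
  have "integrable fock_measure (S_integrand \<phi> f z)" if f: "f \<in> fock_sobolev m" for f z
  proof -
    define g where "g = gauss_bargmann_inv m (comp_op (- \<i>) f)"
    have g: "g \<in> L2 gauss_measure" and Gg: "gauss_bargmann g = comp_op (- \<i>) f"
      using pre[OF f] gauss_sobolev_L2 by (auto simp: g_def)
    have "f = comp_op \<i> (gauss_bargmann g)" by (simp add: Gg comp_op_inverse)
    then show ?thesis
      using S_op_transform(1)[OF g uL L2_mult_exponential[OF uL B]] by (simp add: \<phi>u)
  qed
  moreover have "bounded_op (fock_sobolev m) (fock_sobolev_norm m) (S_op \<phi>)"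
    unfolding bounded_op_def
  proof (intro exI ballI)
    fix f :: "complex^'n \<Rightarrow> complex" assume f: "f \<in> fock_sobolev m"
    define g where "g = gauss_bargmann_inv m (comp_op (- \<i>) f)"
    have gW: "g \<in> gauss_sobolev m" and Gg: "gauss_bargmann g = comp_op (- \<i>) f"
      using pre[OF f] by (simp_all add: g_def)
    have Sf: "S_op \<phi> f = comp_op \<i> (gauss_bargmann (mult_op u g))"
      using rep f unfolding S_represented_by_def by (simp add: g_def)
    have ugW: "mult_op u g \<in> gauss_sobolev m" using C[OF gW] by simp
    have GW: "gauss_bargmann (mult_op u g) \<in> fock_sobolev m" by (rule gauss_bargmann_sobolev_isometry(1)[OF ugW])
    have "fock_sobolev_norm m (S_op \<phi> f) = gauss_sobolev_norm m (mult_op u g)"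
      by (simp add: Sf comp_op_rotate_fock_sobolev(2)[OF norm_ii(1) GW] gauss_bargmann_sobolev_isometry(2)[OF ugW])
    also have "\<dots> \<le> C * gauss_sobolev_norm m g" using C[OF gW] by simp
    also have "gauss_sobolev_norm m g = fock_sobolev_norm m f"
      by (simp add: gauss_bargmann_sobolev_isometry(2)[OF gW] Gg comp_op_rotate_fock_sobolev(2)[OF norm_ii(2) f])
    finally show "S_op \<phi> f \<in> fock_sobolev m \<and> fock_sobolev_norm m (S_op \<phi> f) \<le> C * fock_sobolev_norm m f"
      using comp_op_rotate_fock_sobolev(1)[OF norm_ii(1) GW] by (simp add: Sf)
  qed
  ultimately show ?thesis by (simp add: S_bounded_def)
qed

section \<open>The symbol as an integral\<close>

lemma lborel_integrable_affine:
  fixes f :: "'a::euclidean_space \<Rightarrow> 'b::{banach, second_countable_topology}"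
  assumes f: "integrable lborel f" and c: "c > 0"
  shows "integrable lborel (\<lambda>x. f (t + c *\<^sub>R x))"
proof -
  have fm: "f \<in> borel_measurable borel" using borel_measurable_integrable[OF f] by simp
  have m: "(\<lambda>x. t + c *\<^sub>R x) \<in> measurable lborel (borel :: 'a measure)" by measurable
  have L: "lborel = density (distr lborel borel (\<lambda>x. t + c *\<^sub>R x)) (\<lambda>_. ennreal (\<bar>c\<bar> ^ DIM('a)))"
    by (rule lborel_affine) (use c in simp)
  have "integrable (density (distr lborel borel (\<lambda>x. t + c *\<^sub>R x)) (\<lambda>_. ennreal (\<bar>c\<bar> ^ DIM('a)))) f"
    using f by (subst (asm) L)
  then have "integrable (distr lborel borel (\<lambda>x. t + c *\<^sub>R x)) (\<lambda>x. \<bar>c\<bar> ^ DIM('a) *\<^sub>R f x)"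
    by (subst (asm) integrable_density) (use fm in simp_all)
  then have "integrable (distr lborel borel (\<lambda>x. t + c *\<^sub>R x)) (\<lambda>x. (1 / \<bar>c\<bar> ^ DIM('a)) *\<^sub>R (\<bar>c\<bar> ^ DIM('a) *\<^sub>R f x))"
    by (rule integrable_scaleR_right)
  then have "integrable (distr lborel borel (\<lambda>x. t + c *\<^sub>R x)) f" using c by simp
  then show ?thesis by (rule integrable_distr[OF m])
qed

text \<open>Completing the square in the definition of the transform at \<open>\<i> z\<close> and substituting \<open>2 x\<close> for
  \<open>x\<close>; the constant combines the Jacobian determinant \<open>2 ^ n\<close> with the normalisation of the Gauss
  measure.\<close>

theorem symbol_integral_formula:
  fixes u :: "real^'n::finite \<Rightarrow> complex"
  assumes uL: "u \<in> L2 gauss_measure"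
  defines "h \<equiv> \<lambda>z x. u (2 *\<^sub>R x) * exp (- 2 * cdot (cvec x - (\<i> / 2) *s z) (cvec x - (\<i> / 2) *s z))"
  shows "integrable lborel (h z)"
    and "comp_op \<i> (gauss_bargmann u) z = complex_of_real ((2 / pi) powr (real CARD('n) / 2)) * (LINT x|lborel. h z x)"
proof -
  have um [measurable]: "u \<in> borel_measurable borel" using uL by (simp add: L2_def)
  define k where "k x = gauss_density x *\<^sub>R (u x * bargmann_kernel x (\<i> *s z))" for x
  have km: "k \<in> borel_measurable borel" unfolding k_def by measurable
  have mm: "(\<lambda>x. u x * bargmann_kernel x (\<i> *s z)) \<in> borel_measurable borel" by measurable
  have ki: "integrable lborel k"
    using gauss_bargmann_integrable[OF uL, of "\<i> *s z"] unfolding k_def integrable_gauss_iff[OF mm] .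
  have kh: "k (0 + 2 *\<^sub>R x) = of_real (1 / sqrt (2 * pi) ^ CARD('n)) * h z x" for x
  proof -
    have cv: "cvec (2 *\<^sub>R x) = 2 *s cvec x" by (simp add: vec_eq_iff)
    have "- of_real ((norm (2 *\<^sub>R x))\<^sup>2) / 2 + (cdot (cvec (2 *\<^sub>R x)) (\<i> *s z) - cdot (\<i> *s z) (\<i> *s z) / 2)
       = - 2 * cdot (cvec x - (\<i> / 2) *s z) (cvec x - (\<i> / 2) *s z)"
      unfolding norm_cvec_cdot[symmetric] cv
      by (simp add: cdot_diff_left cdot_diff_right cdot_smult_left cdot_smult_right cdot_commute[of z "cvec x"] ii_mult field_simps)
    then have "exp (- of_real ((norm (2 *\<^sub>R x))\<^sup>2) / 2) * bargmann_kernel (2 *\<^sub>R x) (\<i> *s z) = exp (- 2 * cdot (cvec x - (\<i> / 2) *s z) (cvec x - (\<i> / 2) *s z))"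
      unfolding bargmann_kernel_def by (simp only: exp_add[symmetric])
    moreover have "exp (- of_real ((norm (2 *\<^sub>R x))\<^sup>2) / 2) = complex_of_real (exp (- (norm (2 *\<^sub>R x))\<^sup>2 / 2))"
      by (simp add: exp_of_real[symmetric])
    ultimately have e: "complex_of_real (exp (- (norm (2 *\<^sub>R x))\<^sup>2 / 2)) * bargmann_kernel (2 *\<^sub>R x) (\<i> *s z) = exp (- 2 * cdot (cvec x - (\<i> / 2) *s z) (cvec x - (\<i> / 2) *s z))"
      by (simp only:)
    have d: "gauss_density (2 *\<^sub>R x) = (1 / sqrt (2 * pi) ^ CARD('n)) * exp (- (norm (2 *\<^sub>R x))\<^sup>2 / 2)"
      by (simp add: gauss_density_def)
    show ?thesis
      unfolding k_def h_def e[symmetric] d scaleR_conv_of_real[where 'a=complex] of_real_mult add_0_left by (simp only: mult_ac)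
  qed
  have s0: "complex_of_real (1 / sqrt (2 * pi) ^ CARD('n)) \<noteq> 0" by simp
  have "integrable lborel (\<lambda>x. of_real (1 / sqrt (2 * pi) ^ CARD('n)) * h z x)"
    using lborel_integrable_affine[OF ki, of 2 0] unfolding kh by simp
  then have "integrable lborel (\<lambda>x. of_real (sqrt (2 * pi) ^ CARD('n)) * (of_real (1 / sqrt (2 * pi) ^ CARD('n)) * h z x))"
    by (rule integrable_mult_right)
  moreover have "of_real (sqrt (2 * pi) ^ CARD('n)) * (of_real (1 / sqrt (2 * pi) ^ CARD('n)) * h z x) = h z x" for x
    unfolding mult.assoc[symmetric] of_real_mult[symmetric] by simp
  ultimately show "integrable lborel (h z)" by (simp only:)
  have "comp_op \<i> (gauss_bargmann u) z = (LINT x|lborel. k x)"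
    unfolding comp_op_def gauss_bargmann_eq k_def by (rule integral_gauss[OF mm])
  also have "\<dots> = (2 ^ DIM(real^'n)) *\<^sub>R (LINT x|lborel. k (0 + 2 *\<^sub>R x))"
    by (rule lborel_integral_affine[OF km]) simp
  also have "\<dots> = of_real (2 ^ CARD('n) * (1 / sqrt (2 * pi) ^ CARD('n))) * (LINT x|lborel. h z x)"
    unfolding kh integral_mult_right_zero by (simp add: scaleR_conv_of_real)
  also have "2 ^ CARD('n) * (1 / sqrt (2 * pi) ^ CARD('n)) = (2 / pi) powr (real CARD('n) / 2)"
  proof -
    have "2 / sqrt (2 * pi) = sqrt (2 / pi)"
      by (rule real_sqrt_unique[symmetric]) (simp_all add: power_divide)
    then have "(2 / sqrt (2 * pi)) ^ CARD('n) = (2 / pi) powr (real CARD('n) / 2)" by (simp add: powr_half_card)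
    then show ?thesis by (simp add: power_divide)
  qed
  finally show "comp_op \<i> (gauss_bargmann u) z = complex_of_real ((2 / pi) powr (real CARD('n) / 2)) * (LINT x|lborel. h z x)" .
qed

theorem theorem4p4:
  fixes m :: nat and \<phi> :: "complex^'n::finite \<Rightarrow> complex"
  assumes "m > 0" and "\<phi> \<in> fock_space"
  shows "(S_bounded m \<phi> \<longleftrightarrow> (\<exists>u. multiplier m u \<and> S_represented_by m \<phi> u)) \<and>
    (\<forall>u. multiplier m u \<and> S_represented_by m \<phi> u \<longrightarrow>
      (\<forall>z. let h = (\<lambda>x. u (2 *\<^sub>R x) *
                exp (- 2 * cdot (cvec x - (\<i> / 2) *s z) (cvec x - (\<i> / 2) *s z)))
        in integrable lborel h \<and>
           \<phi> z = complex_of_real ((2 / pi) powr (real CARD('n) / 2)) * (LINT x|lborel. h x)))"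
proof (intro conjI iffI allI impI)
  show "\<exists>u. multiplier m u \<and> S_represented_by m \<phi> u" if "S_bounded m \<phi>"
    by (rule bounded_imp_multiplier[OF assms(2) that])
  show "S_bounded m \<phi>" if "\<exists>u. multiplier m u \<and> S_represented_by m \<phi> u"
    using that multiplier_imp_bounded[OF assms(2)] by (elim exE conjE)
  fix u z assume u: "multiplier m u \<and> S_represented_by m \<phi> u"
  have uL: "u \<in> L2 gauss_measure" and \<phi>u: "\<phi> = comp_op \<i> (gauss_bargmann u)"
    using represented_symbol[OF assms(2), of m u] u by auto
  show "let h = (\<lambda>x. u (2 *\<^sub>R x) * exp (- 2 * cdot (cvec x - (\<i> / 2) *s z) (cvec x - (\<i> / 2) *s z)))
        in integrable lborel h \<and>
           \<phi> z = complex_of_real ((2 / pi) powr (real CARD('n) / 2)) * (LINT x|lborel. h x)"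
    unfolding Let_def \<phi>u using symbol_integral_formula[OF uL, of z] by (intro conjI)
qed

end
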